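(* The forgetful functor $\Box : \mathtt{Isot}_\infty \to \mathtt{CHE}$, from the category of isotopy classes of $A_\infty$-algebras to the category of chain complexes and homotopy classes of chain homotopy equivalences, is a surjective-on-objects discrete Grothendieck bifibration.
   Context: Fix an arbitrary commutative unital ring $R$; all modules are over $R$ and $\otimes$ is over $R$. Chain complexes $(A,\partial)$ are $\mathbb{Z}$-graded, possibly unbounded, with differential of degree $-1$. For a graded module $A$, $T^c(\uparrow A)=\bigoplus_{n\ge1}(\uparrow A)^{\otimes n}$ is the tensor coalgebra (deconcatenation coproduct) on the suspension of $A$. An $A_\infty$-algebra $(A,\partial,\boldsymbol\mu)$ is a chain complex $(A,\partial)$ with linear maps $\mu_k:A^{\otimes k}\to A$, $k\ge2$, of degree $k-2$, such that the degree $-1$ coderivation $\delta$ of $T^c(\uparrow A)$ determined (after the usual suspension) by $\partial,\mu_2,\mu_3,\ldots$ satisfies $\delta^2=0$. An $A_\infty$-morphism $F=(f,f_2,f_3,\ldots):(A',\partial,\boldsymbol\mu')\to(A'',\partial,\boldsymbol\mu'')$ consists of linear maps $f:A'\to A''$ of degree $0$ and $f_k:A'^{\otimes k}\to A''$ of degree $k-1$, $k\ge 2$, such that the coalgebra morphism $\phi:T^c(\uparrow A')\to T^c(\uparrow A'')$ they determine satisfies $\delta''\phi=\phi\delta'$. Then $f$ is a chain map, called the linear part (or underlying chain map) of $F$. Composition is composition of coalgebra morphisms. An $A_\infty$-homotopy between $G=(g,g_2,\ldots)$ and $F=(f,f_2,\ldots)$ is a family $h:A'\to A''$ of degree $1$,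 $h_k:A'^{\otimes k}\to A''$ of degree $k$ ($k\geq 2$), whose associated degree $+1$ map $\eta:T^c(\uparrow A')\to T^c(\uparrow A'')$ satisfying $\Delta''\eta=(\phi\otimes\eta)\Delta'+(\eta\otimes\psi)\Delta'$ fulfills $\psi-\phi=\delta''\eta+\eta\delta'$, where $\phi,\psi$ are the coalgebra morphisms of $F,G$ and $\Delta',\Delta''$ are the coproducts. An isotopy is an $A_\infty$-morphism whose linear part is the identity; two $A_\infty$-structures on the same chain complex are isotopic if there is an isotopy between them (isotopies are invertible). We write $\sim$ for chain homotopy of chain maps. The category $\mathtt{Isot}_\infty$: objects are isotopy classes of $A_\infty$-algebras. Morphisms are equivalence classes of $A_\infty$-morphisms $F:(A,\partial,\boldsymbol\mu)\to(B,\partial,\boldsymbol\nu)$ whose linear part is a chain homotopy equivalence (going from the isotopy class of the source to that of the target), where $F':(A,\partial,\boldsymbol\mu')\to(B,\partial,\boldsymbol\nu')$ and $F'':(A,\partial,\boldsymbol\mu'')\to(B,\partial,\boldsymbol\nu'')$ with linear parts $f',f''$ are identified if and only if one (and hence all) of the following equivalent conditions holds: (i) $f'\sim f''$ and $(A,\partial,\boldsymbol\mu')$, $(A,\partial,\boldsymbol\mu'')$ are isotopic; (ii) $f'\sim f''$ and $(B,\partial,\boldsymbol\nu')$, $(B,\partial,\boldsymbol\nu'')$ are isotopic; (iii) $f'\sim f''$, and both the sources and the targets are isotopic; (iv) there are isotopies $S:(A,\partial,\boldsymbol\mu')\to(A,\partial,\boldsymbol\mu'')$ and $T:(B,\partial,\boldsymbol\nu')\to(B,\partial,\boldsymbol\nu'')$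 such that $TF'$ and $F''S$ are $A_\infty$-homotopic. The composite of the class of $F:(A,\partial,\boldsymbol\mu)\to(B,\partial,\boldsymbol\nu')$ with the class of $Y:(B,\partial,\boldsymbol\nu'')\to(C,\partial,\boldsymbol\omega)$, where $(B,\partial,\boldsymbol\nu')$ and $(B,\partial,\boldsymbol\nu'')$ are isotopic, is the class of $YSF$ for any isotopy $S:(B,\partial,\boldsymbol\nu')\to(B,\partial,\boldsymbol\nu'')$ (this is independent of the choices). The category $\mathtt{CHE}$: objects are chain complexes, morphisms are chain homotopy classes of chain maps which have chain homotopy inverses. The functor $\Box$ sends the isotopy class of $(A,\partial,\boldsymbol\mu)$ to $(A,\partial)$ and the class of $F$ to the chain homotopy class of its linear part. A functor $p:\mathtt{E}\to\mathtt{B}$ is a discrete (Grothendieck) fibration if for each object $e''$ of $\mathtt{E}$ and each morphism $\beta:b'\to p(e'')$ in $\mathtt{B}$ there is a unique morphism $\varepsilon:e'\to e''$ in $\mathtt{E}$ with $p(\varepsilon)=\beta$. It is a discrete opfibration if the induced functor between opposite categories is a discrete fibration, and a discrete bifibration if it is both. *)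

theory Defs
  imports "HOL-Algebra.Algebra"
begin

section \<open>Modules presented by generators and relations\<close>

text \<open>
  Modules are those of the locale \<open>module\<close>, with a carrier inside an arbitrary type.  Linear maps are set-theoretic functions: they take the value \<open>undefined\<close> off the carrier,
  so that equality of linear maps is equality in HOL.
\<close>

definition linmaps :: "('r, 'x) ring_scheme \<Rightarrow> ('r, 'm, 'y) module_scheme \<Rightarrow>
    ('r, 'n, 'z) module_scheme \<Rightarrow> ('m \<Rightarrow> 'n) set" where
  "linmaps R M N = {f \<in> carrier M \<rightarrow>\<^sub>E carrier N.
     (\<forall>x\<in>carrier M. \<forall>y\<in>carrier M. f (x \<oplus>\<^bsub>M\<^esub> y) = f x \<oplus>\<^bsub>N\<^esub> f y) \<and>
     (\<forall>r\<in>carrier R. \<forall>x\<in>carrier M. f (r \<odot>\<^bsub>M\<^esub> x) = r \<odot>\<^bsub>N\<^esub> f x)}"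

definition lin_id :: "('r, 'm, 'y) module_scheme \<Rightarrow> 'm \<Rightarrow> 'm" where
  "lin_id M = (\<lambda>x\<in>carrier M. x)"

definition mod_span :: "('r, 'x) ring_scheme \<Rightarrow> ('r, 'm, 'y) module_scheme \<Rightarrow> 'm set \<Rightarrow> 'm set" where
  "mod_span R M S = \<Inter>{N. submodule N R M \<and> S \<subseteq> N}"

text \<open>The \<open>mult\<close> and \<open>one\<close> fields of a module record carry no meaning.\<close>

definition free_mod :: "('r, 'x) ring_scheme \<Rightarrow> 'g set \<Rightarrow> ('r, 'g \<Rightarrow> 'r) module" where
  "free_mod R G = \<lparr>
     carrier = {c. (\<forall>x. c x \<in> carrier R) \<and> (\<forall>x. x \<notin> G \<longrightarrow> c x = \<zero>\<^bsub>R\<^esub>) \<and> finite {x. c x \<noteq> \<zero>\<^bsub>R\<^esub>}},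
     monoid.mult = undefined, one = undefined,
     ring.zero = (\<lambda>x. \<zero>\<^bsub>R\<^esub>),
     ring.add = (\<lambda>c d x. c x \<oplus>\<^bsub>R\<^esub> d x),
     smult = (\<lambda>r c x. r \<otimes>\<^bsub>R\<^esub> c x)\<rparr>"

definition free_gen :: "('r, 'x) ring_scheme \<Rightarrow> 'g \<Rightarrow> 'g \<Rightarrow> 'r" where
  "free_gen R x = (\<lambda>y. if y = x then \<one>\<^bsub>R\<^esub> else \<zero>\<^bsub>R\<^esub>)"

definition quot_mod :: "('r, 'm, 'y) module_scheme \<Rightarrow> 'm set \<Rightarrow> ('r, 'm set) module" where
  "quot_mod M N = \<lparr>
     carrier = a_rcosets\<^bsub>M\<^esub> N,
     monoid.mult = undefined, one = undefined,
     ring.zero = N,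
     ring.add = (\<lambda>U V. U <+>\<^bsub>M\<^esub> V),
     smult = (\<lambda>r U. \<Union>x\<in>U. N +>\<^bsub>M\<^esub> (r \<odot>\<^bsub>M\<^esub> x))\<rparr>"

definition pres_mod :: "('r, 'x) ring_scheme \<Rightarrow> 'g set \<Rightarrow> ('g \<Rightarrow> 'r) set \<Rightarrow>
    ('r, ('g \<Rightarrow> 'r) set) module" where
  "pres_mod R G S = quot_mod (free_mod R G) (mod_span R (free_mod R G) S)"

definition pres_gen :: "('r, 'x) ring_scheme \<Rightarrow> 'g set \<Rightarrow> ('g \<Rightarrow> 'r) set \<Rightarrow> 'g \<Rightarrow>
    ('g \<Rightarrow> 'r) set" where
  "pres_gen R G S x = mod_span R (free_mod R G) S +>\<^bsub>free_mod R G\<^esub> free_gen R x"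

text \<open>The linear map \<open>M \<rightarrow> N\<close> with prescribed values \<open>h g\<close> on the elements \<open>\<iota> g\<close>, for \<open>g \<in> G\<close>.
  It is only used where the \<open>\<iota> g\<close> generate \<open>M\<close> and the prescription is consistent.\<close>

definition lin_ext :: "('r, 'x) ring_scheme \<Rightarrow> ('r, 'm, 'y) module_scheme \<Rightarrow>
    ('r, 'n, 'z) module_scheme \<Rightarrow> 'g set \<Rightarrow> ('g \<Rightarrow> 'm) \<Rightarrow> ('g \<Rightarrow> 'n) \<Rightarrow> 'm \<Rightarrow> 'n" where
  "lin_ext R M N G \<iota> h = (THE L. L \<in> linmaps R M N \<and> (\<forall>g\<in>G. L (\<iota> g) = h g))"

definition bilin_rels :: "('r, 'x) ring_scheme \<Rightarrow> ('r, 'm, 'y) module_scheme \<Rightarrow>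
    ('r, 'n, 'z) module_scheme \<Rightarrow> ('m \<times> 'n \<Rightarrow> 'r) set" where
  "bilin_rels R M N = (let F = free_mod R (carrier M \<times> carrier N); e = free_gen R in
     {e (x \<oplus>\<^bsub>M\<^esub> x', y) \<ominus>\<^bsub>F\<^esub> (e (x, y) \<oplus>\<^bsub>F\<^esub> e (x', y)) | x x' y.
        x \<in> carrier M \<and> x' \<in> carrier M \<and> y \<in> carrier N} \<union>
     {e (x, y \<oplus>\<^bsub>N\<^esub> y') \<ominus>\<^bsub>F\<^esub> (e (x, y) \<oplus>\<^bsub>F\<^esub> e (x, y')) | x y y'.
        x \<in> carrier M \<and> y \<in> carrier N \<and> y' \<in> carrier N} \<union>
     {e (r \<odot>\<^bsub>M\<^esub> x, y) \<ominus>\<^bsub>F\<^esub> r \<odot>\<^bsub>F\<^esub> e (x, y) | r x y.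
        r \<in> carrier R \<and> x \<in> carrier M \<and> y \<in> carrier N} \<union>
     {e (x, r \<odot>\<^bsub>N\<^esub> y) \<ominus>\<^bsub>F\<^esub> r \<odot>\<^bsub>F\<^esub> e (x, y) | r x y.
        r \<in> carrier R \<and> x \<in> carrier M \<and> y \<in> carrier N})"

definition tensor :: "('r, 'x) ring_scheme \<Rightarrow> ('r, 'm, 'y) module_scheme \<Rightarrow>
    ('r, 'n, 'z) module_scheme \<Rightarrow> ('r, ('m \<times> 'n \<Rightarrow> 'r) set) module" where
  "tensor R M N = pres_mod R (carrier M \<times> carrier N) (bilin_rels R M N)"

definition tens :: "('r, 'x) ring_scheme \<Rightarrow> ('r, 'm, 'y) module_scheme \<Rightarrow>
    ('r, 'n, 'z) module_scheme \<Rightarrow> 'm \<Rightarrow> 'n \<Rightarrow> ('m \<times> 'n \<Rightarrow> 'r) set" where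
  "tens R M N x y = pres_gen R (carrier M \<times> carrier N) (bilin_rels R M N) (x, y)"


section \<open>Graded modules and words\<close>

type_synonym ('r, 'm) gmod = "int \<Rightarrow> ('r, 'm) module"
type_synonym 'm word = "(int \<times> 'm) list"

text \<open>
  A word \<open>[(d\<^sub>1, a\<^sub>1), \<dots>, (d\<^sub>k, a\<^sub>k)]\<close> with \<open>a\<^sub>i\<close> of degree \<open>d\<^sub>i\<close> stands for the elementary tensor of
  the \<open>a\<^sub>i\<close>, or for that of their suspensions.  Its degree \<open>wdeg\<close> is the one in the tensor
  powers of the suspension, where each letter has degree \<open>d\<^sub>i + 1\<close>.
\<close>

definition words :: "('r, 'm) gmod \<Rightarrow> nat set \<Rightarrow> 'm word set" where
  "words A K = {w. length w \<in> K \<and> (\<forall>(d, a)\<in>set w. a \<in> carrier (A d))}"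

definition wdeg :: "'m word \<Rightarrow> int" where
  "wdeg w = (\<Sum>i<length w. fst (w ! i) + 1)"

definition ksgn :: "('r, 'x) ring_scheme \<Rightarrow> int \<Rightarrow> 'r" where
  "ksgn R n = (if even n then \<one>\<^bsub>R\<^esub> else \<ominus>\<^bsub>R\<^esub> \<one>\<^bsub>R\<^esub>)"

text \<open>
  \<open>multi_ops R A B K q\<close>: families, indexed by \<open>k \<in> K\<close>, of linear maps from the \<open>k\<close>-th tensor
  power of \<open>A\<close> to \<open>B\<close>, given as multilinear maps on homogeneous elements.  The \<open>k\<close>-th map has
  degree \<open>k - 1 + q\<close>, so that after suspension all the maps have degree \<open>q\<close>.
\<close>

definition multi_ops :: "('r, 'x) ring_scheme \<Rightarrow> ('r, 'm) gmod \<Rightarrow> ('r, 'm) gmod \<Rightarrow> nat set \<Rightarrow>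
    int \<Rightarrow> ('m word \<Rightarrow> 'm) set" where
  "multi_ops R A B K q = {F \<in> extensional (words A K).
     (\<forall>w\<in>words A K. F w \<in> carrier (B ((\<Sum>i<length w. fst (w ! i)) + int (length w) - 1 + q))) \<and>
     (\<forall>u v d x y. u @ (d, x) # v \<in> words A K \<longrightarrow> y \<in> carrier (A d) \<longrightarrow>
        F (u @ (d, x \<oplus>\<^bsub>A d\<^esub> y) # v) =
          F (u @ (d, x) # v)
            \<oplus>\<^bsub>B (wdeg (u @ (d, x) # v) - 1 + q)\<^esub> F (u @ (d, y) # v)) \<and>
     (\<forall>u v d r x. u @ (d, x) # v \<in> words A K \<longrightarrow> r \<in> carrier R \<longrightarrow>
        F (u @ (d, r \<odot>\<^bsub>A d\<^esub> x) # v) =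
          r \<odot>\<^bsub>B (wdeg (u @ (d, x) # v) - 1 + q)\<^esub> F (u @ (d, x) # v))}"


section \<open>The tensor coalgebra on the suspension\<close>

text \<open>As a module, \<open>Tc R A\<close> is the direct sum of all positive tensor powers of the graded module
  \<open>A\<close>; suspension only affects its grading.\<close>

definition multilin_rels :: "('r, 'x) ring_scheme \<Rightarrow> ('r, 'm) gmod \<Rightarrow> ('m word \<Rightarrow> 'r) set" where
  "multilin_rels R A = (let F = free_mod R (words A {1..}); e = free_gen R in
     {e (u @ (d, x \<oplus>\<^bsub>A d\<^esub> y) # v) \<ominus>\<^bsub>F\<^esub> (e (u @ (d, x) # v) \<oplus>\<^bsub>F\<^esub> e (u @ (d, y) # v)) | u v d x y.
        u @ (d, x) # v \<in> words A {1..} \<and> y \<in> carrier (A d)} \<union>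
     {e (u @ (d, r \<odot>\<^bsub>A d\<^esub> x) # v) \<ominus>\<^bsub>F\<^esub> r \<odot>\<^bsub>F\<^esub> e (u @ (d, x) # v) | u v d r x.
        u @ (d, x) # v \<in> words A {1..} \<and> r \<in> carrier R})"

type_synonym ('r, 'm) tc = "('m word \<Rightarrow> 'r) set"

definition Tc :: "('r, 'x) ring_scheme \<Rightarrow> ('r, 'm) gmod \<Rightarrow> ('r, ('r, 'm) tc) module" where
  "Tc R A = pres_mod R (words A {1..}) (multilin_rels R A)"

definition wcls :: "('r, 'x) ring_scheme \<Rightarrow> ('r, 'm) gmod \<Rightarrow> 'm word \<Rightarrow> ('r, 'm) tc" where
  "wcls R A w = pres_gen R (words A {1..}) (multilin_rels R A) w"

definition Tc_deg :: "('r, 'x) ring_scheme \<Rightarrow> ('r, 'm) gmod \<Rightarrow> int \<Rightarrow> ('r, 'm) tc set" where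
  "Tc_deg R A n = mod_span R (Tc R A) {wcls R A w | w. w \<in> words A {1..} \<and> wdeg w = n}"

abbreviation TT where
  "TT R A \<equiv> tensor R (Tc R A) (Tc R A)"

abbreviation ttens where
  "ttens R A \<equiv> tens R (Tc R A) (Tc R A)"

definition deconc :: "('r, 'x) ring_scheme \<Rightarrow> ('r, 'm) gmod \<Rightarrow> ('r, 'm) tc \<Rightarrow>
    (('r, 'm) tc \<times> ('r, 'm) tc \<Rightarrow> 'r) set" where
  "deconc R A = lin_ext R (Tc R A) (TT R A) (words A {1..}) (wcls R A)
     (\<lambda>w. \<Oplus>\<^bsub>TT R A\<^esub>i\<in>{1..<length w}. ttens R A (wcls R A (take i w)) (wcls R A (drop i w)))"

definition length_one :: "('r, 'x) ring_scheme \<Rightarrow> ('r, 'm) gmod \<Rightarrow> ('r, 'm) tc \<Rightarrow> ('r, 'm) tc" where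
  "length_one R A = lin_ext R (Tc R A) (Tc R A) (words A {1..}) (wcls R A)
     (\<lambda>w. if length w = 1 then wcls R A w else \<zero>\<^bsub>Tc R A\<^esub>)"

definition graded_maps :: "('r, 'x) ring_scheme \<Rightarrow> ('r, 'm) gmod \<Rightarrow> ('r, 'm) gmod \<Rightarrow> int \<Rightarrow>
    (('r, 'm) tc \<Rightarrow> ('r, 'm) tc) set" where
  "graded_maps R A B q =
     {L \<in> linmaps R (Tc R A) (Tc R B). \<forall>n. L ` Tc_deg R A n \<subseteq> Tc_deg R B (n + q)}"

text \<open>The tensor product of \<open>f\<close> and \<open>g\<close>, where \<open>g\<close> has degree \<open>q\<close>, with the Koszul sign
  \<open>(f \<otimes> g) (x \<otimes> y) = (-1)\<^bsup>q |x|\<^esup> f x \<otimes> g y\<close>.\<close>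

definition tensor_map :: "('r, 'x) ring_scheme \<Rightarrow> ('r, 'm) gmod \<Rightarrow> ('r, 'm) gmod \<Rightarrow> int \<Rightarrow>
    (('r, 'm) tc \<Rightarrow> ('r, 'm) tc) \<Rightarrow> (('r, 'm) tc \<Rightarrow> ('r, 'm) tc) \<Rightarrow>
    (('r, 'm) tc \<times> ('r, 'm) tc \<Rightarrow> 'r) set \<Rightarrow> (('r, 'm) tc \<times> ('r, 'm) tc \<Rightarrow> 'r) set" where
  "tensor_map R A B q f g = lin_ext R (TT R A) (TT R B) (words A {1..} \<times> words A {1..})
     (\<lambda>(u, v). ttens R A (wcls R A u) (wcls R A v))
     (\<lambda>(u, v). ksgn R (q * wdeg u) \<odot>\<^bsub>TT R B\<^esub> ttens R B (f (wcls R A u)) (g (wcls R A v)))"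

text \<open>
  The suspended map \<open>\<up> \<circ> F\<^sub>k \<circ> \<down>\<^bsup>\<otimes>k\<^esup>\<close> on a word; by the Koszul rule, \<open>\<down>\<^bsup>\<otimes>k\<^esup>\<close> produces the sign
  \<open>(-1)\<close> to the power of the sum of \<open>(k - i) (d\<^sub>i + 1)\<close> for \<open>i = 1, \<dots>, k\<close> (below, \<open>i\<close> starts at 0).
  The result is a multiple of a word of length one.
\<close>

definition susp_op :: "('r, 'x) ring_scheme \<Rightarrow> ('r, 'm) gmod \<Rightarrow> int \<Rightarrow> ('m word \<Rightarrow> 'm) \<Rightarrow> 'm word \<Rightarrow>
    ('r, 'm) tc" where
  "susp_op R B q F w =
     ksgn R (\<Sum>i<length w. int (length w - 1 - i) * (fst (w ! i) + 1))
       \<odot>\<^bsub>Tc R B\<^esub> wcls R B [((\<Sum>i<length w. fst (w ! i)) + int (length w) - 1 + q, F w)]"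

definition corestricts_to :: "('r, 'x) ring_scheme \<Rightarrow> ('r, 'm) gmod \<Rightarrow> ('r, 'm) gmod \<Rightarrow> int \<Rightarrow>
    ('m word \<Rightarrow> 'm) \<Rightarrow> (('r, 'm) tc \<Rightarrow> ('r, 'm) tc) \<Rightarrow> bool" where
  "corestricts_to R A B q F L \<longleftrightarrow>
     (\<forall>w\<in>words A {1..}. length_one R B (L (wcls R A w)) = susp_op R B q F w)"

definition coderivation :: "('r, 'x) ring_scheme \<Rightarrow> ('r, 'm) gmod \<Rightarrow>
    (('r, 'm) tc \<Rightarrow> ('r, 'm) tc) \<Rightarrow> bool" where
  "coderivation R A \<delta> \<longleftrightarrow> \<delta> \<in> graded_maps R A A (-1) \<and>
     (\<forall>x\<in>carrier (Tc R A). deconc R A (\<delta> x) =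
        tensor_map R A A 0 \<delta> (lin_id (Tc R A)) (deconc R A x)
          \<oplus>\<^bsub>TT R A\<^esub> tensor_map R A A (-1) (lin_id (Tc R A)) \<delta> (deconc R A x))"

definition coalg_morphism :: "('r, 'x) ring_scheme \<Rightarrow> ('r, 'm) gmod \<Rightarrow> ('r, 'm) gmod \<Rightarrow>
    (('r, 'm) tc \<Rightarrow> ('r, 'm) tc) \<Rightarrow> bool" where
  "coalg_morphism R A B \<phi> \<longleftrightarrow> \<phi> \<in> graded_maps R A B 0 \<and>
     (\<forall>x\<in>carrier (Tc R A). deconc R B (\<phi> x) = tensor_map R A B 0 \<phi> \<phi> (deconc R A x))"

definition coalg_homotopy :: "('r, 'x) ring_scheme \<Rightarrow> ('r, 'm) gmod \<Rightarrow> ('r, 'm) gmod \<Rightarrow>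
    (('r, 'm) tc \<Rightarrow> ('r, 'm) tc) \<Rightarrow> (('r, 'm) tc \<Rightarrow> ('r, 'm) tc) \<Rightarrow>
    (('r, 'm) tc \<Rightarrow> ('r, 'm) tc) \<Rightarrow> bool" where
  "coalg_homotopy R A B \<phi> \<psi> \<eta> \<longleftrightarrow> \<eta> \<in> graded_maps R A B 1 \<and>
     (\<forall>x\<in>carrier (Tc R A). deconc R B (\<eta> x) =
        tensor_map R A B 1 \<phi> \<eta> (deconc R A x)
          \<oplus>\<^bsub>TT R B\<^esub> tensor_map R A B 0 \<eta> \<psi> (deconc R A x))"

definition coder_of :: "('r, 'x) ring_scheme \<Rightarrow> ('r, 'm) gmod \<Rightarrow> ('m word \<Rightarrow> 'm) \<Rightarrow>
    ('r, 'm) tc \<Rightarrow> ('r, 'm) tc" where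
  "coder_of R A m = (THE \<delta>. coderivation R A \<delta> \<and> corestricts_to R A A (-1) m \<delta>)"

definition coalg_of :: "('r, 'x) ring_scheme \<Rightarrow> ('r, 'm) gmod \<Rightarrow> ('r, 'm) gmod \<Rightarrow>
    ('m word \<Rightarrow> 'm) \<Rightarrow> ('r, 'm) tc \<Rightarrow> ('r, 'm) tc" where
  "coalg_of R A B F = (THE \<phi>. coalg_morphism R A B \<phi> \<and> corestricts_to R A B 0 F \<phi>)"

definition homotopy_of :: "('r, 'x) ring_scheme \<Rightarrow> ('r, 'm) gmod \<Rightarrow> ('r, 'm) gmod \<Rightarrow>
    ('m word \<Rightarrow> 'm) \<Rightarrow> ('m word \<Rightarrow> 'm) \<Rightarrow> ('m word \<Rightarrow> 'm) \<Rightarrow> ('r, 'm) tc \<Rightarrow> ('r, 'm) tc" where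
  "homotopy_of R A B F G h = (THE \<eta>.
     coalg_homotopy R A B (coalg_of R A B F) (coalg_of R A B G) \<eta> \<and> corestricts_to R A B 1 h \<eta>)"


section \<open>Chain complexes\<close>

record ('r, 'm) chain_cx =
  gr :: "('r, 'm) gmod"
  bd :: "int \<Rightarrow> 'm \<Rightarrow> 'm"

definition chain_complex :: "('r, 'x) ring_scheme \<Rightarrow> ('r, 'm) chain_cx \<Rightarrow> bool" where
  "chain_complex R A \<longleftrightarrow>
     (\<forall>n. module R (gr A n)) \<and>
     (\<forall>n. bd A n \<in> linmaps R (gr A n) (gr A (n - 1))) \<and>
     (\<forall>n. \<forall>a\<in>carrier (gr A n). bd A (n - 1) (bd A n a) = \<zero>\<^bsub>gr A (n - 2)\<^esub>)"

definition chain_maps :: "('r, 'x) ring_scheme \<Rightarrow> ('r, 'm) chain_cx \<Rightarrow> ('r, 'm) chain_cx \<Rightarrow>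
    (int \<Rightarrow> 'm \<Rightarrow> 'm) set" where
  "chain_maps R A B = {f. (\<forall>n. f n \<in> linmaps R (gr A n) (gr B n)) \<and>
     (\<forall>n. \<forall>a\<in>carrier (gr A n). bd B n (f n a) = f (n - 1) (bd A n a))}"

definition chain_id :: "('r, 'm) chain_cx \<Rightarrow> int \<Rightarrow> 'm \<Rightarrow> 'm" where
  "chain_id A = (\<lambda>n. lin_id (gr A n))"

definition chain_comp :: "('r, 'm) chain_cx \<Rightarrow> (int \<Rightarrow> 'm \<Rightarrow> 'm) \<Rightarrow> (int \<Rightarrow> 'm \<Rightarrow> 'm) \<Rightarrow>
    int \<Rightarrow> 'm \<Rightarrow> 'm" where
  "chain_comp A g f = (\<lambda>n. compose (carrier (gr A n)) (g n) (f n))"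

definition chain_homotopic :: "('r, 'x) ring_scheme \<Rightarrow> ('r, 'm) chain_cx \<Rightarrow> ('r, 'm) chain_cx \<Rightarrow>
    (int \<Rightarrow> 'm \<Rightarrow> 'm) \<Rightarrow> (int \<Rightarrow> 'm \<Rightarrow> 'm) \<Rightarrow> bool" where
  "chain_homotopic R A B f g \<longleftrightarrow>
     (\<exists>h. (\<forall>n. h n \<in> linmaps R (gr A n) (gr B (n + 1))) \<and>
        (\<forall>n. \<forall>a\<in>carrier (gr A n).
           g n a \<ominus>\<^bsub>gr B n\<^esub> f n a = bd B (n + 1) (h n a) \<oplus>\<^bsub>gr B n\<^esub> h (n - 1) (bd A n a)))"

definition chain_equivs :: "('r, 'x) ring_scheme \<Rightarrow> ('r, 'm) chain_cx \<Rightarrow> ('r, 'm) chain_cx \<Rightarrow>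
    (int \<Rightarrow> 'm \<Rightarrow> 'm) set" where
  "chain_equivs R A B = {f \<in> chain_maps R A B. \<exists>g\<in>chain_maps R B A.
     chain_homotopic R A A (chain_comp A g f) (chain_id A) \<and>
     chain_homotopic R B B (chain_comp B f g) (chain_id B)}"

definition homotopy_class :: "('r, 'x) ring_scheme \<Rightarrow> ('r, 'm) chain_cx \<Rightarrow> ('r, 'm) chain_cx \<Rightarrow>
    (int \<Rightarrow> 'm \<Rightarrow> 'm) \<Rightarrow> (int \<Rightarrow> 'm \<Rightarrow> 'm) set" where
  "homotopy_class R A B f = {g \<in> chain_maps R A B. chain_homotopic R A B f g}"


section \<open>A-infinity algebras, morphisms, homotopies and isotopies\<close>

text \<open>An A-infinity algebra is a pair of a chain complex and the family of its operations
  \<open>\<mu>\<^sub>k\<close>, \<open>k \<ge> 2\<close>; \<open>ainf_ops\<close> adjoins the differential as the operation of arity one.\<close>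

type_synonym ('r, 'm) ainf = "('r, 'm) chain_cx \<times> ('m word \<Rightarrow> 'm)"

definition ainf_ops :: "('r, 'm) ainf \<Rightarrow> 'm word \<Rightarrow> 'm" where
  "ainf_ops a = (\<lambda>w. if length w = 1 then bd (fst a) (fst (hd w)) (snd (hd w)) else snd a w)"

abbreviation ugr :: "('r, 'm) ainf \<Rightarrow> ('r, 'm) gmod" where
  "ugr a \<equiv> gr (fst a)"

definition codiff :: "('r, 'x) ring_scheme \<Rightarrow> ('r, 'm) ainf \<Rightarrow> ('r, 'm) tc \<Rightarrow> ('r, 'm) tc" where
  "codiff R a = coder_of R (ugr a) (ainf_ops a)"

definition ainf_algebra :: "('r, 'x) ring_scheme \<Rightarrow> ('r, 'm) ainf \<Rightarrow> bool" where
  "ainf_algebra R a \<longleftrightarrow>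
     chain_complex R (fst a) \<and>
     snd a \<in> multi_ops R (ugr a) (ugr a) {2..} (-1) \<and>
     (\<forall>x\<in>carrier (Tc R (ugr a)). codiff R a (codiff R a x) = \<zero>\<^bsub>Tc R (ugr a)\<^esub>)"

text \<open>A morphism is the family \<open>(f, f\<^sub>2, f\<^sub>3, \<dots>)\<close> as one function on words of any positive length.\<close>

definition ainf_morphisms :: "('r, 'x) ring_scheme \<Rightarrow> ('r, 'm) ainf \<Rightarrow> ('r, 'm) ainf \<Rightarrow>
    ('m word \<Rightarrow> 'm) set" where
  "ainf_morphisms R a b = {F \<in> multi_ops R (ugr a) (ugr b) {1..} 0.
     ainf_algebra R a \<and> ainf_algebra R b \<and>
     (\<forall>x\<in>carrier (Tc R (ugr a)).
        codiff R b (coalg_of R (ugr a) (ugr b) F x) = coalg_of R (ugr a) (ugr b) F (codiff R a x))}"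

definition linear_part :: "('m word \<Rightarrow> 'm) \<Rightarrow> int \<Rightarrow> 'm \<Rightarrow> 'm" where
  "linear_part F = (\<lambda>d x. F [(d, x)])"

definition ainf_comp :: "('r, 'x) ring_scheme \<Rightarrow> ('r, 'm) ainf \<Rightarrow> ('r, 'm) ainf \<Rightarrow> ('r, 'm) ainf \<Rightarrow>
    ('m word \<Rightarrow> 'm) \<Rightarrow> ('m word \<Rightarrow> 'm) \<Rightarrow> 'm word \<Rightarrow> 'm" where
  "ainf_comp R a b c G F = (THE H. H \<in> multi_ops R (ugr a) (ugr c) {1..} 0 \<and>
     coalg_of R (ugr a) (ugr c) H =
       compose (carrier (Tc R (ugr a))) (coalg_of R (ugr b) (ugr c) G) (coalg_of R (ugr a) (ugr b) F))"

definition ainf_id :: "('r, 'x) ring_scheme \<Rightarrow> ('r, 'm) ainf \<Rightarrow> 'm word \<Rightarrow> 'm" where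
  "ainf_id R a = (THE H. H \<in> multi_ops R (ugr a) (ugr a) {1..} 0 \<and>
     coalg_of R (ugr a) (ugr a) H = lin_id (Tc R (ugr a)))"

definition ainf_homotopic :: "('r, 'x) ring_scheme \<Rightarrow> ('r, 'm) ainf \<Rightarrow> ('r, 'm) ainf \<Rightarrow>
    ('m word \<Rightarrow> 'm) \<Rightarrow> ('m word \<Rightarrow> 'm) \<Rightarrow> bool" where
  "ainf_homotopic R a b F G \<longleftrightarrow> (\<exists>h\<in>multi_ops R (ugr a) (ugr b) {1..} 1.
     \<forall>x\<in>carrier (Tc R (ugr a)).
       coalg_of R (ugr a) (ugr b) G x \<ominus>\<^bsub>Tc R (ugr b)\<^esub> coalg_of R (ugr a) (ugr b) F x =
         codiff R b (homotopy_of R (ugr a) (ugr b) F G h x)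
           \<oplus>\<^bsub>Tc R (ugr b)\<^esub> homotopy_of R (ugr a) (ugr b) F G h (codiff R a x))"

definition isotopies :: "('r, 'x) ring_scheme \<Rightarrow> ('r, 'm) ainf \<Rightarrow> ('r, 'm) ainf \<Rightarrow>
    ('m word \<Rightarrow> 'm) set" where
  "isotopies R a a' = {S \<in> ainf_morphisms R a a'. fst a = fst a' \<and> linear_part S = chain_id (fst a)}"

definition isotopic :: "('r, 'x) ring_scheme \<Rightarrow> ('r, 'm) ainf \<Rightarrow> ('r, 'm) ainf \<Rightarrow> bool" where
  "isotopic R a a' \<longleftrightarrow> isotopies R a a' \<noteq> {}"

definition isotopy_class :: "('r, 'x) ring_scheme \<Rightarrow> ('r, 'm) ainf \<Rightarrow> ('r, 'm) ainf set" where
  "isotopy_class R a = {a'. isotopic R a a'}"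


section \<open>Categories and discrete fibrations\<close>

record ('o, 'a) category =
  Obj :: "'o set"
  Arr :: "'a set"
  Dom :: "'a \<Rightarrow> 'o"
  Cod :: "'a \<Rightarrow> 'o"
  Ident :: "'o \<Rightarrow> 'a"
  Comp :: "'a \<Rightarrow> 'a \<Rightarrow> 'a"

definition is_category :: "('o, 'a) category \<Rightarrow> bool" where
  "is_category C \<longleftrightarrow>
     (\<forall>f\<in>Arr C. Dom C f \<in> Obj C \<and> Cod C f \<in> Obj C) \<and>
     (\<forall>x\<in>Obj C. Ident C x \<in> Arr C \<and> Dom C (Ident C x) = x \<and> Cod C (Ident C x) = x) \<and>
     (\<forall>f\<in>Arr C. \<forall>g\<in>Arr C. Cod C f = Dom C g \<longrightarrow>
        Comp C g f \<in> Arr C \<and> Dom C (Comp C g f) = Dom C f \<and> Cod C (Comp C g f) = Cod C g) \<and>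
     (\<forall>f\<in>Arr C. Comp C f (Ident C (Dom C f)) = f \<and> Comp C (Ident C (Cod C f)) f = f) \<and>
     (\<forall>f\<in>Arr C. \<forall>g\<in>Arr C. \<forall>h\<in>Arr C. Cod C f = Dom C g \<longrightarrow> Cod C g = Dom C h \<longrightarrow>
        Comp C h (Comp C g f) = Comp C (Comp C h g) f)"

definition op_category :: "('o, 'a) category \<Rightarrow> ('o, 'a) category" where
  "op_category C = \<lparr>Obj = Obj C, Arr = Arr C, Dom = Cod C, Cod = Dom C,
     Ident = Ident C, Comp = (\<lambda>g f. Comp C f g)\<rparr>"

text \<open>A functor is a pair of its action on objects and its action on arrows.\<close>

definition is_functor :: "('o, 'a) category \<Rightarrow> ('p, 'b) category \<Rightarrow> ('o \<Rightarrow> 'p) \<times> ('a \<Rightarrow> 'b) \<Rightarrow> bool" where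
  "is_functor E B p \<longleftrightarrow> is_category E \<and> is_category B \<and>
     (\<forall>x\<in>Obj E. fst p x \<in> Obj B \<and> snd p (Ident E x) = Ident B (fst p x)) \<and>
     (\<forall>f\<in>Arr E. snd p f \<in> Arr B \<and>
        Dom B (snd p f) = fst p (Dom E f) \<and> Cod B (snd p f) = fst p (Cod E f)) \<and>
     (\<forall>f\<in>Arr E. \<forall>g\<in>Arr E. Cod E f = Dom E g \<longrightarrow>
        snd p (Comp E g f) = Comp B (snd p g) (snd p f))"

definition discrete_fibration ::
    "('o, 'a) category \<Rightarrow> ('p, 'b) category \<Rightarrow> ('o \<Rightarrow> 'p) \<times> ('a \<Rightarrow> 'b) \<Rightarrow> bool" where
  "discrete_fibration E B p \<longleftrightarrow> is_functor E B p \<and>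
     (\<forall>e\<in>Obj E. \<forall>\<beta>\<in>Arr B. Cod B \<beta> = fst p e \<longrightarrow>
        (\<exists>!\<epsilon>. \<epsilon> \<in> Arr E \<and> Cod E \<epsilon> = e \<and> snd p \<epsilon> = \<beta>))"

definition discrete_opfibration ::
    "('o, 'a) category \<Rightarrow> ('p, 'b) category \<Rightarrow> ('o \<Rightarrow> 'p) \<times> ('a \<Rightarrow> 'b) \<Rightarrow> bool" where
  "discrete_opfibration E B p \<longleftrightarrow> discrete_fibration (op_category E) (op_category B) p"

definition discrete_bifibration ::
    "('o, 'a) category \<Rightarrow> ('p, 'b) category \<Rightarrow> ('o \<Rightarrow> 'p) \<times> ('a \<Rightarrow> 'b) \<Rightarrow> bool" where
  "discrete_bifibration E B p \<longleftrightarrow> discrete_fibration E B p \<and> discrete_opfibration E B p"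

definition surjective_on_objects ::
    "('o, 'a) category \<Rightarrow> ('p, 'b) category \<Rightarrow> ('o \<Rightarrow> 'p) \<times> ('a \<Rightarrow> 'b) \<Rightarrow> bool" where
  "surjective_on_objects E B p \<longleftrightarrow> fst p ` Obj E = Obj B"


section \<open>The categories and the forgetful functor\<close>

text \<open>Arrows carry their domain and codomain explicitly.\<close>

type_synonym ('r, 'm) che_arr =
  "('r, 'm) chain_cx \<times> ('r, 'm) chain_cx \<times> (int \<Rightarrow> 'm \<Rightarrow> 'm) set"

definition CHE :: "('r, 'x) ring_scheme \<Rightarrow> (('r, 'm) chain_cx, ('r, 'm) che_arr) category" where
  "CHE R = \<lparr>
     Obj = {A. chain_complex R A},
     Arr = {(A, B, homotopy_class R A B f) | A B f.
              chain_complex R A \<and> chain_complex R B \<and> f \<in> chain_equivs R A B},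
     Dom = (\<lambda>(A, B, P). A),
     Cod = (\<lambda>(A, B, P). B),
     Ident = (\<lambda>A. (A, A, homotopy_class R A A (chain_id A))),
     Comp = (\<lambda>(_, C, Q) (A, B, P).
       (A, C, \<Union>f\<in>P. \<Union>g\<in>Q. homotopy_class R A C (chain_comp A g f)))\<rparr>"

text \<open>A morphism together with its source and target.\<close>

type_synonym ('r, 'm) ainf_mor = "('r, 'm) ainf \<times> ('r, 'm) ainf \<times> ('m word \<Rightarrow> 'm)"

definition ainf_equivs :: "('r, 'x) ring_scheme \<Rightarrow> ('r, 'm) ainf_mor set" where
  "ainf_equivs R = {(a, b, F). F \<in> ainf_morphisms R a b \<and>
     linear_part F \<in> chain_equivs R (fst a) (fst b)}"

text \<open>The four disjuncts are equivalent to each other, so that their disjunction amounts to any one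
  of them.\<close>

definition identified :: "('r, 'x) ring_scheme \<Rightarrow> ('r, 'm) ainf_mor \<Rightarrow> ('r, 'm) ainf_mor \<Rightarrow> bool" where
  "identified R = (\<lambda>(a', b', F') (a'', b'', F'').
     (a', b', F') \<in> ainf_equivs R \<and> (a'', b'', F'') \<in> ainf_equivs R \<and>
     fst a' = fst a'' \<and> fst b' = fst b'' \<and>
     (let homotopic = chain_homotopic R (fst a') (fst b') (linear_part F') (linear_part F'') in
        homotopic \<and> isotopic R a' a'' \<or>
        homotopic \<and> isotopic R b' b'' \<or>
        homotopic \<and> isotopic R a' a'' \<and> isotopic R b' b'' \<or>
        (\<exists>S\<in>isotopies R a' a''. \<exists>T\<in>isotopies R b' b''.
           ainf_homotopic R a' b'' (ainf_comp R a' b' b'' T F') (ainf_comp R a' a'' b'' F'' S))))"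

definition mor_class :: "('r, 'x) ring_scheme \<Rightarrow> ('r, 'm) ainf_mor \<Rightarrow> ('r, 'm) ainf_mor set" where
  "mor_class R t = {t'. identified R t t'}"

type_synonym ('r, 'm) isot_arr =
  "('r, 'm) ainf set \<times> ('r, 'm) ainf set \<times> ('r, 'm) ainf_mor set"

text \<open>In \<open>Comp\<close> below, the classes of \<open>Y S F\<close> for the various choices of representatives
  \<open>F\<close>, \<open>Y\<close> and of the isotopy \<open>S\<close> all coincide, so that their union is any one of them;
  similarly for \<open>Ident\<close>.\<close>

definition Isot_inf :: "('r, 'x) ring_scheme \<Rightarrow>
    (('r, 'm) ainf set, ('r, 'm) isot_arr) category" where
  "Isot_inf R = \<lparr>
     Obj = {isotopy_class R a | a. ainf_algebra R a},
     Arr = {(isotopy_class R a, isotopy_class R b, mor_class R (a, b, F)) | a b F.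
              (a, b, F) \<in> ainf_equivs R},
     Dom = (\<lambda>(U, V, P). U),
     Cod = (\<lambda>(U, V, P). V),
     Ident = (\<lambda>U. (U, U, \<Union>a\<in>U. mor_class R (a, a, ainf_id R a))),
     Comp = (\<lambda>(_, V, Q) (U, _, P).
       (U, V, \<Union>(a, b', F)\<in>P. \<Union>(b'', c, Y)\<in>Q. \<Union>S\<in>isotopies R b' b''.
          mor_class R (a, c, ainf_comp R a b'' c Y (ainf_comp R a b' b'' S F))))\<rparr>"

definition underlying :: "('r, 'm) ainf set \<Rightarrow> ('r, 'm) chain_cx" where
  "underlying U = (THE A. \<exists>\<mu>. (A, \<mu>) \<in> U)"

definition Forget :: "('r, 'x) ring_scheme \<Rightarrow>
    (('r, 'm) ainf set \<Rightarrow> ('r, 'm) chain_cx) \<times> (('r, 'm) isot_arr \<Rightarrow> ('r, 'm) che_arr)" where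
  "Forget R = (underlying,
     (\<lambda>(U, V, P). (underlying U, underlying V,
        \<Union>(a, b, F)\<in>P. homotopy_class R (fst a) (fst b) (linear_part F))))"

end

theory Submission
  imports Defs
begin

text \<open>\<^bold>\<open>Reduction.\<close>  An arrow of \<open>Isot_inf\<close> is determined by the homotopy class of its linear part and by
  the isotopy class of either end (\<open>isot_arrow_determined\<close>).  Hence the theorem says: for a chain
  homotopy equivalence \<open>f : A \<rightarrow> B\<close>, an A-infinity structure on one of the two complexes can be transferred
  to the other together with a morphism that extends \<open>f\<close>, and the result is unique up to isotopy.

  \<^bold>\<open>Three constructions.\<close>  Let \<open>p\<close> be the projection of a tensor coalgebra to words of length one.
  Morphisms of tensor coalgebras and coderivations are freely prescribed by their
  corestrictions, their composites with \<open>p\<close>.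

  \<^item> Transfer (\<open>transfer\<close>, \<open>pull\<close>).  Let \<open>\<delta>\<close> be the codifferential of a structure on \<open>B\<close>, with corestriction
    \<open>\<partial> + b2\<close>, where \<open>b2\<close> lives on words of length at least two.  Let \<open>g : B \<rightarrow> A\<close> be a chain map and
    \<open>\<partial> h + h \<partial> = f g - 1\<close>.  There is a unique morphism \<open>\<phi>\<close> with corestriction \<open>f + h b2 \<phi>\<close>, by recursion on
    the length of words, since \<open>b2\<close> kills words of length one.  Let \<open>\<mu>\<close> be the coderivation
    with corestriction \<open>\<partial> + g b2 \<phi>\<close>.  From \<open>\<delta> \<delta> = 0\<close>, that is \<open>\<partial> b2 = - b2 \<delta>\<close>, one computes that
    \<open>E = \<delta> \<phi> - \<phi> \<mu>\<close> has corestriction \<open>h b2 E\<close>, whence \<open>E = 0\<close>, again by recursion on length.  Then \<open>\<mu> \<mu>\<close> has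
    corestriction \<open>\<partial> g b2 \<phi> + g b2 \<delta> \<phi> = 0\<close>.  So \<open>\<mu>\<close> is a structure on \<open>A\<close> and \<open>\<phi>\<close> a morphism
    extending \<open>f\<close>.

  \<^item> Homotopy (\<open>homotope\<close>, \<open>rehomotope\<close>).  The linear part of a morphism can be replaced by any homotopic
    chain map: if \<open>h\<close> is the homotopy, take \<open>\<psi> = \<phi> + \<delta> \<eta> + \<eta> \<mu>\<close>, where \<open>\<eta>\<close> is the
    \<open>(\<phi>, \<psi>)\<close>-coderivation with corestriction \<open>h\<close>.

  \<^item> Inversion (\<open>comorph_inverse\<close>, \<open>isotopic_sym\<close>).  Isotopies are invertible.

  \<^bold>\<open>Consequences.\<close>  Let \<open>G : c \<rightarrow> b\<close> be a morphism whose linear part \<open>g\<close> is an equivalence, with inverse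
  \<open>r\<close>.  Transfer along \<open>r\<close> gives \<open>K : b' \<rightarrow> c\<close>; the linear part of \<open>G K : b' \<rightarrow> b\<close> is homotopic to the identity,
  so \<open>b'\<close> and \<open>b\<close> are isotopic, and \<open>r\<close> is the linear part of a morphism \<open>b \<rightarrow> c\<close> (\<open>quasi_inverse\<close>).
  Therefore a structure can also be transferred from \<open>A\<close> to \<open>B\<close>, along an inverse of \<open>f\<close> (\<open>push\<close>).  And
  two structures on \<open>A\<close> with morphisms to isotopic structures on \<open>B\<close>, with homotopic linear
  parts, are connected by a morphism with linear part homotopic to the identity, which means by an isotopy
  (\<open>isotopic_sources\<close>, and dually \<open>isotopic_targets\<close>).

  \<^bold>\<open>Form of the computations.\<close>  The modules of a complex have their carriers in a type.  They are all
  retracts of one abelian group, of type \<open>ambient\<close>, and their linear maps are extended to it; then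
  maps of tensor coalgebras are total functions that can be added and composed, and
  equations between them need no membership conditions.  The identity \<open>x = p x + glue (\<Delta> x)\<close>
  (\<open>split_proj1\<close>) turns every property of the coproduct \<open>\<Delta>\<close> into a recursion on the length
  of words; its existence part is \<open>fixpoint\<close> and its uniqueness part \<open>vanishing\<close>.
\<close>

section \<open>An abelian group that contains every module\<close>

text \<open>An element chooses one vector in every abelian group whose carrier lies in the type \<open>'m\<close>.  Every
  module \<open>M\<close> is a retract of this one group, by \<open>emb M\<close> and \<open>prj M\<close>, so that identities in
  varying carriers become identities in a type of class \<open>ab_group_add\<close>, where a linear map can be
  total.  The value \<open>undefined\<close> at records that are not groups makes elements equal as
  soon as their coordinates in groups agree.\<close>

typedef ('r, 'm) ambient = "{v :: ('r, 'm) module \<Rightarrow> 'm.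
    \<forall>M. (abelian_group M \<longrightarrow> v M \<in> carrier M) \<and> (\<not> abelian_group M \<longrightarrow> v M = undefined)}"
  by (rule exI[of _ "\<lambda>M. if abelian_group M then \<zero>\<^bsub>M\<^esub> else undefined"])
     (auto intro: abelian_groupE)

setup_lifting type_definition_ambient

lemma ambient_eqI: "(\<And>M. abelian_group M \<Longrightarrow> Rep_ambient v M = Rep_ambient w M) \<Longrightarrow> v = w"
proof -
  assume a: "\<And>M. abelian_group M \<Longrightarrow> Rep_ambient v M = Rep_ambient w M"
  have "Rep_ambient v M = Rep_ambient w M" for M
    using a[of M] Rep_ambient[of v] Rep_ambient[of w] by (cases "abelian_group M") simp_all
  then show ?thesis by (simp add: Rep_ambient_inject[symmetric] ext)
qed

instantiation ambient :: (type, type) ab_group_add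
begin

lift_definition zero_ambient :: "('a, 'b) ambient" is
  "\<lambda>M. if abelian_group M then \<zero>\<^bsub>M\<^esub> else undefined"
  by (auto intro: abelian_groupE)

lift_definition plus_ambient :: "('a, 'b) ambient \<Rightarrow> ('a, 'b) ambient \<Rightarrow> ('a, 'b) ambient" is
  "\<lambda>v w M. if abelian_group M then v M \<oplus>\<^bsub>M\<^esub> w M else undefined"
  by (auto intro: abelian_groupE)

lift_definition uminus_ambient :: "('a, 'b) ambient \<Rightarrow> ('a, 'b) ambient" is
  "\<lambda>v M. if abelian_group M then \<ominus>\<^bsub>M\<^esub> v M else undefined"
  by (auto simp: abelian_group.a_inv_closed)

definition minus_ambient :: "('a, 'b) ambient \<Rightarrow> ('a, 'b) ambient \<Rightarrow> ('a, 'b) ambient" where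
  "minus_ambient v w = v + - w"

instance
proof
  fix a b c :: "('a, 'b) ambient"
  have cl: "Rep_ambient v M \<in> carrier M" if "abelian_group M" for v :: "('a, 'b) ambient" and M
    using Rep_ambient[of v] that by (auto split: if_splits)
  show "a + b + c = a + (b + c)"
    by (rule ambient_eqI) (simp add: plus_ambient.rep_eq abelian_group.axioms abelian_monoid.a_assoc cl)
  show "a + b = b + a"
    by (rule ambient_eqI) (simp add: plus_ambient.rep_eq abelian_group.axioms abelian_monoid.a_comm cl)
  show "0 + a = a"
    by (rule ambient_eqI)
       (simp add: plus_ambient.rep_eq zero_ambient.rep_eq abelian_group.axioms abelian_monoid.l_zero cl)
  show "- a + a = 0"
    by (rule ambient_eqI)
       (simp add: plus_ambient.rep_eq zero_ambient.rep_eq uminus_ambient.rep_eq abelian_group.l_neg cl)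
  show "a - b = a + - b" by (fact minus_ambient_def)
qed

end

definition prj :: "('r, 'm) module \<Rightarrow> ('r, 'm) ambient \<Rightarrow> 'm" where
  "prj M v = Rep_ambient v M"

lift_definition emb :: "('r, 'm) module \<Rightarrow> 'm \<Rightarrow> ('r, 'm) ambient" is
  "\<lambda>M x M'. if abelian_group M' then (if M' = M \<and> x \<in> carrier M then x else \<zero>\<^bsub>M'\<^esub>) else undefined"
  by (auto intro: abelian_groupE)

text \<open>The idempotent onto the copy of \<open>M\<close>; it plays the part of the identity of \<open>M\<close> among the maps
  of the ambient group.\<close>

definition retr :: "('r, 'm) module \<Rightarrow> ('r, 'm) ambient \<Rightarrow> ('r, 'm) ambient" where
  "retr M v = emb M (prj M v)"

text \<open>Scalars act on the coordinates that are \<open>R\<close>-modules and fix the others: this is additive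
  throughout, and agrees with the action of \<open>R\<close> on every module.\<close>

lift_definition scale :: "('r, 'x) ring_scheme \<Rightarrow> 'r \<Rightarrow> ('r, 'm) ambient \<Rightarrow> ('r, 'm) ambient" is
  "\<lambda>R r v M. if module R M \<and> r \<in> carrier R then r \<odot>\<^bsub>M\<^esub> v M else v M"
  by (auto simp: module.axioms(2) module.smult_closed split: if_splits)

lemma prj_closed [simp]: "abelian_group M \<Longrightarrow> prj M v \<in> carrier M"
  using Rep_ambient[of v] by (auto simp: prj_def split: if_splits)

lemma prj_add [simp]: "abelian_group M \<Longrightarrow> prj M (v + w) = prj M v \<oplus>\<^bsub>M\<^esub> prj M w"
  by (simp add: prj_def plus_ambient.rep_eq)

lemma prj_zero [simp]: "abelian_group M \<Longrightarrow> prj M 0 = \<zero>\<^bsub>M\<^esub>"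
  by (simp add: prj_def zero_ambient.rep_eq)

lemma prj_uminus [simp]: "abelian_group M \<Longrightarrow> prj M (- v) = \<ominus>\<^bsub>M\<^esub> prj M v"
  by (simp add: prj_def uminus_ambient.rep_eq)

lemma prj_scale [simp]: "module R M \<Longrightarrow> r \<in> carrier R \<Longrightarrow> prj M (scale R r v) = r \<odot>\<^bsub>M\<^esub> prj M v"
  by (simp add: prj_def scale.rep_eq)

lemma prj_emb [simp]: "abelian_group M \<Longrightarrow> x \<in> carrier M \<Longrightarrow> prj M (emb M x) = x"
  by (simp add: prj_def emb.rep_eq)

lemma emb_eq_iff:
  "abelian_group M \<Longrightarrow> x \<in> carrier M \<Longrightarrow> y \<in> carrier M \<Longrightarrow> emb M x = emb M y \<longleftrightarrow> x = y"
  by (metis prj_emb)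

lemma emb_add: "abelian_group M \<Longrightarrow> x \<in> carrier M \<Longrightarrow> y \<in> carrier M \<Longrightarrow>
    emb M (x \<oplus>\<^bsub>M\<^esub> y) = emb M x + emb M y"
  by (rule ambient_eqI)
     (auto simp: emb.rep_eq plus_ambient.rep_eq abelian_group.axioms abelian_monoid.a_closed
       abelian_monoid.l_zero abelian_monoid.zero_closed)

lemma emb_zero: "abelian_group M \<Longrightarrow> emb M \<zero>\<^bsub>M\<^esub> = 0"
  by (rule ambient_eqI) (auto simp: emb.rep_eq zero_ambient.rep_eq)

lemma emb_uminus: "abelian_group M \<Longrightarrow> x \<in> carrier M \<Longrightarrow> emb M (\<ominus>\<^bsub>M\<^esub> x) = - emb M x"
  by (metis add_eq_0_iff abelian_group.a_inv_closed abelian_group.r_neg emb_add emb_zero)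

lemma emb_diff: "abelian_group M \<Longrightarrow> x \<in> carrier M \<Longrightarrow> y \<in> carrier M \<Longrightarrow>
    emb M (x \<ominus>\<^bsub>M\<^esub> y) = emb M x - emb M y"
  by (simp add: a_minus_def emb_add emb_uminus abelian_group.a_inv_closed)

lemma emb_scale: "module R M \<Longrightarrow> r \<in> carrier R \<Longrightarrow> x \<in> carrier M \<Longrightarrow>
    emb M (r \<odot>\<^bsub>M\<^esub> x) = scale R r (emb M x)"
  by (rule ambient_eqI) (auto simp: emb.rep_eq scale.rep_eq module.smult_closed module.smult_r_null)

lemma scale_add: "scale R r (v + w) = scale R r v + scale R r w"
  by (rule ambient_eqI)
     (auto simp: plus_ambient.rep_eq scale.rep_eq module.smult_r_distr prj_closed[unfolded prj_def])

lemma retr_add: "abelian_group M \<Longrightarrow> retr M (v + w) = retr M v + retr M w"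
  by (simp add: retr_def emb_add)

lemma retr_scale: "module R M \<Longrightarrow> r \<in> carrier R \<Longrightarrow> retr M (scale R r v) = scale R r (retr M v)"
  by (simp add: retr_def emb_scale module.axioms(2))

lemma prj_retr [simp]: "abelian_group M \<Longrightarrow> prj M (retr M v) = prj M v"
  by (simp add: retr_def)

lemma retr_retr [simp]: "abelian_group M \<Longrightarrow> retr M (retr M v) = retr M v"
  by (simp add: retr_def)

lemma retr_emb [simp]: "abelian_group M \<Longrightarrow> x \<in> carrier M \<Longrightarrow> retr M (emb M x) = emb M x"
  by (simp add: retr_def)

lemma emb_prj: "emb M (prj M v) = retr M v"
  by (simp add: retr_def)

lemma scale_lincomb:
  assumes "module R M" "r \<in> carrier R" "s \<in> carrier R" "retr M v = v"
  shows "scale R (r \<oplus>\<^bsub>R\<^esub> s) v = scale R r v + scale R s v"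
    and "scale R (r \<otimes>\<^bsub>R\<^esub> s) v = scale R r (scale R s v)"
    and "scale R \<one>\<^bsub>R\<^esub> v = v"
    and "scale R \<zero>\<^bsub>R\<^esub> v = 0"
proof -
  interpret module R M by fact
  have v: "v = emb M (prj M v)" using assms(4) by (simp add: retr_def)
  have p: "prj M v \<in> carrier M" by (simp add: M.abelian_group_axioms)
  note s = emb_scale[OF assms(1), symmetric]
  show "scale R (r \<oplus>\<^bsub>R\<^esub> s) v = scale R r v + scale R s v"
    by (subst v, subst (2) v, subst (3) v)
       (simp add: s p assms smult_l_distr emb_add M.abelian_group_axioms)
  show "scale R (r \<otimes>\<^bsub>R\<^esub> s) v = scale R r (scale R s v)"
    by (subst v, subst (2) v) (simp add: s p assms smult_assoc1)
  show "scale R \<one>\<^bsub>R\<^esub> v = v"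
    by (subst v, subst (2) v) (simp add: s p)
  show "scale R \<zero>\<^bsub>R\<^esub> v = 0"
    by (subst v) (simp add: s p emb_zero M.abelian_group_axioms)
qed

section \<open>Linear maps of ambient groups\<close>

definition lin :: "('r, 'x) ring_scheme \<Rightarrow> (('r, 'm) ambient \<Rightarrow> ('r, 'n) ambient) \<Rightarrow> bool" where
  "lin R f \<longleftrightarrow> (\<forall>v w. f (v + w) = f v + f w) \<and> (\<forall>r\<in>carrier R. \<forall>v. f (scale R r v) = scale R r (f v))"

lemma lin_add: "lin R f \<Longrightarrow> f (v + w) = f v + f w"
  by (simp add: lin_def)

lemma lin_scale: "lin R f \<Longrightarrow> r \<in> carrier R \<Longrightarrow> f (scale R r v) = scale R r (f v)"
  by (simp add: lin_def)

lemma lin_0: "lin R f \<Longrightarrow> f 0 = 0"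
  using lin_add[of R f 0 0] by simp

lemma lin_uminus: "lin R f \<Longrightarrow> f (- v) = - f v"
  using lin_add[of R f v "-v"] by (simp add: lin_0 add_eq_0_iff)

lemma lin_diff: "lin R f \<Longrightarrow> f (v - w) = f v - f w"
  using lin_add[of R f v "-w"] by (simp add: lin_uminus)

lemma lin_sum: "lin R f \<Longrightarrow> f (\<Sum>i\<in>I. g i) = (\<Sum>i\<in>I. f (g i))"
  by (induction I rule: infinite_finite_induct) (simp_all add: lin_0 lin_add)

lemma scale_0: "scale R r 0 = 0"
  using scale_add[of R r 0 0] by simp

lemma scale_uminus: "scale R r (- v) = - scale R r v"
  using scale_add[of R r v "-v"] by (simp add: scale_0 add_eq_0_iff)

lemma lin_zero [intro, simp]: "lin R (\<lambda>x. 0)"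
  by (simp add: lin_def scale_0)

lemma lin_plus [intro]: "lin R f \<Longrightarrow> lin R g \<Longrightarrow> lin R (\<lambda>x. f x + g x)"
  by (simp add: lin_def scale_add algebra_simps)

lemma lin_neg [intro]: "lin R f \<Longrightarrow> lin R (\<lambda>x. - f x)"
  by (simp add: lin_def scale_uminus)

lemma lin_minus [intro]: "lin R f \<Longrightarrow> lin R g \<Longrightarrow> lin R (\<lambda>x. f x - g x)"
  using lin_plus[of R f "\<lambda>x. - g x"] lin_neg[of R g] by simp

lemma lin_comp [intro]: "lin R f \<Longrightarrow> lin R g \<Longrightarrow> lin R (\<lambda>x. f (g x))"
  by (simp add: lin_def)

lemma lin_retr [intro, simp]: "module R M \<Longrightarrow> lin R (retr M)"
  by (simp add: lin_def retr_add retr_scale module.axioms(2))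

lemma lin_scale_map: "cring R \<Longrightarrow> r \<in> carrier R \<Longrightarrow> lin R (scale R r)"
  unfolding lin_def
proof (intro conjI ballI allI)
  fix s and v :: "('a, 'c) ambient"
  assume "cring R" "r \<in> carrier R" "s \<in> carrier R"
  then show "scale R r (scale R s v) = scale R s (scale R r v)"
    by (intro ambient_eqI) (auto simp: scale.rep_eq prj_closed[unfolded prj_def]
        module.smult_assoc1[symmetric] cring.cring_simprules(14) module.axioms(2))
qed (simp add: scale_add)

text \<open>The linear maps \<open>M \<rightarrow> N\<close>, extended to the ambient groups through the retractions.  This is a
  bijection, by \<open>hat\<close> and \<open>unhat\<close>.\<close>

definition lhom :: "('r, 'x) ring_scheme \<Rightarrow> ('r, 'm) module \<Rightarrow> ('r, 'n) module \<Rightarrow>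
    (('r, 'm) ambient \<Rightarrow> ('r, 'n) ambient) \<Rightarrow> bool" where
  "lhom R M N f \<longleftrightarrow> lin R f \<and> (\<forall>v. f (retr M v) = f v) \<and> (\<forall>v. retr N (f v) = f v)"

lemma lhom_lin: "lhom R M N f \<Longrightarrow> lin R f" by (simp add: lhom_def)

lemma lhom_retr: "lhom R M N f \<Longrightarrow> f (retr M v) = f v" by (simp add: lhom_def)

lemma retr_lhom: "lhom R M N f \<Longrightarrow> retr N (f v) = f v" by (simp add: lhom_def)

lemma lhom_comp [intro]: "lhom R N P f \<Longrightarrow> lhom R M N g \<Longrightarrow> lhom R M P (\<lambda>x. f (g x))"
  by (auto simp: lhom_def)

lemma lhom_id [intro, simp]: "module R M \<Longrightarrow> lhom R M M (retr M)"
  by (auto simp: lhom_def module.axioms(2))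

lemma lhom_plus [intro]:
  "module R N \<Longrightarrow> lhom R M N f \<Longrightarrow> lhom R M N g \<Longrightarrow> lhom R M N (\<lambda>x. f x + g x)"
  by (auto simp: lhom_def retr_add module.axioms(2))

lemma lhom_zero [intro, simp]: "module R N \<Longrightarrow> lhom R M N (\<lambda>x. 0)"
  by (auto simp: lhom_def lin_0[OF lin_retr])

lemma lhom_neg [intro]: "module R N \<Longrightarrow> lhom R M N f \<Longrightarrow> lhom R M N (\<lambda>x. - f x)"
  by (auto simp: lhom_def lin_uminus[OF lin_retr])

lemma lhom_minus [intro]:
  "module R N \<Longrightarrow> lhom R M N f \<Longrightarrow> lhom R M N g \<Longrightarrow> lhom R M N (\<lambda>x. f x - g x)"
  by (auto simp: lhom_def lin_diff[OF lin_retr])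

definition hat :: "('r, 'm) module \<Rightarrow> ('r, 'n) module \<Rightarrow> ('m \<Rightarrow> 'n) \<Rightarrow> ('r, 'm) ambient \<Rightarrow> ('r, 'n) ambient" where
  "hat M N g = (\<lambda>v. emb N (g (prj M v)))"

definition unhat :: "('r, 'm) module \<Rightarrow> ('r, 'n) module \<Rightarrow> (('r, 'm) ambient \<Rightarrow> ('r, 'n) ambient) \<Rightarrow> 'm \<Rightarrow> 'n" where
  "unhat M N f = (\<lambda>x\<in>carrier M. prj N (f (emb M x)))"

lemma linmapsD:
  assumes "g \<in> linmaps R M N"
  shows "x \<in> carrier M \<Longrightarrow> g x \<in> carrier N"
    and "x \<in> carrier M \<Longrightarrow> y \<in> carrier M \<Longrightarrow> g (x \<oplus>\<^bsub>M\<^esub> y) = g x \<oplus>\<^bsub>N\<^esub> g y"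
    and "r \<in> carrier R \<Longrightarrow> x \<in> carrier M \<Longrightarrow> g (r \<odot>\<^bsub>M\<^esub> x) = r \<odot>\<^bsub>N\<^esub> g x"
    and "g \<in> extensional (carrier M)"
  using assms by (auto simp: linmaps_def PiE_def)

lemma lhom_hat:
  assumes "module R M" "module R N" "g \<in> linmaps R M N"
  shows "lhom R M N (hat M N g)"
proof -
  interpret M: module R M by fact
  interpret N: module R N by fact
  show ?thesis
    by (auto simp: lhom_def lin_def hat_def assms linmapsD[OF assms(3)] emb_add emb_scale[OF assms(2)]
        M.M.abelian_group_axioms N.M.abelian_group_axioms)
qed

lemma unhat_linmaps:
  assumes "module R M" "module R N" "lin R f"
  shows "unhat M N f \<in> linmaps R M N"
proof -
  interpret M: module R M by fact
  interpret N: module R N by fact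
  show ?thesis
    by (auto simp: linmaps_def unhat_def assms lin_add[OF assms(3)] lin_scale[OF assms(3)] emb_add
        emb_scale[OF assms(1)] M.M.abelian_group_axioms N.M.abelian_group_axioms)
qed

lemma hat_unhat:
  assumes "module R M" "module R N" "lhom R M N f"
  shows "hat M N (unhat M N f) = f"
proof
  fix v
  have "hat M N (unhat M N f) v = retr N (f (retr M v))"
    using assms by (simp add: hat_def unhat_def retr_def module.axioms(2))
  then show "hat M N (unhat M N f) v = f v" using assms by (simp add: lhom_retr retr_lhom)
qed

lemma unhat_hat:
  assumes "module R M" "module R N" "g \<in> linmaps R M N"
  shows "unhat M N (hat M N g) = g"
proof (rule extensionalityI[of _ "carrier M"])
  show "unhat M N (hat M N g) \<in> extensional (carrier M)" by (simp add: unhat_def)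
  show "g \<in> extensional (carrier M)" by (rule linmapsD(4)[OF assms(3)])
  show "unhat M N (hat M N g) x = g x" if "x \<in> carrier M" for x
    using that assms by (simp add: hat_def unhat_def module.axioms(2) linmapsD(1)[OF assms(3)])
qed

lemma hat_emb: "abelian_group M \<Longrightarrow> x \<in> carrier M \<Longrightarrow> hat M N g (emb M x) = emb N (g x)"
  by (simp add: hat_def)

section \<open>Free modules and presentations\<close>

lemma free_mod_sel [simp]:
  "ring.zero (free_mod R G) = (\<lambda>x. \<zero>\<^bsub>R\<^esub>)"
  "ring.add (free_mod R G) = (\<lambda>c d x. c x \<oplus>\<^bsub>R\<^esub> d x)"
  "smult (free_mod R G) = (\<lambda>r c x. r \<otimes>\<^bsub>R\<^esub> c x)"
  by (simp_all add: free_mod_def)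

lemma free_mod_carrier: "c \<in> carrier (free_mod R G) \<longleftrightarrow>
    (\<forall>x. c x \<in> carrier R) \<and> (\<forall>x. x \<notin> G \<longrightarrow> c x = \<zero>\<^bsub>R\<^esub>) \<and> finite {x. c x \<noteq> \<zero>\<^bsub>R\<^esub>}"
  by (simp add: free_mod_def)

lemma free_mod_module:
  assumes "cring R" shows "module R (free_mod R G)"
proof -
  interpret cring R by fact
  show ?thesis
  proof (rule moduleI)
    show "abelian_group (free_mod R G)"
    proof (rule abelian_groupI)
      show "x \<oplus>\<^bsub>free_mod R G\<^esub> y \<in> carrier (free_mod R G)"
        if "x \<in> carrier (free_mod R G)" "y \<in> carrier (free_mod R G)" for x y
      proof -
        have "finite ({g. x g \<noteq> \<zero>\<^bsub>R\<^esub>} \<union> {g. y g \<noteq> \<zero>\<^bsub>R\<^esub>})" using that by (simp add: free_mod_carrier)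
        then have "finite {g. x g \<oplus>\<^bsub>R\<^esub> y g \<noteq> \<zero>\<^bsub>R\<^esub>}" by (rule rev_finite_subset) auto
        then show ?thesis using that by (simp add: free_mod_carrier)
      qed
      show "\<exists>y\<in>carrier (free_mod R G). y \<oplus>\<^bsub>free_mod R G\<^esub> x = \<zero>\<^bsub>free_mod R G\<^esub>"
        if "x \<in> carrier (free_mod R G)" for x
      proof (rule bexI[of _ "\<lambda>g. \<ominus>\<^bsub>R\<^esub> x g"])
        have "finite {g. \<ominus>\<^bsub>R\<^esub> x g \<noteq> \<zero>\<^bsub>R\<^esub>}"
          by (rule finite_subset[of _ "{g. x g \<noteq> \<zero>\<^bsub>R\<^esub>}"]) (use that in \<open>auto simp: free_mod_carrier\<close>)
        then show "(\<lambda>g. \<ominus>\<^bsub>R\<^esub> x g) \<in> carrier (free_mod R G)"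
          using that by (simp add: free_mod_carrier)
      qed (use that in \<open>auto simp: free_mod_carrier l_neg\<close>)
    qed (auto simp: free_mod_carrier a_ac)
    show "a \<odot>\<^bsub>free_mod R G\<^esub> x \<in> carrier (free_mod R G)"
      if "a \<in> carrier R" "x \<in> carrier (free_mod R G)" for a x
    proof -
      have "finite {g. a \<otimes>\<^bsub>R\<^esub> x g \<noteq> \<zero>\<^bsub>R\<^esub>}"
        by (rule finite_subset[of _ "{g. x g \<noteq> \<zero>\<^bsub>R\<^esub>}"]) (use that in \<open>auto simp: free_mod_carrier\<close>)
      then show ?thesis using that by (simp add: free_mod_carrier)
    qed
  qed (auto simp: free_mod_carrier l_distr r_distr m_assoc assms)
qed

lemma free_gen_closed [simp]: "cring R \<Longrightarrow> x \<in> G \<Longrightarrow> free_gen R x \<in> carrier (free_mod R G)"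
  by (auto simp: free_mod_carrier free_gen_def cring_def ring.ring_simprules)

text \<open>The extension is the sum over the support, which is taken in the ambient group of \<open>N\<close>.\<close>

lemma free_mod_ext:
  assumes "cring R" "module R N" and k: "\<And>x. x \<in> G \<Longrightarrow> retr N (k x) = k x"
  shows "\<exists>f. lhom R (free_mod R G) N f \<and> (\<forall>x\<in>G. f (emb (free_mod R G) (free_gen R x)) = k x)"
proof -
  let ?F = "free_mod R G"
  interpret R: cring R by fact
  interpret F: module R ?F by (rule free_mod_module) fact
  interpret N: module R N by fact
  define ev where "ev c = (\<Sum>x\<in>{x\<in>G. c x \<noteq> \<zero>\<^bsub>R\<^esub>}. scale R (c x) (k x))" for c
  have sc0: "scale R \<zero>\<^bsub>R\<^esub> (k x) = 0" if "x \<in> G" for x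
    by (rule scale_lincomb(4)[OF assms(2) R.zero_closed R.zero_closed]) (simp add: k that)
  have evX: "ev c = (\<Sum>x\<in>Y. scale R (c x) (k x))"
    if "finite Y" "Y \<subseteq> G" "{x\<in>G. c x \<noteq> \<zero>\<^bsub>R\<^esub>} \<subseteq> Y" for c Y
    unfolding ev_def by (rule sum.mono_neutral_left) (use that sc0 in auto)
  have fin: "finite {x\<in>G. c x \<noteq> \<zero>\<^bsub>R\<^esub>}" if "c \<in> carrier ?F" for c
    using that by (auto simp: free_mod_carrier)
  have add: "ev (c \<oplus>\<^bsub>?F\<^esub> d) = ev c + ev d" if "c \<in> carrier ?F" "d \<in> carrier ?F" for c d
  proof -
    let ?Y = "{x\<in>G. c x \<noteq> \<zero>\<^bsub>R\<^esub>} \<union> {x\<in>G. d x \<noteq> \<zero>\<^bsub>R\<^esub>}"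
    have Y: "finite ?Y" "?Y \<subseteq> G" using that fin by auto
    have c: "ev c = (\<Sum>x\<in>?Y. scale R (c x) (k x))" and d: "ev d = (\<Sum>x\<in>?Y. scale R (d x) (k x))"
      by (rule evX[OF Y]; auto)+
    have "ev (c \<oplus>\<^bsub>?F\<^esub> d) = (\<Sum>x\<in>?Y. scale R (c x \<oplus>\<^bsub>R\<^esub> d x) (k x))"
      by (subst evX[OF Y]) auto
    also have "\<dots> = (\<Sum>x\<in>?Y. scale R (c x) (k x) + scale R (d x) (k x))"
      by (rule sum.cong[OF refl], rule scale_lincomb(1)[OF assms(2)])
         (use that k in \<open>auto simp: free_mod_carrier\<close>)
    finally show ?thesis by (simp add: c d sum.distrib)
  qed
  have sm: "ev (r \<odot>\<^bsub>?F\<^esub> c) = scale R r (ev c)" if "r \<in> carrier R" "c \<in> carrier ?F" for r c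
  proof -
    let ?Y = "{x\<in>G. c x \<noteq> \<zero>\<^bsub>R\<^esub>}"
    note l = lin_scale_map[OF assms(1) that(1)]
    have "ev (r \<odot>\<^bsub>?F\<^esub> c) = (\<Sum>x\<in>?Y. scale R (r \<otimes>\<^bsub>R\<^esub> c x) (k x))"
      by (subst evX[of ?Y]) (use that fin in auto)
    also have "\<dots> = (\<Sum>x\<in>?Y. scale R r (scale R (c x) (k x)))"
      by (rule sum.cong[OF refl], rule scale_lincomb(2)[OF assms(2)])
         (use that k in \<open>auto simp: free_mod_carrier\<close>)
    also have "\<dots> = scale R r (ev c)" by (simp add: lin_sum[OF l] ev_def)
    finally show ?thesis .
  qed
  have prev: "retr N (ev c) = ev c" if "c \<in> carrier ?F" for c
    unfolding ev_def lin_sum[OF lin_retr[OF assms(2)]]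
    by (rule sum.cong) (use that k in \<open>auto simp: retr_scale[OF assms(2)] free_mod_carrier\<close>)
  define f where "f v = ev (prj ?F v)" for v
  have pf: "prj ?F v \<in> carrier ?F" for v by (simp add: F.M.abelian_group_axioms)
  have "lhom R ?F N f"
    unfolding lhom_def lin_def f_def using F.M.abelian_group_axioms F.module_axioms
    by (auto simp del: free_mod_sel simp: add pf sm prev)
  moreover have "f (emb ?F (free_gen R x)) = k x" if "x \<in> G" for x
  proof -
    have "f (emb ?F (free_gen R x)) = ev (free_gen R x)"
      by (simp add: f_def F.M.abelian_group_axioms that assms(1))
    also have "\<dots> = (\<Sum>y\<in>{x}. scale R (free_gen R x y) (k y))"
      by (rule evX) (use that in \<open>auto simp: free_gen_def\<close>)
    also have "\<dots> = k x"
      using scale_lincomb(3)[OF assms(2) R.zero_closed R.zero_closed k[OF that]] by (simp add: free_gen_def)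
    finally show ?thesis .
  qed
  ultimately show ?thesis by blast
qed

text \<open>Removing one point from the support of an element changes it by a multiple of a generator.\<close>

lemma free_mod_span:
  assumes "cring R" "submodule H R (free_mod R G)" "\<And>x. x \<in> G \<Longrightarrow> free_gen R x \<in> H"
  shows "H = carrier (free_mod R G)"
proof
  let ?F = "free_mod R G"
  interpret R: cring R by fact
  interpret F: module R ?F by (rule free_mod_module) fact
  note H = F.submoduleE[OF assms(2)]
  show "H \<subseteq> carrier ?F" by (rule H(1))
  show "carrier ?F \<subseteq> H"
  proof
    fix c assume "c \<in> carrier ?F"
    then show "c \<in> H"
    proof (induction "card {x. c x \<noteq> \<zero>\<^bsub>R\<^esub>}" arbitrary: c)
      case 0
      then have "c = \<zero>\<^bsub>?F\<^esub>" by (auto simp: free_mod_carrier)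
      moreover have "\<zero>\<^bsub>?F\<^esub> \<in> H"
        using assms(2) by (metis submodule.axioms(1) subgroup.one_closed monoid.select_convs(2))
      ultimately show ?case by simp
    next
      case (Suc n)
      then obtain x where x: "c x \<noteq> \<zero>\<^bsub>R\<^esub>" by (metis (mono_tags, lifting) card.empty empty_Collect_eq nat.distinct(1))
      with Suc.prems have xG: "x \<in> G" by (auto simp: free_mod_carrier)
      let ?d = "c(x := \<zero>\<^bsub>R\<^esub>)"
      have eq: "{y. ?d y \<noteq> \<zero>\<^bsub>R\<^esub>} = {y. c y \<noteq> \<zero>\<^bsub>R\<^esub>} - {x}" by auto
      have fin: "finite {y. c y \<noteq> \<zero>\<^bsub>R\<^esub>}" using Suc.prems by (simp add: free_mod_carrier)
      have "?d \<in> H"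
      proof (rule Suc.hyps(1))
        show "n = card {y. ?d y \<noteq> \<zero>\<^bsub>R\<^esub>}" unfolding eq using Suc.hyps(2) x fin by simp
        have "finite {y. ?d y \<noteq> \<zero>\<^bsub>R\<^esub>}" unfolding eq using fin by simp
        then show "?d \<in> carrier ?F" using Suc.prems by (auto simp: free_mod_carrier)
      qed
      moreover have "c x \<odot>\<^bsub>?F\<^esub> free_gen R x \<in> H"
        by (rule H(4)) (use Suc.prems assms(3)[OF xG] in \<open>auto simp: free_mod_carrier\<close>)
      moreover have "?d \<oplus>\<^bsub>?F\<^esub> (c x \<odot>\<^bsub>?F\<^esub> free_gen R x) = c"
        using Suc.prems by (auto simp: free_mod_carrier free_gen_def fun_eq_iff)
      ultimately show ?case using H(5) by metis
    qed
  qed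
qed

lemma mod_span_submodule:
  assumes "module R M" "S \<subseteq> carrier M"
  shows "submodule (mod_span R M S) R M" "S \<subseteq> mod_span R M S"
proof -
  interpret module R M by fact
  let ?I = "mod_span R M S"
  show "S \<subseteq> ?I" by (auto simp: mod_span_def)
  have c: "submodule (carrier M) R M" by (rule carrier_is_submodule)
  show "submodule ?I R M"
  proof (rule submoduleI)
    show "?I \<subseteq> carrier M" using c assms(2) by (auto simp: mod_span_def)
    have "\<zero>\<^bsub>M\<^esub> \<in> N" if "submodule N R M" for N
      using that by (metis submodule.axioms(1) subgroup.one_closed monoid.select_convs(2))
    then show "\<zero>\<^bsub>M\<^esub> \<in> ?I" by (auto simp: mod_span_def)
  qed (auto simp: mod_span_def dest: submoduleE)
qed

lemma mod_span_least: "submodule N R M \<Longrightarrow> S \<subseteq> N \<Longrightarrow> mod_span R M S \<subseteq> N"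
  by (auto simp: mod_span_def)

lemma quot_mod_sel [simp]:
  "carrier (quot_mod M N) = a_rcosets\<^bsub>M\<^esub> N" "ring.zero (quot_mod M N) = N"
  "ring.add (quot_mod M N) = (\<lambda>U V. U <+>\<^bsub>M\<^esub> V)"
  "smult (quot_mod M N) = (\<lambda>r U. \<Union>x\<in>U. N +>\<^bsub>M\<^esub> (r \<odot>\<^bsub>M\<^esub> x))"
  by (simp_all add: quot_mod_def)

lemma submodule_abelian_subgroup: "module R M \<Longrightarrow> submodule N R M \<Longrightarrow> abelian_subgroup N M"
  by (auto intro!: abelian_subgroupI3 additive_subgroup.intro
      dest: module.axioms(2) submodule.axioms(1))

lemma quot_smult:
  assumes "module R M" "submodule N R M" "r \<in> carrier R" "x \<in> carrier M"
  shows "(\<Union>y\<in>N +>\<^bsub>M\<^esub> x. N +>\<^bsub>M\<^esub> (r \<odot>\<^bsub>M\<^esub> y)) = N +>\<^bsub>M\<^esub> (r \<odot>\<^bsub>M\<^esub> x)"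
proof -
  interpret module R M by fact
  interpret S: abelian_subgroup N M by (rule submodule_abelian_subgroup) fact+
  have "N +>\<^bsub>M\<^esub> (r \<odot>\<^bsub>M\<^esub> y) = N +>\<^bsub>M\<^esub> (r \<odot>\<^bsub>M\<^esub> x)" if y: "y \<in> N +>\<^bsub>M\<^esub> x" for y
  proof -
    obtain n where n: "n \<in> N" "y = n \<oplus>\<^bsub>M\<^esub> x" using y by (auto simp: a_r_coset_def')
    have nc: "n \<in> carrier M" using n S.a_subset by auto
    have "r \<odot>\<^bsub>M\<^esub> y = r \<odot>\<^bsub>M\<^esub> n \<oplus>\<^bsub>M\<^esub> r \<odot>\<^bsub>M\<^esub> x"
      using n nc assms by (simp add: smult_r_distr)
    moreover have "r \<odot>\<^bsub>M\<^esub> n \<in> N" using n assms(2,3) by (simp add: submodule.smult_closed)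
    ultimately have "r \<odot>\<^bsub>M\<^esub> y \<in> N +>\<^bsub>M\<^esub> (r \<odot>\<^bsub>M\<^esub> x)" by (auto simp: a_r_coset_def')
    then show ?thesis using S.a_repr_independence' assms(3,4) by (metis smult_closed)
  qed
  moreover have "x \<in> N +>\<^bsub>M\<^esub> x" using assms S.a_rcos_self by blast
  ultimately show ?thesis by blast
qed

lemma quot_mod_module:
  assumes "module R M" "submodule N R M"
  shows "module R (quot_mod M N)"
proof -
  interpret module R M by fact
  interpret S: abelian_subgroup N M by (rule submodule_abelian_subgroup) fact+
  let ?Q = "quot_mod M N"
  have car: "\<exists>x\<in>carrier M. U = N +>\<^bsub>M\<^esub> x" if "U \<in> carrier ?Q" for U
    using that by (auto simp: A_RCOSETS_def')
  have el: "N +>\<^bsub>M\<^esub> x \<in> carrier ?Q" if "x \<in> carrier M" for x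
    using that by (auto simp: A_RCOSETS_def')
  have sm: "r \<odot>\<^bsub>?Q\<^esub> (N +>\<^bsub>M\<^esub> x) = N +>\<^bsub>M\<^esub> (r \<odot>\<^bsub>M\<^esub> x)" if "r \<in> carrier R" "x \<in> carrier M" for r x
    using quot_smult[OF assms that] by simp
  have ad: "(N +>\<^bsub>M\<^esub> x) \<oplus>\<^bsub>?Q\<^esub> (N +>\<^bsub>M\<^esub> y) = N +>\<^bsub>M\<^esub> (x \<oplus>\<^bsub>M\<^esub> y)"
    if "x \<in> carrier M" "y \<in> carrier M" for x y
    using that S.a_rcos_sum by simp
  have zr: "\<zero>\<^bsub>?Q\<^esub> = N +>\<^bsub>M\<^esub> \<zero>\<^bsub>M\<^esub>" using S.a_subset by simp
  show ?thesis
  proof (rule moduleI)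
    show "cring R" by (rule R.is_cring)
    show "abelian_group ?Q"
    proof (rule abelian_groupI)
      show "\<exists>V\<in>carrier ?Q. V \<oplus>\<^bsub>?Q\<^esub> U = \<zero>\<^bsub>?Q\<^esub>" if "U \<in> carrier ?Q" for U
        using car[OF that] by (metis M.a_inv_closed M.l_neg ad el zr)
    qed (auto simp del: quot_mod_sel simp: zr ad el M.a_ac dest!: car)
  qed (auto simp del: quot_mod_sel simp: sm ad el smult_l_distr smult_r_distr smult_assoc1 dest!: car)
qed

text \<open>The kernel is a submodule, so it contains the span of \<open>S\<close> and the map is constant on cosets.\<close>

lemma quot_ext:
  assumes M: "module R M" and N: "module R N" and S: "S \<subseteq> carrier M" and f: "lhom R M N f"
    and kill: "\<And>s. s \<in> S \<Longrightarrow> f (emb M s) = 0"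
  shows "\<exists>g. lhom R (quot_mod M (mod_span R M S)) N g \<and>
    (\<forall>x\<in>carrier M. g (emb (quot_mod M (mod_span R M S)) (mod_span R M S +>\<^bsub>M\<^esub> x)) = f (emb M x))"
proof -
  let ?I = "mod_span R M S"
  let ?Q = "quot_mod M ?I"
  interpret module R M by fact
  have sub: "submodule ?I R M" by (rule mod_span_submodule) fact+
  interpret Q: module R ?Q by (rule quot_mod_module) fact+
  interpret S: abelian_subgroup ?I M by (rule submodule_abelian_subgroup) fact+
  note ag = M.abelian_group_axioms Q.M.abelian_group_axioms
  note l = lhom_lin[OF f]
  have "submodule {x \<in> carrier M. f (emb M x) = 0} R M"
    by (rule submoduleI)
       (auto simp: emb_zero emb_uminus emb_add emb_scale[OF M] ag lin_0[OF l] lin_uminus[OF l] lin_add[OF l]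
         lin_scale[OF l] scale_0)
  then have "?I \<subseteq> {x \<in> carrier M. f (emb M x) = 0}"
    by (rule mod_span_least) (use S kill in auto)
  then have zero: "f (emb M x) = 0" if "x \<in> ?I" for x using that by auto
  have well: "f (emb M x) = f (emb M y)" if "?I +>\<^bsub>M\<^esub> x = ?I +>\<^bsub>M\<^esub> y" "x \<in> carrier M" "y \<in> carrier M" for x y
  proof -
    have "x \<in> ?I +>\<^bsub>M\<^esub> y" using that S.a_rcos_self by blast
    then obtain n where n: "n \<in> ?I" "x = n \<oplus>\<^bsub>M\<^esub> y" by (auto simp: a_r_coset_def')
    moreover have "n \<in> carrier M" using n S.a_subset by auto
    ultimately show ?thesis using that by (simp add: emb_add ag lin_add[OF l] zero)
  qed
  define rp where "rp U = (SOME x. x \<in> carrier M \<and> U = ?I +>\<^bsub>M\<^esub> x)" for U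
  have rp: "rp U \<in> carrier M \<and> U = ?I +>\<^bsub>M\<^esub> rp U" if "U \<in> carrier ?Q" for U
    unfolding rp_def by (rule someI_ex) (use that in \<open>auto simp: A_RCOSETS_def'\<close>)
  define g where "g v = f (emb M (rp (prj ?Q v)))" for v
  have gv: "g v = f (emb M x)" if "prj ?Q v = ?I +>\<^bsub>M\<^esub> x" "x \<in> carrier M" for v x
  proof -
    have "prj ?Q v \<in> carrier ?Q" by (simp add: ag del: quot_mod_sel)
    from rp[OF this] have "rp (prj ?Q v) \<in> carrier M" "?I +>\<^bsub>M\<^esub> rp (prj ?Q v) = ?I +>\<^bsub>M\<^esub> x"
      using that by auto
    then show ?thesis unfolding g_def using well that(2) by blast
  qed
  have ex: "\<exists>x\<in>carrier M. prj ?Q v = ?I +>\<^bsub>M\<^esub> x" for v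
  proof -
    have "prj ?Q v \<in> carrier ?Q" by (simp add: ag del: quot_mod_sel)
    then show ?thesis by (auto simp: A_RCOSETS_def')
  qed
  have "lin R g"
    unfolding lin_def
  proof (intro conjI allI ballI)
    fix v w
    obtain x y where x: "x \<in> carrier M" "prj ?Q v = ?I +>\<^bsub>M\<^esub> x" and y: "y \<in> carrier M" "prj ?Q w = ?I +>\<^bsub>M\<^esub> y"
      using ex by meson
    have "prj ?Q (v + w) = ?I +>\<^bsub>M\<^esub> (x \<oplus>\<^bsub>M\<^esub> y)" using x y by (simp add: ag S.a_rcos_sum)
    then show "g (v + w) = g v + g w"
      using x y by (simp add: gv emb_add ag lin_add[OF l])
  next
    fix r v assume r: "r \<in> carrier R"
    obtain x where x: "x \<in> carrier M" "prj ?Q v = ?I +>\<^bsub>M\<^esub> x" using ex by meson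
    have "prj ?Q (scale R r v) = ?I +>\<^bsub>M\<^esub> (r \<odot>\<^bsub>M\<^esub> x)"
      using x r quot_smult[OF M sub r x(1)] by (simp add: Q.module_axioms)
    then show "g (scale R r v) = scale R r (g v)"
      using x r by (simp add: gv emb_scale[OF M] lin_scale[OF l])
  qed
  then have "lhom R ?Q N g"
    unfolding lhom_def g_def by (simp add: ag retr_lhom[OF f])
  moreover have "g (emb ?Q (?I +>\<^bsub>M\<^esub> x)) = f (emb M x)" if "x \<in> carrier M" for x
  proof (rule gv[OF _ that])
    have "?I +>\<^bsub>M\<^esub> x \<in> carrier ?Q" using that by (auto simp: A_RCOSETS_def')
    then show "prj ?Q (emb ?Q (?I +>\<^bsub>M\<^esub> x)) = ?I +>\<^bsub>M\<^esub> x" by (rule prj_emb[OF ag(2)])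
  qed
  ultimately show ?thesis by blast
qed

lemma pres_mod_module:
  "cring R \<Longrightarrow> S \<subseteq> carrier (free_mod R G) \<Longrightarrow> module R (pres_mod R G S)"
  unfolding pres_mod_def by (intro quot_mod_module mod_span_submodule free_mod_module)

lemma pres_gen_closed:
  assumes "cring R" "S \<subseteq> carrier (free_mod R G)" "x \<in> G"
  shows "pres_gen R G S x \<in> carrier (pres_mod R G S)"
  using assms by (auto simp: pres_gen_def pres_mod_def A_RCOSETS_def')

text \<open>The quotient map from the free module, as a map of ambient groups.\<close>

definition pres_cls where
  "pres_cls R G S v = emb (pres_mod R G S)
     (mod_span R (free_mod R G) S +>\<^bsub>free_mod R G\<^esub> prj (free_mod R G) v)"

lemma pres_cls_lhom:
  assumes "cring R" "S \<subseteq> carrier (free_mod R G)"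
  shows "lhom R (free_mod R G) (pres_mod R G S) (pres_cls R G S)"
    and "s \<in> S \<Longrightarrow> pres_cls R G S (emb (free_mod R G) s) = 0"
    and "x \<in> G \<Longrightarrow> pres_cls R G S (emb (free_mod R G) (free_gen R x)) = emb (pres_mod R G S) (pres_gen R G S x)"
proof -
  let ?F = "free_mod R G" and ?P = "pres_mod R G S"
  let ?I = "mod_span R ?F S"
  have F: "module R ?F" and P: "module R ?P" using assms by (auto intro: free_mod_module pres_mod_module)
  have sub: "submodule ?I R ?F" by (rule mod_span_submodule[OF F assms(2)])
  interpret F: module R ?F by fact
  interpret P: module R ?P by fact
  interpret S: abelian_subgroup ?I ?F by (rule submodule_abelian_subgroup) fact+
  note ag = F.M.abelian_group_axioms P.M.abelian_group_axioms
  have el: "?I +>\<^bsub>?F\<^esub> x \<in> carrier ?P" if "x \<in> carrier ?F" for x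
    using that by (auto simp: A_RCOSETS_def' pres_mod_def)
  have pf: "prj ?F v \<in> carrier ?F" for v by (simp add: ag)
  have add: "?I +>\<^bsub>?F\<^esub> (x \<oplus>\<^bsub>?F\<^esub> y) = (?I +>\<^bsub>?F\<^esub> x) \<oplus>\<^bsub>?P\<^esub> (?I +>\<^bsub>?F\<^esub> y)"
    if "x \<in> carrier ?F" "y \<in> carrier ?F" for x y
    using S.a_rcos_sum[OF that] by (simp add: pres_mod_def)
  have sm: "?I +>\<^bsub>?F\<^esub> (r \<odot>\<^bsub>?F\<^esub> x) = r \<odot>\<^bsub>?P\<^esub> (?I +>\<^bsub>?F\<^esub> x)"
    if "r \<in> carrier R" "x \<in> carrier ?F" for r x
    using quot_smult[OF F sub that] by (simp add: pres_mod_def)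
  show "lhom R ?F ?P (pres_cls R G S)"
    unfolding lhom_def lin_def pres_cls_def
    by (auto simp del: free_mod_sel simp: ag pf el add sm emb_add emb_scale[OF P] F)
  show "pres_cls R G S (emb ?F s) = 0" if "s \<in> S"
  proof -
    have "s \<in> ?I" using that mod_span_submodule(2)[OF F assms(2)] by auto
    then have "?I +>\<^bsub>?F\<^esub> s = ?I" by (rule S.a_rcos_const)
    moreover have "s \<in> carrier ?F" using that assms by auto
    moreover have "\<zero>\<^bsub>?P\<^esub> = ?I" by (simp add: pres_mod_def)
    ultimately show ?thesis using ag emb_zero[OF ag(2)] by (simp add: pres_cls_def)
  qed
  show "pres_cls R G S (emb ?F (free_gen R x)) = emb ?P (pres_gen R G S x)" if "x \<in> G"
    using that assms by (simp add: pres_cls_def pres_gen_def ag)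
qed

text \<open>The universal property.  That the relations are killed is asked for every linear map with
  the prescribed values on generators, so that it can be checked by linearity, without a formula
  for the extension.\<close>

lemma pres_ext:
  assumes R: "cring R" and N: "module R N" and S: "S \<subseteq> carrier (free_mod R G)"
    and k: "\<And>x. x \<in> G \<Longrightarrow> retr N (k x) = k x"
    and kill: "\<And>f s. lhom R (free_mod R G) N f \<Longrightarrow>
      (\<And>x. x \<in> G \<Longrightarrow> f (emb (free_mod R G) (free_gen R x)) = k x) \<Longrightarrow> s \<in> S \<Longrightarrow>
      f (emb (free_mod R G) s) = 0"
  shows "\<exists>g. lhom R (pres_mod R G S) N g \<and> (\<forall>x\<in>G. g (emb (pres_mod R G S) (pres_gen R G S x)) = k x)"
proof -
  have F: "module R (free_mod R G)" by (rule free_mod_module) fact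
  obtain f where f: "lhom R (free_mod R G) N f" "\<And>x. x \<in> G \<Longrightarrow> f (emb (free_mod R G) (free_gen R x)) = k x"
    using free_mod_ext[OF R N, of G k] k by metis
  have kill': "f (emb (free_mod R G) s) = 0" if "s \<in> S" for s
    by (rule kill[OF f(1) f(2) that])
  obtain g where g: "lhom R (pres_mod R G S) N g" "\<And>x. x \<in> carrier (free_mod R G) \<Longrightarrow>
     g (emb (pres_mod R G S) (mod_span R (free_mod R G) S +>\<^bsub>free_mod R G\<^esub> x)) = f (emb (free_mod R G) x)"
    using quot_ext[OF F N S f(1) kill'] unfolding pres_mod_def by blast
  have "g (emb (pres_mod R G S) (pres_gen R G S x)) = k x" if "x \<in> G" for x
    using g(2)[of "free_gen R x"] that f(2) R by (simp add: pres_gen_def)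
  with g(1) show ?thesis by blast
qed

lemma pres_span:
  assumes R: "cring R" and S: "S \<subseteq> carrier (free_mod R G)"
    and H: "submodule H R (pres_mod R G S)" "\<And>x. x \<in> G \<Longrightarrow> pres_gen R G S x \<in> H"
  shows "H = carrier (pres_mod R G S)"
proof
  let ?F = "free_mod R G" and ?P = "pres_mod R G S"
  have F: "module R ?F" and P: "module R ?P" using assms by (auto intro: free_mod_module pres_mod_module)
  interpret F: module R ?F by fact
  interpret P: module R ?P by fact
  note ag = F.M.abelian_group_axioms P.M.abelian_group_axioms
  note h = pres_cls_lhom[OF R S]
  note l = lhom_lin[OF h(1)]
  note HE = P.submoduleE[OF H(1)]
  show "H \<subseteq> carrier ?P" by (rule HE(1))
  let ?q = "\<lambda>x. prj ?P (pres_cls R G S (emb ?F x))"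
  have "submodule {x \<in> carrier ?F. ?q x \<in> H} R ?F"
  proof (rule F.submoduleI)
    have "\<zero>\<^bsub>?P\<^esub> \<in> H" using H(1) by (metis submodule.axioms(1) subgroup.one_closed monoid.select_convs(2))
    then show "\<zero>\<^bsub>?F\<^esub> \<in> {x \<in> carrier ?F. ?q x \<in> H}"
      by (simp del: free_mod_sel add: emb_zero ag lin_0[OF l])
  qed (auto simp del: free_mod_sel simp: emb_uminus emb_add emb_scale[OF F] ag P lin_uminus[OF l]
      lin_add[OF l] lin_scale[OF l] HE)
  moreover have "free_gen R x \<in> {x \<in> carrier ?F. ?q x \<in> H}" if "x \<in> G" for x
    using that H(2)[OF that] pres_gen_closed[OF R S that] R by (simp add: h ag)
  ultimately have "{x \<in> carrier ?F. ?q x \<in> H} = carrier ?F" using free_mod_span[OF R] by blast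
  then have q: "?q x \<in> H" if "x \<in> carrier ?F" for x using that by auto
  show "carrier ?P \<subseteq> H"
  proof
    fix U assume U: "U \<in> carrier ?P"
    then obtain x where x: "x \<in> carrier ?F" "U = mod_span R ?F S +>\<^bsub>?F\<^esub> x"
      by (auto simp: pres_mod_def A_RCOSETS_def')
    have "?q x = U" using x U by (simp add: pres_cls_def ag)
    then show "U \<in> H" using q[OF x(1)] by simp
  qed
qed

lemma lhom_agree_submodule:
  assumes M: "module R M" and f: "lhom R M N f" and g: "lhom R M N g"
  shows "submodule {x \<in> carrier M. f (emb M x) = g (emb M x)} R M"
proof -
  interpret module R M by fact
  note ag = M.abelian_group_axioms
  note l = lhom_lin[OF f] lhom_lin[OF g]
  show ?thesis
    by (rule submoduleI) (auto simp: emb_zero emb_uminus emb_add emb_scale[OF M] ag l[THEN lin_0]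
        l[THEN lin_uminus] l[THEN lin_add] l[THEN lin_scale])
qed

lemma lhom_eqI:
  assumes M: "module R M" and f: "lhom R M N f" and g: "lhom R M N g"
    and "\<And>x. x \<in> carrier M \<Longrightarrow> f (emb M x) = g (emb M x)"
  shows "f = g"
proof
  fix v
  have "f (retr M v) = g (retr M v)" unfolding retr_def by (rule assms(4)) (simp add: module.axioms(2)[OF M])
  then show "f v = g v" using f g by (simp add: lhom_retr)
qed

lemma pres_unique:
  assumes R: "cring R" and S: "S \<subseteq> carrier (free_mod R G)"
    and f: "lhom R (pres_mod R G S) N f" and g: "lhom R (pres_mod R G S) N g"
    and eq: "\<And>x. x \<in> G \<Longrightarrow> f (emb (pres_mod R G S) (pres_gen R G S x)) =
       g (emb (pres_mod R G S) (pres_gen R G S x))"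
  shows "f = g"
proof (rule lhom_eqI[OF pres_mod_module[OF R S] f g])
  let ?P = "pres_mod R G S"
  have "{x \<in> carrier ?P. f (emb ?P x) = g (emb ?P x)} = carrier ?P"
    by (rule pres_span[OF R S lhom_agree_submodule[OF pres_mod_module[OF R S] f g]])
       (simp add: eq pres_gen_closed[OF R S])
  then show "f (emb ?P x) = g (emb ?P x)" if "x \<in> carrier ?P" for x using that by auto
qed

lemma module_ab: "module R M \<Longrightarrow> abelian_group M"
  by (rule module.axioms(2))

lemma module_cring: "module R M \<Longrightarrow> cring R"
  by (rule module.axioms(1))

lemma emb_rel:
  assumes "module R F" "lhom R F P f" "a \<in> carrier F" "b \<in> carrier F"
  shows "f (emb F (a \<ominus>\<^bsub>F\<^esub> b)) = f (emb F a) - f (emb F b)"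
  using assms by (simp add: emb_diff module_ab lin_diff[OF lhom_lin])

section \<open>Tensor products\<close>

definition bilin where
  "bilin R M N P \<beta> \<longleftrightarrow> (\<forall>y. lhom R M P (\<lambda>x. \<beta> x y)) \<and> (\<forall>x. lhom R N P (\<beta> x))"

text \<open>Elementary tensors, total and bilinear in the ambient groups.\<close>

definition tprod where
  "tprod R M N x y = emb (tensor R M N) (tens R M N (prj M x) (prj N y))"

lemma bilin_rels_closed:
  assumes "module R M" "module R N"
  shows "bilin_rels R M N \<subseteq> carrier (free_mod R (carrier M \<times> carrier N))"
proof -
  have R: "cring R" using assms by (simp add: module_cring)
  interpret F: module R "free_mod R (carrier M \<times> carrier N)" by (rule free_mod_module) fact
  interpret M: module R M by fact
  interpret N: module R N by fact
  show ?thesis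
    unfolding bilin_rels_def Let_def
    by (auto simp del: free_mod_sel One_nat_def simp: R)
qed

lemma tensor_module:
  assumes "module R M" "module R N" shows "module R (tensor R M N)"
  unfolding tensor_def using assms
  by (intro pres_mod_module bilin_rels_closed) (auto simp: module_cring)

lemma tprod_bilin:
  assumes M: "module R M" and N: "module R N"
  shows "bilin R M N (tensor R M N) (tprod R M N)"
proof -
  let ?G = "carrier M \<times> carrier N" and ?S = "bilin_rels R M N"
  let ?F = "free_mod R ?G" and ?T = "tensor R M N"
  have R: "cring R" using assms by (simp add: module_cring)
  note S = bilin_rels_closed[OF M N]
  have F: "module R ?F" by (rule free_mod_module) fact
  interpret F: module R ?F by fact
  interpret M: module R M by fact
  interpret N: module R N by fact
  have T: "module R ?T" by (rule tensor_module) fact+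
  note ag = M.M.abelian_group_axioms N.M.abelian_group_axioms F.M.abelian_group_axioms
  let ?c = "pres_cls R ?G ?S"
  note c = pres_cls_lhom[OF R S]
  note l = lhom_lin[OF c(1)]
  let ?t = "\<lambda>x y. emb ?T (tens R M N x y)"
  have g: "?t x y = ?c (emb ?F (free_gen R (x, y)))" if "x \<in> carrier M" "y \<in> carrier N" for x y
    using c(3)[of "(x, y)"] that by (simp add: tens_def tensor_def)
  have gc: "free_gen R (x, y) \<in> carrier ?F" if "x \<in> carrier M" "y \<in> carrier N" for x y
    using R that by simp
  have *: "?c (emb ?F a) = ?c (emb ?F b)"
    if "a \<ominus>\<^bsub>?F\<^esub> b \<in> ?S" "a \<in> carrier ?F" "b \<in> carrier ?F" for a b
    using c(2)[OF that(1)] emb_rel[OF F c(1) that(2,3)] by simp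
  have a1: "?t (x \<oplus>\<^bsub>M\<^esub> x') y = ?t x y + ?t x' y" if "x \<in> carrier M" "x' \<in> carrier M" "y \<in> carrier N" for x x' y
  proof -
    have "free_gen R (x \<oplus>\<^bsub>M\<^esub> x', y) \<ominus>\<^bsub>?F\<^esub> (free_gen R (x, y) \<oplus>\<^bsub>?F\<^esub> free_gen R (x', y)) \<in> ?S"
      unfolding bilin_rels_def Let_def using that by blast
    from *[OF this] show ?thesis using that
      by (simp del: free_mod_sel One_nat_def add: g gc emb_add ag lin_add[OF l])
  qed
  have a2: "?t x (y \<oplus>\<^bsub>N\<^esub> y') = ?t x y + ?t x y'" if "x \<in> carrier M" "y \<in> carrier N" "y' \<in> carrier N" for x y y'
  proof -
    have "free_gen R (x, y \<oplus>\<^bsub>N\<^esub> y') \<ominus>\<^bsub>?F\<^esub> (free_gen R (x, y) \<oplus>\<^bsub>?F\<^esub> free_gen R (x, y')) \<in> ?S"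
      unfolding bilin_rels_def Let_def using that by blast
    from *[OF this] show ?thesis using that
      by (simp del: free_mod_sel One_nat_def add: g gc emb_add ag lin_add[OF l])
  qed
  have s1: "?t (r \<odot>\<^bsub>M\<^esub> x) y = scale R r (?t x y)" if "x \<in> carrier M" "r \<in> carrier R" "y \<in> carrier N" for x r y
  proof -
    have "free_gen R (r \<odot>\<^bsub>M\<^esub> x, y) \<ominus>\<^bsub>?F\<^esub> (r \<odot>\<^bsub>?F\<^esub> free_gen R (x, y)) \<in> ?S"
      unfolding bilin_rels_def Let_def using that by blast
    from *[OF this] show ?thesis using that
      by (simp del: free_mod_sel One_nat_def add: g gc emb_scale[OF F] ag lin_scale[OF l])
  qed
  have s2: "?t x (r \<odot>\<^bsub>N\<^esub> y) = scale R r (?t x y)" if "x \<in> carrier M" "r \<in> carrier R" "y \<in> carrier N" for x r y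
  proof -
    have "free_gen R (x, r \<odot>\<^bsub>N\<^esub> y) \<ominus>\<^bsub>?F\<^esub> (r \<odot>\<^bsub>?F\<^esub> free_gen R (x, y)) \<in> ?S"
      unfolding bilin_rels_def Let_def using that by blast
    from *[OF this] show ?thesis using that
      by (simp del: free_mod_sel One_nat_def add: g gc emb_scale[OF F] ag lin_scale[OF l])
  qed
  have p: "retr ?T (?t x y) = ?t x y" if "x \<in> carrier M" "y \<in> carrier N" for x y
    using that retr_lhom[OF c(1)] by (simp add: g) (simp add: tensor_def)
  show ?thesis
    unfolding bilin_def lhom_def lin_def tprod_def
    by (auto simp: ag a1 a2 s1 s2 p M N)
qed

lemma tprod_ext:
  assumes M: "module R M" and N: "module R N" and P: "module R P" and b: "bilin R M N P \<beta>"
  shows "\<exists>f. lhom R (tensor R M N) P f \<and> (\<forall>x y. f (tprod R M N x y) = \<beta> x y)"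
proof -
  let ?G = "carrier M \<times> carrier N" and ?S = "bilin_rels R M N"
  let ?F = "free_mod R ?G" and ?T = "tensor R M N"
  have R: "cring R" using assms by (simp add: module_cring)
  note S = bilin_rels_closed[OF M N]
  have F: "module R ?F" by (rule free_mod_module) fact
  interpret F: module R ?F by fact
  interpret M: module R M by fact
  interpret N: module R N by fact
  note ag = M.M.abelian_group_axioms N.M.abelian_group_axioms F.M.abelian_group_axioms
  have h1: "lhom R M P (\<lambda>x. \<beta> x y)" and h2: "lhom R N P (\<lambda>y. \<beta> x y)" for x y
    using b by (auto simp: bilin_def)
  let ?k = "\<lambda>(x, y). \<beta> (emb M x) (emb N y)"
  have "\<exists>g. lhom R (pres_mod R ?G ?S) P g \<and> (\<forall>x\<in>?G. g (emb (pres_mod R ?G ?S) (pres_gen R ?G ?S x)) = ?k x)"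
  proof (rule pres_ext[OF R P S])
    fix f s
    assume f: "lhom R ?F P f" and k: "\<And>x. x \<in> ?G \<Longrightarrow> f (emb ?F (free_gen R x)) = ?k x" and s: "s \<in> ?S"
    have k': "f (emb ?F (free_gen R (x, y))) = \<beta> (emb M x) (emb N y)" if "x \<in> carrier M" "y \<in> carrier N" for x y
      using k[of "(x, y)"] that by simp
    show "f (emb ?F s) = 0"
      using s unfolding bilin_rels_def Let_def
      by (auto simp del: free_mod_sel One_nat_def simp: emb_rel[OF F f] R k' emb_add ag lin_add[OF lhom_lin[OF f]]
        lin_add[OF lhom_lin[OF h1]] lin_add[OF lhom_lin[OF h2]] lin_scale[OF lhom_lin[OF h1]]
        lin_scale[OF lhom_lin[OF h2]] emb_scale[OF F] emb_scale[OF M] emb_scale[OF N] lin_scale[OF lhom_lin[OF f]])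
  qed (auto simp: retr_lhom[OF h1])
  then obtain g where g: "lhom R ?T P g" "\<And>x y. x \<in> carrier M \<Longrightarrow> y \<in> carrier N \<Longrightarrow>
      g (emb ?T (tens R M N x y)) = \<beta> (emb M x) (emb N y)"
    by (auto simp: tensor_def tens_def)
  have "g (tprod R M N x y) = \<beta> x y" for x y
    using g(2)[of "prj M x" "prj N y"] by (simp add: ag tprod_def emb_prj lhom_retr[OF h1] lhom_retr[OF h2])
  with g(1) show ?thesis by blast
qed

lemma tprod_unique:
  assumes M: "module R M" and N: "module R N" and f: "lhom R (tensor R M N) P f" and g: "lhom R (tensor R M N) P g"
    and eq: "\<And>x y. f (tprod R M N x y) = g (tprod R M N x y)"
  shows "f = g"
proof (rule pres_unique[OF _ bilin_rels_closed[OF M N], folded tensor_def, OF _ f g])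
  show "cring R" using M by (rule module_cring)
  fix x assume "x \<in> carrier M \<times> carrier N"
  then obtain a b where x: "x = (a, b)" "a \<in> carrier M" "b \<in> carrier N" by auto
  show "f (emb (tensor R M N) (pres_gen R (carrier M \<times> carrier N) (bilin_rels R M N) x)) =
    g (emb (tensor R M N) (pres_gen R (carrier M \<times> carrier N) (bilin_rels R M N) x))"
    using eq[of "emb M a" "emb N b"] x M N by (simp add: tprod_def tens_def module_ab)
qed


section \<open>The tensor coalgebra as the module of classes of words\<close>

type_synonym ('r, 'm) aword = "(int \<times> ('r, 'm) ambient) list"

definition graded where "graded R A \<longleftrightarrow> (\<forall>n. module R (A n))"

lemma graded_D: "graded R A \<Longrightarrow> module R (A n)" by (simp add: graded_def)

lemma graded_ab: "graded R A \<Longrightarrow> abelian_group (A n)" unfolding graded_def using module_ab by blast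

lemma graded_cring: "graded R A \<Longrightarrow> cring R" by (metis graded_def module_cring)

text \<open>A letter of an ambient word is a degree with an arbitrary ambient vector; its meaning is
  the component of the vector in the module of that degree.\<close>

definition prj_word :: "('r, 'm) gmod \<Rightarrow> ('r, 'm) aword \<Rightarrow> 'm word" where
  "prj_word A w = map (\<lambda>(d, x). (d, prj (A d) x)) w"

definition emb_word :: "('r, 'm) gmod \<Rightarrow> 'm word \<Rightarrow> ('r, 'm) aword" where
  "emb_word A w = map (\<lambda>(d, x). (d, emb (A d) x)) w"

lemma prj_word_simps [simp]: "prj_word A [] = []" "prj_word A ((d, x) # w) = (d, prj (A d) x) # prj_word A w"
  "prj_word A (u @ v) = prj_word A u @ prj_word A v" "length (prj_word A w) = length w" "prj_word A w = [] \<longleftrightarrow> w = []"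
  by (simp_all add: prj_word_def)

lemma emb_word_simps [simp]: "emb_word A [] = []" "emb_word A ((d, x) # w) = (d, emb (A d) x) # emb_word A w"
  "emb_word A (u @ v) = emb_word A u @ emb_word A v" "length (emb_word A w) = length w" "emb_word A w = [] \<longleftrightarrow> w = []"
  by (simp_all add: emb_word_def)

lemma words_append: "u @ v \<in> words A K \<longleftrightarrow> length u + length v \<in> K \<and>
    (\<forall>(d, a)\<in>set u. a \<in> carrier (A d)) \<and> (\<forall>(d, a)\<in>set v. a \<in> carrier (A d))"
  by (auto simp: words_def)

lemma prj_word_words: "graded R A \<Longrightarrow> length w \<in> K \<Longrightarrow> prj_word A w \<in> words A K"
  by (auto simp: words_def prj_word_def graded_ab)

lemma prj_word_emb_word: "graded R A \<Longrightarrow> w \<in> words A K \<Longrightarrow> prj_word A (emb_word A w) = w"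
  by (auto simp: prj_word_def emb_word_def words_def graded_ab intro!: map_idI)

text \<open>Multilinear functions of words with values in \<open>N\<close>, where each letter only matters through its
  component in the module of its degree.\<close>

definition multilin where
  "multilin R A N \<Theta> \<longleftrightarrow> (\<forall>u d v. lhom R (A d) N (\<lambda>x. \<Theta> (u @ (d, x) # v)))"

lemma multilin_retr:
  assumes "multilin R A N \<Theta>" shows "\<Theta> (u @ emb_word A (prj_word A w)) = \<Theta> (u @ w)"
proof (induction w arbitrary: u)
  case (Cons a w)
  obtain d x where a: "a = (d, x)" by force
  have "\<Theta> (u @ emb_word A (prj_word A (a # w))) = \<Theta> ((u @ [(d, retr (A d) x)]) @ emb_word A (prj_word A w))"
    by (simp add: a emb_prj)
  also have "\<dots> = \<Theta> ((u @ [(d, retr (A d) x)]) @ w)" by (rule Cons.IH)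
  also have "\<dots> = \<Theta> (u @ a # w)"
    using assms lhom_retr[of R "A d" N "\<lambda>x. \<Theta> (u @ (d, x) # w)"] by (simp add: multilin_def a)
  finally show ?case .
qed simp

lemma multilin_rels_closed:
  assumes "graded R A" shows "multilin_rels R A \<subseteq> carrier (free_mod R (words A {1..}))"
proof -
  have R: "cring R" using assms by (rule graded_cring)
  interpret F: module R "free_mod R (words A {1..})" by (rule free_mod_module) fact
  have "u @ (d, x \<oplus>\<^bsub>A d\<^esub> y) # v \<in> words A {1..}" if "u @ (d, x) # v \<in> words A {1..}" "y \<in> carrier (A d)" for u d x y v
    using that graded_ab[OF assms] by (auto simp: words_append abelian_groupE(1))
  moreover have "u @ (d, r \<odot>\<^bsub>A d\<^esub> x) # v \<in> words A {1..}" if "u @ (d, x) # v \<in> words A {1..}" "r \<in> carrier R" for u d x r v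
    using that by (auto simp: words_append intro!: module.smult_closed[OF graded_D[OF assms]])
  moreover have "u @ (d, y) # v \<in> words A {1..}" if "u @ (d, x) # v \<in> words A {1..}" "y \<in> carrier (A d)" for u d x y v
    using that by (auto simp: words_append)
  ultimately show ?thesis
    unfolding multilin_rels_def Let_def
    by (auto simp del: free_mod_sel One_nat_def simp: R)
qed

lemma Tc_module [simp]: "graded R A \<Longrightarrow> module R (Tc R A)"
  unfolding Tc_def by (intro pres_mod_module multilin_rels_closed graded_cring)

lemma Tc_ab [simp]: "graded R A \<Longrightarrow> abelian_group (Tc R A)"
  using module_ab Tc_module by blast

lemma TT_module [simp]: "graded R A \<Longrightarrow> module R (TT R A)"
  by (simp add: tensor_module)

lemma wcls_closed: "graded R A \<Longrightarrow> w \<in> words A {1..} \<Longrightarrow> wcls R A w \<in> carrier (Tc R A)"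
  unfolding Tc_def wcls_def by (intro pres_gen_closed multilin_rels_closed graded_cring)

text \<open>The class of a word in the tensor coalgebra.  The empty word has no class there and goes to
  \<open>0\<close>, which keeps multilinearity: it has no letters.\<close>

definition cls where
  "cls R A w = (if w = [] then 0 else emb (Tc R A) (wcls R A (prj_word A w)))"

lemma cls_emb_word: "graded R A \<Longrightarrow> w \<in> words A {1..} \<Longrightarrow> cls R A (emb_word A w) = emb (Tc R A) (wcls R A w)"
  by (auto simp: cls_def prj_word_emb_word) (simp add: words_def)

lemma cls_Nil [simp]: "cls R A [] = 0" by (simp add: cls_def)

text \<open>The relations of \<open>Tc\<close> say exactly this.\<close>

lemma cls_multilin:
  assumes A: "graded R A" shows "multilin R A (Tc R A) (cls R A)"
proof -
  let ?G = "words A {1..}" and ?S = "multilin_rels R A"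
  let ?F = "free_mod R ?G" and ?T = "Tc R A"
  have R: "cring R" using A by (rule graded_cring)
  note S = multilin_rels_closed[OF A]
  have F: "module R ?F" by (rule free_mod_module) fact
  interpret F: module R ?F by fact
  note ag = graded_ab[OF A] F.M.abelian_group_axioms
  let ?c = "pres_cls R ?G ?S"
  note c = pres_cls_lhom[OF R S]
  note l = lhom_lin[OF c(1)]
  let ?t = "\<lambda>w. emb ?T (wcls R A w)"
  have g: "?t w = ?c (emb ?F (free_gen R w))" if "w \<in> ?G" for w
    using c(3)[of w] that by (simp add: Tc_def wcls_def)
  have gc: "free_gen R w \<in> carrier ?F" if "w \<in> ?G" for w
    using R that by simp
  have *: "?c (emb ?F a) = ?c (emb ?F b)"
    if "a \<ominus>\<^bsub>?F\<^esub> b \<in> ?S" "a \<in> carrier ?F" "b \<in> carrier ?F" for a b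
    using c(2)[OF that(1)] emb_rel[OF F c(1) that(2,3)] by simp
  have a1: "?t (u @ (d, x \<oplus>\<^bsub>A d\<^esub> y) # v) = ?t (u @ (d, x) # v) + ?t (u @ (d, y) # v)"
    if w: "u @ (d, x) # v \<in> ?G" and y: "y \<in> carrier (A d)" for u d x y v
  proof -
    have w': "u @ (d, y) # v \<in> ?G" "u @ (d, x \<oplus>\<^bsub>A d\<^esub> y) # v \<in> ?G"
      using w y graded_ab[OF A, of d] by (auto simp: words_append abelian_groupE(1))
    have "free_gen R (u @ (d, x \<oplus>\<^bsub>A d\<^esub> y) # v) \<ominus>\<^bsub>?F\<^esub> (free_gen R (u @ (d, x) # v) \<oplus>\<^bsub>?F\<^esub> free_gen R (u @ (d, y) # v)) \<in> ?S"
      unfolding multilin_rels_def Let_def using w y by blast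
    from *[OF this] show ?thesis using w w'
      by (simp del: free_mod_sel One_nat_def add: g gc emb_add ag lin_add[OF l])
  qed
  have a2: "?t (u @ (d, r \<odot>\<^bsub>A d\<^esub> x) # v) = scale R r (?t (u @ (d, x) # v))"
    if w: "u @ (d, x) # v \<in> ?G" and r: "r \<in> carrier R" for u d x r v
  proof -
    have w': "u @ (d, r \<odot>\<^bsub>A d\<^esub> x) # v \<in> ?G"
      using w r graded_D[OF A, of d] by (auto simp: words_append module.smult_closed)
    have "free_gen R (u @ (d, r \<odot>\<^bsub>A d\<^esub> x) # v) \<ominus>\<^bsub>?F\<^esub> (r \<odot>\<^bsub>?F\<^esub> free_gen R (u @ (d, x) # v)) \<in> ?S"
      unfolding multilin_rels_def Let_def using w r by blast
    from *[OF this] show ?thesis using w w' r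
      by (simp del: free_mod_sel One_nat_def add: g gc emb_scale[OF F] ag lin_scale[OF l])
  qed
  have p: "retr ?T (?t w) = ?t w" if "w \<in> ?G" for w
    using that retr_lhom[OF c(1)] by (simp add: g) (simp add: Tc_def)
  have wd: "prj_word A u @ (d, prj (A d) x) # prj_word A v \<in> ?G" for u d x v
    using prj_word_words[OF A, of "u @ (d, x) # v" "{1..}"] by simp
  show ?thesis
    unfolding multilin_def
  proof (intro allI)
    fix u d v
    note pw = p[OF wd[of u d _ v]]
    show "lhom R (A d) ?T (\<lambda>x. cls R A (u @ (d, x) # v))"
      unfolding lhom_def lin_def cls_def
      using a1[OF wd[of u d _ v]] a2[OF wd[of u d _ v]]
      by (auto simp: ag graded_D[OF A] pw)
  qed
qed

text \<open>The universal property of the tensor coalgebra as a module: multilinear functions of nonempty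
  words extend uniquely to linear maps.\<close>

lemma cls_ext:
  assumes A: "graded R A" and N: "module R N" and m: "multilin R A N \<Theta>"
  shows "\<exists>f. lhom R (Tc R A) N f \<and> (\<forall>w. w \<noteq> [] \<longrightarrow> f (cls R A w) = \<Theta> w)"
proof -
  let ?G = "words A {1..}" and ?S = "multilin_rels R A"
  let ?F = "free_mod R ?G" and ?T = "Tc R A"
  have R: "cring R" using A by (rule graded_cring)
  note S = multilin_rels_closed[OF A]
  have F: "module R ?F" by (rule free_mod_module) fact
  interpret F: module R ?F by fact
  note ag = graded_ab[OF A] F.M.abelian_group_axioms
  have h: "lhom R (A d) N (\<lambda>x. \<Theta> (u @ (d, x) # v))" for u d v using m by (simp add: multilin_def)
  let ?k = "\<lambda>w. \<Theta> (emb_word A w)"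
  have "\<exists>g. lhom R (pres_mod R ?G ?S) N g \<and> (\<forall>w\<in>?G. g (emb (pres_mod R ?G ?S) (pres_gen R ?G ?S w)) = ?k w)"
  proof (rule pres_ext[OF R N S])
    fix w assume "w \<in> ?G"
    then obtain d x w' where "w = (d, x) # w'" by (cases w) (auto simp: words_def)
    then show "retr N (?k w) = ?k w" using retr_lhom[OF h[of d "[]" "emb_word A w'"]] by simp
  next
    fix f s
    assume f: "lhom R ?F N f" and k: "\<And>w. w \<in> ?G \<Longrightarrow> f (emb ?F (free_gen R w)) = ?k w" and s: "s \<in> ?S"
    note l = lhom_lin[OF f]
    from s consider
      (add) u v d x y where "u @ (d, x) # v \<in> ?G" "y \<in> carrier (A d)"
        "s = free_gen R (u @ (d, x \<oplus>\<^bsub>A d\<^esub> y) # v) \<ominus>\<^bsub>?F\<^esub> (free_gen R (u @ (d, x) # v) \<oplus>\<^bsub>?F\<^esub> free_gen R (u @ (d, y) # v))"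
      | (sm) u v d r x where "u @ (d, x) # v \<in> ?G" "r \<in> carrier R"
        "s = free_gen R (u @ (d, r \<odot>\<^bsub>A d\<^esub> x) # v) \<ominus>\<^bsub>?F\<^esub> (r \<odot>\<^bsub>?F\<^esub> free_gen R (u @ (d, x) # v))"
      unfolding multilin_rels_def Let_def by blast
    then show "f (emb ?F s) = 0"
    proof cases
      case add
      have w': "u @ (d, y) # v \<in> ?G" "u @ (d, x \<oplus>\<^bsub>A d\<^esub> y) # v \<in> ?G" "x \<in> carrier (A d)"
        using add graded_ab[OF A, of d] by (auto simp: words_append abelian_groupE(1))
      then show ?thesis using add lin_add[OF lhom_lin[OF h[of d "emb_word A u" "emb_word A v"]]]
        by (simp del: free_mod_sel One_nat_def add: emb_rel[OF F f] R k emb_add ag lin_add[OF l])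
    next
      case sm
      have w': "u @ (d, r \<odot>\<^bsub>A d\<^esub> x) # v \<in> ?G" "x \<in> carrier (A d)"
        using sm graded_D[OF A, of d] by (auto simp: words_append module.smult_closed)
      then show ?thesis using sm lin_scale[OF lhom_lin[OF h[of d "emb_word A u" "emb_word A v"]]]
        by (simp del: free_mod_sel One_nat_def add: emb_rel[OF F f] R k emb_scale[OF F] emb_scale[OF graded_D[OF A]] ag lin_scale[OF l])
    qed
  qed
  then obtain g where g: "lhom R ?T N g" "\<And>w. w \<in> ?G \<Longrightarrow> g (emb ?T (wcls R A w)) = \<Theta> (emb_word A w)"
    by (auto simp: Tc_def wcls_def)
  have "g (cls R A w) = \<Theta> w" if "w \<noteq> []" for w
    using g(2)[of "prj_word A w"] that multilin_retr[OF m, of "[]"] prj_word_words[OF A, of w "{1..}"]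
    by (simp add: cls_def Suc_le_eq)
  with g(1) show ?thesis by blast
qed

lemma cls_unique:
  assumes A: "graded R A" and f: "lhom R (Tc R A) N f" and g: "lhom R (Tc R A) N g"
    and eq: "\<And>w. w \<noteq> [] \<Longrightarrow> f (cls R A w) = g (cls R A w)"
  shows "f = g"
proof (rule pres_unique[OF _ multilin_rels_closed[OF A], folded Tc_def, OF _ f g])
  show "cring R" using A by (rule graded_cring)
  fix w assume w: "w \<in> words A {1..}"
  then have "emb_word A w \<noteq> []" by (auto simp: words_def)
  from eq[OF this] show "f (emb (Tc R A) (pres_gen R (words A {1..}) (multilin_rels R A) w)) =
      g (emb (Tc R A) (pres_gen R (words A {1..}) (multilin_rels R A) w))"
    using cls_emb_word[OF A w] by (simp add: wcls_def)
qed

lemma Tc_span: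
  assumes A: "graded R A" and H: "submodule H R (Tc R A)" "\<And>w. w \<in> words A {1..} \<Longrightarrow> wcls R A w \<in> H"
  shows "H = carrier (Tc R A)"
  by (rule pres_span[OF graded_cring[OF A] multilin_rels_closed[OF A], folded Tc_def, OF H(1)])
     (use H(2) in \<open>simp add: wcls_def\<close>)

lemma multilin_lhom: "multilin R A N \<Theta> \<Longrightarrow> lhom R N P f \<Longrightarrow> multilin R A P (\<lambda>w. f (\<Theta> w))"
  by (auto simp: multilin_def)

lemma bilin_comp: "bilin R M N P \<beta> \<Longrightarrow> lhom R P Q f \<Longrightarrow> bilin R M N Q (\<lambda>x y. f (\<beta> x y))"
  by (auto simp: bilin_def)

lemma bilin_comp2: "bilin R M N P \<beta> \<Longrightarrow> lhom R M' M f \<Longrightarrow> lhom R N' N g \<Longrightarrow> bilin R M' N' P (\<lambda>x y. \<beta> (f x) (g y))"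
  unfolding bilin_def by (auto intro: lhom_comp[where f="\<lambda>x. \<beta> x _"] lhom_comp[where f="\<lambda>x. \<beta> _ x"])

text \<open>A function that is multilinear in two words extends in the second word first.  By uniqueness,
  the extension is still multilinear in the first word, and extends again.\<close>

lemma bilin_cls_ext:
  assumes A: "graded R A" and B: "graded R B" and N: "module R N"
    and m1: "\<And>v. v \<noteq> [] \<Longrightarrow> multilin R A N (\<lambda>u. \<Gamma> u v)" and m2: "\<And>u. u \<noteq> [] \<Longrightarrow> multilin R B N (\<Gamma> u)"
  shows "\<exists>\<beta>. bilin R (Tc R A) (Tc R B) N \<beta> \<and>
    (\<forall>u v. u \<noteq> [] \<longrightarrow> v \<noteq> [] \<longrightarrow> \<beta> (cls R A u) (cls R B v) = \<Gamma> u v)"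
proof -
  have "\<exists>f. u \<noteq> [] \<longrightarrow> lhom R (Tc R B) N f \<and> (\<forall>v. v \<noteq> [] \<longrightarrow> f (cls R B v) = \<Gamma> u v)" for u
    using cls_ext[OF B N m2] by blast
  then obtain g where g: "\<And>u. u \<noteq> [] \<Longrightarrow> lhom R (Tc R B) N (g u)"
    "\<And>u v. u \<noteq> [] \<Longrightarrow> v \<noteq> [] \<Longrightarrow> g u (cls R B v) = \<Gamma> u v" by metis
  have ne: "u @ (d, x) # v \<noteq> []" for u v :: "(int \<times> ('a, 'c) ambient) list" and d x by simp
  note h1 = m1[unfolded multilin_def, rule_format]
  have "multilin R A N (\<lambda>u. g u y)" for y
    unfolding multilin_def
  proof (intro allI)
    fix u d v
    have h1': "lhom R (A d) N (\<lambda>x. \<Gamma> (u @ (d, x) # v) w)" if "w \<noteq> []" for w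
      using h1[OF that] .
    let ?w = "\<lambda>x. u @ (d, x) # v"
    have add: "g (?w (x + x')) = (\<lambda>y. g (?w x) y + g (?w x') y)" for x x'
      by (rule cls_unique[OF B g(1)[OF ne]])
         (auto intro!: lhom_plus N g(1) simp: g(2) lin_add[OF lhom_lin[OF h1']])
    have sm: "g (?w (scale R r x)) = (\<lambda>y. scale R r (g (?w x) y))" if "r \<in> carrier R" for r x
    proof (rule cls_unique[OF B g(1)[OF ne]])
      show "lhom R (Tc R B) N (\<lambda>y. scale R r (g (?w x) y))"
        using g(1)[OF ne[of u d x v]] lin_comp[OF lin_scale_map[OF graded_cring[OF A] that]]
        by (auto simp: lhom_def retr_scale[OF N that])
    qed (auto simp: g(2) lin_scale[OF lhom_lin[OF h1'] that])
    have pra: "g (?w (retr (A d) x)) = g (?w x)" for x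
      by (rule cls_unique[OF B g(1)[OF ne] g(1)[OF ne]]) (simp add: g(2) lhom_retr[OF h1'])
    show "lhom R (A d) N (\<lambda>x. g (u @ (d, x) # v) y)"
      unfolding lhom_def lin_def using retr_lhom[OF g(1)[OF ne]] by (simp add: add sm pra)
  qed
  then have "\<exists>f. lhom R (Tc R A) N f \<and> (\<forall>u. u \<noteq> [] \<longrightarrow> f (cls R A u) = g u y)" for y
    using cls_ext[OF A N] by blast
  then obtain h where h: "\<And>y. lhom R (Tc R A) N (h y)" "\<And>u y. u \<noteq> [] \<Longrightarrow> h y (cls R A u) = g u y" by metis
  have "lhom R (Tc R B) N (\<lambda>y. h y x)" for x
  proof -
    have add: "h (y + y') = (\<lambda>x. h y x + h y' x)" for y y'
      by (rule cls_unique[OF A h(1)]) (auto intro!: lhom_plus N h(1) simp: h(2) lin_add[OF lhom_lin[OF g(1)]])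
    have sm: "h (scale R r y) = (\<lambda>x. scale R r (h y x))" if "r \<in> carrier R" for r y
    proof (rule cls_unique[OF A h(1)])
      show "lhom R (Tc R A) N (\<lambda>x. scale R r (h y x))"
        using h(1)[of y] lin_comp[OF lin_scale_map[OF graded_cring[OF A] that]]
        by (auto simp: lhom_def retr_scale[OF N that])
    qed (auto simp: h(2) lin_scale[OF lhom_lin[OF g(1)] that])
    have pra: "h (retr (Tc R B) y) = h y" for y
      by (rule cls_unique[OF A h(1) h(1)]) (simp add: h(2) lhom_retr[OF g(1)])
    show ?thesis
      unfolding lhom_def lin_def using retr_lhom[OF h(1)] by (simp add: add sm pra)
  qed
  then have "bilin R (Tc R A) (Tc R B) N (\<lambda>x y. h y x)" using h(1) by (simp add: bilin_def)
  then show ?thesis using h(2) g(2) by (intro exI[of _ "\<lambda>x y. h y x"]) simp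
qed

lemma bilin_cls_unique:
  assumes A: "graded R A" and B: "graded R B" and f: "bilin R (Tc R A) (Tc R B) N \<beta>" and g: "bilin R (Tc R A) (Tc R B) N \<gamma>"
    and eq: "\<And>u v. u \<noteq> [] \<Longrightarrow> v \<noteq> [] \<Longrightarrow> \<beta> (cls R A u) (cls R B v) = \<gamma> (cls R A u) (cls R B v)"
  shows "\<beta> = \<gamma>"
proof -
  have 1: "\<beta> (cls R A u) = \<gamma> (cls R A u)" if "u \<noteq> []" for u
    by (rule cls_unique[OF B]) (use f g eq that in \<open>auto simp: bilin_def\<close>)
  have "(\<lambda>x. \<beta> x y) = (\<lambda>x. \<gamma> x y)" for y
    by (rule cls_unique[OF A]) (use f g 1 in \<open>auto simp: bilin_def\<close>)
  then show ?thesis by (metis ext)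
qed

text \<open>Elementary tensors of classes of words generate the tensor square.\<close>

lemma TT_unique:
  assumes A: "graded R A" and f: "lhom R (TT R A) P f" and g: "lhom R (TT R A) P g"
    and eq: "\<And>u v. u \<noteq> [] \<Longrightarrow> v \<noteq> [] \<Longrightarrow> f (tprod R (Tc R A) (Tc R A) (cls R A u) (cls R A v)) =
      g (tprod R (Tc R A) (Tc R A) (cls R A u) (cls R A v))"
  shows "f = g"
proof (rule tprod_unique[OF _ _ f g])
  note t = tprod_bilin[OF Tc_module[OF A] Tc_module[OF A]]
  show "f (tprod R (Tc R A) (Tc R A) x y) = g (tprod R (Tc R A) (Tc R A) x y)" for x y
    using bilin_cls_unique[OF A A bilin_comp[OF t f] bilin_comp[OF t g] eq] by metis
qed (simp_all add: A)

section \<open>Sums over the splittings of a word\<close>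

text \<open>The shape of the deconcatenation coproduct, and of every formula derived from it: a sum over the
  splittings of a word in two nonempty parts.\<close>

definition split_sum :: "('a list \<Rightarrow> 'a list \<Rightarrow> 'b) \<Rightarrow> 'a list \<Rightarrow> 'b::ab_group_add" where
  "split_sum g w = (\<Sum>i\<in>{1..<length w}. g (take i w) (drop i w))"

lemma split_sum_Nil [simp]: "split_sum g [] = 0" "split_sum g [a] = 0"
  by (simp_all add: split_sum_def)

lemma split_sum_Cons: "w \<noteq> [] \<Longrightarrow> split_sum g (a # w) = g [a] w + split_sum (\<lambda>u. g (a # u)) w"
proof -
  assume w: "w \<noteq> []"
  have "split_sum g (a # w) = (\<Sum>i\<in>{0..<length w}. g (a # take i w) (drop i w))"
    using sum.shift_bounds_Suc_ivl[of "\<lambda>i. g (take i (a # w)) (drop i (a # w))" 0 "length w"]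
    by (simp add: split_sum_def del: sum.op_ivl_Suc)
  also have "\<dots> = g [a] w + split_sum (\<lambda>u. g (a # u)) w"
    using w by (simp add: sum.atLeast_Suc_lessThan split_sum_def)
  finally show ?thesis .
qed

lemma split_sum_cong:
  assumes "\<And>u v. w = u @ v \<Longrightarrow> u \<noteq> [] \<Longrightarrow> v \<noteq> [] \<Longrightarrow> g u v = h u v"
  shows "split_sum g w = split_sum h w"
  unfolding split_sum_def
proof (rule sum.cong[OF refl])
  fix i assume i: "i \<in> {1..<length w}"
  show "g (take i w) (drop i w) = h (take i w) (drop i w)" by (rule assms) (use i in auto)
qed

lemma split_sum_add: "split_sum (\<lambda>u v. g u v + h u v) w = split_sum g w + split_sum h w"
  by (simp add: split_sum_def sum.distrib)

lemma split_sum_zero [simp]: "split_sum (\<lambda>u v. 0) w = 0"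
  by (simp add: split_sum_def)

lemma lin_split_sum: "lin R f \<Longrightarrow> f (split_sum g w) = split_sum (\<lambda>u v. f (g u v)) w"
  by (simp add: split_sum_def lin_sum)

text \<open>Coassociativity: both sides run over the splittings of \<open>w\<close> in three nonempty parts.\<close>

lemma split_sum_assoc: "split_sum (\<lambda>u v. split_sum (\<lambda>x y. g x y v) u) w = split_sum (\<lambda>u v. split_sum (\<lambda>x y. g u x y) v) w"
proof (induction w arbitrary: g)
  case (Cons a w)
  show ?case
  proof (cases "w = []")
    case False
    have "split_sum (\<lambda>u v. split_sum (\<lambda>x y. g x y v) (a # u)) w =
      split_sum (\<lambda>u v. g [a] u v + split_sum (\<lambda>x y. g (a # x) y v) u) w"
      by (rule split_sum_cong) (simp add: split_sum_Cons)
    with False show ?thesis by (simp add: split_sum_Cons split_sum_add Cons.IH[of "\<lambda>x. g (a # x)"])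
  qed simp
qed simp

lemma split_sum_first: "w \<noteq> [] \<Longrightarrow> split_sum (\<lambda>u v. if length u = 1 then h u v else 0) w =
    (if length w = 1 then 0 else h [hd w] (tl w))"
proof -
  assume "w \<noteq> []"
  then obtain a w' where w: "w = a # w'" by (cases w) auto
  have "split_sum (\<lambda>u v. if length (a # u) = 1 then h (a # u) v else 0) w' = split_sum (\<lambda>u v. 0) w'"
    by (rule split_sum_cong) auto
  then show ?thesis by (cases "w' = []") (simp_all add: w split_sum_Cons)
qed

lemma lhom_sum:
  assumes "module R N" "\<And>i. i \<in> I \<Longrightarrow> lhom R M N (f i)"
  shows "lhom R M N (\<lambda>x. \<Sum>i\<in>I. f i x)"
  using assms(2)
  by (induction I rule: infinite_finite_induct) (auto intro!: lhom_zero lhom_plus assms(1))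

lemma multilin_split_sum:
  fixes A :: "('a, 'c) gmod"
  assumes N: "module R N"
    and m1: "\<And>v. v \<noteq> [] \<Longrightarrow> multilin R A N (\<lambda>u. g u v)" and m2: "\<And>u. u \<noteq> [] \<Longrightarrow> multilin R A N (g u)"
  shows "multilin R A N (split_sum g)"
  unfolding multilin_def split_sum_def
proof (intro allI)
  fix u v :: "(int \<times> ('a, 'c) ambient) list" and d :: int
  have "lhom R (A d) N (\<lambda>x. \<Sum>i\<in>{1..<length u + Suc (length v)}.
      g (take i (u @ (d, x) # v)) (drop i (u @ (d, x) # v)))"
  proof (rule lhom_sum[OF N])
    fix i assume i: "i \<in> {1..<length u + Suc (length v)}"
    show "lhom R (A d) N (\<lambda>x. g (take i (u @ (d, x) # v)) (drop i (u @ (d, x) # v)))"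
    proof (cases "i \<le> length u")
      case True
      have "take i u \<noteq> []" using i True by auto
      from m2[OF this] show ?thesis using True by (simp add: multilin_def)
    next
      case False
      then obtain j where j: "i = length u + Suc j" by (metis add_Suc_right less_imp_Suc_add not_le)
      have "drop j v \<noteq> []" using i j by auto
      from m1[OF this] show ?thesis using j by (simp add: multilin_def)
    qed
  qed
  then show "lhom R (A d) N (\<lambda>x. \<Sum>i\<in>{1..<length (u @ (d, x) # v)}.
      g (take i (u @ (d, x) # v)) (drop i (u @ (d, x) # v)))" by simp
qed

lemma multilin_if:
  assumes "module R N" "\<And>u d x y v. P (u @ (d, x) # v) = P (u @ (d, y) # v)" "multilin R A N \<Theta>" "multilin R A N \<Xi>"
  shows "multilin R A N (\<lambda>w. if P w then \<Theta> w else \<Xi> w)"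
  unfolding multilin_def
proof (intro allI)
  fix u d v
  have "lhom R (A d) N (\<lambda>x. \<Theta> (u @ (d, x) # v))" "lhom R (A d) N (\<lambda>x. \<Xi> (u @ (d, x) # v))"
    using assms by (auto simp: multilin_def)
  moreover define b where "b = P (u @ (d, 0) # v)"
  moreover have "P (u @ (d, x) # v) = b" for x using assms(2) by (simp add: b_def)
  ultimately show "lhom R (A d) N (\<lambda>x. if P (u @ (d, x) # v) then \<Theta> (u @ (d, x) # v) else \<Xi> (u @ (d, x) # v))"
    by (cases b) simp_all
qed

lemma multilin_zero [simp]: "module R N \<Longrightarrow> multilin R A N (\<lambda>w. 0)"
  by (simp add: multilin_def)

lemma multilin_neg: "module R N \<Longrightarrow> multilin R A N \<Theta> \<Longrightarrow> multilin R A N (\<lambda>w. - \<Theta> w)"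
  by (auto simp: multilin_def)

lemma wdeg_sum_list: "wdeg w = sum_list (map (\<lambda>a. fst a + 1) w)"
  by (simp add: wdeg_def sum_list_sum_nth atLeast0LessThan)

lemma wdeg_simps [simp]: "wdeg [] = 0" "wdeg ((d, x) # w) = d + 1 + wdeg w"
  "wdeg (u @ v) = wdeg u + wdeg v"
  by (simp_all add: wdeg_sum_list)

section \<open>Operators on the tensor coalgebra\<close>

abbreviation (input) tten where "tten R A \<equiv> tprod R (Tc R A) (Tc R A)"

abbreviation thom where "thom R A B \<equiv> lhom R (Tc R A) (Tc R B)"

abbreviation tid where "tid R A \<equiv> retr (Tc R A)"

definition word_ext where
  "word_ext R A N \<Theta> = (SOME f. lhom R (Tc R A) N f \<and> (\<forall>w. w \<noteq> [] \<longrightarrow> f (cls R A w) = \<Theta> w))"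

lemma word_ext:
  assumes "graded R A" "module R N" "multilin R A N \<Theta>"
  shows "lhom R (Tc R A) N (word_ext R A N \<Theta>)" "w \<noteq> [] \<Longrightarrow> word_ext R A N \<Theta> (cls R A w) = \<Theta> w"
  using someI_ex[OF cls_ext[OF assms]] unfolding word_ext_def by blast+

definition signed :: "int \<Rightarrow> 'a::ab_group_add \<Rightarrow> 'a" where
  "signed n x = (if even n then x else - x)"

lemma signed_simps [simp]: "signed n 0 = 0" "signed n (- x) = - signed n x" "signed n (signed n x) = x"
  "signed 0 x = x" "signed (- n) x = signed n x"
  by (simp_all add: signed_def)

lemma signed_signed: "signed m (signed n x) = signed (m + n) x"
  by (simp add: signed_def)

lemma lin_signed: "lin R f \<Longrightarrow> f (signed n x) = signed n (f x)"
  by (simp add: signed_def lin_uminus)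

text \<open>The operators on which everything is built.  \<open>proj1\<close> is the projection to words of length
  one, so \<open>proj1 \<circ> L\<close> is the corestriction of \<open>L\<close>.  The involution \<open>sigma\<close> is multiplication by the
  sign of the degree; with it, the Koszul sign of a tensor product \<open>f \<otimes> g\<close> becomes the
  composition of \<open>f\<close> with a power of \<open>sigma\<close>, and \<open>tmap\<close> needs no signs.  \<open>deg_part\<close> and
  \<open>len_part\<close> project to one degree and to bounded length, and \<open>cop\<close> is the coproduct.  Finally
  \<open>glue\<close> sends \<open>x \<otimes> y\<close> to the word of \<open>x\<close> followed by that of \<open>y\<close> if \<open>x\<close> has
  length one, and to \<open>0\<close> otherwise; it recovers a word of length at least two from its coproduct.\<close>

definition proj1 where "proj1 R A = word_ext R A (Tc R A) (\<lambda>w. if length w = 1 then cls R A w else 0)"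
definition sigma where "sigma R A = word_ext R A (Tc R A) (\<lambda>w. signed (wdeg w) (cls R A w))"
definition deg_part where "deg_part R A n = word_ext R A (Tc R A) (\<lambda>w. if wdeg w = n then cls R A w else 0)"
definition len_part where "len_part R A n = word_ext R A (Tc R A) (\<lambda>w. if length w \<le> n then cls R A w else 0)"
definition cop where "cop R A = word_ext R A (TT R A) (split_sum (\<lambda>u v. tten R A (cls R A u) (cls R A v)))"

definition glue where
  "glue R A = (SOME f. lhom R (TT R A) (Tc R A) f \<and> (\<forall>u v. u \<noteq> [] \<longrightarrow> v \<noteq> [] \<longrightarrow>
     f (tten R A (cls R A u) (cls R A v)) = (if length u = 1 then cls R A (u @ v) else 0)))"

definition tmap where
  "tmap R A B f g = (SOME h. lhom R (TT R A) (TT R B) h \<and>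
     (\<forall>x y. h (tten R A x y) = tten R B (f x) (g y)))"

lemma tten_bilin: "graded R A \<Longrightarrow> bilin R (Tc R A) (Tc R A) (TT R A) (tten R A)"
  by (simp add: tprod_bilin)

lemma tten_lhom:
  assumes "graded R A"
  shows "lhom R (Tc R A) (TT R A) (\<lambda>x. tten R A x y)" "lhom R (Tc R A) (TT R A) (tten R A x)"
  using tten_bilin[OF assms] by (auto simp: bilin_def)

lemma tten_simps:
  assumes "graded R A"
  shows "tten R A (x + x') y = tten R A x y + tten R A x' y" "tten R A x (y + y') = tten R A x y + tten R A x y'"
    "tten R A (- x) y = - tten R A x y" "tten R A x (- y) = - tten R A x y"
    "tten R A 0 y = 0" "tten R A x 0 = 0"
    "tten R A (x - x') y = tten R A x y - tten R A x' y" "tten R A x (y - y') = tten R A x y - tten R A x y'"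
    "tten R A (tid R A x) y = tten R A x y" "tten R A x (tid R A y) = tten R A x y"
proof -
  note h = tten_lhom[OF assms]
  note l = h(1)[THEN lhom_lin] h(2)[THEN lhom_lin]
  show "tten R A (x + x') y = tten R A x y + tten R A x' y" by (rule lin_add[OF l(1)])
  show "tten R A x (y + y') = tten R A x y + tten R A x y'" by (rule lin_add[OF l(2)])
  show "tten R A (- x) y = - tten R A x y" by (rule lin_uminus[OF l(1)])
  show "tten R A x (- y) = - tten R A x y" by (rule lin_uminus[OF l(2)])
  show "tten R A 0 y = 0" by (rule lin_0[OF l(1)])
  show "tten R A x 0 = 0" by (rule lin_0[OF l(2)])
  show "tten R A (x - x') y = tten R A x y - tten R A x' y" by (rule lin_diff[OF l(1)])
  show "tten R A x (y - y') = tten R A x y - tten R A x y'" by (rule lin_diff[OF l(2)])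
  show "tten R A (tid R A x) y = tten R A x y" by (rule lhom_retr[OF h(1)])
  show "tten R A x (tid R A y) = tten R A x y" by (rule lhom_retr[OF h(2)])
qed

lemma proj1: assumes "graded R A"
  shows "thom R A A (proj1 R A)" "w \<noteq> [] \<Longrightarrow> proj1 R A (cls R A w) = (if length w = 1 then cls R A w else 0)"
proof -
  have "multilin R A (Tc R A) (\<lambda>w. if length w = 1 then cls R A w else 0)"
    using assms cls_multilin[OF assms] by (intro multilin_if) simp_all
  from word_ext[OF assms Tc_module[OF assms] this] show "thom R A A (proj1 R A)"
    "w \<noteq> [] \<Longrightarrow> proj1 R A (cls R A w) = (if length w = 1 then cls R A w else 0)" by (simp_all add: proj1_def)
qed

lemma sigma: assumes "graded R A"
  shows "thom R A A (sigma R A)" "sigma R A (cls R A w) = signed (wdeg w) (cls R A w)"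
proof -
  have "multilin R A (Tc R A) (\<lambda>w. if even (wdeg w) then cls R A w else - cls R A w)"
    using assms cls_multilin[OF assms] by (intro multilin_if) (simp_all add: multilin_neg)
  then have "multilin R A (Tc R A) (\<lambda>w. signed (wdeg w) (cls R A w))" by (simp add: signed_def)
  from word_ext[OF assms Tc_module[OF assms] this] show 1: "thom R A A (sigma R A)"
    and "sigma R A (cls R A w) = signed (wdeg w) (cls R A w)"
    by (cases "w = []"; simp_all add: sigma_def lin_0[OF lhom_lin])+
qed

lemma deg_part: assumes "graded R A"
  shows "thom R A A (deg_part R A n)" "deg_part R A n (cls R A w) = (if wdeg w = n then cls R A w else 0)"
proof -
  have "multilin R A (Tc R A) (\<lambda>w. if wdeg w = n then cls R A w else 0)"
    using assms cls_multilin[OF assms] by (intro multilin_if) simp_all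
  from word_ext[OF assms Tc_module[OF assms] this] show "thom R A A (deg_part R A n)"
    and "deg_part R A n (cls R A w) = (if wdeg w = n then cls R A w else 0)"
    by (cases "w = []"; simp_all add: deg_part_def lin_0[OF lhom_lin])+
qed

lemma len_part: assumes "graded R A"
  shows "thom R A A (len_part R A n)" "len_part R A n (cls R A w) = (if length w \<le> n then cls R A w else 0)"
proof -
  have "multilin R A (Tc R A) (\<lambda>w. if length w \<le> n then cls R A w else 0)"
    using assms cls_multilin[OF assms] by (intro multilin_if) simp_all
  from word_ext[OF assms Tc_module[OF assms] this] show "thom R A A (len_part R A n)"
    and "len_part R A n (cls R A w) = (if length w \<le> n then cls R A w else 0)"
    by (cases "w = []"; simp_all add: len_part_def lin_0[OF lhom_lin])+
qed

lemma cop: assumes "graded R A"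
  shows "lhom R (Tc R A) (TT R A) (cop R A)"
    "cop R A (cls R A w) = split_sum (\<lambda>u v. tten R A (cls R A u) (cls R A v)) w"
proof -
  have "multilin R A (TT R A) (split_sum (\<lambda>u v. tten R A (cls R A u) (cls R A v)))"
    using assms cls_multilin[OF assms] tten_lhom[OF assms]
    by (intro multilin_split_sum multilin_lhom[OF cls_multilin[OF assms]]) simp_all
  from word_ext[OF assms TT_module[OF assms] this] show "lhom R (Tc R A) (TT R A) (cop R A)"
    and "cop R A (cls R A w) = split_sum (\<lambda>u v. tten R A (cls R A u) (cls R A v)) w"
    by (cases "w = []"; simp_all add: cop_def lin_0[OF lhom_lin])+
qed

lemma glue: assumes A: "graded R A"
  shows "lhom R (TT R A) (Tc R A) (glue R A)"
    "u \<noteq> [] \<Longrightarrow> v \<noteq> [] \<Longrightarrow> glue R A (tten R A (cls R A u) (cls R A v)) = (if length u = 1 then cls R A (u @ v) else 0)"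
proof -
  note m = cls_multilin[OF A, unfolded multilin_def, rule_format]
  have 1: "multilin R A (Tc R A) (\<lambda>u. if length u = 1 then cls R A (u @ v) else 0)" for v
    using m A by (intro multilin_if) (simp_all add: multilin_def)
  have 2: "multilin R A (Tc R A) (\<lambda>v. if length u = 1 then cls R A (u @ v) else 0)" for u
    by (cases "length u = 1") (use m[of _ "u @ _"] A in \<open>auto simp: multilin_def\<close>)
  obtain \<beta> where b: "bilin R (Tc R A) (Tc R A) (Tc R A) \<beta>"
    "\<And>u v. u \<noteq> [] \<Longrightarrow> v \<noteq> [] \<Longrightarrow> \<beta> (cls R A u) (cls R A v) = (if length u = 1 then cls R A (u @ v) else 0)"
    using bilin_cls_ext[OF A A Tc_module[OF A] 1 2] by blast
  have "\<exists>f. lhom R (TT R A) (Tc R A) f \<and> (\<forall>u v. u \<noteq> [] \<longrightarrow> v \<noteq> [] \<longrightarrow>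
     f (tten R A (cls R A u) (cls R A v)) = (if length u = 1 then cls R A (u @ v) else 0))"
    using tprod_ext[OF Tc_module[OF A] Tc_module[OF A] Tc_module[OF A] b(1)] b(2) by metis
  from someI_ex[OF this] show "lhom R (TT R A) (Tc R A) (glue R A)"
    "u \<noteq> [] \<Longrightarrow> v \<noteq> [] \<Longrightarrow> glue R A (tten R A (cls R A u) (cls R A v)) = (if length u = 1 then cls R A (u @ v) else 0)"
    unfolding glue_def by blast+
qed

lemma tmap: assumes A: "graded R A" and B: "graded R B" and f: "thom R A B f" and g: "thom R A B g"
  shows "lhom R (TT R A) (TT R B) (tmap R A B f g)" "tmap R A B f g (tten R A x y) = tten R B (f x) (g y)"
proof -
  have "\<exists>h. lhom R (TT R A) (TT R B) h \<and> (\<forall>x y. h (tten R A x y) = tten R B (f x) (g y))"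
    by (rule tprod_ext[OF _ _ _ bilin_comp2[OF tten_bilin[OF B] f g]]) (simp_all add: A B)
  from someI_ex[OF this] show "lhom R (TT R A) (TT R B) (tmap R A B f g)"
    "tmap R A B f g (tten R A x y) = tten R B (f x) (g y)"
    unfolding tmap_def by blast+
qed

lemma TT_eqI:
  assumes A: "graded R A" and f: "lhom R (TT R A) P f" and g: "lhom R (TT R A) P g"
    and eq: "\<And>x y. f (tten R A x y) = g (tten R A x y)"
  shows "f z = g z"
  using tprod_unique[OF Tc_module[OF A] Tc_module[OF A] f g eq] by simp

lemma tmap_comp:
  assumes A: "graded R A" and B: "graded R B" and C: "graded R C" and f: "thom R B C f" and g: "thom R B C g"
    and f': "thom R A B f'" and g': "thom R A B g'"
  shows "tmap R B C f g (tmap R A B f' g' z) = tmap R A C (\<lambda>x. f (f' x)) (\<lambda>x. g (g' x)) z"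
  by (rule TT_eqI[OF A lhom_comp[OF tmap(1)[OF B C f g] tmap(1)[OF A B f' g']]
        tmap(1)[OF A C lhom_comp[OF f f'] lhom_comp[OF g g']]])
     (use tmap(2)[OF A B f' g'] tmap(2)[OF B C f g] tmap(2)[OF A C lhom_comp[OF f f'] lhom_comp[OF g g']] in simp)

lemma tmap_add:
  assumes A: "graded R A" and B: "graded R B" and f: "thom R A B f" and f': "thom R A B f'" and g: "thom R A B g"
  shows "tmap R A B (\<lambda>x. f x + f' x) g z = tmap R A B f g z + tmap R A B f' g z"
    "tmap R A B g (\<lambda>x. f x + f' x) z = tmap R A B g f z + tmap R A B g f' z"
proof -
  note h = lhom_plus[OF Tc_module[OF B] f f']
  show "tmap R A B (\<lambda>x. f x + f' x) g z = tmap R A B f g z + tmap R A B f' g z"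
    by (rule TT_eqI[OF A tmap(1)[OF A B h g] lhom_plus[OF TT_module[OF B] tmap(1)[OF A B f g] tmap(1)[OF A B f' g]]])
       (simp add: tmap(2)[OF A B] f f' g h tten_simps[OF B])
  show "tmap R A B g (\<lambda>x. f x + f' x) z = tmap R A B g f z + tmap R A B g f' z"
    by (rule TT_eqI[OF A tmap(1)[OF A B g h] lhom_plus[OF TT_module[OF B] tmap(1)[OF A B g f] tmap(1)[OF A B g f']]])
       (simp add: tmap(2)[OF A B] f f' g h tten_simps[OF B])
qed

lemma tmap_neg:
  assumes A: "graded R A" and B: "graded R B" and f: "thom R A B f" and g: "thom R A B g"
  shows "tmap R A B (\<lambda>x. - f x) g z = - tmap R A B f g z" "tmap R A B g (\<lambda>x. - f x) z = - tmap R A B g f z"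
proof -
  note h = lhom_neg[OF Tc_module[OF B] f]
  show "tmap R A B (\<lambda>x. - f x) g z = - tmap R A B f g z"
    by (rule TT_eqI[OF A tmap(1)[OF A B h g] lhom_neg[OF TT_module[OF B] tmap(1)[OF A B f g]]])
       (simp add: tmap(2)[OF A B] f g h tten_simps[OF B])
  show "tmap R A B g (\<lambda>x. - f x) z = - tmap R A B g f z"
    by (rule TT_eqI[OF A tmap(1)[OF A B g h] lhom_neg[OF TT_module[OF B] tmap(1)[OF A B g f]]])
       (simp add: tmap(2)[OF A B] f g h tten_simps[OF B])
qed

lemma tmap_diff:
  assumes A: "graded R A" and B: "graded R B" and f: "thom R A B f" and f': "thom R A B f'" and g: "thom R A B g"
  shows "tmap R A B (\<lambda>x. f x - f' x) g z = tmap R A B f g z - tmap R A B f' g z"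
    "tmap R A B g (\<lambda>x. f x - f' x) z = tmap R A B g f z - tmap R A B g f' z"
  using tmap_add[OF A B f lhom_neg[OF Tc_module[OF B] f'] g] tmap_neg[OF A B f' g] by simp_all

lemma tmap_id: "graded R A \<Longrightarrow> tmap R A A (tid R A) (tid R A) z = retr (TT R A) z"
  by (rule TT_eqI[where f="tmap R A A (tid R A) (tid R A)", OF _ tmap(1)])
     (auto intro!: lhom_id simp: tmap(2) tten_simps retr_lhom[OF tten_lhom(1)])

lemma cls_eqI:
  assumes A: "graded R A" and f: "lhom R (Tc R A) N f" and g: "lhom R (Tc R A) N g"
    and eq: "\<And>w. w \<noteq> [] \<Longrightarrow> f (cls R A w) = g (cls R A w)"
  shows "f x = g x"
  using cls_unique[OF A f g eq] by simp

lemma tid_cls: "graded R A \<Longrightarrow> tid R A (cls R A w) = cls R A w"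
proof (cases w)
  case (Cons a w')
  assume "graded R A"
  from cls_multilin[OF this] have "lhom R (A (fst a)) (Tc R A) (\<lambda>x. cls R A ([] @ (fst a, x) # w'))"
    unfolding multilin_def by blast
  from retr_lhom[OF this, of "snd a"] show ?thesis by (simp add: Cons)
qed (simp add: lin_0[OF lin_retr[OF Tc_module]])

lemma proj1_proj1: "graded R A \<Longrightarrow> proj1 R A (proj1 R A x) = proj1 R A x"
  by (rule cls_eqI[OF _ lhom_comp[OF proj1(1) proj1(1)] proj1(1)]) (simp_all add: proj1 lin_0[OF lhom_lin[OF proj1(1)]])

lemma proj1_glue: assumes A: "graded R A" shows "proj1 R A (glue R A z) = 0"
  by (rule fun_cong[OF TT_unique[OF A lhom_comp[OF proj1(1)[OF A] glue(1)[OF A]] lhom_zero]])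
     (simp_all add: A proj1 glue lin_0[OF lhom_lin[OF proj1(1)]])

text \<open>In the coproduct of a word of length at least two there is one term with first factor of
  length one, and \<open>glue\<close> returns the word from it.\<close>

lemma glue_cop: assumes A: "graded R A" shows "glue R A (cop R A x) = tid R A x - proj1 R A x"
proof (rule cls_eqI[OF A lhom_comp[OF glue(1)[OF A] cop(1)[OF A]] lhom_minus])
  fix w :: "('a, 'c) aword" assume w: "w \<noteq> []"
  have "glue R A (cop R A (cls R A w)) = split_sum (\<lambda>u v. if length u = 1 then cls R A (u @ v) else 0) w"
    unfolding cop(2)[OF A] lin_split_sum[OF lhom_lin[OF glue(1)[OF A]]]
    by (rule split_sum_cong) (simp add: glue(2)[OF A])
  also have "\<dots> = (if length w = 1 then 0 else cls R A w)"
    unfolding split_sum_first[OF w] using w by simp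
  finally show "glue R A (cop R A (cls R A w)) = tid R A (cls R A w) - proj1 R A (cls R A w)"
    using w by (simp add: tid_cls A proj1)
qed (simp_all add: A proj1)

text \<open>The reason why maps into a tensor coalgebra are governed by their corestrictions: an element is
  the sum of its part of length one and of a function of its coproduct.\<close>

lemma split_proj1: assumes A: "graded R A" and x: "tid R A x = x" shows "x = proj1 R A x + glue R A (cop R A x)"
  by (simp add: glue_cop[OF A] x)

lemma cop_proj1: assumes A: "graded R A" shows "cop R A (proj1 R A x) = 0"
proof (rule cls_eqI[OF A lhom_comp[OF cop(1)[OF A] proj1(1)[OF A]] lhom_zero])
  fix w :: "('a, 'c) aword" assume w: "w \<noteq> []"
  show "cop R A (proj1 R A (cls R A w)) = 0"
    using w by (cases w) (auto simp: A proj1 cop lin_0[OF lhom_lin[OF cop(1)]])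
qed (simp add: A)

lemma glue_lhom: assumes A: "graded R A"
  shows "thom R A A (\<lambda>a. glue R A (tten R A x a))" "thom R A A (\<lambda>a. glue R A (tten R A a y))"
  using lhom_comp[OF glue(1)[OF A] tten_lhom(2)[OF A]] lhom_comp[OF glue(1)[OF A] tten_lhom(1)[OF A]] by simp_all

text \<open>The coproduct of a word \<open>x y\<close> with \<open>x\<close> of length one: the splittings after \<open>x\<close>, and those
  inside \<open>y\<close> with \<open>x\<close> put in front.\<close>

lemma cop_glue: assumes A: "graded R A"
  shows "cop R A (glue R A (tten R A x y)) =
     tten R A (proj1 R A x) y + tmap R A A (\<lambda>a. glue R A (tten R A x a)) (tid R A) (cop R A y)"
proof -
  note tmh = tmap[OF A A glue_lhom(1)[OF A] lhom_id[OF Tc_module[OF A]]]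
  have 1: "cop R A (glue R A (tten R A x (cls R A v))) = tten R A (proj1 R A x) (cls R A v) +
      tmap R A A (\<lambda>a. glue R A (tten R A x a)) (tid R A) (cop R A (cls R A v))" if v: "v \<noteq> []" for v x
  proof -
    have r: "tmap R A A (\<lambda>a. glue R A (tten R A x a)) (tid R A) (cop R A (cls R A v)) =
       split_sum (\<lambda>s t. tten R A (glue R A (tten R A x (cls R A s))) (cls R A t)) v" for x
      unfolding cop(2)[OF A] lin_split_sum[OF lhom_lin[OF tmh(1)]] by (simp add: tmh(2) tid_cls A)
    have "lhom R (Tc R A) (TT R A) (\<lambda>x. tten R A (proj1 R A x) (cls R A v) +
        split_sum (\<lambda>s t. tten R A (glue R A (tten R A x (cls R A s))) (cls R A t)) v)"
      unfolding split_sum_def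
      by (intro lhom_plus lhom_sum TT_module A lhom_comp[OF tten_lhom(1)[OF A] proj1(1)[OF A]]
          lhom_comp[OF tten_lhom(1)[OF A] glue_lhom(2)[OF A]])
    note h1 = this
    have h2: "lhom R (Tc R A) (TT R A) (\<lambda>x. cop R A (glue R A (tten R A x (cls R A v))))"
      by (rule lhom_comp[OF cop(1)[OF A] glue_lhom(2)[OF A]])
    show ?thesis
      unfolding r
    proof (rule cls_eqI[OF A h2 h1])
      fix w :: "('a, 'c) aword" assume w: "w \<noteq> []"
      have s: "split_sum (\<lambda>s t. tten R A (glue R A (tten R A (cls R A w) (cls R A s))) (cls R A t)) v =
         split_sum (\<lambda>s t. tten R A (if length w = 1 then cls R A (w @ s) else 0) (cls R A t)) v"
        by (rule split_sum_cong) (simp add: glue(2)[OF A w])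
      show "cop R A (glue R A (tten R A (cls R A w) (cls R A v))) = tten R A (proj1 R A (cls R A w)) (cls R A v) +
         split_sum (\<lambda>s t. tten R A (glue R A (tten R A (cls R A w) (cls R A s))) (cls R A t)) v"
        unfolding s using w v by (cases w) (auto simp: A glue proj1 cop split_sum_Cons tten_simps lin_0[OF lhom_lin[OF cop(1)]])
    qed
  qed
  show ?thesis
    by (rule cls_eqI[OF A lhom_comp[OF cop(1)[OF A] glue_lhom(1)[OF A]]
          lhom_plus[OF TT_module[OF A] tten_lhom(2)[OF A] lhom_comp[OF tmh(1) cop(1)[OF A]]] 1])
qed

text \<open>The convolution of \<open>f\<close> and \<open>g\<close> for \<open>glue\<close>: on a word, the sum over its splittings of
  \<open>f\<close> of the first part, reduced to length one, times \<open>g\<close> of the second part.\<close>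

definition conv where "conv R A B f g x = glue R B (tmap R A B f g (cop R A x))"

lemma conv: assumes A: "graded R A" and B: "graded R B" and f: "thom R A B f" and g: "thom R A B g"
  shows "thom R A B (conv R A B f g)"
    "conv R A B f g (cls R A w) = split_sum (\<lambda>u v. glue R B (tten R B (f (cls R A u)) (g (cls R A v)))) w"
  unfolding conv_def
  using lhom_comp[OF glue(1)[OF B] lhom_comp[OF tmap(1)[OF A B f g] cop(1)[OF A]]]
  by (auto simp: cop[OF A] lin_split_sum[OF lhom_lin[OF tmap(1)[OF A B f g]]] tmap(2)[OF A B f g]
     lin_split_sum[OF lhom_lin[OF glue(1)[OF B]]])

section \<open>Coalgebra morphisms and twisted coderivations\<close>

definition comorph where
  "comorph R A B \<phi> \<longleftrightarrow> thom R A B \<phi> \<and> (\<forall>x. cop R B (\<phi> x) = tmap R A B \<phi> \<phi> (cop R A x))"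

text \<open>For morphisms \<open>\<phi>\<close> and \<open>\<psi>\<close> and \<open>\<theta> = \<phi> \<circ> sigma\<^sup>q\<close>, these are the \<open>(\<phi>, \<psi>)\<close>-coderivations of degree
  \<open>q\<close>.  Coderivations of degree \<open>-1\<close> have \<open>\<theta> = sigma\<close> and \<open>\<psi>\<close> the identity.  Since \<open>sigma\<close> is itself a
  morphism of coalgebras, \<open>\<theta>\<close> is one, and no sign appears.\<close>

definition coder where
  "coder R A B \<theta> \<psi> \<eta> \<longleftrightarrow> thom R A B \<eta> \<and>
     (\<forall>x. cop R B (\<eta> x) = tmap R A B \<theta> \<eta> (cop R A x) + tmap R A B \<eta> \<psi> (cop R A x))"

lemma comorph_lhom: "comorph R A B \<phi> \<Longrightarrow> thom R A B \<phi>" by (simp add: comorph_def)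
lemma comorph_D: "comorph R A B \<phi> \<Longrightarrow> cop R B (\<phi> x) = tmap R A B \<phi> \<phi> (cop R A x)" by (simp add: comorph_def)
lemma coder_lhom: "coder R A B \<theta> \<psi> \<eta> \<Longrightarrow> thom R A B \<eta>" by (simp add: coder_def)
lemma coder_D: "coder R A B \<theta> \<psi> \<eta> \<Longrightarrow> cop R B (\<eta> x) = tmap R A B \<theta> \<eta> (cop R A x) + tmap R A B \<eta> \<psi> (cop R A x)"
  by (simp add: coder_def)

lemma glue_add: "graded R A \<Longrightarrow> glue R A (z + z') = glue R A z + glue R A z'"
  by (rule lin_add[OF lhom_lin[OF glue(1)]])

text \<open>Applying \<open>glue\<close> to the coproduct identity expresses the value on a word by the corestriction
  and by values on shorter words.  The next three lemmas say the same of coderivations, and that the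
  recursions conversely imply the coproduct identities.\<close>

lemma comorph_rec: assumes B: "graded R B" and c: "comorph R A B \<phi>"
  shows "\<phi> x = proj1 R B (\<phi> x) + conv R A B \<phi> \<phi> x"
  using split_proj1[OF B retr_lhom[OF comorph_lhom[OF c]]] by (simp add: comorph_D[OF c] conv_def)

lemma coder_rec: assumes B: "graded R B" and c: "coder R A B \<theta> \<psi> \<eta>"
  shows "\<eta> x = proj1 R B (\<eta> x) + (conv R A B \<theta> \<eta> x + conv R A B \<eta> \<psi> x)"
  using split_proj1[OF B retr_lhom[OF coder_lhom[OF c]]] by (simp add: coder_D[OF c] conv_def glue_add[OF B])

text \<open>By induction on the length of the word.  The coproduct of the recursion is a sum over splittings in
  three parts; after regrouping by coassociativity, the recursion for the first two parts
  gives the claim.\<close>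

lemma comorphI_rec:
  assumes A: "graded R A" and B: "graded R B" and h: "thom R A B \<phi>"
    and rec: "\<And>x. \<phi> x = proj1 R B (\<phi> x) + conv R A B \<phi> \<phi> x"
  shows "comorph R A B \<phi>"
proof -
  note cW = conv(2)[OF A B h h]
  note tmW = lin_split_sum[OF lhom_lin[OF tmap(1)[OF A B h h]]] tmap(2)[OF A B h h]
  note tmi = tmap[OF B B glue_lhom(1)[OF B] lhom_id[OF Tc_module[OF B]]]
  note ldl = lhom_lin[OF cop(1)[OF B]]
  have "cop R B (\<phi> (cls R A w)) = split_sum (\<lambda>u v. tten R B (\<phi> (cls R A u)) (\<phi> (cls R A v))) w" for w
  proof (induction "length w" arbitrary: w rule: less_induct)
    case less
    have "cop R B (\<phi> (cls R A w)) = cop R B (conv R A B \<phi> \<phi> (cls R A w))"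
      by (subst rec) (simp add: lin_add[OF ldl] cop_proj1[OF B])
    also have "\<dots> = split_sum (\<lambda>u v. tten R B (proj1 R B (\<phi> (cls R A u))) (\<phi> (cls R A v)) +
        split_sum (\<lambda>s t. tten R B (glue R B (tten R B (\<phi> (cls R A u)) (\<phi> (cls R A s)))) (\<phi> (cls R A t))) v) w"
      unfolding cW lin_split_sum[OF ldl]
    proof (rule split_sum_cong)
      fix u v assume w: "w = u @ v" "u \<noteq> []" "v \<noteq> []"
      show "cop R B (glue R B (tten R B (\<phi> (cls R A u)) (\<phi> (cls R A v)))) =
        tten R B (proj1 R B (\<phi> (cls R A u))) (\<phi> (cls R A v)) +
        split_sum (\<lambda>s t. tten R B (glue R B (tten R B (\<phi> (cls R A u)) (\<phi> (cls R A s)))) (\<phi> (cls R A t))) v"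
        unfolding cop_glue[OF B] using w
        by (simp add: less[of v] lin_split_sum[OF lhom_lin[OF tmi(1)]] tmi(2) retr_lhom[OF h])
    qed
    also have "\<dots> = split_sum (\<lambda>u v. tten R B (proj1 R B (\<phi> (cls R A u)) + conv R A B \<phi> \<phi> (cls R A u)) (\<phi> (cls R A v))) w"
      by (simp add: split_sum_add tten_simps[OF B] cW lin_split_sum[OF lhom_lin[OF tten_lhom(1)[OF B]]] split_sum_assoc[symmetric])
    finally show ?case by (simp add: rec[symmetric])
  qed
  note e = this
  have "cop R B (\<phi> x) = tmap R A B \<phi> \<phi> (cop R A x)" for x
    by (rule cls_eqI[OF A lhom_comp[OF cop(1)[OF B] h] lhom_comp[OF tmap(1)[OF A B h h] cop(1)[OF A]]])
       (simp add: e cop[OF A] tmW)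
  with h show ?thesis by (simp add: comorph_def)
qed

lemma coderI_rec:
  assumes A: "graded R A" and B: "graded R B" and h: "thom R A B \<eta>" and t: "comorph R A B \<theta>" and p: "comorph R A B \<psi>"
    and rec: "\<And>x. \<eta> x = proj1 R B (\<eta> x) + (conv R A B \<theta> \<eta> x + conv R A B \<eta> \<psi> x)"
  shows "coder R A B \<theta> \<psi> \<eta>"
proof -
  note th = comorph_lhom[OF t] and ph = comorph_lhom[OF p]
  note tmi = tmap[OF B B glue_lhom(1)[OF B] lhom_id[OF Tc_module[OF B]]]
  note ldl = lhom_lin[OF cop(1)[OF B]]
  note cW = conv(2)[OF A B th h] conv(2)[OF A B h ph]
  have pW: "cop R B (\<psi> (cls R A w)) = split_sum (\<lambda>u v. tten R B (\<psi> (cls R A u)) (\<psi> (cls R A v))) w" for w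
    by (simp add: comorph_D[OF p] cop[OF A] lin_split_sum[OF lhom_lin[OF tmap(1)[OF A B ph ph]]] tmap(2)[OF A B ph ph])
  have "cop R B (\<eta> (cls R A w)) = split_sum (\<lambda>u v. tten R B (\<theta> (cls R A u)) (\<eta> (cls R A v)) +
      tten R B (\<eta> (cls R A u)) (\<psi> (cls R A v))) w" for w
  proof (induction "length w" arbitrary: w rule: less_induct)
    case less
    have "cop R B (\<eta> (cls R A w)) = cop R B (conv R A B \<theta> \<eta> (cls R A w)) + cop R B (conv R A B \<eta> \<psi> (cls R A w))"
      by (subst rec) (simp add: lin_add[OF ldl] cop_proj1[OF B])
    also have "cop R B (conv R A B \<theta> \<eta> (cls R A w)) = split_sum (\<lambda>u v. tten R B (proj1 R B (\<theta> (cls R A u))) (\<eta> (cls R A v)) +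
        split_sum (\<lambda>s t. tten R B (glue R B (tten R B (\<theta> (cls R A u)) (\<theta> (cls R A s)))) (\<eta> (cls R A t)) +
          tten R B (glue R B (tten R B (\<theta> (cls R A u)) (\<eta> (cls R A s)))) (\<psi> (cls R A t))) v) w"
      unfolding cW lin_split_sum[OF ldl]
    proof (rule split_sum_cong)
      fix u v assume w: "w = u @ v" "u \<noteq> []" "v \<noteq> []"
      show "cop R B (glue R B (tten R B (\<theta> (cls R A u)) (\<eta> (cls R A v)))) =
        tten R B (proj1 R B (\<theta> (cls R A u))) (\<eta> (cls R A v)) +
        split_sum (\<lambda>s t. tten R B (glue R B (tten R B (\<theta> (cls R A u)) (\<theta> (cls R A s)))) (\<eta> (cls R A t)) +
          tten R B (glue R B (tten R B (\<theta> (cls R A u)) (\<eta> (cls R A s)))) (\<psi> (cls R A t))) v"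
        unfolding cop_glue[OF B] using w
        by (simp add: less[of v] lin_split_sum[OF lhom_lin[OF tmi(1)]] lin_add[OF lhom_lin[OF tmi(1)]]
            tmi(2) retr_lhom[OF h] retr_lhom[OF ph])
    qed
    also have "cop R B (conv R A B \<eta> \<psi> (cls R A w)) = split_sum (\<lambda>u v. tten R B (proj1 R B (\<eta> (cls R A u))) (\<psi> (cls R A v)) +
        split_sum (\<lambda>s t. tten R B (glue R B (tten R B (\<eta> (cls R A u)) (\<psi> (cls R A s)))) (\<psi> (cls R A t))) v) w"
      unfolding cW lin_split_sum[OF ldl] cop_glue[OF B] pW
      by (simp add: lin_split_sum[OF lhom_lin[OF tmi(1)]] tmi(2) retr_lhom[OF ph])
    finally have "cop R B (\<eta> (cls R A w)) =
       split_sum (\<lambda>u v. tten R B (proj1 R B (\<theta> (cls R A u)) + conv R A B \<theta> \<theta> (cls R A u)) (\<eta> (cls R A v)) +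
         tten R B (proj1 R B (\<eta> (cls R A u)) + (conv R A B \<theta> \<eta> (cls R A u) + conv R A B \<eta> \<psi> (cls R A u))) (\<psi> (cls R A v))) w"
      by (simp add: split_sum_add tten_simps[OF B] cW conv(2)[OF A B th th] lin_split_sum[OF lhom_lin[OF tten_lhom(1)[OF B]]]
          split_sum_assoc[symmetric] algebra_simps)
    then show ?case by (simp add: rec[symmetric] comorph_rec[OF B t, symmetric])
  qed
  note e = this
  have "cop R B (\<eta> x) = tmap R A B \<theta> \<eta> (cop R A x) + tmap R A B \<eta> \<psi> (cop R A x)" for x
    by (rule cls_eqI[OF A lhom_comp[OF cop(1)[OF B] h] lhom_plus[OF TT_module[OF B]
       lhom_comp[OF tmap(1)[OF A B th h] cop(1)[OF A]] lhom_comp[OF tmap(1)[OF A B h ph] cop(1)[OF A]]]])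
       (simp add: e cop[OF A] lin_split_sum[OF lhom_lin[OF tmap(1)[OF A B]]] tmap(2)[OF A B] h th ph split_sum_add)
  with h show ?thesis by (simp add: coder_def)
qed

section \<open>Degrees and word length\<close>

definition homog where "homog R A n x \<longleftrightarrow> deg_part R A n x = x"

definition has_deg where
  "has_deg R A B q f \<longleftrightarrow> (\<forall>w. w \<noteq> [] \<longrightarrow> homog R B (wdeg w + q) (f (cls R A w)))"

lemma deg_part_lin: "graded R A \<Longrightarrow> lin R (deg_part R A n)" by (rule lhom_lin[OF deg_part(1)])

lemma homog_0 [simp]: "graded R A \<Longrightarrow> homog R A n 0"
  by (simp add: homog_def lin_0[OF deg_part_lin])

lemma homog_add: "graded R A \<Longrightarrow> homog R A n x \<Longrightarrow> homog R A n y \<Longrightarrow> homog R A n (x + y)"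
  by (simp add: homog_def lin_add[OF deg_part_lin])

lemma homog_neg: "graded R A \<Longrightarrow> homog R A n x \<Longrightarrow> homog R A n (- x)"
  by (simp add: homog_def lin_uminus[OF deg_part_lin])

lemma homog_split_sum:
  assumes "graded R A" "\<And>u v. w = u @ v \<Longrightarrow> u \<noteq> [] \<Longrightarrow> v \<noteq> [] \<Longrightarrow> homog R A n (g u v)"
  shows "homog R A n (split_sum g w)"
  unfolding homog_def lin_split_sum[OF deg_part_lin[OF assms(1)]]
  by (rule split_sum_cong) (use assms(2) in \<open>simp add: homog_def\<close>)

lemma homog_cls: "graded R A \<Longrightarrow> homog R A (wdeg w) (cls R A w)"
  by (simp add: homog_def deg_part)

lemma deg_part_deg_part: "graded R A \<Longrightarrow> deg_part R A m (deg_part R A n x) = (if m = n then deg_part R A n x else 0)"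
proof (cases "m = n")
  case True
  assume A: "graded R A"
  have "deg_part R A n (deg_part R A n x) = deg_part R A n x"
    by (rule cls_eqI[OF A lhom_comp[OF deg_part(1)[OF A] deg_part(1)[OF A]] deg_part(1)[OF A]])
       (simp add: deg_part[OF A] lin_0[OF deg_part_lin[OF A]])
  then show ?thesis using True by simp
next
  case False
  assume A: "graded R A"
  have "deg_part R A m (deg_part R A n x) = 0"
    by (rule cls_eqI[OF A lhom_comp[OF deg_part(1)[OF A] deg_part(1)[OF A]] lhom_zero[OF Tc_module[OF A]]])
       (use False in \<open>simp add: deg_part[OF A] lin_0[OF deg_part_lin[OF A]]\<close>)
  then show ?thesis using False by simp
qed

lemma has_deg_deg_part:
  assumes A: "graded R A" and B: "graded R B" and f: "thom R A B f" and d: "has_deg R A B q f"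
  shows "f (deg_part R A n x) = deg_part R B (n + q) (f x)"
proof (rule cls_eqI[OF A lhom_comp[OF f deg_part(1)[OF A]] lhom_comp[OF deg_part(1)[OF B] f]])
  fix w :: "('a, 'c) aword" assume w: "w \<noteq> []"
  have h: "deg_part R B (wdeg w + q) (f (cls R A w)) = f (cls R A w)" using d w by (simp add: has_deg_def homog_def)
  show "f (deg_part R A n (cls R A w)) = deg_part R B (n + q) (f (cls R A w))"
    using deg_part_deg_part[OF B, of "n + q" "wdeg w + q" "f (cls R A w)"]
    by (simp add: h deg_part[OF A] lin_0[OF lhom_lin[OF f]])
qed

lemma has_deg_homog:
  assumes "graded R A" "graded R B" "thom R A B f" "has_deg R A B q f" "homog R A n x"
  shows "homog R B (n + q) (f x)"
  using has_deg_deg_part[OF assms(1-4), of n x] assms(5) by (simp add: homog_def)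

lemma has_deg_comp:
  assumes "graded R B" "graded R C" "thom R B C f" "has_deg R B C q f" "has_deg R A B r g"
  shows "has_deg R A C (r + q) (\<lambda>x. f (g x))"
  unfolding has_deg_def
proof (intro allI impI)
  fix w :: "('a, 'e) aword" assume "w \<noteq> []"
  then have "homog R B (wdeg w + r) (g (cls R A w))" using assms(5) by (simp add: has_deg_def)
  from has_deg_homog[OF assms(1-4) this] show "homog R C (wdeg w + (r + q)) (f (g (cls R A w)))"
    by (simp add: add.assoc)
qed

lemma has_deg_plus: "graded R B \<Longrightarrow> has_deg R A B q f \<Longrightarrow> has_deg R A B q g \<Longrightarrow> has_deg R A B q (\<lambda>x. f x + g x)"
  by (simp add: has_deg_def homog_add)

lemma has_deg_neg: "graded R B \<Longrightarrow> has_deg R A B q f \<Longrightarrow> has_deg R A B q (\<lambda>x. - f x)"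
  by (simp add: has_deg_def homog_neg)

lemma has_deg_diff: "graded R B \<Longrightarrow> has_deg R A B q f \<Longrightarrow> has_deg R A B q g \<Longrightarrow> has_deg R A B q (\<lambda>x. f x - g x)"
  using has_deg_plus[of R B A q f "\<lambda>x. - g x"] has_deg_neg[of R B A q g] by simp

lemma has_deg_zero [simp]: "graded R B \<Longrightarrow> has_deg R A B q (\<lambda>x. 0)"
  by (simp add: has_deg_def)

lemma has_deg_id: "graded R A \<Longrightarrow> has_deg R A A 0 (tid R A)"
  by (simp add: has_deg_def tid_cls homog_cls)

lemma has_deg_proj1: "graded R A \<Longrightarrow> has_deg R A A 0 (proj1 R A)"
  by (simp add: has_deg_def proj1 homog_cls)

lemma has_deg_sigma: "graded R A \<Longrightarrow> has_deg R A A 0 (sigma R A)"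
  by (simp add: has_deg_def sigma signed_def homog_cls homog_neg)

lemma sigma_homog: assumes A: "graded R A" and x: "homog R A n x" shows "sigma R A x = signed n x"
proof -
  have "sigma R A (deg_part R A n x) = signed n (deg_part R A n x)"
  proof (rule cls_eqI[OF A lhom_comp[OF sigma(1)[OF A] deg_part(1)[OF A]]])
    show "thom R A A (\<lambda>x. signed n (deg_part R A n x))"
      unfolding signed_def using deg_part(1)[OF A, of n] lhom_neg[OF Tc_module[OF A] deg_part(1)[OF A, of n]]
      by (cases "even n") simp_all
  qed (auto simp: deg_part[OF A] sigma[OF A] lin_0[OF lhom_lin[OF sigma(1)[OF A]]])
  with x show ?thesis by (simp add: homog_def)
qed

text \<open>The commutation rule that produces all signs below.\<close>

lemma sigma_has_deg:
  assumes A: "graded R A" and B: "graded R B" and f: "thom R A B f" and d: "has_deg R A B q f"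
  shows "sigma R B (f x) = signed q (f (sigma R A x))"
proof (rule cls_eqI[OF A lhom_comp[OF sigma(1)[OF B] f]])
  have "thom R A B (\<lambda>x. f (sigma R A x))" by (rule lhom_comp[OF f sigma(1)[OF A]])
  then show "thom R A B (\<lambda>x. signed q (f (sigma R A x)))"
    unfolding signed_def using lhom_neg[OF Tc_module[OF B]] by (cases "even q") simp_all
  fix w :: "('a, 'c) aword" assume "w \<noteq> []"
  with d have "homog R B (wdeg w + q) (f (cls R A w))" by (simp add: has_deg_def)
  from sigma_homog[OF B this] show "sigma R B (f (cls R A w)) = signed q (f (sigma R A (cls R A w)))"
    by (simp add: sigma[OF A] lin_signed[OF lhom_lin[OF f]] signed_signed add.commute)
qed

lemma homog_glue:
  assumes A: "graded R A" and x: "homog R A m x" and y: "homog R A n y"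
  shows "homog R A (m + n) (glue R A (tten R A x y))"
proof -
  let ?b = "\<lambda>x y. glue R A (tten R A (deg_part R A m x) (deg_part R A n y))"
  have b: "bilin R (Tc R A) (Tc R A) (Tc R A) ?b"
    by (rule bilin_comp[OF bilin_comp2[OF tten_bilin[OF A] deg_part(1)[OF A] deg_part(1)[OF A]] glue(1)[OF A]])
  have "(\<lambda>x y. deg_part R A (m + n) (?b x y)) = ?b"
    by (rule bilin_cls_unique[OF A A bilin_comp[OF b deg_part(1)[OF A]] b])
       (auto simp: deg_part[OF A] tten_simps[OF A] glue[OF A] lin_0[OF lhom_lin[OF glue(1)[OF A]]] lin_0[OF deg_part_lin[OF A]])
  from fun_cong[OF fun_cong[OF this, of x], of y] x y show ?thesis by (simp add: homog_def)
qed

lemma conv_has_deg: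
  assumes A: "graded R A" and B: "graded R B" and f: "thom R A B f" and g: "thom R A B g"
    and w: "\<And>u v. w = u @ v \<Longrightarrow> u \<noteq> [] \<Longrightarrow> v \<noteq> [] \<Longrightarrow>
      homog R B (wdeg u + p) (f (cls R A u)) \<and> homog R B (wdeg v + q) (g (cls R A v))"
  shows "homog R B (wdeg w + (p + q)) (conv R A B f g (cls R A w))"
  unfolding conv(2)[OF A B f g]
proof (rule homog_split_sum[OF B])
  fix u v assume "w = u @ v" "u \<noteq> []" "v \<noteq> []"
  with homog_glue[OF B w[OF this, THEN conjunct1] w[OF this, THEN conjunct2]]
  show "homog R B (wdeg w + (p + q)) (glue R B (tten R B (f (cls R A u)) (g (cls R A v))))"
    by (simp add: algebra_simps)
qed

lemma sigma_sigma: "graded R A \<Longrightarrow> sigma R A (sigma R A x) = tid R A x"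
  by (rule cls_eqI[OF _ lhom_comp[OF sigma(1) sigma(1)] lhom_id[OF Tc_module]])
     (simp_all add: sigma lin_signed[OF lhom_lin[OF sigma(1)]] tid_cls)

lemma comorph_id: assumes A: "graded R A" shows "comorph R A A (tid R A)"
  unfolding comorph_def
  using lhom_id[OF Tc_module[OF A]] by (auto simp: tmap_id[OF A] lhom_retr[OF cop(1)[OF A]] retr_lhom[OF cop(1)[OF A]])

text \<open>Degrees add up along a splitting of a word, so signs multiply.\<close>

lemma comorph_sigma: assumes A: "graded R A" shows "comorph R A A (sigma R A)"
proof -
  note t = tmap[OF A A sigma(1)[OF A] sigma(1)[OF A]]
  have "cop R A (sigma R A x) = tmap R A A (sigma R A) (sigma R A) (cop R A x)" for x
  proof (rule cls_eqI[OF A lhom_comp[OF cop(1)[OF A] sigma(1)[OF A]] lhom_comp[OF t(1) cop(1)[OF A]]])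
    fix w :: "('a, 'c) aword"
    have "tmap R A A (sigma R A) (sigma R A) (cop R A (cls R A w)) =
        split_sum (\<lambda>u v. signed (wdeg w) (tten R A (cls R A u) (cls R A v))) w"
      unfolding cop(2)[OF A] lin_split_sum[OF lhom_lin[OF t(1)]]
      by (rule split_sum_cong)
         (simp add: t(2) sigma[OF A] lin_signed[OF lhom_lin[OF tten_lhom(1)[OF A]]] lin_signed[OF lhom_lin[OF tten_lhom(2)[OF A]]] signed_signed add.commute)
    also have "\<dots> = signed (wdeg w) (cop R A (cls R A w))"
      by (simp add: cop(2)[OF A] split_sum_def signed_def sum_negf)
    finally show "cop R A (sigma R A (cls R A w)) = tmap R A A (sigma R A) (sigma R A) (cop R A (cls R A w))"
      by (simp add: sigma[OF A] lin_signed[OF lhom_lin[OF cop(1)[OF A]]])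
  qed
  with sigma(1)[OF A] show ?thesis by (simp add: comorph_def)
qed

lemma comorph_comp:
  assumes A: "graded R A" and B: "graded R B" and C: "graded R C" and f: "comorph R B C \<phi>" and g: "comorph R A B \<psi>"
  shows "comorph R A C (\<lambda>x. \<phi> (\<psi> x))"
  unfolding comorph_def
  using lhom_comp[OF comorph_lhom[OF f] comorph_lhom[OF g]]
  by (simp add: comorph_D[OF f] comorph_D[OF g] tmap_comp[OF A B C comorph_lhom[OF f] comorph_lhom[OF f] comorph_lhom[OF g] comorph_lhom[OF g]])

definition len_le where "len_le R A n x \<longleftrightarrow> len_part R A n x = x"

lemma len_part_lin: "graded R A \<Longrightarrow> lin R (len_part R A n)" by (rule lhom_lin[OF len_part(1)])

lemma len_part_len_part: "graded R A \<Longrightarrow> n \<le> m \<Longrightarrow> len_part R A m (len_part R A n x) = len_part R A n x"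
  by (rule cls_eqI[OF _ lhom_comp[OF len_part(1) len_part(1)] len_part(1)]) (simp_all add: len_part lin_0[OF len_part_lin])

lemma len_le_mono: "graded R A \<Longrightarrow> len_le R A n x \<Longrightarrow> n \<le> m \<Longrightarrow> len_le R A m x"
  by (metis len_part_len_part len_le_def)

lemma len_le_add: "graded R A \<Longrightarrow> len_le R A n x \<Longrightarrow> len_le R A n y \<Longrightarrow> len_le R A n (x + y)"
  by (simp add: len_le_def lin_add[OF len_part_lin])

lemma len_le_cls: "graded R A \<Longrightarrow> length w \<le> n \<Longrightarrow> len_le R A n (cls R A w)"
  by (simp add: len_le_def len_part)

lemma len_le_split_sum:
  assumes "graded R A" "\<And>u v. w = u @ v \<Longrightarrow> u \<noteq> [] \<Longrightarrow> v \<noteq> [] \<Longrightarrow> len_le R A n (g u v)"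
  shows "len_le R A n (split_sum g w)"
  unfolding len_le_def lin_split_sum[OF len_part_lin[OF assms(1)]]
  by (rule split_sum_cong) (use assms(2) in \<open>simp add: len_le_def\<close>)

lemma len_le_proj1: assumes A: "graded R A" and n: "1 \<le> n" shows "len_le R A n (proj1 R A x)"
  unfolding len_le_def
  by (rule cls_eqI[OF A lhom_comp[OF len_part(1)[OF A] proj1(1)[OF A]] proj1(1)[OF A]])
     (use n in \<open>simp add: proj1[OF A] len_part[OF A] lin_0[OF len_part_lin[OF A]]\<close>)

lemma len_le_glue:
  assumes A: "graded R A" and y: "len_le R A n y"
  shows "len_le R A (Suc n) (glue R A (tten R A x y))"
proof -
  let ?b = "\<lambda>x y. glue R A (tten R A (tid R A x) (len_part R A n y))"
  have b: "bilin R (Tc R A) (Tc R A) (Tc R A) ?b"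
    by (rule bilin_comp[OF bilin_comp2[OF tten_bilin[OF A] lhom_id[OF Tc_module[OF A]] len_part(1)[OF A]] glue(1)[OF A]])
  have "(\<lambda>x y. len_part R A (Suc n) (?b x y)) = ?b"
    by (rule bilin_cls_unique[OF A A bilin_comp[OF b len_part(1)[OF A]] b])
       (auto simp: len_part[OF A] tten_simps[OF A] glue[OF A] lin_0[OF lhom_lin[OF glue(1)[OF A]]] lin_0[OF len_part_lin[OF A]])
  from fun_cong[OF fun_cong[OF this, of x], of y] y show ?thesis by (simp add: len_le_def tten_simps[OF A])
qed

text \<open>Coderivations do not lengthen words.\<close>

lemma coder_len_le:
  assumes A: "graded R A" and t: "thom R A A \<theta>" and c: "coder R A A \<theta> (tid R A) \<delta>" and w: "w \<noteq> []"
  shows "len_le R A (length w) (\<delta> (cls R A w))"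
  using w
proof (induction "length w" arbitrary: w rule: less_induct)
  case less
  note d = coder_lhom[OF c] and i = lhom_id[OF Tc_module[OF A]]
  have l: "1 \<le> length w" using less.prems by (simp add: Suc_le_eq)
  have "len_le R A (length w) (conv R A A \<theta> \<delta> (cls R A w))"
    unfolding conv(2)[OF A A t d]
  proof (rule len_le_split_sum[OF A])
    fix u v assume u: "w = u @ v" "u \<noteq> []" "v \<noteq> []"
    have "len_le R A (Suc (length v)) (glue R A (tten R A (\<theta> (cls R A u)) (\<delta> (cls R A v))))"
      by (rule len_le_glue[OF A less.hyps]) (use u in auto)
    then show "len_le R A (length w) (glue R A (tten R A (\<theta> (cls R A u)) (\<delta> (cls R A v))))"
      by (rule len_le_mono[OF A]) (use u in \<open>cases u; simp\<close>)
  qed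
  moreover have "len_le R A (length w) (conv R A A \<delta> (tid R A) (cls R A w))"
    unfolding conv(2)[OF A A d i]
  proof (rule len_le_split_sum[OF A])
    fix u v assume u: "w = u @ v" "u \<noteq> []" "v \<noteq> []"
    have "len_le R A (Suc (length v)) (glue R A (tten R A (\<delta> (cls R A u)) (tid R A (cls R A v))))"
      by (rule len_le_glue[OF A]) (simp add: tid_cls[OF A] len_le_cls[OF A])
    then show "len_le R A (length w) (glue R A (tten R A (\<delta> (cls R A u)) (tid R A (cls R A v))))"
      by (rule len_le_mono[OF A]) (use u in \<open>cases u; simp\<close>)
  qed
  ultimately show ?case
    by (subst coder_rec[OF A c]) (intro len_le_add A len_le_proj1[OF A l])
qed

lemma len_le_vanish:
  assumes A: "graded R A" and N: "module R N" and L: "lhom R (Tc R A) N L"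
    and v: "\<And>w. w \<noteq> [] \<Longrightarrow> length w \<le> n \<Longrightarrow> L (cls R A w) = 0" and x: "len_le R A n x"
  shows "L x = 0"
proof -
  have "L (len_part R A n x) = 0"
    by (rule cls_eqI[OF A lhom_comp[OF L len_part(1)[OF A]] lhom_zero[OF N]])
       (simp add: len_part[OF A] v lin_0[OF lhom_lin[OF L]])
  with x show ?thesis by (simp add: len_le_def)
qed

section \<open>Uniqueness of maps with given corestriction\<close>

text \<open>The device by which identities between maps are proved: their difference \<open>L\<close> vanishes if its
  coproduct only involves values of \<open>L\<close> on shorter words, and if its corestriction is \<open>\<Psi> \<circ> L\<close> for
  some \<open>\<Psi>\<close> that vanishes on words of length one.\<close>

lemma vanishing:
  assumes A: "graded R A" and B: "graded R B" and L: "thom R A B L"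
    and p: "\<And>x. proj1 R B (L x) = \<Psi> (L x)" and q: "\<And>x. \<Psi> (proj1 R B x) = 0"
    and s: "\<And>w. w \<noteq> [] \<Longrightarrow> (\<And>v. v \<noteq> [] \<Longrightarrow> length v < length w \<Longrightarrow> L (cls R A v) = 0) \<Longrightarrow> cop R B (L (cls R A w)) = 0"
  shows "L x = 0"
proof (rule cls_eqI[OF A L lhom_zero[OF Tc_module[OF B]]])
  fix w :: "('a, 'c) aword" assume "w \<noteq> []"
  then show "L (cls R A w) = 0"
  proof (induction "length w" arbitrary: w rule: less_induct)
    case less
    have "cop R B (L (cls R A w)) = 0" by (rule s[OF less.prems]) (use less.hyps in blast)
    then have e: "L (cls R A w) = proj1 R B (L (cls R A w))"
      using split_proj1[OF B retr_lhom[OF L, of "cls R A w"]] by (simp add: lin_0[OF lhom_lin[OF glue(1)[OF B]]])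
    then show ?case by (metis p q)
  qed
qed

lemma tmap_cop_zero:
  assumes A: "graded R A" and B: "graded R B" and f: "thom R A B f" and g: "thom R A B g"
    and z: "\<And>u v. w = u @ v \<Longrightarrow> u \<noteq> [] \<Longrightarrow> v \<noteq> [] \<Longrightarrow> f (cls R A u) = 0 \<or> g (cls R A v) = 0"
  shows "tmap R A B f g (cop R A (cls R A w)) = 0"
proof -
  have "tmap R A B f g (cop R A (cls R A w)) = split_sum (\<lambda>u v. tten R B (f (cls R A u)) (g (cls R A v))) w"
    by (simp add: cop(2)[OF A] lin_split_sum[OF lhom_lin[OF tmap(1)[OF A B f g]]] tmap(2)[OF A B f g])
  also have "\<dots> = split_sum (\<lambda>u v. 0) w"
    by (rule split_sum_cong) (use z in \<open>fastforce simp: tten_simps[OF B]\<close>)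
  finally show ?thesis by simp
qed

lemma coder_zero:
  assumes A: "graded R A" and B: "graded R B" and t: "thom R A B \<theta>" and u: "thom R A B \<psi>" and c: "coder R A B \<theta> \<psi> L"
    and p: "\<And>x. proj1 R B (L x) = \<Psi> (L x)" and q: "\<And>x. \<Psi> (proj1 R B x) = 0"
  shows "L x = 0"
proof (rule vanishing[where \<Psi>=\<Psi>, OF A B coder_lhom[OF c] p q])
  fix w :: "('a, 'c) aword"
  assume v: "\<And>v. v \<noteq> [] \<Longrightarrow> length v < length w \<Longrightarrow> L (cls R A v) = 0"
  have "tmap R A B \<theta> L (cop R A (cls R A w)) = 0"
    by (rule tmap_cop_zero[OF A B t coder_lhom[OF c]]) (use v in auto)
  moreover have "tmap R A B L \<psi> (cop R A (cls R A w)) = 0"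
    by (rule tmap_cop_zero[OF A B coder_lhom[OF c] u]) (use v in auto)
  ultimately show "cop R B (L (cls R A w)) = 0" by (simp add: coder_D[OF c])
qed

lemma coder_unique:
  assumes A: "graded R A" and B: "graded R B" and t: "thom R A B \<theta>" and u: "thom R A B \<psi>"
    and c: "coder R A B \<theta> \<psi> \<eta>" and c': "coder R A B \<theta> \<psi> \<eta>'"
    and p: "\<And>x. proj1 R B (\<eta> x) = proj1 R B (\<eta>' x)"
  shows "\<eta> = \<eta>'"
proof
  fix x
  note h = coder_lhom[OF c] coder_lhom[OF c']
  have "coder R A B \<theta> \<psi> (\<lambda>x. \<eta> x - \<eta>' x)"
    unfolding coder_def using lhom_minus[OF Tc_module[OF B] h]
    by (simp add: lin_diff[OF lhom_lin[OF cop(1)[OF B]]] coder_D[OF c] coder_D[OF c'] tmap_diff[OF A B h t] tmap_diff[OF A B h u])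
  from coder_zero[where \<Psi>="\<lambda>x. 0", OF A B t u this] have "\<eta> x - \<eta>' x = 0"
    using p by (simp add: lin_diff[OF lhom_lin[OF proj1(1)[OF B]]])
  then show "\<eta> x = \<eta>' x" by simp
qed

text \<open>The difference of two morphisms \<open>\<phi>\<close> and \<open>\<phi>'\<close> is a \<open>(\<phi>, \<phi>')\<close>-coderivation.\<close>

lemma comorph_unique:
  assumes A: "graded R A" and B: "graded R B" and c: "comorph R A B \<phi>" and c': "comorph R A B \<phi>'"
    and p: "\<And>x. proj1 R B (\<phi> x) = proj1 R B (\<phi>' x)"
  shows "\<phi> = \<phi>'"
proof
  fix x
  note h = comorph_lhom[OF c] comorph_lhom[OF c']
  have "coder R A B \<phi> \<phi>' (\<lambda>x. \<phi> x - \<phi>' x)"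
    unfolding coder_def using lhom_minus[OF Tc_module[OF B] h]
    by (simp add: lin_diff[OF lhom_lin[OF cop(1)[OF B]]] comorph_D[OF c] comorph_D[OF c'] tmap_diff[OF A B h h(1)] tmap_diff[OF A B h h(2)])
  from coder_zero[where \<Psi>="\<lambda>x. 0", OF A B h this] have "\<phi> x - \<phi>' x = 0"
    using p by (simp add: lin_diff[OF lhom_lin[OF proj1(1)[OF B]]])
  then show "\<phi> x = \<phi>' x" by simp
qed

section \<open>Existence of maps with given corestriction\<close>

definition agree_upto where
  "agree_upto R A n f g \<longleftrightarrow> (\<forall>w. w \<noteq> [] \<longrightarrow> length w \<le> n \<longrightarrow> f (cls R A w) = g (cls R A w))"

lemma conv_agree_upto:
  assumes A: "graded R A" and B: "graded R B" and h: "thom R A B f" "thom R A B g" "thom R A B f'" "thom R A B g'"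
    and a: "agree_upto R A n f f'" "agree_upto R A n g g'"
  shows "agree_upto R A (Suc n) (conv R A B f g) (conv R A B f' g')"
  unfolding agree_upto_def conv(2)[OF A B h(1,2)] conv(2)[OF A B h(3,4)]
proof (intro allI impI split_sum_cong)
  fix w u v :: "('a, 'c) aword"
  assume "length w \<le> Suc n" "w = u @ v" "u \<noteq> []" "v \<noteq> []"
  then have "length u \<le> n" "length v \<le> n" by (cases u; cases v; simp)+
  with a \<open>u \<noteq> []\<close> \<open>v \<noteq> []\<close> show "glue R B (tten R B (f (cls R A u)) (g (cls R A v))) =
      glue R B (tten R B (f' (cls R A u)) (g' (cls R A v)))" by (simp add: agree_upto_def)
qed

text \<open>All the maps below come from this recursion.  The corestriction of the morphism \<open>\<psi>\<close> may depend on
  \<open>\<psi>\<close> itself, through a map \<open>\<Psi>\<close> that kills words of length one, and on the twisted coderivation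
  \<open>\<eta>\<close>.  This is well founded: the part of length at least two of \<open>\<psi>\<close>, and all of
  \<open>\<eta>\<close> except its given corestriction \<open>H\<close>, involve only values on shorter words.  The
  proof iterates the recursion from \<open>0\<close>; the \<open>n\<close>-th iterate is correct on words of length at
  most \<open>n\<close>.\<close>

lemma fixpoint:
  assumes A: "graded R A" and B: "graded R B" and t: "comorph R A B \<theta>"
    and H: "thom R A B H" "\<And>x. proj1 R B (H x) = H x"
    and b: "thom R A B b" "\<And>x. proj1 R B (b x) = b x"
    and P: "thom R B B \<Psi>" "\<And>x. proj1 R B (\<Psi> x) = \<Psi> x" "\<And>x. \<Psi> (proj1 R B x) = 0"
    and C: "thom R B B \<Xi>" "\<And>x. proj1 R B (\<Xi> x) = \<Xi> x"
  shows "\<exists>\<psi> \<eta>. comorph R A B \<psi> \<and> coder R A B \<theta> \<psi> \<eta> \<and> (\<forall>x. proj1 R B (\<eta> x) = H x) \<and>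
    (\<forall>x. proj1 R B (\<psi> x) = b x + \<Psi> (\<psi> x) + \<Xi> (\<eta> x))"
proof -
  note th = comorph_lhom[OF t]
  note TB = Tc_module[OF B]
  \<comment> \<open>One step of the recursion: the new value of \<open>\<eta>\<close> and, in terms of it, that of \<open>\<psi>\<close>.\<close>
  define N where "N \<psi> \<eta> x = H x + (conv R A B \<theta> \<eta> x + conv R A B \<eta> \<psi> x)" for \<psi> \<eta> x
  define S where "S \<psi> \<eta> x = b x + \<Psi> (conv R A B \<psi> \<psi> x) + \<Xi> (N \<psi> \<eta> x) + conv R A B \<psi> \<psi> x" for \<psi> \<eta> x
  have hN: "thom R A B (N \<psi> \<eta>)" if "thom R A B \<psi>" "thom R A B \<eta>" for \<psi> \<eta>
    unfolding N_def by (intro lhom_plus TB H(1) conv(1)[OF A B] th that)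
  have hS: "thom R A B (S \<psi> \<eta>)" if "thom R A B \<psi>" "thom R A B \<eta>" for \<psi> \<eta>
    unfolding S_def by (intro lhom_plus TB b(1) lhom_comp[OF P(1)] lhom_comp[OF C(1)] hN conv(1)[OF A B] that)
  have agN: "agree_upto R A (Suc n) (N \<psi> \<eta>) (N \<psi>' \<eta>')"
    if "thom R A B \<psi>" "thom R A B \<eta>" "thom R A B \<psi>'" "thom R A B \<eta>'" "agree_upto R A n \<psi> \<psi>'" "agree_upto R A n \<eta> \<eta>'"
    for n \<psi> \<eta> \<psi>' \<eta>'
    using conv_agree_upto[OF A B th that(2) th that(4) _ that(6)] conv_agree_upto[OF A B that(2,1,4,3,6,5)]
    by (auto simp: agree_upto_def N_def)
  have agS: "agree_upto R A (Suc n) (S \<psi> \<eta>) (S \<psi>' \<eta>')"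
    if "thom R A B \<psi>" "thom R A B \<eta>" "thom R A B \<psi>'" "thom R A B \<eta>'" "agree_upto R A n \<psi> \<psi>'" "agree_upto R A n \<eta> \<eta>'"
    for n \<psi> \<eta> \<psi>' \<eta>'
    using agN[OF that] conv_agree_upto[OF A B that(1,1,3,3,5,5)] by (auto simp: agree_upto_def S_def)
  define it where "it n = ((\<lambda>(\<psi>, \<eta>). (S \<psi> \<eta>, N \<psi> \<eta>)) ^^ n) (\<lambda>x. 0, \<lambda>x. 0)" for n :: nat
  let ?p = "\<lambda>n. fst (it n)" and ?e = "\<lambda>n. snd (it n)"
  have itS: "?p (Suc n) = S (?p n) (?e n)" "?e (Suc n) = N (?p n) (?e n)" for n
    by (simp_all add: it_def case_prod_beta)
  have hit: "thom R A B (?p n) \<and> thom R A B (?e n)" for n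
    by (induction n) (auto simp: itS hS hN, auto simp: it_def lhom_zero[OF TB])
  note hp = hit[THEN conjunct1] and he = hit[THEN conjunct2]
  have stab1: "agree_upto R A n (?p n) (?p (Suc n)) \<and> agree_upto R A n (?e n) (?e (Suc n))" for n
  proof (induction n)
    case (Suc n)
    then show ?case unfolding itS(1)[of n] itS(2)[of n] itS(1)[of "Suc n"] itS(2)[of "Suc n"]
      using agN[OF hp he hp he] agS[OF hp he hp he] by (metis itS)
  qed (simp add: agree_upto_def)
  have stab: "?p (length w + k) (cls R A w) = ?p (length w) (cls R A w) \<and>
      ?e (length w + k) (cls R A w) = ?e (length w) (cls R A w)" if "w \<noteq> []" for w k
  proof (induction k)
    case (Suc k)
    with stab1[of "length w + k"] that show ?case by (simp add: agree_upto_def)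
  qed simp
  have lim: "multilin R A (Tc R B) (\<lambda>w. f (length w) (cls R A w))" if "\<And>n. thom R A B (f n)" for f :: "nat \<Rightarrow> _"
    using cls_multilin[OF A] by (auto simp: multilin_def intro!: lhom_comp[OF that])
  \<comment> \<open>The limit takes on each word the value at which the iteration has become stationary.\<close>
  define \<psi> where "\<psi> = word_ext R A (Tc R B) (\<lambda>w. ?p (length w) (cls R A w))"
  define \<eta> where "\<eta> = word_ext R A (Tc R B) (\<lambda>w. ?e (length w) (cls R A w))"
  have ps: "thom R A B \<psi>" "w \<noteq> [] \<Longrightarrow> \<psi> (cls R A w) = ?p (length w) (cls R A w)" for w
    unfolding \<psi>_def using word_ext[OF A TB lim[of ?p]] hp by simp_all
  have et: "thom R A B \<eta>" "w \<noteq> [] \<Longrightarrow> \<eta> (cls R A w) = ?e (length w) (cls R A w)" for w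
    unfolding \<eta>_def using word_ext[OF A TB lim[of ?e]] he by simp_all
  have ag: "agree_upto R A n \<psi> (?p n)" "agree_upto R A n \<eta> (?e n)" for n
    unfolding agree_upto_def using ps(2) et(2) stab by (metis le_add_diff_inverse)+
  have rp: "\<psi> x = S \<psi> \<eta> x" for x
  proof (rule cls_eqI[OF A ps(1) hS[OF ps(1) et(1)]])
    fix w :: "('a, 'c) aword" assume w: "w \<noteq> []"
    then obtain n where n: "length w = Suc n" by (cases w) auto
    have "agree_upto R A (Suc n) (S \<psi> \<eta>) (?p (Suc n))"
      unfolding itS by (rule agS[OF ps(1) et(1) hp he ag])
    then show "\<psi> (cls R A w) = S \<psi> \<eta> (cls R A w)" using w n ps(2) by (simp add: agree_upto_def)
  qed
  have re: "\<eta> x = N \<psi> \<eta> x" for x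
  proof (rule cls_eqI[OF A et(1) hN[OF ps(1) et(1)]])
    fix w :: "('a, 'c) aword" assume w: "w \<noteq> []"
    then obtain n where n: "length w = Suc n" by (cases w) auto
    have "agree_upto R A (Suc n) (N \<psi> \<eta>) (?e (Suc n))"
      unfolding itS by (rule agN[OF ps(1) et(1) hp he ag])
    then show "\<eta> (cls R A w) = N \<psi> \<eta> (cls R A w)" using w n et(2) by (simp add: agree_upto_def)
  qed
  note lp = lin_add[OF lhom_lin[OF proj1(1)[OF B]]]
  have pc: "proj1 R B (conv R A B f g x) = 0" for f g x by (simp add: conv_def proj1_glue[OF B])
  have pe: "proj1 R B (\<eta> x) = H x" for x
    by (subst re) (simp add: N_def lp H pc)
  have pp: "proj1 R B (\<psi> x) = b x + \<Psi> (conv R A B \<psi> \<psi> x) + \<Xi> (\<eta> x)" for x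
    by (subst rp) (simp add: S_def lp b P C pc re[symmetric])
  have rp': "\<psi> x = proj1 R B (\<psi> x) + conv R A B \<psi> \<psi> x" for x
    unfolding pp using rp[of x] unfolding S_def re[symmetric] .
  have re': "\<eta> x = proj1 R B (\<eta> x) + (conv R A B \<theta> \<eta> x + conv R A B \<eta> \<psi> x)" for x
    unfolding pe using re[of x] unfolding N_def .
  have cp: "comorph R A B \<psi>" by (rule comorphI_rec[OF A B ps(1) rp'])
  have ce: "coder R A B \<theta> \<psi> \<eta>" by (rule coderI_rec[OF A B et(1) t cp re'])
  have "\<Psi> (\<psi> x) = \<Psi> (conv R A B \<psi> \<psi> x)" for x
    by (subst rp') (simp add: lin_add[OF lhom_lin[OF P(1)]] P(3))
  with pp have "proj1 R B (\<psi> x) = b x + \<Psi> (\<psi> x) + \<Xi> (\<eta> x)" for x by simp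
  with cp ce pe show ?thesis by blast
qed

lemma fixpoint_has_deg:
  assumes A: "graded R A" and B: "graded R B" and t: "comorph R A B \<theta>" and p: "comorph R A B \<psi>" and e: "coder R A B \<theta> \<psi> \<eta>"
    and pe: "\<And>x. proj1 R B (\<eta> x) = H x" and pp: "\<And>x. proj1 R B (\<psi> x) = b x + \<Psi> (\<psi> x) + \<Xi> (\<eta> x)"
    and P: "thom R B B \<Psi>" "\<And>x. \<Psi> (proj1 R B x) = 0" and C: "thom R B B \<Xi>"
    and d: "has_deg R A B 0 \<theta>" "has_deg R A B q H" "has_deg R A B 0 b" "has_deg R B B 0 \<Psi>" "has_deg R B B (- q) \<Xi>"
  shows "has_deg R A B 0 \<psi>" "has_deg R A B q \<eta>"
proof -
  note h = comorph_lhom[OF t] comorph_lhom[OF p] coder_lhom[OF e]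
  have "homog R B (wdeg w) (\<psi> (cls R A w)) \<and> homog R B (wdeg w + q) (\<eta> (cls R A w))" if "w \<noteq> []" for w
    using that
  proof (induction "length w" arbitrary: w rule: less_induct)
    case less
    have cv: "homog R B (wdeg w + (q' + r)) (conv R A B f g (cls R A w))"
      if "thom R A B f" "thom R A B g"
        "\<And>u. u \<noteq> [] \<Longrightarrow> length u < length w \<Longrightarrow> homog R B (wdeg u + q') (f (cls R A u))"
        "\<And>u. u \<noteq> [] \<Longrightarrow> length u < length w \<Longrightarrow> homog R B (wdeg u + r) (g (cls R A u))" for f g q' r
      by (rule conv_has_deg[OF A B that(1,2)]) (use that(3,4) in auto)
    have 1: "homog R B (wdeg w) (conv R A B \<psi> \<psi> (cls R A w))"
      using cv[OF h(2,2), of 0 0] less.hyps by simp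
    have 2: "homog R B (wdeg w + q) (conv R A B \<theta> \<eta> (cls R A w))"
      using cv[OF h(1,3), of 0 q] less.hyps d(1) by (simp add: has_deg_def)
    have 3: "homog R B (wdeg w + q) (conv R A B \<eta> \<psi> (cls R A w))"
      using cv[OF h(3,2), of q 0] less.hyps by simp
    have he: "homog R B (wdeg w + q) (\<eta> (cls R A w))"
      by (subst coder_rec[OF B e])
         (use d(2) less.prems 2 3 in \<open>simp add: pe has_deg_def homog_add[OF B]\<close>)
    have "\<Psi> (\<psi> (cls R A w)) = \<Psi> (conv R A B \<psi> \<psi> (cls R A w))"
      by (subst comorph_rec[OF B p]) (simp add: lin_add[OF lhom_lin[OF P(1)]] P(2))
    then have "homog R B (wdeg w) (proj1 R B (\<psi> (cls R A w)))"
      unfolding pp using d(3) less.prems has_deg_homog[OF B B P(1) d(4) 1] has_deg_homog[OF B B C d(5) he]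
      by (simp add: has_deg_def homog_add[OF B])
    with 1 he show ?case by (subst comorph_rec[OF B p]) (simp add: homog_add[OF B])
  qed
  then show "has_deg R A B 0 \<psi>" "has_deg R A B q \<eta>" by (auto simp: has_deg_def)
qed

text \<open>\<open>fixpoint\<close> without a coderivation.\<close>

lemma comorph_exists:
  assumes A: "graded R A" and B: "graded R B" and b: "thom R A B b" "\<And>x. proj1 R B (b x) = b x" and d: "has_deg R A B 0 b"
    and P: "thom R B B \<Psi>" "\<And>x. proj1 R B (\<Psi> x) = \<Psi> x" "\<And>x. \<Psi> (proj1 R B x) = 0" "has_deg R B B 0 \<Psi>"
    and t: "comorph R A B \<theta>" "has_deg R A B 0 \<theta>"
  shows "\<exists>\<psi>. comorph R A B \<psi> \<and> has_deg R A B 0 \<psi> \<and> (\<forall>x. proj1 R B (\<psi> x) = b x + \<Psi> (\<psi> x))"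
proof -
  note z = lhom_zero[OF Tc_module[OF B]]
  have p0: "proj1 R B 0 = 0" by (rule lin_0[OF lhom_lin[OF proj1(1)[OF B]]])
  obtain \<psi> \<eta> where c: "comorph R A B \<psi>" "coder R A B \<theta> \<psi> \<eta>" "\<And>x. proj1 R B (\<eta> x) = 0"
    "\<And>x. proj1 R B (\<psi> x) = b x + \<Psi> (\<psi> x) + 0"
    using fixpoint[OF A B t(1) z p0 b P(1-3) z p0] by blast
  have "has_deg R A B 0 \<psi>"
    by (rule fixpoint_has_deg(1)[OF A B t(1) c(1,2,3,4) P(1) P(3) z t(2) _ d P(4), of 0]) (simp_all add: B)
  with c show ?thesis by auto
qed

lemma comorph_zero: "graded R A \<Longrightarrow> graded R B \<Longrightarrow> comorph R A B (\<lambda>x. 0)"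
  unfolding comorph_def
proof (intro conjI allI)
  fix x assume A: "graded R A" and B: "graded R B"
  show "cop R B 0 = tmap R A B (\<lambda>x. 0) (\<lambda>x. 0) (cop R A x)"
    by (rule cls_eqI[OF A lhom_comp[OF cop(1)[OF B] lhom_zero[OF Tc_module[OF B]]]
          lhom_comp[OF tmap(1)[OF A B lhom_zero lhom_zero] cop(1)[OF A]]])
       (simp_all add: A B lin_0[OF lhom_lin[OF cop(1)[OF B]]] tmap_cop_zero)
qed simp

text \<open>\<open>fixpoint\<close> with the corestriction of \<open>\<psi>\<close> as the base: the morphism it returns is \<open>\<psi>\<close>, by
  uniqueness.\<close>

lemma coder_exists:
  assumes A: "graded R A" and B: "graded R B" and t: "comorph R A B \<theta>" "has_deg R A B 0 \<theta>" and p: "comorph R A B \<psi>" "has_deg R A B 0 \<psi>"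
    and H: "thom R A B H" "\<And>x. proj1 R B (H x) = H x" "has_deg R A B q H"
  shows "\<exists>\<eta>. coder R A B \<theta> \<psi> \<eta> \<and> has_deg R A B q \<eta> \<and> (\<forall>x. proj1 R B (\<eta> x) = H x)"
proof -
  note z = lhom_zero[OF Tc_module[OF B]]
  have p0: "proj1 R B 0 = 0" by (rule lin_0[OF lhom_lin[OF proj1(1)[OF B]]])
  obtain \<psi>' \<eta> where c: "comorph R A B \<psi>'" "coder R A B \<theta> \<psi>' \<eta>" "\<And>x. proj1 R B (\<eta> x) = H x"
    "\<And>x. proj1 R B (\<psi>' x) = proj1 R B (\<psi> x) + 0 + 0"
    using fixpoint[OF A B t(1) H(1,2) lhom_comp[OF proj1(1)[OF B] comorph_lhom[OF p(1)]] proj1_proj1[OF B] z p0 refl z p0] by blast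
  have eq: "\<psi>' = \<psi>" by (rule comorph_unique[OF A B c(1) p(1)]) (simp add: c(4))
  have "has_deg R A B 0 (\<lambda>x. proj1 R B (\<psi> x))"
    using has_deg_comp[OF B B proj1(1)[OF B] has_deg_proj1[OF B] p(2)] by simp
  then have "has_deg R A B q \<eta>"
    by (intro fixpoint_has_deg(2)[OF A B t(1) c(1,2,3,4) z refl z t(2) H(3)]) (simp_all add: B)
  with c show ?thesis unfolding eq by blast
qed

section \<open>Transfer, homotopy and inversion for codifferentials\<close>

definition codifferential where
  "codifferential R A \<delta> \<longleftrightarrow> coder R A A (sigma R A) (tid R A) \<delta> \<and> has_deg R A A (-1) \<delta> \<and> (\<forall>x. \<delta> (\<delta> x) = 0)"

lemma comorph_proj1: assumes A: "graded R A" and B: "graded R B" and c: "comorph R A B \<phi>"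
  shows "\<phi> (proj1 R A x) = proj1 R B (\<phi> (proj1 R A x))"
  using comorph_rec[OF B c, of "proj1 R A x"]
  by (simp add: conv_def cop_proj1[OF A] lin_0[OF lhom_lin[OF tmap(1)[OF A B]]] comorph_lhom[OF c] lin_0[OF lhom_lin[OF glue(1)[OF B]]])

lemma coder_proj1: assumes A: "graded R A" and B: "graded R B" and t: "thom R A B \<theta>" and p: "thom R A B \<psi>" and c: "coder R A B \<theta> \<psi> \<eta>"
  shows "\<eta> (proj1 R A x) = proj1 R B (\<eta> (proj1 R A x))"
  using coder_rec[OF B c, of "proj1 R A x"]
  by (simp add: conv_def cop_proj1[OF A] lin_0[OF lhom_lin[OF tmap(1)[OF A B]]] t p coder_lhom[OF c] lin_0[OF lhom_lin[OF glue(1)[OF B]]])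

text \<open>The square of an odd coderivation is a coderivation: the cross terms cancel by sign.\<close>

lemma square_zero:
  assumes A: "graded R A" and c: "coder R A A (sigma R A) (tid R A) \<mu>" and d: "has_deg R A A (-1) \<mu>"
    and p: "\<And>x. proj1 R A (\<mu> (\<mu> x)) = 0"
  shows "\<mu> (\<mu> x) = 0"
proof -
  note h = coder_lhom[OF c] and s = sigma(1)[OF A] and i = lhom_id[OF Tc_module[OF A]]
  note hh = lhom_comp[OF h h]
  have sm: "sigma R A (\<mu> x) = - \<mu> (sigma R A x)" for x
    using sigma_has_deg[OF A A h d] by (simp add: signed_def)
  note cmp = tmap_comp[OF A A A]
  have "coder R A A (tid R A) (tid R A) (\<lambda>x. \<mu> (\<mu> x))"
    unfolding coder_def
  proof (intro conjI allI)
    fix x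
    have "cop R A (\<mu> (\<mu> x)) = tmap R A A (sigma R A) \<mu> (cop R A (\<mu> x)) + tmap R A A \<mu> (tid R A) (cop R A (\<mu> x))"
      by (rule coder_D[OF c])
    also have "\<dots> = tmap R A A (tid R A) (\<lambda>x. \<mu> (\<mu> x)) (cop R A x) + tmap R A A (\<lambda>x. - \<mu> (sigma R A x)) \<mu> (cop R A x)
       + (tmap R A A (\<lambda>x. \<mu> (sigma R A x)) \<mu> (cop R A x) + tmap R A A (\<lambda>x. \<mu> (\<mu> x)) (tid R A) (cop R A x))"
      by (simp add: coder_D[OF c] lin_add[OF lhom_lin[OF tmap(1)[OF A A]]] h s i cmp sigma_sigma[OF A] sm
          lhom_retr[OF h] retr_lhom[OF h] Tc_ab[OF A])
    also have "\<dots> = tmap R A A (tid R A) (\<lambda>x. \<mu> (\<mu> x)) (cop R A x) + tmap R A A (\<lambda>x. \<mu> (\<mu> x)) (tid R A) (cop R A x)"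
      by (simp add: tmap_neg[OF A A lhom_comp[OF h s] h])
    finally show "cop R A (\<mu> (\<mu> x)) = \<dots>" .
  qed (rule hh)
  from coder_zero[where \<Psi>="\<lambda>x. 0", OF A A i i this] p show ?thesis by simp
qed

text \<open>So the defect of a morphism from commuting with two coderivations is determined by its
  corestriction.\<close>

lemma commutator_coder:
  assumes A: "graded R A" and B: "graded R B" and D: "coder R B B (sigma R B) (tid R B) \<delta>" and M: "coder R A A (sigma R A) (tid R A) \<mu>"
    and c: "comorph R A B \<phi>" and d: "has_deg R A B 0 \<phi>"
  shows "coder R A B (\<lambda>x. \<phi> (sigma R A x)) \<phi> (\<lambda>x. \<delta> (\<phi> x) - \<phi> (\<mu> x))"
proof -
  note hd = coder_lhom[OF D] and lhom = coder_lhom[OF M] and h = comorph_lhom[OF c]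
  note sA = sigma(1)[OF A] and sB = sigma(1)[OF B] and iA = lhom_id[OF Tc_module[OF A]] and iB = lhom_id[OF Tc_module[OF B]]
  note h1 = lhom_comp[OF hd h] and h2 = lhom_comp[OF h lhom] and h3 = lhom_comp[OF h sA]
  have s: "sigma R B (\<phi> x) = \<phi> (sigma R A x)" for x using sigma_has_deg[OF A B h d] by simp
  show ?thesis
    unfolding coder_def
  proof (intro conjI allI)
    fix x
    have 1: "cop R B (\<delta> (\<phi> x)) = tmap R A B (\<lambda>x. \<phi> (sigma R A x)) (\<lambda>x. \<delta> (\<phi> x)) (cop R A x) +
       tmap R A B (\<lambda>x. \<delta> (\<phi> x)) \<phi> (cop R A x)"
      by (simp add: coder_D[OF D] comorph_D[OF c] tmap_comp[OF A B B] hd h sB iB s retr_lhom[OF h])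
    have 2: "cop R B (\<phi> (\<mu> x)) = tmap R A B (\<lambda>x. \<phi> (sigma R A x)) (\<lambda>x. \<phi> (\<mu> x)) (cop R A x) +
       tmap R A B (\<lambda>x. \<phi> (\<mu> x)) \<phi> (cop R A x)"
      by (simp add: comorph_D[OF c] coder_D[OF M] lin_add[OF lhom_lin[OF tmap(1)[OF A B h h]]] tmap_comp[OF A A B] lhom h sA iA lhom_retr[OF h])
    show "cop R B (\<delta> (\<phi> x) - \<phi> (\<mu> x)) =
      tmap R A B (\<lambda>x. \<phi> (sigma R A x)) (\<lambda>x. \<delta> (\<phi> x) - \<phi> (\<mu> x)) (cop R A x) +
      tmap R A B (\<lambda>x. \<delta> (\<phi> x) - \<phi> (\<mu> x)) \<phi> (cop R A x)"
      unfolding lin_diff[OF lhom_lin[OF cop(1)[OF B]]] 1 2 tmap_diff[OF A B h1 h2 h3] tmap_diff[OF A B h1 h2 h]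
      by (simp add: algebra_simps)
  qed (intro lhom_minus Tc_module B h1 h2)
qed

text \<open>The transfer of a codifferential \<open>\<delta>\<close> along \<open>f\<close>, given \<open>g\<close> and a homotopy \<open>h\<close> from the
  identity to \<open>f g\<close>.  Let \<open>b2\<close> be the part of arity at least two of the corestriction of
  \<open>\<delta>\<close>.  The morphism has corestriction \<open>f + h b2 \<phi>\<close> and the transferred structure
  \<open>\<alpha> + g b2 \<phi>\<close>.  The defect \<open>E = \<delta> \<phi> - \<phi> \<mu>\<close> then has corestriction \<open>h b2 E\<close>, and vanishes
  by recursion on length.  The corestriction of \<open>\<mu> \<mu>\<close> is
  \<open>\<alpha> g b2 \<phi> + g b2 \<delta> \<phi> = g (\<beta> b2 + b2 \<delta>) \<phi> = 0\<close>.\<close>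

lemma transfer:
  assumes A: "graded R A" and B: "graded R B" and D: "codifferential R B \<delta>"
    and dA: "thom R A A \<alpha>" "\<And>x. proj1 R A (\<alpha> x) = \<alpha> x" "\<And>x. \<alpha> (proj1 R A x) = \<alpha> x" "has_deg R A A (-1) \<alpha>" "\<And>x. \<alpha> (\<alpha> x) = 0"
    and dB: "\<And>x. proj1 R B (\<delta> (proj1 R B x)) = \<beta> x"
    and f: "thom R A B f" "\<And>x. proj1 R B (f x) = f x" "\<And>x. f (proj1 R A x) = f x" "has_deg R A B 0 f" "\<And>x. \<beta> (f x) = f (\<alpha> x)"
    and g: "thom R B A g" "\<And>x. proj1 R A (g x) = g x" "has_deg R B A 0 g" "\<And>x. \<alpha> (g x) = g (\<beta> x)"
    and h: "thom R B B h" "\<And>x. proj1 R B (h x) = h x" "has_deg R B B 1 h"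
      "\<And>x. \<beta> (h x) + h (\<beta> x) = f (g x) - proj1 R B x"
  shows "\<exists>\<phi> \<mu>. comorph R A B \<phi> \<and> has_deg R A B 0 \<phi> \<and> codifferential R A \<mu> \<and> (\<forall>x. \<phi> (proj1 R A x) = f x) \<and>
    (\<forall>x. \<mu> (proj1 R A x) = \<alpha> x) \<and> (\<forall>x. \<delta> (\<phi> x) = \<phi> (\<mu> x))"
proof -
  have Dc: "coder R B B (sigma R B) (tid R B) \<delta>" and codiff_hat: "has_deg R B B (-1) \<delta>" and DD: "\<delta> (\<delta> x) = 0" for x
    using D by (auto simp: codifferential_def)
  note hd = coder_lhom[OF Dc]
  note TA = Tc_module[OF A] and TB = Tc_module[OF B]
  note p1A = proj1(1)[OF A] and p1B = proj1(1)[OF B]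
  have hb: "thom R B B \<beta>"
    using lhom_comp[OF p1B lhom_comp[OF hd p1B]] by (simp add: dB)
  have db: "has_deg R B B (-1) \<beta>"
    using has_deg_comp[OF B B p1B has_deg_proj1[OF B] has_deg_comp[OF B B hd codiff_hat has_deg_proj1[OF B]]] by (simp add: dB)
  have pb: "proj1 R B (\<beta> x) = \<beta> x" and bp: "\<beta> (proj1 R B x) = \<beta> x" for x
    by (simp_all add: dB[symmetric] proj1_proj1[OF B])
  note l = lhom_lin
  note lb = lin_add[OF l[OF hb]] lin_diff[OF l[OF hb]] and lpB = lin_add[OF l[OF p1B]] lin_diff[OF l[OF p1B]]
  define b2 where "b2 x = proj1 R B (\<delta> x) - \<beta> x" for x
  have hb2: "thom R B B b2" unfolding b2_def by (intro lhom_minus TB hb lhom_comp[OF p1B hd])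
  have b2p: "b2 (proj1 R B x) = 0" for x by (simp add: b2_def dB bp)
  have pb2: "proj1 R B (b2 x) = b2 x" for x by (simp add: b2_def lpB proj1_proj1[OF B] pb)
  have db2: "has_deg R B B (-1) b2"
    unfolding b2_def using has_deg_comp[OF B B p1B has_deg_proj1[OF B] codiff_hat] by (intro has_deg_diff B db) simp
  \<comment> \<open>The components of arity at least two of \<open>\<delta> \<delta> = 0\<close>.\<close>
  have bb2: "\<beta> (b2 x) = - b2 (\<delta> x)" for x
  proof -
    have s: "proj1 R B (\<delta> x) = \<beta> x + b2 x" for x by (simp add: b2_def)
    have "\<beta> (\<beta> x) = 0" for x
    proof -
      have "\<beta> (\<beta> x) = proj1 R B (\<delta> (proj1 R B (\<delta> (proj1 R B x))))" by (simp add: dB[symmetric] proj1_proj1[OF B])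
      also have "\<dots> = proj1 R B (\<delta> (\<delta> (proj1 R B x)))"
        using coder_proj1[OF B B sigma(1)[OF B] lhom_id[OF TB] Dc, of x] by simp
      finally show ?thesis by (simp add: DD lin_0[OF l[OF p1B]])
    qed
    moreover have "\<beta> (proj1 R B (\<delta> x)) + b2 (\<delta> x) = 0"
      using s[of "\<delta> x"] by (simp add: DD lin_0[OF l[OF p1B]] bp)
    ultimately show ?thesis by (simp add: s lb add_eq_0_iff)
  qed
  note hh = lhom_comp[OF h(1) hb2]
  have dhh: "has_deg R B B 0 (\<lambda>x. h (b2 x))" using has_deg_comp[OF B B h(1,3) db2] by simp
  obtain \<phi> where c: "comorph R A B \<phi>" "has_deg R A B 0 \<phi>" and pp: "\<And>x. proj1 R B (\<phi> x) = f x + h (b2 (\<phi> x))"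
    using comorph_exists[OF A B f(1,2,4) hh, OF h(2) _ dhh comorph_zero[OF A B]]
    by (auto simp: b2p lin_0[OF l[OF h(1)]] B)
  note hp = comorph_lhom[OF c(1)]
  define m where "m x = \<alpha> x + g (b2 (\<phi> x))" for x
  have hm': "thom R A A m" unfolding m_def by (intro lhom_plus TA dA(1) lhom_comp[OF g(1)] lhom_comp[OF hb2] hp)
  have dm: "has_deg R A A (-1) m"
    unfolding m_def using has_deg_comp[OF B A g(1,3) has_deg_comp[OF B B hb2 db2 c(2)]] by (intro has_deg_plus A dA(4)) simp
  have pm: "proj1 R A (m x) = m x" for x
    by (simp add: m_def lin_add[OF l[OF p1A]] dA(2) g(2))
  obtain \<mu> where M: "coder R A A (sigma R A) (tid R A) \<mu>" "has_deg R A A (-1) \<mu>" and pmu: "\<And>x. proj1 R A (\<mu> x) = m x"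
    using coder_exists[OF A A comorph_sigma[OF A] has_deg_sigma[OF A] comorph_id[OF A] has_deg_id[OF A] hm' pm dm] by blast
  note hM = coder_lhom[OF M(1)]
  define E where "E x = \<delta> (\<phi> x) - \<phi> (\<mu> x)" for x
  have cE: "coder R A B (\<lambda>x. \<phi> (sigma R A x)) \<phi> E"
    unfolding E_def by (rule commutator_coder[OF A B Dc M(1) c])
  have pE: "proj1 R B (E x) = h (b2 (E x))" for x
  proof -
    have fg: "f (g x) = \<beta> (h x) + h (\<beta> x) + proj1 R B x" for x using h(4)[of x] by simp
    have s: "proj1 R B (\<delta> y) = \<beta> (proj1 R B y) + b2 y" for y by (simp add: b2_def bp)
    have "f (\<mu> x) = f (proj1 R A (\<mu> x))" by (simp add: f(3))
    also have "\<dots> = \<beta> (f x) + (\<beta> (h (b2 (\<phi> x))) - h (b2 (\<delta> (\<phi> x))) + b2 (\<phi> x))"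
      by (simp add: pmu m_def lin_add[OF l[OF f(1)]] f(5) fg bb2 pb2 lin_uminus[OF l[OF h(1)]])
    finally have "proj1 R B (\<phi> (\<mu> x)) = \<beta> (f x) + (\<beta> (h (b2 (\<phi> x))) - h (b2 (\<delta> (\<phi> x))) + b2 (\<phi> x)) + h (b2 (\<phi> (\<mu> x)))"
      by (simp add: pp)
    moreover have "proj1 R B (\<delta> (\<phi> x)) = \<beta> (f x) + \<beta> (h (b2 (\<phi> x))) + b2 (\<phi> x)"
      by (simp add: s pp lb)
    ultimately show ?thesis
      by (simp add: E_def lpB lin_diff[OF l[OF h(1)]] lin_diff[OF l[OF hb2]])
  qed
  have "E x = 0" for x
    by (rule coder_zero[where \<Psi>="\<lambda>x. h (b2 x)", OF A B lhom_comp[OF hp sigma(1)[OF A]] hp cE pE])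
       (simp add: b2p lin_0[OF l[OF h(1)]])
  then have dp: "\<delta> (\<phi> x) = \<phi> (\<mu> x)" for x by (simp add: E_def)
  have "proj1 R A (\<mu> (\<mu> x)) = 0" for x
  proof -
    have "proj1 R A (\<mu> (\<mu> x)) = \<alpha> (\<mu> x) + g (b2 (\<delta> (\<phi> x)))"
      by (simp add: pmu m_def dp)
    also have "\<alpha> (\<mu> x) = \<alpha> (m x)" by (metis dA(3) pmu)
    also have "\<dots> = - g (b2 (\<delta> (\<phi> x)))"
      by (simp add: m_def lin_add[OF l[OF dA(1)]] dA(5) g(4) bb2 lin_uminus[OF l[OF g(1)]])
    finally show ?thesis by simp
  qed
  then have "codifferential R A \<mu>" using square_zero[OF A M] M by (simp add: codifferential_def)
  moreover have "\<mu> (proj1 R A x) = \<alpha> x" for x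
  proof -
    have "b2 (\<phi> (proj1 R A x)) = b2 (proj1 R B (\<phi> (proj1 R A x)))" using comorph_proj1[OF A B c(1)] by simp
    then show ?thesis
      by (subst coder_proj1[OF A A sigma(1)[OF A] lhom_id[OF TA] M(1)])
         (simp add: pmu m_def dA(3) b2p lin_0[OF l[OF g(1)]])
  qed
  moreover have "\<phi> (proj1 R A x) = f x" for x
  proof -
    have "b2 (\<phi> (proj1 R A x)) = 0" using b2p comorph_proj1[OF A B c(1)] by metis
    moreover have "\<phi> (proj1 R A x) = f (proj1 R A x) + h (b2 (\<phi> (proj1 R A x)))"
      using comorph_proj1[OF A B c(1)] pp by metis
    ultimately show ?thesis by (simp only: f(3) lin_0[OF l[OF h(1)]] add_0_right)
  qed
  ultimately show ?thesis using c dp by blast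
qed

text \<open>A morphism \<open>\<phi>\<close> of codifferential coalgebras and a homotopy \<open>h\<close> of its linear part define
  a morphism \<open>\<psi> = \<phi> + \<delta> \<eta> + \<eta> \<mu>\<close>, where \<open>\<eta>\<close> is the \<open>(\<phi>, \<psi>)\<close>-coderivation with corestriction \<open>h\<close>.
  The definition is recursive, since \<open>\<eta>\<close> involves \<open>\<psi>\<close>: the recursion only prescribes the
  corestriction of \<open>\<psi>\<close>, and the full identity is the vanishing of its defect \<open>E\<close>.\<close>

lemma homotope:
  assumes A: "graded R A" and B: "graded R B" and M: "codifferential R A \<mu>" and D: "codifferential R B \<delta>"
    and c: "comorph R A B \<phi>" and d: "has_deg R A B 0 \<phi>" and ch: "\<And>x. \<delta> (\<phi> x) = \<phi> (\<mu> x)"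
    and h: "thom R A B h" "\<And>x. proj1 R B (h x) = h x" "\<And>x. h (proj1 R A x) = h x" "has_deg R A B 1 h"
  shows "\<exists>\<psi>. comorph R A B \<psi> \<and> has_deg R A B 0 \<psi> \<and> (\<forall>x. \<delta> (\<psi> x) = \<psi> (\<mu> x)) \<and>
    (\<forall>x. \<psi> (proj1 R A x) = \<phi> (proj1 R A x) + \<delta> (h x) + h (\<mu> (proj1 R A x)))"
proof -
  have Dc: "coder R B B (sigma R B) (tid R B) \<delta>" and codiff_hat: "has_deg R B B (-1) \<delta>" and DD: "\<delta> (\<delta> x) = 0" for x
    using D by (auto simp: codifferential_def)
  have Mc: "coder R A A (sigma R A) (tid R A) \<mu>" and Md: "has_deg R A A (-1) \<mu>" and MM: "\<mu> (\<mu> x) = 0" for x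
    using M by (auto simp: codifferential_def)
  note hd = coder_lhom[OF Dc] and hM = coder_lhom[OF Mc] and hp = comorph_lhom[OF c]
  note TA = Tc_module[OF A] and TB = Tc_module[OF B]
  note p1A = proj1(1)[OF A] and p1B = proj1(1)[OF B]
  note sA = sigma(1)[OF A] and sB = sigma(1)[OF B] and iA = lhom_id[OF TA] and iB = lhom_id[OF TB]
  note l = lhom_lin
  define b where "b x = proj1 R B (\<phi> x) + h (\<mu> x)" for x
  have hb: "thom R A B b" unfolding b_def by (intro lhom_plus TB lhom_comp[OF p1B hp] lhom_comp[OF h(1) hM])
  have pb: "proj1 R B (b x) = b x" for x
    by (simp add: b_def lin_add[OF l[OF p1B]] proj1_proj1[OF B] h(2))
  have db: "has_deg R A B 0 b"
    unfolding b_def using has_deg_comp[OF B B p1B has_deg_proj1[OF B] d] has_deg_comp[OF A B h(1,4) Md] by (intro has_deg_plus B) simp_all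
  note ths = comorph_comp[OF A A B c comorph_sigma[OF A]]
  have dths: "has_deg R A B 0 (\<lambda>x. \<phi> (sigma R A x))" using has_deg_comp[OF A B hp d has_deg_sigma[OF A]] by simp
  note hpd = lhom_comp[OF p1B hd]
  have dpd: "has_deg R B B (-1) (\<lambda>x. proj1 R B (\<delta> x))" using has_deg_comp[OF B B p1B has_deg_proj1[OF B] codiff_hat] by simp
  have z: "proj1 R B 0 = 0" by (rule lin_0[OF l[OF p1B]])
  obtain \<psi> \<eta> where p: "comorph R A B \<psi>" and e: "coder R A B (\<lambda>x. \<phi> (sigma R A x)) \<psi> \<eta>"
    and pe: "\<And>x. proj1 R B (\<eta> x) = h x" and pp: "\<And>x. proj1 R B (\<psi> x) = b x + 0 + proj1 R B (\<delta> (\<eta> x))"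
    using fixpoint[OF A B ths h(1,2) hb pb lhom_zero[OF TB] z refl hpd proj1_proj1[OF B]] by blast
  have dpsi: "has_deg R A B 0 \<psi>" and de: "has_deg R A B 1 \<eta>"
    using fixpoint_has_deg[OF A B ths p e pe pp lhom_zero[OF TB] refl hpd dths h(4) db _ dpd] by (simp_all add: B)
  note hps = comorph_lhom[OF p] and he = coder_lhom[OF e] and hps' = lhom_comp[OF hp sA]
  define E where "E x = \<psi> x - \<phi> x - (\<delta> (\<eta> x) + \<eta> (\<mu> x))" for x
  note hde = lhom_comp[OF hd he] and hem = lhom_comp[OF he hM]
  note hK = lhom_plus[OF TB hde hem] and hPP = lhom_minus[OF TB hps hp]
  have hE: "thom R A B E" unfolding E_def by (intro lhom_minus lhom_plus TB hps hp hde hem)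
  have se: "sigma R B (\<eta> x) = - \<eta> (sigma R A x)" for x using sigma_has_deg[OF A B he de] by (simp add: signed_def)
  have sp: "sigma R B (\<phi> x) = \<phi> (sigma R A x)" for x using sigma_has_deg[OF A B hp d] by simp
  have sm: "sigma R A (\<mu> x) = - \<mu> (sigma R A x)" for x using sigma_has_deg[OF A A hM Md] by (simp add: signed_def)
  have comm: "\<delta> (\<psi> x) - \<psi> (\<mu> x) = \<delta> (E x) - E (\<mu> x)" for x
    by (simp add: E_def lin_diff[OF l[OF hd]] lin_add[OF l[OF hd]] DD MM ch lin_0[OF l[OF he]] lin_0[OF l[OF hd]])
  have pE: "proj1 R B (E x) = 0" for x
    by (simp add: E_def lin_diff[OF l[OF p1B]] lin_add[OF l[OF p1B]] pp pe b_def)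
  \<comment> \<open>In the coproduct of \<open>E\<close>, the cross terms of \<open>\<delta> \<eta> + \<eta> \<mu>\<close> cancel up to the defect of \<open>\<psi>\<close>
    from being a chain map, which is again expressed by \<open>E\<close>.\<close>
  have dlE: "cop R B (E x) = tmap R A B \<phi> E (cop R A x) + tmap R A B E \<psi> (cop R A x) +
      tmap R A B (\<lambda>x. \<eta> (sigma R A x)) (\<lambda>x. \<delta> (E x) - E (\<mu> x)) (cop R A x)" for x
  proof -
    let ?z = "cop R A x"
    note hes = lhom_comp[OF he sA] and hdp = lhom_comp[OF hd hps] and hpm = lhom_comp[OF hps hM]
    have 1: "cop R B (\<delta> (\<eta> x)) = tmap R A B \<phi> (\<lambda>x. \<delta> (\<eta> x)) ?z - tmap R A B (\<lambda>x. \<eta> (sigma R A x)) (\<lambda>x. \<delta> (\<psi> x)) ?z +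
      (tmap R A B (\<lambda>x. \<delta> (\<phi> (sigma R A x))) \<eta> ?z + tmap R A B (\<lambda>x. \<delta> (\<eta> x)) \<psi> ?z)"
      by (simp add: coder_D[OF Dc] coder_D[OF e] lin_add[OF l[OF tmap(1)[OF B B]]] hd sB iB tmap_comp[OF A B B] hps' he hps
          sp sigma_sigma[OF A] lhom_retr[OF hp] se tmap_neg[OF A B hes hdp] retr_lhom[OF he] retr_lhom[OF hps])
    have 2: "cop R B (\<eta> (\<mu> x)) = tmap R A B \<phi> (\<lambda>x. \<eta> (\<mu> x)) ?z - tmap R A B (\<lambda>x. \<delta> (\<phi> (sigma R A x))) \<eta> ?z +
      (tmap R A B (\<lambda>x. \<eta> (sigma R A x)) (\<lambda>x. \<psi> (\<mu> x)) ?z + tmap R A B (\<lambda>x. \<eta> (\<mu> x)) \<psi> ?z)"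
      by (simp add: coder_D[OF e] coder_D[OF Mc] lin_add[OF l[OF tmap(1)[OF A B]]] hM sA iA tmap_comp[OF A A B] hps' he hps
          sigma_sigma[OF A] lhom_retr[OF hp] lhom_retr[OF he] lhom_retr[OF hps] sm lin_uminus[OF l[OF hp]] ch[symmetric]
          tmap_neg[OF A B lhom_comp[OF hd hps'] he])
    have 3: "tmap R A B (\<lambda>x. \<eta> (sigma R A x)) (\<lambda>x. \<delta> (E x) - E (\<mu> x)) ?z =
      tmap R A B (\<lambda>x. \<eta> (sigma R A x)) (\<lambda>x. \<delta> (\<psi> x)) ?z - tmap R A B (\<lambda>x. \<eta> (sigma R A x)) (\<lambda>x. \<psi> (\<mu> x)) ?z"
      unfolding comm[symmetric] by (rule tmap_diff(2)[OF A B hdp hpm hes])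
    have 4: "tmap R A B \<phi> E ?z = tmap R A B \<phi> \<psi> ?z - tmap R A B \<phi> \<phi> ?z -
        (tmap R A B \<phi> (\<lambda>x. \<delta> (\<eta> x)) ?z + tmap R A B \<phi> (\<lambda>x. \<eta> (\<mu> x)) ?z)"
      unfolding E_def tmap_diff(2)[OF A B hPP hK hp] tmap_diff(2)[OF A B hps hp hp] tmap_add(2)[OF A B hde hem hp] ..
    have 5: "tmap R A B E \<psi> ?z = tmap R A B \<psi> \<psi> ?z - tmap R A B \<phi> \<psi> ?z -
        (tmap R A B (\<lambda>x. \<delta> (\<eta> x)) \<psi> ?z + tmap R A B (\<lambda>x. \<eta> (\<mu> x)) \<psi> ?z)"
      unfolding E_def tmap_diff(1)[OF A B hPP hK hps] tmap_diff(1)[OF A B hps hp hps] tmap_add(1)[OF A B hde hem hps] ..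
    have "cop R B (E x) = tmap R A B \<psi> \<psi> ?z - tmap R A B \<phi> \<phi> ?z - (cop R B (\<delta> (\<eta> x)) + cop R B (\<eta> (\<mu> x)))"
      by (simp add: E_def lin_diff[OF l[OF cop(1)[OF B]]] lin_add[OF l[OF cop(1)[OF B]]] comorph_D[OF c] comorph_D[OF p])
    then show ?thesis unfolding 1 2 3 4 5 by (simp add: algebra_simps)
  qed
  have E0: "E x = 0" for x
  proof (rule vanishing[where \<Psi>="\<lambda>x. 0", OF A B hE pE refl])
    fix w :: "('a, 'c) aword"
    assume v: "\<And>v. v \<noteq> [] \<Longrightarrow> length v < length w \<Longrightarrow> E (cls R A v) = 0"
    have Em: "E (\<mu> (cls R A v)) = 0" if "v \<noteq> []" "length v < length w" for v
      by (rule len_le_vanish[OF A TB hE _ coder_len_le[OF A sA Mc that(1)]]) (use v that in auto)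
    have "tmap R A B \<phi> E (cop R A (cls R A w)) = 0"
      by (rule tmap_cop_zero[OF A B hp hE]) (use v in auto)
    moreover have "tmap R A B E \<psi> (cop R A (cls R A w)) = 0"
      by (rule tmap_cop_zero[OF A B hE hps]) (use v in auto)
    moreover have "tmap R A B (\<lambda>x. \<eta> (sigma R A x)) (\<lambda>x. \<delta> (E x) - E (\<mu> x)) (cop R A (cls R A w)) = 0"
      by (rule tmap_cop_zero[OF A B lhom_comp[OF he sA] lhom_minus[OF TB lhom_comp[OF hd hE] lhom_comp[OF hE hM]]])
         (use v Em in \<open>auto simp: lin_0[OF l[OF hd]]\<close>)
    ultimately show "cop R B (E (cls R A w)) = 0" by (simp add: dlE)
  qed
  have "\<delta> (\<psi> x) = \<psi> (\<mu> x)" for x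
    using comm[of x] by (simp add: E0 lin_0[OF l[OF hd]])
  moreover have "\<psi> (proj1 R A x) = \<phi> (proj1 R A x) + \<delta> (h x) + h (\<mu> (proj1 R A x))" for x
  proof -
    have e1: "\<eta> (proj1 R A y) = h y" for y
      by (subst coder_proj1[OF A B hps' hps e]) (simp add: pe h(3))
    have "\<mu> (proj1 R A x) = proj1 R A (\<mu> (proj1 R A x))" by (rule coder_proj1[OF A A sA iA Mc])
    then have "\<eta> (\<mu> (proj1 R A x)) = h (\<mu> (proj1 R A x))" using e1 by metis
    then show ?thesis using E0[of "proj1 R A x"] by (simp add: E_def e1 algebra_simps)
  qed
  ultimately show ?thesis using p dpsi by blast
qed

text \<open>The equation \<open>proj1 \<circ> \<phi> \<circ> \<chi> = proj1\<close> can be solved for the corestriction of \<open>\<chi>\<close>, since \<open>\<phi>\<close>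
  changes a word only by shorter words.\<close>

lemma right_inverse:
  assumes A: "graded R A" and c: "comorph R A A \<phi>" and d: "has_deg R A A 0 \<phi>" and u: "\<And>x. \<phi> (proj1 R A x) = proj1 R A x"
  shows "\<exists>\<chi>. comorph R A A \<chi> \<and> has_deg R A A 0 \<chi> \<and> (\<forall>x. \<chi> (proj1 R A x) = proj1 R A x) \<and> (\<forall>x. \<phi> (\<chi> x) = tid R A x)"
proof -
  note h = comorph_lhom[OF c] and p = proj1(1)[OF A] and TA = Tc_module[OF A]
  note lp = lhom_lin[OF p]
  define P where "P x = proj1 R A x - proj1 R A (\<phi> x)" for x
  have hP: "thom R A A P" unfolding P_def by (intro lhom_minus TA p lhom_comp[OF p h])
  have deg_part: "has_deg R A A 0 P"
    unfolding P_def using has_deg_comp[OF A A p has_deg_proj1[OF A] d] by (intro has_deg_diff A has_deg_proj1) simp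
  have pP: "proj1 R A (P x) = P x" for x by (simp add: P_def lin_diff[OF lp] proj1_proj1[OF A])
  have Pp: "P (proj1 R A x) = 0" for x by (simp add: P_def u proj1_proj1[OF A])
  obtain \<chi> where x: "comorph R A A \<chi>" "has_deg R A A 0 \<chi>" "\<And>x. proj1 R A (\<chi> x) = proj1 R A x + P (\<chi> x)"
    using comorph_exists[OF A A p proj1_proj1[OF A] has_deg_proj1[OF A] hP pP Pp deg_part comorph_id[OF A] has_deg_id[OF A]] by blast
  have "(\<lambda>x. \<phi> (\<chi> x)) = tid R A"
  proof (rule comorph_unique[OF A A comorph_comp[OF A A A c x(1)] comorph_id[OF A]])
    show "proj1 R A (\<phi> (\<chi> y)) = proj1 R A (tid R A y)" for y
      using x(3)[of y] by (simp add: P_def lhom_retr[OF p])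
  qed
  moreover have "\<chi> (proj1 R A y) = proj1 R A y" for y
  proof -
    have "P (\<chi> (proj1 R A y)) = 0" by (subst comorph_proj1[OF A A x(1)]) (rule Pp)
    then show ?thesis by (subst comorph_proj1[OF A A x(1)]) (simp add: x(3) proj1_proj1[OF A])
  qed
  ultimately show ?thesis using x(1,2) by (metis)
qed

text \<open>The right inverse has itself a right inverse, which must be the given morphism.\<close>

lemma comorph_inverse:
  assumes A: "graded R A" and c: "comorph R A A \<phi>" and d: "has_deg R A A 0 \<phi>" and u: "\<And>x. \<phi> (proj1 R A x) = proj1 R A x"
  shows "\<exists>\<chi>. comorph R A A \<chi> \<and> has_deg R A A 0 \<chi> \<and> (\<forall>x. \<chi> (proj1 R A x) = proj1 R A x) \<and>
    (\<forall>x. \<phi> (\<chi> x) = tid R A x) \<and> (\<forall>x. \<chi> (\<phi> x) = tid R A x)"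
proof -
  obtain \<chi> where x: "comorph R A A \<chi>" "has_deg R A A 0 \<chi>" "\<And>x. \<chi> (proj1 R A x) = proj1 R A x" "\<And>x. \<phi> (\<chi> x) = tid R A x"
    using right_inverse[OF assms] by blast
  obtain \<chi>' where x': "comorph R A A \<chi>'" "\<And>x. \<chi> (\<chi>' x) = tid R A x"
    using right_inverse[OF A x(1-3)] by blast
  have "\<chi>' y = \<phi> y" for y
    using x(4)[of "\<chi>' y"] by (simp add: x'(2) lhom_retr[OF comorph_lhom[OF c]] retr_lhom[OF comorph_lhom[OF x'(1)]])
  with x x'(2) show ?thesis by metis
qed

section \<open>Coalgebra structure maps as ambient operators\<close>

lemma emb_finsum:
  assumes N: "module R N" and "finite I" "f \<in> I \<rightarrow> carrier N"
  shows "emb N (finsum N f I) = (\<Sum>i\<in>I. emb N (f i))"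
proof -
  interpret module R N by fact
  show ?thesis using assms(2,3)
    by (induction I rule: finite_induct)
       (simp_all add: emb_zero emb_add M.abelian_group_axioms Pi_def)
qed

lemma emb_ksgn:
  assumes N: "module R N" and x: "x \<in> carrier N"
  shows "emb N (ksgn R n \<odot>\<^bsub>N\<^esub> x) = signed n (emb N x)" "ksgn R n \<odot>\<^bsub>N\<^esub> x \<in> carrier N"
proof -
  interpret module R N by fact
  show "emb N (ksgn R n \<odot>\<^bsub>N\<^esub> x) = signed n (emb N x)" "ksgn R n \<odot>\<^bsub>N\<^esub> x \<in> carrier N"
    using x by (auto simp: ksgn_def signed_def smult_l_minus emb_uminus M.abelian_group_axioms)
qed

lemma all_emb:
  assumes "module R M" "lhom R M N f" "lhom R M N g"
  shows "(\<forall>x\<in>carrier M. f (emb M x) = g (emb M x)) \<longleftrightarrow> (\<forall>v. f v = g v)"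
  using lhom_eqI[OF assms] by auto

text \<open>The description \<open>lin_ext\<close> denotes the linear map with the prescribed values, once one is known
  and the elements \<open>\<iota> i\<close> generate.\<close>

lemma lin_ext_eq:
  assumes M: "module R M" and N: "module R N" and f: "lhom R M N f"
    and c: "\<And>i. i \<in> G \<Longrightarrow> \<iota> i \<in> carrier M" and d: "\<And>i. i \<in> G \<Longrightarrow> h i \<in> carrier N"
    and e: "\<And>i. i \<in> G \<Longrightarrow> f (emb M (\<iota> i)) = emb N (h i)"
    and u: "\<And>f g. lhom R M N f \<Longrightarrow> lhom R M N g \<Longrightarrow> (\<And>i. i \<in> G \<Longrightarrow> f (emb M (\<iota> i)) = g (emb M (\<iota> i))) \<Longrightarrow> f = g"
  shows "lin_ext R M N G \<iota> h = unhat M N f"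
  unfolding lin_ext_def
proof (rule the_equality)
  note ab = module_ab[OF M] module_ab[OF N]
  have "unhat M N f (\<iota> i) = h i" if "i \<in> G" for i
    using that by (simp add: unhat_def c e d ab)
  then show "unhat M N f \<in> linmaps R M N \<and> (\<forall>g\<in>G. unhat M N f (\<iota> g) = h g)"
    using unhat_linmaps[OF M N lhom_lin[OF f]] by simp
  fix L assume L: "L \<in> linmaps R M N \<and> (\<forall>g\<in>G. L (\<iota> g) = h g)"
  have "hat M N L = f"
    by (rule u[OF lhom_hat[OF M N L[THEN conjunct1]] f]) (use L in \<open>simp add: hat_emb ab c e\<close>)
  then show "L = unhat M N f" using unhat_hat[OF M N] L by metis
qed

lemma cls_prj_word: "graded R A \<Longrightarrow> cls R A (emb_word A (prj_word A w)) = cls R A w"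
  using multilin_retr[OF cls_multilin, of R A "[]" w] by simp

lemma emb_word_words: "w \<in> words A {1..} \<Longrightarrow> emb_word A w \<noteq> []"
  by (auto simp: words_def)

lemma all_words:
  assumes A: "graded R A" and f: "\<And>w. f (emb_word A (prj_word A w)) = f w"
  shows "(\<forall>w\<in>words A {1..}. f (emb_word A w)) \<longleftrightarrow> (\<forall>w. w \<noteq> [] \<longrightarrow> f w)"
proof (intro iffI allI impI ballI)
  fix w :: "(int \<times> ('a, 'c) ambient) list" assume a: "\<forall>w\<in>words A {1..}. f (emb_word A w)" and w: "w \<noteq> []"
  have "prj_word A w \<in> words A {1..}" using w by (intro prj_word_words[OF A]) (simp add: Suc_le_eq)
  with a f show "f w" by metis
qed (use emb_word_words in blast)

lemma wdeg_emb_word [simp]: "wdeg (emb_word A w) = wdeg w"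
  by (simp add: wdeg_sum_list emb_word_def case_prod_beta comp_def)

lemma wdeg_prj_word [simp]: "wdeg (prj_word A w) = wdeg w"
  by (simp add: wdeg_sum_list prj_word_def case_prod_beta comp_def)

lemma wcls_unique:
  assumes A: "graded R A" and "lhom R (Tc R A) N f" "lhom R (Tc R A) N g"
    and e: "\<And>w. w \<in> words A {1..} \<Longrightarrow> f (emb (Tc R A) (wcls R A w)) = g (emb (Tc R A) (wcls R A w))"
  shows "f = g"
proof (rule cls_unique[OF assms(1-3)])
  fix w :: "('a, 'c) aword" assume "w \<noteq> []"
  then have "prj_word A w \<in> words A {1..}" by (intro prj_word_words[OF A]) (simp add: Suc_le_eq)
  from e[OF this] cls_emb_word[OF A this] show "f (cls R A w) = g (cls R A w)" by (simp add: cls_prj_word[OF A])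
qed

lemma tens_closed:
  assumes "module R M" "module R N" "x \<in> carrier M" "y \<in> carrier N"
  shows "tens R M N x y \<in> carrier (tensor R M N)"
  unfolding tens_def tensor_def
  using assms by (intro pres_gen_closed bilin_rels_closed) (auto simp: module_cring)

lemma emb_tens: "module R M \<Longrightarrow> module R N \<Longrightarrow> x \<in> carrier M \<Longrightarrow> y \<in> carrier N \<Longrightarrow>
    emb (tensor R M N) (tens R M N x y) = tprod R M N (emb M x) (emb N y)"
  by (simp add: tprod_def module_ab)

lemma take_drop_words:
  assumes "w \<in> words A {1..}" "i \<in> {1..<length w}"
  shows "take i w \<in> words A {1..}" "drop i w \<in> words A {1..}"
  using assms by (auto simp: words_def dest: in_set_takeD in_set_dropD)

lemma take_emb_word: "take i (emb_word A w) = emb_word A (take i w)" "drop i (emb_word A w) = emb_word A (drop i w)"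
  by (simp_all add: emb_word_def take_map drop_map)

lemma deconc:
  assumes A: "graded R A"
  shows "deconc R A = unhat (Tc R A) (TT R A) (cop R A)"
  unfolding deconc_def
proof (rule lin_ext_eq[OF Tc_module[OF A] TT_module[OF A] cop(1)[OF A]])
  note T = Tc_module[OF A]
  interpret TT: module R "TT R A" by (rule TT_module[OF A])
  fix w :: "'c word" assume w: "w \<in> words A {1..}"
  show "wcls R A w \<in> carrier (Tc R A)" by (rule wcls_closed[OF A w])
  have f: "(\<lambda>i. ttens R A (wcls R A (take i w)) (wcls R A (drop i w))) \<in> {1..<length w} \<rightarrow> carrier (TT R A)"
  proof
    fix i assume i: "i \<in> {1..<length w}"
    show "ttens R A (wcls R A (take i w)) (wcls R A (drop i w)) \<in> carrier (TT R A)"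
      using take_drop_words[OF w i] by (intro tens_closed T wcls_closed[OF A])
  qed
  then show "(\<Oplus>\<^bsub>TT R A\<^esub>i\<in>{1..<length w}. ttens R A (wcls R A (take i w)) (wcls R A (drop i w))) \<in> carrier (TT R A)"
    by (intro TT.M.finsum_closed)
  have "emb (TT R A) (\<Oplus>\<^bsub>TT R A\<^esub>i\<in>{1..<length w}. ttens R A (wcls R A (take i w)) (wcls R A (drop i w))) =
     (\<Sum>i\<in>{1..<length w}. emb (TT R A) (ttens R A (wcls R A (take i w)) (wcls R A (drop i w))))"
    by (rule emb_finsum[OF TT_module[OF A] _ f]) simp
  also have "\<dots> = (\<Sum>i\<in>{1..<length w}. tten R A (cls R A (take i (emb_word A w))) (cls R A (drop i (emb_word A w))))"
  proof (rule sum.cong[OF refl])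
    fix i assume i: "i \<in> {1..<length w}"
    note td = take_drop_words[OF w i]
    show "emb (TT R A) (ttens R A (wcls R A (take i w)) (wcls R A (drop i w))) =
       tten R A (cls R A (take i (emb_word A w))) (cls R A (drop i (emb_word A w)))"
      unfolding take_emb_word cls_emb_word[OF A td(1)] cls_emb_word[OF A td(2)]
      by (rule emb_tens[OF T T wcls_closed[OF A td(1)] wcls_closed[OF A td(2)]])
  qed
  also have "\<dots> = cop R A (emb (Tc R A) (wcls R A w))"
    using cop(2)[OF A, of "emb_word A w"] by (simp add: cls_emb_word[OF A w] split_sum_def)
  finally show "cop R A (emb (Tc R A) (wcls R A w)) =
     emb (TT R A) (\<Oplus>\<^bsub>TT R A\<^esub>i\<in>{1..<length w}. ttens R A (wcls R A (take i w)) (wcls R A (drop i w)))" ..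
qed (rule wcls_unique[OF A])

lemma length_one:
  assumes A: "graded R A"
  shows "length_one R A = unhat (Tc R A) (Tc R A) (proj1 R A)"
  unfolding length_one_def
proof (rule lin_ext_eq[OF Tc_module[OF A] Tc_module[OF A] proj1(1)[OF A]])
  fix w :: "'c word" assume w: "w \<in> words A {1..}"
  show "wcls R A w \<in> carrier (Tc R A)" by (rule wcls_closed[OF A w])
  then show "(if length w = 1 then wcls R A w else \<zero>\<^bsub>Tc R A\<^esub>) \<in> carrier (Tc R A)"
    using Tc_ab[OF A] by (auto intro: abelian_groupE)
  show "proj1 R A (emb (Tc R A) (wcls R A w)) = emb (Tc R A) (if length w = 1 then wcls R A w else \<zero>\<^bsub>Tc R A\<^esub>)"
    using proj1(2)[OF A emb_word_words[OF w]] by (simp add: cls_emb_word[OF A w] emb_zero Tc_ab[OF A])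
qed (rule wcls_unique[OF A])

lemma lin_id_hat: assumes M: "module R M"
  shows "lin_id M \<in> linmaps R M M" "hat M M (lin_id M) = retr M"
proof -
  have "lin_id M = unhat M M (retr M)"
    by (auto simp: lin_id_def unhat_def module_ab[OF M])
  then show "lin_id M \<in> linmaps R M M" "hat M M (lin_id M) = retr M"
    using unhat_linmaps[OF M M lin_retr[OF M]] hat_unhat[OF M M lhom_id[OF M]] by simp_all
qed

abbreviation hatc where "hatc R A B \<equiv> hat (Tc R A) (Tc R B)"

text \<open>The Koszul sign in \<open>f \<otimes> g\<close> for \<open>g\<close> of degree \<open>q\<close>.\<close>

definition twist where "twist R A q f = (if even (q::int) then f else (\<lambda>x. f (sigma R A x)))"

lemma twist_simps: "twist R A 0 f = f" "twist R A 1 f = (\<lambda>x. f (sigma R A x))"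
  by (simp_all add: twist_def)

lemma twist_lhom: "graded R A \<Longrightarrow> lhom R (Tc R A) N f \<Longrightarrow> lhom R (Tc R A) N (twist R A q f)"
  unfolding twist_def using lhom_comp[OF _ sigma(1)] by auto

lemma tensor_map:
  assumes A: "graded R A" and B: "graded R B" and f: "f \<in> linmaps R (Tc R A) (Tc R B)" and g: "g \<in> linmaps R (Tc R A) (Tc R B)"
  shows "tensor_map R A B q f g = unhat (TT R A) (TT R B) (tmap R A B (twist R A q (hatc R A B f)) (hatc R A B g))"
  unfolding tensor_map_def
proof (rule lin_ext_eq[OF TT_module[OF A] TT_module[OF B]])
  note TA = Tc_module[OF A] and TB = Tc_module[OF B]
  note hf = lhom_hat[OF TA TB f] and homog = lhom_hat[OF TA TB g]
  note t = tmap[OF A B twist_lhom[OF A hf] homog]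
  show "lhom R (TT R A) (TT R B) (tmap R A B (twist R A q (hatc R A B f)) (hatc R A B g))" by (rule t(1))
  fix i :: "'c word \<times> 'c word" assume i: "i \<in> words A {1..} \<times> words A {1..}"
  then obtain u v where uv: "i = (u, v)" "u \<in> words A {1..}" "v \<in> words A {1..}" by auto
  note wu = wcls_closed[OF A uv(2)] and wv = wcls_closed[OF A uv(3)]
  show "(case i of (u, v) \<Rightarrow> ttens R A (wcls R A u) (wcls R A v)) \<in> carrier (TT R A)"
    using tens_closed[OF TA TA wu wv] uv by simp
  have c: "ttens R B (f (wcls R A u)) (g (wcls R A v)) \<in> carrier (TT R B)"
    by (rule tens_closed[OF TB TB linmapsD(1)[OF f wu] linmapsD(1)[OF g wv]])
  show "(case i of (u, v) \<Rightarrow> ksgn R (q * wdeg u) \<odot>\<^bsub>TT R B\<^esub> ttens R B (f (wcls R A u)) (g (wcls R A v))) \<in> carrier (TT R B)"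
    using emb_ksgn(2)[OF TT_module[OF B] c] uv by simp
  have s: "twist R A q (hatc R A B f) (cls R A w) = signed (q * wdeg w) (hatc R A B f (cls R A w))" for w
    by (cases "even q") (auto simp: twist_def sigma[OF A] signed_def lin_uminus[OF lhom_lin[OF hf]])
  have hat_simps: "emb (Tc R B) (f (wcls R A u)) = hatc R A B f (cls R A (emb_word A u))"
    "emb (Tc R B) (g (wcls R A v)) = hatc R A B g (cls R A (emb_word A v))"
    using wu wv uv by (simp_all add: cls_emb_word[OF A] hat_emb Tc_ab[OF A])
  show "tmap R A B (twist R A q (hatc R A B f)) (hatc R A B g)
       (emb (TT R A) (case i of (u, v) \<Rightarrow> ttens R A (wcls R A u) (wcls R A v))) =
     emb (TT R B) (case i of (u, v) \<Rightarrow> ksgn R (q * wdeg u) \<odot>\<^bsub>TT R B\<^esub> ttens R B (f (wcls R A u)) (g (wcls R A v)))"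
    using uv
    by (simp add: emb_tens[OF TA TA wu wv] t(2) cls_emb_word[OF A, symmetric] s emb_ksgn(1)[OF TT_module[OF B] c]
        emb_tens[OF TB TB linmapsD(1)[OF f wu] linmapsD(1)[OF g wv]] hat_simps lin_signed[OF lhom_lin[OF tten_lhom(1)[OF B]]])
next
  note TA = Tc_module[OF A]
  show "f = g" if "lhom R (TT R A) (TT R B) f" "lhom R (TT R A) (TT R B) g"
    "\<And>i. i \<in> words A {1..} \<times> words A {1..} \<Longrightarrow>
       f (emb (TT R A) (case i of (u, v) \<Rightarrow> ttens R A (wcls R A u) (wcls R A v))) =
       g (emb (TT R A) (case i of (u, v) \<Rightarrow> ttens R A (wcls R A u) (wcls R A v)))" for f g
  proof (rule TT_unique[OF A that(1,2)])
    fix u v :: "('a, 'c) aword" assume uv: "u \<noteq> []" "v \<noteq> []"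
    have l: "prj_word A u \<in> words A {1..}" "prj_word A v \<in> words A {1..}"
      using uv by (auto intro!: prj_word_words[OF A] simp: Suc_le_eq)
    have e: "emb (TT R A) (ttens R A (wcls R A (prj_word A u)) (wcls R A (prj_word A v))) = tten R A (cls R A u) (cls R A v)"
      using l by (simp add: emb_tens[OF TA TA] wcls_closed[OF A] cls_emb_word[OF A, symmetric] cls_prj_word[OF A])
    show "f (tten R A (cls R A u) (cls R A v)) = g (tten R A (cls R A u) (cls R A v))"
      using that(3)[of "(prj_word A u, prj_word A v)"] l e by simp
  qed
qed

section \<open>Graded maps as ambient operators\<close>

text \<open>The span of the words of degree \<open>n\<close> is the image of the projection to that degree.\<close>

lemma Tc_deg_iff:
  assumes A: "graded R A"
  shows "x \<in> Tc_deg R A n \<longleftrightarrow> x \<in> carrier (Tc R A) \<and> homog R A n (emb (Tc R A) x)"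
proof
  let ?T = "Tc R A" and ?S = "{wcls R A w | w. w \<in> words A {1..} \<and> wdeg w = n}"
  note T = Tc_module[OF A]
  interpret module R ?T by (rule T)
  have S: "?S \<subseteq> carrier ?T" using wcls_closed[OF A] by auto
  have hgS: "homog R A (wdeg w) (emb ?T (wcls R A w))" if "w \<in> words A {1..}" for w
    using homog_cls[OF A, of "emb_word A w"] by (simp add: cls_emb_word[OF A that])
  show "x \<in> carrier ?T \<and> homog R A n (emb ?T x)" if "x \<in> Tc_deg R A n"
  proof -
    have "mod_span R ?T ?S \<subseteq> {x \<in> carrier ?T. deg_part R A n (emb ?T x) = tid R A (emb ?T x)}"
      by (rule mod_span_least[OF lhom_agree_submodule[OF T deg_part(1)[OF A] lhom_id[OF T]]])
         (use S hgS in \<open>auto simp: homog_def Tc_ab[OF A] wcls_closed[OF A]\<close>)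
    with that show ?thesis by (auto simp: Tc_deg_def homog_def Tc_ab[OF A])
  qed
  show "x \<in> Tc_deg R A n" if x: "x \<in> carrier ?T \<and> homog R A n (emb ?T x)"
  proof -
    let ?D = "Tc_deg R A n"
    have D: "submodule ?D R ?T" "?S \<subseteq> ?D" using mod_span_submodule[OF T S] by (auto simp: Tc_deg_def)
    note DE = submoduleE[OF D(1)]
    have z: "\<zero>\<^bsub>?T\<^esub> \<in> ?D" using D(1) by (metis submodule.axioms(1) subgroup.one_closed monoid.select_convs(2))
    note l = deg_part_lin[OF A]
    have "submodule {x \<in> carrier ?T. prj ?T (deg_part R A n (emb ?T x)) \<in> ?D} R ?T"
      by (rule submoduleI)
         (auto simp: emb_zero emb_uminus emb_add emb_scale[OF T] lin_0[OF l] lin_uminus[OF l] lin_add[OF l]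
           lin_scale[OF l] Tc_ab[OF A] T z DE)
    moreover have "wcls R A w \<in> {x \<in> carrier ?T. prj ?T (deg_part R A n (emb ?T x)) \<in> ?D}" if w: "w \<in> words A {1..}" for w
    proof (cases "wdeg w = n")
      case True
      then have "wcls R A w \<in> ?D" using D(2) w by blast
      with True hgS[OF w] show ?thesis by (simp add: wcls_closed[OF A w] homog_def Tc_ab[OF A])
    next
      case False
      then have "deg_part R A n (emb ?T (wcls R A w)) = 0"
        using deg_part(2)[OF A, of n "emb_word A w"] by (simp add: cls_emb_word[OF A w])
      then show ?thesis by (simp add: wcls_closed[OF A w] Tc_ab[OF A] z)
    qed
    ultimately have "{x \<in> carrier ?T. prj ?T (deg_part R A n (emb ?T x)) \<in> ?D} = carrier ?T"
      by (rule Tc_span[OF A])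
    then have "prj ?T (deg_part R A n (emb ?T x)) \<in> ?D" using x by blast
    then show ?thesis using x by (simp add: homog_def Tc_ab[OF A])
  qed
qed

lemma graded_maps_iff:
  assumes A: "graded R A" and B: "graded R B"
  shows "L \<in> graded_maps R A B q \<longleftrightarrow> L \<in> linmaps R (Tc R A) (Tc R B) \<and> has_deg R A B q (hatc R A B L)"
proof -
  note TA = Tc_module[OF A] and TB = Tc_module[OF B]
  have "(\<forall>n. L ` Tc_deg R A n \<subseteq> Tc_deg R B (n + q)) \<longleftrightarrow> has_deg R A B q (hatc R A B L)"
    if L: "L \<in> linmaps R (Tc R A) (Tc R B)"
  proof
    note h = lhom_hat[OF TA TB L]
    assume a: "\<forall>n. L ` Tc_deg R A n \<subseteq> Tc_deg R B (n + q)"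
    show "has_deg R A B q (hatc R A B L)"
      unfolding has_deg_def
    proof (intro allI impI)
      fix w :: "('a, 'c) aword" assume w: "w \<noteq> []"
      then have prj_word: "prj_word A w \<in> words A {1..}" by (intro prj_word_words[OF A]) (simp add: Suc_le_eq)
      have e: "emb (Tc R A) (wcls R A (prj_word A w)) = cls R A w" using w by (simp add: cls_def)
      have "wcls R A (prj_word A w) \<in> Tc_deg R A (wdeg w)"
        unfolding Tc_deg_iff[OF A] using homog_cls[OF A, of w] wcls_closed[OF A prj_word] by (simp add: e)
      with a have "L (wcls R A (prj_word A w)) \<in> Tc_deg R B (wdeg w + q)" by blast
      then have "homog R B (wdeg w + q) (emb (Tc R B) (L (wcls R A (prj_word A w))))"
        by (simp add: Tc_deg_iff[OF B])
      then show "homog R B (wdeg w + q) (hatc R A B L (cls R A w))"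
        using hat_emb[OF Tc_ab[OF A] wcls_closed[OF A prj_word]] by (metis e)
    qed
  next
    note h = lhom_hat[OF TA TB L]
    assume d: "has_deg R A B q (hatc R A B L)"
    show "\<forall>n. L ` Tc_deg R A n \<subseteq> Tc_deg R B (n + q)"
    proof (intro allI image_subsetI)
      fix n x assume "x \<in> Tc_deg R A n"
      then have x: "x \<in> carrier (Tc R A)" "homog R A n (emb (Tc R A) x)" by (auto simp: Tc_deg_iff[OF A])
      from has_deg_homog[OF A B h d x(2)] show "L x \<in> Tc_deg R B (n + q)"
        by (simp add: Tc_deg_iff[OF B] hat_emb[OF Tc_ab[OF A] x(1)] linmapsD(1)[OF L x(1)])
    qed
  qed
  then show ?thesis by (auto simp: graded_maps_def)
qed

section \<open>Coderivations, morphisms and homotopies as ambient operators\<close>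

lemma emb_deconc:
  assumes A: "graded R A" and x: "x \<in> carrier (Tc R A)"
  shows "emb (TT R A) (deconc R A x) = cop R A (emb (Tc R A) x)" "deconc R A x \<in> carrier (TT R A)"
  using x by (simp_all add: deconc[OF A] unhat_def emb_prj retr_lhom[OF cop(1)[OF A]] module_ab[OF TT_module[OF A]])

lemma emb_tensor_map:
  assumes A: "graded R A" and B: "graded R B" and f: "f \<in> linmaps R (Tc R A) (Tc R B)" and g: "g \<in> linmaps R (Tc R A) (Tc R B)"
    and z: "z \<in> carrier (TT R A)"
  shows "emb (TT R B) (tensor_map R A B q f g z) = tmap R A B (twist R A q (hatc R A B f)) (hatc R A B g) (emb (TT R A) z)"
    "tensor_map R A B q f g z \<in> carrier (TT R B)"
proof -
  have "lhom R (TT R A) (TT R B) (tmap R A B (twist R A q (hatc R A B f)) (hatc R A B g))"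
    by (intro tmap(1)[OF A B] twist_lhom[OF A] lhom_hat Tc_module A B f g)
  from retr_lhom[OF this] z show "emb (TT R B) (tensor_map R A B q f g z) = tmap R A B (twist R A q (hatc R A B f)) (hatc R A B g) (emb (TT R A) z)"
    "tensor_map R A B q f g z \<in> carrier (TT R B)"
    by (simp_all add: tensor_map[OF A B f g] unhat_def emb_prj module_ab[OF TT_module[OF B]])
qed

lemma eq_emb_iff: "abelian_group M \<Longrightarrow> x \<in> carrier M \<Longrightarrow> y \<in> carrier M \<Longrightarrow> x = y \<longleftrightarrow> emb M x = emb M y"
  by (simp add: emb_eq_iff)

text \<open>Coderivations and coalgebra homotopies only differ in the twist and in the two morphisms.\<close>

lemma coder_iff:
  assumes A: "graded R A" and B: "graded R B" and f: "f \<in> linmaps R (Tc R A) (Tc R B)" and g: "g \<in> linmaps R (Tc R A) (Tc R B)"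
    and L: "L \<in> linmaps R (Tc R A) (Tc R B)"
  shows "(\<forall>x\<in>carrier (Tc R A). deconc R B (L x) =
        tensor_map R A B q f L (deconc R A x) \<oplus>\<^bsub>TT R B\<^esub> tensor_map R A B 0 L g (deconc R A x)) \<longleftrightarrow>
      coder R A B (twist R A q (hatc R A B f)) (hatc R A B g) (hatc R A B L)"
proof -
  note TA = Tc_module[OF A] and TB = Tc_module[OF B]
  note h = lhom_hat[OF TA TB f] lhom_hat[OF TA TB g] lhom_hat[OF TA TB L]
  note TTa = module_ab[OF TT_module[OF B]]
  let ?f = "twist R A q (hatc R A B f)" and ?g = "hatc R A B g" and ?L = "hatc R A B L"
  note tf = twist_lhom[OF A h(1), of q]
  have "(\<forall>x\<in>carrier (Tc R A). deconc R B (L x) =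
        tensor_map R A B q f L (deconc R A x) \<oplus>\<^bsub>TT R B\<^esub> tensor_map R A B 0 L g (deconc R A x)) \<longleftrightarrow>
     (\<forall>x\<in>carrier (Tc R A). cop R B (?L (emb (Tc R A) x)) =
        tmap R A B ?f ?L (cop R A (emb (Tc R A) x)) + tmap R A B ?L ?g (cop R A (emb (Tc R A) x)))"
  proof (rule ball_cong[OF refl])
    fix x assume x: "x \<in> carrier (Tc R A)"
    note Lx = linmapsD(1)[OF L x]
    note e = emb_tensor_map[OF A B f L emb_deconc(2)[OF A x], of q] emb_tensor_map[OF A B L g emb_deconc(2)[OF A x], of 0]
    have c: "tensor_map R A B q f L (deconc R A x) \<oplus>\<^bsub>TT R B\<^esub> tensor_map R A B 0 L g (deconc R A x) \<in> carrier (TT R B)"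
      using e(2,4) by (rule abelian_groupE(1)[OF TTa])
    show "(deconc R B (L x) = tensor_map R A B q f L (deconc R A x) \<oplus>\<^bsub>TT R B\<^esub> tensor_map R A B 0 L g (deconc R A x)) \<longleftrightarrow>
       cop R B (?L (emb (Tc R A) x)) =
        tmap R A B ?f ?L (cop R A (emb (Tc R A) x)) + tmap R A B ?L ?g (cop R A (emb (Tc R A) x))"
      unfolding eq_emb_iff[OF TTa emb_deconc(2)[OF B Lx] c] emb_add[OF TTa e(2,4)] e(1,3) emb_deconc(1)[OF B Lx]
        emb_deconc(1)[OF A x] twist_simps by (simp add: hat_emb[OF Tc_ab[OF A] x])
  qed
  also have "\<dots> \<longleftrightarrow> (\<forall>v. cop R B (?L v) = tmap R A B ?f ?L (cop R A v) + tmap R A B ?L ?g (cop R A v))"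
    by (rule all_emb[OF TA lhom_comp[OF cop(1)[OF B] h(3)] lhom_plus[OF TT_module[OF B]
          lhom_comp[OF tmap(1)[OF A B tf h(3)] cop(1)[OF A]] lhom_comp[OF tmap(1)[OF A B h(3,2)] cop(1)[OF A]]]])
  finally show ?thesis using h(3) by (simp add: coder_def)
qed

lemma coderivation_iff:
  assumes A: "graded R A"
  shows "coderivation R A \<delta> \<longleftrightarrow> \<delta> \<in> linmaps R (Tc R A) (Tc R A) \<and>
    coder R A A (sigma R A) (tid R A) (hatc R A A \<delta>) \<and> has_deg R A A (-1) (hatc R A A \<delta>)"
proof -
  note T = Tc_module[OF A]
  note i = lin_id_hat[OF T]
  interpret TT: module R "TT R A" by (rule TT_module[OF A])
  have tws: "twist R A (-1) (tid R A) = sigma R A" by (simp add: twist_def retr_lhom[OF sigma(1)[OF A]] even_minus)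
  have "(\<forall>x\<in>carrier (Tc R A). deconc R A (\<delta> x) =
        tensor_map R A A 0 \<delta> (lin_id (Tc R A)) (deconc R A x)
          \<oplus>\<^bsub>TT R A\<^esub> tensor_map R A A (-1) (lin_id (Tc R A)) \<delta> (deconc R A x)) \<longleftrightarrow>
     coder R A A (sigma R A) (tid R A) (hatc R A A \<delta>)" if d: "\<delta> \<in> linmaps R (Tc R A) (Tc R A)"
    unfolding coder_iff[OF A A i(1) i(1) d, of "-1", unfolded i(2) tws, symmetric]
    using emb_tensor_map(2)[OF A A i(1) d emb_deconc(2)[OF A]] emb_tensor_map(2)[OF A A d i(1) emb_deconc(2)[OF A]]
    by (intro ball_cong refl) (simp add: TT.M.a_comm)
  then show ?thesis by (auto simp: coderivation_def graded_maps_iff[OF A A])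
qed

lemma coalg_homotopy_iff:
  assumes A: "graded R A" and B: "graded R B" and f: "\<phi> \<in> linmaps R (Tc R A) (Tc R B)" and g: "\<psi> \<in> linmaps R (Tc R A) (Tc R B)"
  shows "coalg_homotopy R A B \<phi> \<psi> \<eta> \<longleftrightarrow> \<eta> \<in> linmaps R (Tc R A) (Tc R B) \<and>
    coder R A B (\<lambda>x. hatc R A B \<phi> (sigma R A x)) (hatc R A B \<psi>) (hatc R A B \<eta>) \<and> has_deg R A B 1 (hatc R A B \<eta>)"
proof -
  show ?thesis using coder_iff[OF A B f g, of _ 1]
    by (auto simp: twist_simps coalg_homotopy_def graded_maps_iff[OF A B])
qed

lemma coalg_morphism_iff:
  assumes A: "graded R A" and B: "graded R B"
  shows "coalg_morphism R A B \<phi> \<longleftrightarrow> \<phi> \<in> linmaps R (Tc R A) (Tc R B) \<and>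
    comorph R A B (hatc R A B \<phi>) \<and> has_deg R A B 0 (hatc R A B \<phi>)"
proof -
  note TA = Tc_module[OF A] and TB = Tc_module[OF B] and TTa = module_ab[OF TT_module[OF B]]
  have "(\<forall>x\<in>carrier (Tc R A). deconc R B (\<phi> x) = tensor_map R A B 0 \<phi> \<phi> (deconc R A x)) \<longleftrightarrow>
     comorph R A B (hatc R A B \<phi>)" if p: "\<phi> \<in> linmaps R (Tc R A) (Tc R B)"
  proof -
    note h = lhom_hat[OF TA TB p]
    let ?L = "hatc R A B \<phi>"
    have "(\<forall>x\<in>carrier (Tc R A). deconc R B (\<phi> x) = tensor_map R A B 0 \<phi> \<phi> (deconc R A x)) \<longleftrightarrow>
      (\<forall>x\<in>carrier (Tc R A). cop R B (?L (emb (Tc R A) x)) = tmap R A B ?L ?L (cop R A (emb (Tc R A) x)))"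
    proof (rule ball_cong[OF refl])
      fix x assume x: "x \<in> carrier (Tc R A)"
      note Lx = linmapsD(1)[OF p x]
      note e = emb_tensor_map[OF A B p p emb_deconc(2)[OF A x], of 0]
      show "(deconc R B (\<phi> x) = tensor_map R A B 0 \<phi> \<phi> (deconc R A x)) \<longleftrightarrow>
        cop R B (?L (emb (Tc R A) x)) = tmap R A B ?L ?L (cop R A (emb (Tc R A) x))"
        unfolding eq_emb_iff[OF TTa emb_deconc(2)[OF B Lx] e(2)] e(1) emb_deconc(1)[OF B Lx]
          emb_deconc(1)[OF A x] twist_simps by (simp add: hat_emb[OF Tc_ab[OF A] x])
    qed
    also have "\<dots> \<longleftrightarrow> (\<forall>v. cop R B (?L v) = tmap R A B ?L ?L (cop R A v))"
      by (rule all_emb[OF TA lhom_comp[OF cop(1)[OF B] h] lhom_comp[OF tmap(1)[OF A B h h] cop(1)[OF A]]])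
    finally show ?thesis using h by (simp add: comorph_def)
  qed
  then show ?thesis by (auto simp: coalg_morphism_def graded_maps_iff[OF A B])
qed

section \<open>Multilinear operations as maps into words of length one\<close>

text \<open>The exponent of the sign in \<open>susp_op\<close>.  It depends on the degrees of the letters only, so
  it does not interfere with multilinearity.\<close>

definition susp_exp :: "'a word \<Rightarrow> int" where
  "susp_exp w = (\<Sum>i<length w. int (length w - 1 - i) * (fst (w ! i) + 1))"

lemma susp_exp_cong: "map fst w = map fst w' \<Longrightarrow> susp_exp w = susp_exp w'"
proof -
  assume e: "map fst w = map fst w'"
  then have l: "length w = length w'" by (metis length_map)
  have "fst (w ! i) = fst (w' ! i)" if "i < length w" for i
    using that l e by (metis nth_map)
  then show ?thesis unfolding susp_exp_def l by (intro sum.cong) (auto simp: l)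
qed

lemma susp_exp_prj_word [simp]: "susp_exp (prj_word A w) = susp_exp w"
  by (rule susp_exp_cong) (auto simp: prj_word_def)

lemma susp_exp_emb_word [simp]: "susp_exp (emb_word A w) = susp_exp w"
  by (rule susp_exp_cong) (auto simp: emb_word_def)

lemma susp_exp_letter: "susp_exp (u @ (d, x) # v) = susp_exp (u @ (d, y) # v)"
  by (rule susp_exp_cong) simp

lemma susp_exp_single [simp]: "susp_exp [a] = 0" by (simp add: susp_exp_def)

lemma wdeg_alt: "(\<Sum>i<length w. fst (w ! i)) + int (length w) = wdeg w"
  by (simp add: wdeg_def sum.distrib)

lemma susp_op_alt: "susp_op R B q F w =
    ksgn R (susp_exp w) \<odot>\<^bsub>Tc R B\<^esub> wcls R B [(wdeg w - 1 + q, F w)]"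
  by (simp add: susp_op_def susp_exp_def wdeg_alt)

lemma multi_opsD:
  assumes "F \<in> multi_ops R A B K q"
  shows "w \<in> words A K \<Longrightarrow> F w \<in> carrier (B (wdeg w - 1 + q))"
    and "u @ (d, x) # v \<in> words A K \<Longrightarrow> y \<in> carrier (A d) \<Longrightarrow>
      F (u @ (d, x \<oplus>\<^bsub>A d\<^esub> y) # v) = F (u @ (d, x) # v)
        \<oplus>\<^bsub>B (wdeg (u @ (d, x) # v) - 1 + q)\<^esub> F (u @ (d, y) # v)"
    and "u @ (d, x) # v \<in> words A K \<Longrightarrow> r \<in> carrier R \<Longrightarrow>
      F (u @ (d, r \<odot>\<^bsub>A d\<^esub> x) # v) = r \<odot>\<^bsub>B (wdeg (u @ (d, x) # v) - 1 + q)\<^esub> F (u @ (d, x) # v)"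
    and "F \<in> extensional (words A K)"
  using assms unfolding multi_ops_def wdeg_alt by blast+

lemma lhom_signed: "module R N \<Longrightarrow> lhom R M N f \<Longrightarrow> lhom R M N (\<lambda>x. signed n (f x))"
  unfolding signed_def using lhom_neg[of R N M f] by (cases "even n") simp_all

lemma cls1_lhom: "graded R B \<Longrightarrow> lhom R (B e) (Tc R B) (\<lambda>y. cls R B [(e, y)])"
proof -
  assume "graded R B"
  from cls_multilin[OF this] have "lhom R (B e) (Tc R B) (\<lambda>y. cls R B ([] @ (e, y) # []))"
    unfolding multilin_def by blast
  then show ?thesis by simp
qed

text \<open>The suspended family of operations, as a map from the tensor coalgebra to words of length one.\<close>

definition susp_ops where
  "susp_ops R A B q F = word_ext R A (Tc R B) (\<lambda>w. signed (susp_exp w)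
     (cls R B [(wdeg w - 1 + q, emb (B (wdeg w - 1 + q)) (F (prj_word A w)))]))"

lemma susp_ops:
  fixes A B :: "('r, 'm) gmod"
  assumes A: "graded R A" and B: "graded R B" and F: "F \<in> multi_ops R A B {1..} q"
  shows "thom R A B (susp_ops R A B q F)" "w \<noteq> [] \<Longrightarrow> susp_ops R A B q F (cls R A w) =
     signed (susp_exp w) (cls R B [(wdeg w - 1 + q, emb (B (wdeg w - 1 + q)) (F (prj_word A w)))])"
proof -
  note D = multi_opsD[OF F]
  have "multilin R A (Tc R B) (\<lambda>w. signed (susp_exp w)
     (cls R B [(wdeg w - 1 + q, emb (B (wdeg w - 1 + q)) (F (prj_word A w)))]))"
    unfolding multilin_def
  proof (intro allI)
    fix u v :: "('r, 'm) aword" and d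
    define e where "e = wdeg u + (d + 1 + wdeg v) - 1 + q"
    have wd: "prj_word A u @ (d, x) # prj_word A v \<in> words A {1..}" if "x \<in> carrier (A d)" for x
      using that prj_word_words[OF A, of u "{length u}"] prj_word_words[OF A, of v "{length v}"] by (auto simp: words_def)
    have pd: "prj (A d) x \<in> carrier (A d)" for x by (simp add: graded_ab[OF A])
    note Be = graded_D[OF B, of e] and Ae = graded_D[OF A, of d] and abs = graded_ab[OF A, of d] graded_ab[OF B, of e]
    define c where "c = susp_exp (u @ (d, 0) # v)"
    have sx: "susp_exp (u @ (d, x) # v) = c" for x :: "('r, 'm) ambient" unfolding c_def by (rule susp_exp_letter)
    have dd: "wdeg (prj_word A u @ (d, y) # prj_word A v) - 1 + q = e" for y by (simp add: e_def)
    have "lhom R (A d) (B e) (\<lambda>x. emb (B e) (F (prj_word A u @ (d, prj (A d) x) # prj_word A v)))"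
      unfolding lhom_def lin_def
      using D(1)[OF wd[OF pd], unfolded dd] D(2)[OF wd[OF pd] pd, unfolded dd] D(3)[OF wd[OF pd], unfolded dd]
      by (simp add: abs Ae emb_add emb_scale[OF Be])
    from lhom_signed[OF Tc_module[OF B] lhom_comp[OF cls1_lhom[OF B] this], of c]
    show "lhom R (A d) (Tc R B) (\<lambda>x. signed (susp_exp (u @ (d, x) # v))
      (cls R B [(wdeg (u @ (d, x) # v) - 1 + q, emb (B (wdeg (u @ (d, x) # v) - 1 + q)) (F (prj_word A (u @ (d, x) # v))))]))"
      unfolding sx wdeg_simps e_def[symmetric] prj_word_simps .
  qed
  from word_ext[OF A Tc_module[OF B] this] show "thom R A B (susp_ops R A B q F)" "w \<noteq> [] \<Longrightarrow> susp_ops R A B q F (cls R A w) =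
     signed (susp_exp w) (cls R B [(wdeg w - 1 + q, emb (B (wdeg w - 1 + q)) (F (prj_word A w)))])"
    by (simp_all add: susp_ops_def)
qed

lemma homog_signed: "graded R A \<Longrightarrow> homog R A n x \<Longrightarrow> homog R A n (signed m x)"
  by (simp add: signed_def homog_neg)

lemma susp_ops_props:
  assumes A: "graded R A" and B: "graded R B" and F: "F \<in> multi_ops R A B {1..} q"
  shows "proj1 R B (susp_ops R A B q F x) = susp_ops R A B q F x" "has_deg R A B q (susp_ops R A B q F)"
proof -
  note s = susp_ops[OF A B F]
  show "proj1 R B (susp_ops R A B q F x) = susp_ops R A B q F x"
    by (rule cls_eqI[OF A lhom_comp[OF proj1(1)[OF B] s(1)] s(1)])
       (simp add: s(2) lin_signed[OF lhom_lin[OF proj1(1)[OF B]]] proj1(2)[OF B])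
  show "has_deg R A B q (susp_ops R A B q F)"
    unfolding has_deg_def
  proof (intro allI impI)
    fix w :: "('a, 'c) aword" assume "w \<noteq> []"
    moreover have "homog R B (wdeg w - 1 + q + 1) (cls R B [(wdeg w - 1 + q, y)])" for y
      using homog_cls[OF B, of "[(wdeg w - 1 + q, y)]"] by simp
    ultimately show "homog R B (wdeg w + q) (susp_ops R A B q F (cls R A w))"
      by (simp add: s(2) homog_signed[OF B] algebra_simps)
  qed
qed

lemma multilin_single:
  fixes A :: "('r, 'm) gmod"
  assumes N: "module R N" and g: "\<And>d. lhom R (A d) N (g d)"
  shows "multilin R A N (\<lambda>w. if length w = 1 then g (fst (hd w)) (snd (hd w)) else 0)"
  unfolding multilin_def
proof (intro allI)
  fix u v :: "('r, 'm) aword" and d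
  show "lhom R (A d) N (\<lambda>x. if length (u @ (d, x) # v) = 1
     then g (fst (hd (u @ (d, x) # v))) (snd (hd (u @ (d, x) # v))) else 0)"
    by (cases "u = [] \<and> v = []") (use g N in auto)
qed

text \<open>The component of degree \<open>e\<close> of the part of length one, as a vector of \<open>B e\<close>.\<close>

definition letter where
  "letter R B e = word_ext R B (B e) (\<lambda>w. if length w = 1 then
     (if fst (hd w) = e then retr (B e) (snd (hd w)) else 0) else 0)"

lemma letter:
  assumes B: "graded R B"
  shows "lhom R (Tc R B) (B e) (letter R B e)"
    "w \<noteq> [] \<Longrightarrow> letter R B e (cls R B w) = (if length w = 1 then (if fst (hd w) = e then retr (B e) (snd (hd w)) else 0) else 0)"
    "letter R B e (cls R B [(e, x)]) = retr (B e) x"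
proof -
  have "lhom R (B d) (B e) (\<lambda>x. if d = e then retr (B e) x else 0)" for d
    using graded_D[OF B] by (cases "d = e") auto
  from multilin_single[OF graded_D[OF B] this]
  have m: "multilin R B (B e) (\<lambda>w. if length w = 1 then
     (if fst (hd w) = e then retr (B e) (snd (hd w)) else 0) else 0)" .
  from word_ext[OF B graded_D[OF B] m] show "lhom R (Tc R B) (B e) (letter R B e)"
    "w \<noteq> [] \<Longrightarrow> letter R B e (cls R B w) = (if length w = 1 then (if fst (hd w) = e then retr (B e) (snd (hd w)) else 0) else 0)"
    by (simp_all add: letter_def)
  from word_ext(2)[OF B graded_D[OF B] m, of "[(e, x)]"] show "letter R B e (cls R B [(e, x)]) = retr (B e) x"
    by (simp add: letter_def)
qed

lemma cls1_retr: "graded R B \<Longrightarrow> cls R B [(e, retr (B e) x)] = cls R B [(e, x)]"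
  by (rule lhom_retr[OF cls1_lhom])

text \<open>An element of degree \<open>n\<close> and length one is a single letter, of degree \<open>n - 1\<close> because of the
  suspension.\<close>

lemma proj1_deg_part_letter:
  assumes B: "graded R B"
  shows "proj1 R B (deg_part R B n x) = cls R B [(n - 1, letter R B (n - 1) x)]"
proof (rule cls_eqI[OF B lhom_comp[OF proj1(1)[OF B] deg_part(1)[OF B]] lhom_comp[OF cls1_lhom[OF B] letter(1)[OF B]]])
  fix w :: "('a, 'c) aword" assume w: "w \<noteq> []"
  note z = lin_0[OF lhom_lin[OF cls1_lhom[OF B]]] lin_0[OF lhom_lin[OF proj1(1)[OF B]]]
  show "proj1 R B (deg_part R B n (cls R B w)) = cls R B [(n - 1, letter R B (n - 1) (cls R B w))]"
  proof (cases "length w = 1")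
    case True
    then obtain d x where "w = [(d, x)]" by (cases w) auto
    then show ?thesis by (auto simp: deg_part[OF B] proj1[OF B] letter(2)[OF B] cls1_retr[OF B] z)
  qed (use w in \<open>auto simp: deg_part[OF B] proj1[OF B] letter(2)[OF B] z\<close>)
qed

lemma cls1_letter:
  assumes B: "graded R B" and x: "proj1 R B x = x" "homog R B n x"
  shows "x = cls R B [(n - 1, letter R B (n - 1) x)]"
  using proj1_deg_part_letter[OF B, of n x] x by (simp add: homog_def)

lemma cls1_emb_iff:
  assumes B: "graded R B" and "b \<in> carrier (B e)" "b' \<in> carrier (B e)"
  shows "cls R B [(e, emb (B e) b)] = cls R B [(e, emb (B e) b')] \<longleftrightarrow> b = b'"
  using letter(3)[OF B] assms by (metis emb_eq_iff graded_ab retr_emb)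

lemma susp_ops_inj:
  assumes A: "graded R A" and B: "graded R B" and F: "F \<in> multi_ops R A B {1..} q" "F' \<in> multi_ops R A B {1..} q"
    and e: "\<And>x. susp_ops R A B q F x = susp_ops R A B q F' x"
  shows "F = F'"
proof (rule extensionalityI[OF multi_opsD(4)[OF F(1)] multi_opsD(4)[OF F(2)]])
  fix w assume w: "w \<in> words A {1..}"
  from e[of "cls R A (emb_word A w)"] have "signed (susp_exp w) (cls R B [(wdeg w - 1 + q, emb (B (wdeg w - 1 + q)) (F w))]) =
      signed (susp_exp w) (cls R B [(wdeg w - 1 + q, emb (B (wdeg w - 1 + q)) (F' w))])"
    using emb_word_words[OF w] by (simp add: susp_ops(2)[OF A B F(1)] susp_ops(2)[OF A B F(2)] prj_word_emb_word[OF A w])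
  then have "cls R B [(wdeg w - 1 + q, emb (B (wdeg w - 1 + q)) (F w))] =
      cls R B [(wdeg w - 1 + q, emb (B (wdeg w - 1 + q)) (F' w))]"
    by (metis signed_simps(3))
  then show "F w = F' w"
    using cls1_emb_iff[OF B multi_opsD(1)[OF F(1) w] multi_opsD(1)[OF F(2) w]] by simp
qed

text \<open>Together with \<open>susp_ops_inj\<close>: families of multilinear operations of degree \<open>q\<close> are the same as
  homogeneous linear maps of degree \<open>q\<close> to words of length one.\<close>

lemma susp_ops_surj:
  fixes A B :: "('r, 'm) gmod"
  assumes A: "graded R A" and B: "graded R B" and G: "thom R A B G" "\<And>x. proj1 R B (G x) = G x" "has_deg R A B q G"
  shows "\<exists>F\<in>multi_ops R A B {1..} q. \<forall>x. susp_ops R A B q F x = G x"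
proof -
  define g where "g w = letter R B (wdeg w - 1 + q) (signed (susp_exp w) (G (cls R A w)))" for w
  define F where "F = (\<lambda>w\<in>words A {1..}. prj (B (wdeg w - 1 + q)) (g (emb_word A w)))"
  note lG = lhom_lin[OF G(1)]
  have hgm: "lhom R (A d) (B (wdeg (u @ (d, y) # v) - 1 + q)) (\<lambda>x. g (u @ (d, x) # v))"
    for u v :: "('r, 'm) aword" and d and y :: "('r, 'm) ambient"
  proof -
    define c where "c = susp_exp (u @ (d, y) # v)"
    have sx: "susp_exp (u @ (d, x) # v) = c" for x unfolding c_def by (rule susp_exp_letter)
    have "lhom R (A d) (Tc R A) (\<lambda>x. cls R A (u @ (d, x) # v))" using cls_multilin[OF A] by (simp add: multilin_def)
    from lhom_comp[OF letter(1)[OF B] lhom_signed[OF Tc_module[OF B] lhom_comp[OF G(1) this]],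
        of "wdeg (u @ (d, y) # v) - 1 + q" c]
    show ?thesis unfolding g_def sx by simp
  qed
  have Fi: "emb (B (wdeg w - 1 + q)) (F w) = g (emb_word A w)" if w: "w \<in> words A {1..}" for w
  proof -
    obtain d x w' where wc: "w = (d, x) # w'" using w by (cases w) (auto simp: words_def)
    show ?thesis
      using retr_lhom[OF hgm[of d "[]" "emb (A d) x" "emb_word A w'"], of "emb (A d) x"] w
      by (simp add: F_def wc emb_prj)
  qed
  have "F \<in> multi_ops R A B {1..} q"
    unfolding multi_ops_def wdeg_alt mem_Collect_eq
  proof (intro conjI allI ballI impI)
    show "F \<in> extensional (words A {1..})" by (simp add: F_def)
    show "F w \<in> carrier (B (wdeg w - 1 + q))" if "w \<in> words A {1..}" for w
      using that by (simp add: F_def graded_ab[OF B])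
    fix u v :: "'m word" and d x assume w: "u @ (d, x) # v \<in> words A {1..}"
    then have x: "x \<in> carrier (A d)" by (auto simp: words_append)
    note l = lhom_lin[OF hgm[of d "emb_word A u" "emb (A d) x" "emb_word A v"]]
    let ?B = "B (wdeg (u @ (d, x) # v) - 1 + q)"
    {
      fix y assume y: "y \<in> carrier (A d)"
      have w': "u @ (d, x \<oplus>\<^bsub>A d\<^esub> y) # v \<in> words A {1..}" "u @ (d, y) # v \<in> words A {1..}"
        using w y graded_ab[OF A, of d] by (auto simp: words_append abelian_groupE(1))
      show "F (u @ (d, x \<oplus>\<^bsub>A d\<^esub> y) # v) = F (u @ (d, x) # v) \<oplus>\<^bsub>?B\<^esub> F (u @ (d, y) # v)"
        using w w' lin_add[OF l] by (simp add: F_def emb_add graded_ab[OF A] graded_ab[OF B] x y)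
    }
    fix r assume r: "r \<in> carrier R"
    have w': "u @ (d, r \<odot>\<^bsub>A d\<^esub> x) # v \<in> words A {1..}"
      using w r graded_D[OF A, of d] by (auto simp: words_append module.smult_closed)
    show "F (u @ (d, r \<odot>\<^bsub>A d\<^esub> x) # v) = r \<odot>\<^bsub>?B\<^esub> F (u @ (d, x) # v)"
      using w w' lin_scale[OF l r] r by (simp add: F_def emb_scale[OF graded_D[OF A]] graded_D[OF B] x)
  qed
  moreover have "susp_ops R A B q F x = G x" for x
  proof (rule cls_eqI[OF A susp_ops(1)[OF A B \<open>F \<in> _\<close>] G(1)])
    fix w :: "('r, 'm) aword" assume w: "w \<noteq> []"
    then have prj_word: "prj_word A w \<in> words A {1..}" by (intro prj_word_words[OF A]) (simp add: Suc_le_eq)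
    have "emb (B (wdeg w - 1 + q)) (F (prj_word A w)) = letter R B (wdeg w - 1 + q) (signed (susp_exp w) (G (cls R A w)))"
      using Fi[OF prj_word] by (simp add: g_def cls_prj_word[OF A])
    moreover have "cls R B [(wdeg w - 1 + q, letter R B (wdeg w - 1 + q) (signed (susp_exp w) (G (cls R A w))))] =
        signed (susp_exp w) (G (cls R A w))"
    proof -
      have "homog R B (wdeg w + q) (signed (susp_exp w) (G (cls R A w)))"
        using G(3) w by (simp add: has_deg_def homog_signed[OF B])
      from cls1_letter[OF B _ this] show ?thesis
        by (simp add: lin_signed[OF lhom_lin[OF proj1(1)[OF B]]] G(2) algebra_simps)
    qed
    ultimately show "susp_ops R A B q F (cls R A w) = G (cls R A w)"
      by (simp add: susp_ops(2)[OF A B \<open>F \<in> _\<close> w])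
  qed
  ultimately show ?thesis by blast
qed

section \<open>Families of linear maps as letterwise operators\<close>

definition lin_family where "lin_family R A B q f \<longleftrightarrow> (\<forall>n::int. f n \<in> linmaps R (A n) (B (n + q)))"

definition susp_lin where
  "susp_lin R A B q f = word_ext R A (Tc R B) (\<lambda>w. if length w = 1 then
     cls R B [(fst (hd w) + q, hat (A (fst (hd w))) (B (fst (hd w) + q)) (f (fst (hd w))) (snd (hd w)))] else 0)"

text \<open>The image of \<open>susp_lin\<close>, see \<open>letterwise_susp_lin\<close>.  These operators compose and add like the
  families, so that chain-level algebra is done with them.\<close>

definition letterwise where
  "letterwise R A B q G \<longleftrightarrow> thom R A B G \<and> (\<forall>x. proj1 R B (G x) = G x) \<and> (\<forall>x. G (proj1 R A x) = G x) \<and> has_deg R A B q G"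

lemma letterwise_D:
  assumes "letterwise R A B q G"
  shows "thom R A B G" "proj1 R B (G x) = G x" "G (proj1 R A x) = G x" "has_deg R A B q G"
  using assms unfolding letterwise_def by blast+

lemma susp_lin:
  assumes A: "graded R A" and B: "graded R B" and f: "lin_family R A B q f"
  shows "thom R A B (susp_lin R A B q f)"
    "susp_lin R A B q f (cls R A [(d, x)]) = cls R B [(d + q, hat (A d) (B (d + q)) (f d) x)]"
    "w \<noteq> [] \<Longrightarrow> length w \<noteq> 1 \<Longrightarrow> susp_lin R A B q f (cls R A w) = 0"
proof -
  have "lhom R (A d) (Tc R B) (\<lambda>x. cls R B [(d + q, hat (A d) (B (d + q)) (f d) x)])" for d
    using f by (intro lhom_comp[OF cls1_lhom[OF B] lhom_hat] graded_D A B) (simp add: lin_family_def)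
  from multilin_single[OF Tc_module[OF B] this]
  have m: "multilin R A (Tc R B) (\<lambda>w. if length w = 1 then
     cls R B [(fst (hd w) + q, hat (A (fst (hd w))) (B (fst (hd w) + q)) (f (fst (hd w))) (snd (hd w)))] else 0)" .
  show "thom R A B (susp_lin R A B q f)"
    "susp_lin R A B q f (cls R A [(d, x)]) = cls R B [(d + q, hat (A d) (B (d + q)) (f d) x)]"
    "w \<noteq> [] \<Longrightarrow> length w \<noteq> 1 \<Longrightarrow> susp_lin R A B q f (cls R A w) = 0"
    unfolding susp_lin_def using word_ext[OF A Tc_module[OF B] m] word_ext(2)[OF A Tc_module[OF B] m, of "[(d, x)]"]
    by simp_all
qed

lemma susp_lin_emb:
  assumes A: "graded R A" and B: "graded R B" and f: "lin_family R A B q f" and a: "a \<in> carrier (A d)"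
  shows "susp_lin R A B q f (cls R A [(d, emb (A d) a)]) = cls R B [(d + q, emb (B (d + q)) (f d a))]"
  by (simp add: susp_lin(2)[OF A B f] hat_emb graded_ab[OF A] a)

lemma lin_family_closed: "lin_family R A B q f \<Longrightarrow> a \<in> carrier (A d) \<Longrightarrow> f d a \<in> carrier (B (d + q))"
  unfolding lin_family_def by (rule linmapsD(1)[of _ R]) auto

lemma susp_lin_letterwise:
  assumes A: "graded R A" and B: "graded R B" and f: "lin_family R A B q f"
  shows "letterwise R A B q (susp_lin R A B q f)"
proof -
  note b = susp_lin[OF A B f]
  have z: "proj1 R B 0 = 0" by (rule lin_0[OF lhom_lin[OF proj1(1)[OF B]]])
  have cs: "(\<exists>d x. w = [(d, x)]) \<or> length w \<noteq> 1" for w :: "('a, 'c) aword" by (cases w) auto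
  have 1: "proj1 R B (susp_lin R A B q f x) = susp_lin R A B q f x" for x
  proof (rule cls_eqI[OF A lhom_comp[OF proj1(1)[OF B] b(1)] b(1)])
    show "proj1 R B (susp_lin R A B q f (cls R A w)) = susp_lin R A B q f (cls R A w)" if "w \<noteq> []" for w
      using cs[of w] that by (auto simp: b z proj1(2)[OF B])
  qed
  have 2: "susp_lin R A B q f (proj1 R A x) = susp_lin R A B q f x" for x
    by (rule cls_eqI[OF A lhom_comp[OF b(1) proj1(1)[OF A]] b(1)])
       (auto simp: b proj1(2)[OF A] lin_0[OF lhom_lin[OF b(1)]])
  have "homog R B (wdeg w + q) (susp_lin R A B q f (cls R A w))" if "w \<noteq> []" for w
  proof -
    have "homog R B (d + q + 1) (cls R B [(d + q, y)])" for d y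
      using homog_cls[OF B, of "[(d + q, y)]"] by simp
    then show ?thesis using cs[of w] that by (auto simp: b B algebra_simps)
  qed
  then show ?thesis using b(1) 1 2 by (simp add: letterwise_def has_deg_def)
qed

lemma letterwise_eqI:
  assumes A: "graded R A" and f: "thom R A B f" "\<And>x. f (proj1 R A x) = f x" and g: "thom R A B g" "\<And>x. g (proj1 R A x) = g x"
    and e: "\<And>d a. a \<in> carrier (A d) \<Longrightarrow> f (cls R A [(d, emb (A d) a)]) = g (cls R A [(d, emb (A d) a)])"
  shows "f x = g x"
proof (rule cls_eqI[OF A f(1) g(1)])
  fix w :: "('a, 'c) aword" assume w: "w \<noteq> []"
  show "f (cls R A w) = g (cls R A w)"
  proof (cases "length w = 1")
    case True
    then obtain d x where wd: "w = [(d, x)]" by (cases w) auto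
    have "cls R A w = cls R A [(d, emb (A d) (prj (A d) x))]"
      by (simp add: wd emb_prj cls1_retr[OF A])
    then show ?thesis using e[of "prj (A d) x" d] by (simp add: graded_ab[OF A])
  next
    case False
    have "f (cls R A w) = f (proj1 R A (cls R A w))" "g (cls R A w) = g (proj1 R A (cls R A w))" by (simp_all add: f g)
    then show ?thesis using False w by (simp add: proj1(2)[OF A] lin_0[OF lhom_lin[OF f(1)]] lin_0[OF lhom_lin[OF g(1)]])
  qed
qed

lemma letterwise_susp_lin:
  assumes A: "graded R A" and B: "graded R B" and G: "letterwise R A B q G"
  shows "\<exists>f. lin_family R A B q f \<and> (\<forall>x. susp_lin R A B q f x = G x)"
proof -
  note g = letterwise_D[OF G]
  define f where "f d = unhat (A d) (B (d + q)) (\<lambda>x. letter R B (d + q) (G (cls R A [(d, x)])))" for d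
  have h: "lhom R (A d) (B (d + q)) (\<lambda>x. letter R B (d + q) (G (cls R A [(d, x)])))" for d
    by (rule lhom_comp[OF letter(1)[OF B] lhom_comp[OF g(1) cls1_lhom[OF A]]])
  have GLf: "lin_family R A B q f"
    unfolding lin_family_def f_def using lhom_lin[OF h] by (auto intro: unhat_linmaps graded_D A B)
  have "susp_lin R A B q f x = G x" for x
  proof (rule letterwise_eqI[OF A susp_lin(1)[OF A B GLf] letterwise_D(3)[OF susp_lin_letterwise[OF A B GLf]] g(1,3)])
    fix d a assume a: "a \<in> carrier (A d)"
    let ?x = "G (cls R A [(d, emb (A d) a)])"
    have "homog R B (d + q + 1) ?x"
      using g(4)[unfolded has_deg_def, rule_format, of "[(d, emb (A d) a)]"] by (simp add: algebra_simps)
    from cls1_letter[OF B g(2) this] have "?x = cls R B [(d + q, letter R B (d + q) ?x)]" by simp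
    moreover have "hat (A d) (B (d + q)) (f d) (emb (A d) a) = letter R B (d + q) ?x"
      unfolding f_def hat_unhat[OF graded_D[OF A] graded_D[OF B] h] ..
    ultimately show "susp_lin R A B q f (cls R A [(d, emb (A d) a)]) = ?x" by (simp add: susp_lin(2)[OF A B GLf])
  qed
  with GLf show ?thesis by blast
qed

lemma susp_lin_inj:
  assumes A: "graded R A" and B: "graded R B" and f: "lin_family R A B q f" and g: "lin_family R A B q g"
    and e: "\<And>x. susp_lin R A B q f x = susp_lin R A B q g x"
  shows "f = g"
proof
  fix d
  have fd: "f d \<in> linmaps R (A d) (B (d + q))" "g d \<in> linmaps R (A d) (B (d + q))"
    using f g by (auto simp: lin_family_def)
  show "f d = g d"
  proof (rule extensionalityI[OF linmapsD(4)[OF fd(1)] linmapsD(4)[OF fd(2)]])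
    fix a assume a: "a \<in> carrier (A d)"
    from e[of "cls R A [(d, emb (A d) a)]"] show "f d a = g d a"
      by (simp add: susp_lin_emb[OF A B f a] susp_lin_emb[OF A B g a] cls1_emb_iff[OF B lin_family_closed[where q=q and f=f, OF f a] lin_family_closed[where q=q and f=g, OF g a]])
  qed
qed

lemma letterwise_comp:
  assumes A: "graded R A" and B: "graded R B" and C: "graded R C" and f: "letterwise R B C q f" and g: "letterwise R A B r g"
  shows "letterwise R A C (r + q) (\<lambda>x. f (g x))"
  using lhom_comp[OF letterwise_D(1)[OF f] letterwise_D(1)[OF g]] has_deg_comp[OF B C letterwise_D(1,4)[OF f] letterwise_D(4)[OF g]] letterwise_D(2)[OF f] letterwise_D(3)[OF g]
  by (simp add: letterwise_def)

lemma letterwise_plus: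
  assumes B: "graded R B" and f: "letterwise R A B q f" and g: "letterwise R A B q g"
  shows "letterwise R A B q (\<lambda>x. f x + g x)" "letterwise R A B q (\<lambda>x. - f x)" "letterwise R A B q (\<lambda>x. f x - g x)"
proof -
  note l = lhom_lin[OF proj1(1)[OF B]]
  note a = letterwise_D[OF f] and b = letterwise_D[OF g]
  show "letterwise R A B q (\<lambda>x. f x + g x)"
    using lhom_plus[OF Tc_module[OF B] a(1) b(1)] has_deg_plus[OF B a(4) b(4)] by (simp add: letterwise_def lin_add[OF l] a b)
  show "letterwise R A B q (\<lambda>x. - f x)"
    using lhom_neg[OF Tc_module[OF B] a(1)] has_deg_neg[OF B a(4)] by (simp add: letterwise_def lin_uminus[OF l] a)
  show "letterwise R A B q (\<lambda>x. f x - g x)"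
    using lhom_minus[OF Tc_module[OF B] a(1) b(1)] has_deg_diff[OF B a(4) b(4)] by (simp add: letterwise_def lin_diff[OF l] a b)
qed

lemma letterwise_zero: "graded R B \<Longrightarrow> letterwise R A B q (\<lambda>x. 0)"
  by (simp add: letterwise_def lin_0[OF lhom_lin[OF proj1(1)]])

text \<open>On words of length one there is no sign from suspension.\<close>

lemma susp_ops_proj1:
  assumes A: "graded R A" and B: "graded R B" and F: "F \<in> multi_ops R A B {1..} q"
  shows "lin_family R A B q (linear_part F)" "susp_ops R A B q F (proj1 R A x) = susp_lin R A B q (linear_part F) x"
proof -
  note D = multi_opsD[OF F]
  have w: "[(d, a)] \<in> words A {1..}" if "a \<in> carrier (A d)" for d a using that by (simp add: words_def)
  have e: "wdeg [(d, a)] - 1 + q = d + q" for d and a :: 'b by simp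
  show GLf: "lin_family R A B q (linear_part F)"
    unfolding lin_family_def linmaps_def linear_part_def
  proof (intro allI CollectI conjI ballI)
    fix d
    have "F [(d, x)] = undefined" if "x \<notin> carrier (A d)" for x
      using extensional_arb[OF D(4)] that by (auto simp: words_def)
    then show "(\<lambda>x. F [(d, x)]) \<in> carrier (A d) \<rightarrow>\<^sub>E carrier (B (d + q))"
      using D(1)[OF w] by (auto simp: e)
    show "F [(d, x \<oplus>\<^bsub>A d\<^esub> y)] = F [(d, x)] \<oplus>\<^bsub>B (d + q)\<^esub> F [(d, y)]" if "x \<in> carrier (A d)" "y \<in> carrier (A d)" for x y
      using D(2)[of "[]" d x "[]" y] w that by (simp add: e)
    show "F [(d, r \<odot>\<^bsub>A d\<^esub> x)] = r \<odot>\<^bsub>B (d + q)\<^esub> F [(d, x)]" if "r \<in> carrier R" "x \<in> carrier (A d)" for r x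
      using D(3)[of "[]" d x "[]" r] w that by (simp add: e)
  qed
  show "susp_ops R A B q F (proj1 R A x) = susp_lin R A B q (linear_part F) x"
  proof (rule letterwise_eqI[OF A lhom_comp[OF susp_ops(1)[OF A B F] proj1(1)[OF A]] _ susp_lin(1)[OF A B GLf] letterwise_D(3)[OF susp_lin_letterwise[OF A B GLf]]])
    show "susp_ops R A B q F (proj1 R A (cls R A [(d, emb (A d) a)])) = susp_lin R A B q (linear_part F) (cls R A [(d, emb (A d) a)])"
      if a: "a \<in> carrier (A d)" for d a
      unfolding susp_lin_emb[OF A B GLf a] using a
      by (simp add: proj1(2)[OF A] susp_ops(2)[OF A B F] graded_ab[OF A] linear_part_def)
  qed (simp add: proj1_proj1[OF A])
qed

section \<open>Unique extension of corestrictions\<close>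

lemma hatc_inj:
  assumes A: "graded R A" and B: "graded R B" and L: "L \<in> linmaps R (Tc R A) (Tc R B)" "L' \<in> linmaps R (Tc R A) (Tc R B)"
    and e: "hatc R A B L = hatc R A B L'"
  shows "L = L'"
  using unhat_hat[OF Tc_module[OF A] Tc_module[OF B]] L e by metis

lemma hatc_surj:
  assumes A: "graded R A" and B: "graded R B" and f: "thom R A B f"
  shows "\<exists>L\<in>linmaps R (Tc R A) (Tc R B). hatc R A B L = f"
  using hat_unhat[OF Tc_module[OF A] Tc_module[OF B] f]
    unhat_linmaps[OF Tc_module[OF A] Tc_module[OF B] lhom_lin[OF f]] by blast

lemma corestricts_iff:
  assumes A: "graded R A" and B: "graded R B" and F: "F \<in> multi_ops R A B {1..} q" and L: "L \<in> linmaps R (Tc R A) (Tc R B)"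
  shows "corestricts_to R A B q F L \<longleftrightarrow> (\<forall>x. proj1 R B (hatc R A B L x) = susp_ops R A B q F x)"
proof -
  note h = lhom_hat[OF Tc_module[OF A] Tc_module[OF B] L]
  note s = susp_ops[OF A B F] and T = Tc_ab[OF B]
  let ?P = "\<lambda>w. proj1 R B (hatc R A B L (cls R A w)) = susp_ops R A B q F (cls R A w)"
  have "(length_one R B (L (wcls R A w)) = susp_op R B q F w) \<longleftrightarrow> ?P (emb_word A w)" if w: "w \<in> words A {1..}" for w
  proof -
    note wc = wcls_closed[OF A w] and Lc = linmapsD(1)[OF L wcls_closed[OF A w]]
    let ?n = "wdeg w - 1 + q"
    have sw: "[(?n, F w)] \<in> words B {1..}" using multi_opsD(1)[OF F w] by (simp add: words_def)
    note wb = wcls_closed[OF B sw]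
    have 1: "length_one R B (L (wcls R A w)) \<in> carrier (Tc R B)"
      "emb (Tc R B) (length_one R B (L (wcls R A w))) = proj1 R B (hatc R A B L (cls R A (emb_word A w)))"
      using Lc wc by (simp_all add: length_one[OF B] unhat_def T emb_prj retr_lhom[OF proj1(1)[OF B]] cls_emb_word[OF A w]
          hat_emb Tc_ab[OF A])
    have 2: "susp_op R B q F w \<in> carrier (Tc R B)"
      "emb (Tc R B) (susp_op R B q F w) = susp_ops R A B q F (cls R A (emb_word A w))"
      unfolding susp_op_alt
      using emb_ksgn[OF Tc_module[OF B] wb] emb_word_words[OF w] cls_emb_word[OF B sw]
      by (simp_all add: s(2) prj_word_emb_word[OF A w])
    show ?thesis unfolding eq_emb_iff[OF T 1(1) 2(1)] 1(2) 2(2) ..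
  qed
  then have "corestricts_to R A B q F L \<longleftrightarrow> (\<forall>w\<in>words A {1..}. ?P (emb_word A w))"
    by (simp add: corestricts_to_def)
  also have "\<dots> \<longleftrightarrow> (\<forall>w. w \<noteq> [] \<longrightarrow> ?P w)"
    by (rule all_words[OF A]) (simp add: cls_prj_word[OF A])
  also have "\<dots> \<longleftrightarrow> (\<forall>x. proj1 R B (hatc R A B L x) = susp_ops R A B q F x)"
    using cls_eqI[OF A lhom_comp[OF proj1(1)[OF B] h] s(1)] by blast
  finally show ?thesis .
qed

text \<open>The definite descriptions \<open>coder_of\<close>, \<open>coalg_of\<close> and \<open>homotopy_of\<close> denote: existence and
  uniqueness are \<open>coder_exists\<close>, \<open>comorph_exists\<close>, \<open>coder_unique\<close> and \<open>comorph_unique\<close>.\<close>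

lemma coder_of:
  assumes A: "graded R A" and m: "m \<in> multi_ops R A A {1..} (-1)"
  shows "coder_of R A m \<in> linmaps R (Tc R A) (Tc R A)"
    "coder R A A (sigma R A) (tid R A) (hatc R A A (coder_of R A m))"
    "has_deg R A A (-1) (hatc R A A (coder_of R A m))"
    "proj1 R A (hatc R A A (coder_of R A m) x) = susp_ops R A A (-1) m x"
proof -
  let ?P = "\<lambda>\<delta>. coderivation R A \<delta> \<and> corestricts_to R A A (-1) m \<delta>"
  note s = susp_ops(1)[OF A A m] susp_ops_props[OF A A m]
  note i = lhom_id[OF Tc_module[OF A]]
  obtain \<eta> where e: "coder R A A (sigma R A) (tid R A) \<eta>" "has_deg R A A (-1) \<eta>" "\<And>x. proj1 R A (\<eta> x) = susp_ops R A A (-1) m x"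
    using coder_exists[OF A A comorph_sigma[OF A] has_deg_sigma[OF A] comorph_id[OF A] has_deg_id[OF A] s(1,2,3)] by blast
  obtain L where L: "L \<in> linmaps R (Tc R A) (Tc R A)" "hatc R A A L = \<eta>"
    using hatc_surj[OF A A coder_lhom[OF e(1)]] by blast
  have "?P (coder_of R A m)"
    unfolding coder_of_def
  proof (rule theI[where P="?P" and a=L])
    show "?P L" using L e by (simp add: coderivation_iff[OF A] corestricts_iff[OF A A m])
    fix L' assume "?P L'"
    then have L': "L' \<in> linmaps R (Tc R A) (Tc R A)" "coder R A A (sigma R A) (tid R A) (hatc R A A L')"
      "\<And>x. proj1 R A (hatc R A A L' x) = susp_ops R A A (-1) m x"
      by (auto simp: coderivation_iff[OF A] corestricts_iff[OF A A m])
    have "hatc R A A L' = \<eta>"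
      by (rule coder_unique[OF A A sigma(1)[OF A] i L'(2) e(1)]) (simp add: L'(3) e(3))
    then show "L' = L" using hatc_inj[OF A A L'(1) L(1)] L(2) by simp
  qed
  then show "coder_of R A m \<in> linmaps R (Tc R A) (Tc R A)"
    "coder R A A (sigma R A) (tid R A) (hatc R A A (coder_of R A m))"
    "has_deg R A A (-1) (hatc R A A (coder_of R A m))"
    "proj1 R A (hatc R A A (coder_of R A m) x) = susp_ops R A A (-1) m x"
    by (auto simp: coderivation_iff[OF A] corestricts_iff[OF A A m])
qed

lemma coalg_of:
  assumes A: "graded R A" and B: "graded R B" and m: "F \<in> multi_ops R A B {1..} 0"
  shows "coalg_of R A B F \<in> linmaps R (Tc R A) (Tc R B)"
    "comorph R A B (hatc R A B (coalg_of R A B F))"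
    "has_deg R A B 0 (hatc R A B (coalg_of R A B F))"
    "proj1 R B (hatc R A B (coalg_of R A B F) x) = susp_ops R A B 0 F x"
proof -
  let ?P = "\<lambda>\<phi>. coalg_morphism R A B \<phi> \<and> corestricts_to R A B 0 F \<phi>"
  note s = susp_ops(1)[OF A B m] susp_ops_props[OF A B m]
  note z = lhom_zero[OF Tc_module[OF B]]
  have p0: "proj1 R B 0 = 0" by (rule lin_0[OF lhom_lin[OF proj1(1)[OF B]]])
  obtain \<eta> where e: "comorph R A B \<eta>" "has_deg R A B 0 \<eta>" "\<And>x. proj1 R B (\<eta> x) = susp_ops R A B 0 F x"
    using comorph_exists[OF A B s(1,2,3) z p0 refl _ comorph_zero[OF A B]] B by auto
  obtain L where L: "L \<in> linmaps R (Tc R A) (Tc R B)" "hatc R A B L = \<eta>"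
    using hatc_surj[OF A B comorph_lhom[OF e(1)]] by blast
  have "?P (coalg_of R A B F)"
    unfolding coalg_of_def
  proof (rule theI[where P="?P" and a=L])
    show "?P L" using L e by (simp add: coalg_morphism_iff[OF A B] corestricts_iff[OF A B m])
    fix L' assume "?P L'"
    then have L': "L' \<in> linmaps R (Tc R A) (Tc R B)" "comorph R A B (hatc R A B L')"
      "\<And>x. proj1 R B (hatc R A B L' x) = susp_ops R A B 0 F x"
      by (auto simp: coalg_morphism_iff[OF A B] corestricts_iff[OF A B m])
    have "hatc R A B L' = \<eta>"
      by (rule comorph_unique[OF A B L'(2) e(1)]) (simp add: L'(3) e(3))
    then show "L' = L" using hatc_inj[OF A B L'(1) L(1)] L(2) by simp
  qed
  then show "coalg_of R A B F \<in> linmaps R (Tc R A) (Tc R B)"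
    "comorph R A B (hatc R A B (coalg_of R A B F))"
    "has_deg R A B 0 (hatc R A B (coalg_of R A B F))"
    "proj1 R B (hatc R A B (coalg_of R A B F) x) = susp_ops R A B 0 F x"
    by (auto simp: coalg_morphism_iff[OF A B] corestricts_iff[OF A B m])
qed

lemma homotopy_of:
  assumes A: "graded R A" and B: "graded R B" and F: "F \<in> multi_ops R A B {1..} 0" and G: "G \<in> multi_ops R A B {1..} 0"
    and h: "h \<in> multi_ops R A B {1..} 1"
  shows "homotopy_of R A B F G h \<in> linmaps R (Tc R A) (Tc R B)"
    "coder R A B (\<lambda>x. hatc R A B (coalg_of R A B F) (sigma R A x)) (hatc R A B (coalg_of R A B G))
       (hatc R A B (homotopy_of R A B F G h))"
    "proj1 R B (hatc R A B (homotopy_of R A B F G h) x) = susp_ops R A B 1 h x"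
proof -
  note f = coalg_of[OF A B F] and g = coalg_of[OF A B G]
  let ?P = "\<lambda>\<eta>. coalg_homotopy R A B (coalg_of R A B F) (coalg_of R A B G) \<eta> \<and> corestricts_to R A B 1 h \<eta>"
  let ?f = "\<lambda>x. hatc R A B (coalg_of R A B F) (sigma R A x)" and ?g = "hatc R A B (coalg_of R A B G)"
  note cf = comorph_comp[OF A A B f(2) comorph_sigma[OF A]]
  have df: "has_deg R A B 0 ?f" using has_deg_comp[OF A B comorph_lhom[OF f(2)] f(3) has_deg_sigma[OF A]] by simp
  note s = susp_ops(1)[OF A B h] susp_ops_props[OF A B h]
  note iff = coalg_homotopy_iff[OF A B f(1) g(1)] corestricts_iff[OF A B h]
  obtain \<eta> where e: "coder R A B ?f ?g \<eta>" "has_deg R A B 1 \<eta>" "\<And>x. proj1 R B (\<eta> x) = susp_ops R A B 1 h x"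
    using coder_exists[OF A B cf df g(2,3) s(1,2,3)] by blast
  obtain L where L: "L \<in> linmaps R (Tc R A) (Tc R B)" "hatc R A B L = \<eta>"
    using hatc_surj[OF A B coder_lhom[OF e(1)]] by blast
  have "?P (homotopy_of R A B F G h)"
    unfolding homotopy_of_def
  proof (rule theI[where P="?P" and a=L])
    show "?P L" using L e by (simp add: iff)
    fix L' assume "?P L'"
    then have L': "L' \<in> linmaps R (Tc R A) (Tc R B)" "coder R A B ?f ?g (hatc R A B L')"
      "\<And>x. proj1 R B (hatc R A B L' x) = susp_ops R A B 1 h x"
      by (auto simp: iff)
    have "hatc R A B L' = \<eta>"
      by (rule coder_unique[OF A B comorph_lhom[OF cf] comorph_lhom[OF g(2)] L'(2) e(1)]) (simp add: L'(3) e(3))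
    then show "L' = L" using hatc_inj[OF A B L'(1) L(1)] L(2) by simp
  qed
  then show "homotopy_of R A B F G h \<in> linmaps R (Tc R A) (Tc R B)"
    "coder R A B ?f ?g (hatc R A B (homotopy_of R A B F G h))"
    "proj1 R B (hatc R A B (homotopy_of R A B F G h) x) = susp_ops R A B 1 h x"
    by (auto simp: iff)
qed

section \<open>Chain complexes\<close>

definition susp_bd where "susp_bd R C = susp_lin R (gr C) (gr C) (-1) (bd C)"
definition susp_chain where "susp_chain R A B f = susp_lin R (gr A) (gr B) 0 f"

lemma cx_graded: "chain_complex R C \<Longrightarrow> graded R (gr C)"
  by (simp add: chain_complex_def graded_def)

lemma cx_lin_family: "chain_complex R C \<Longrightarrow> lin_family R (gr C) (gr C) (-1) (bd C)"
  by (simp add: chain_complex_def lin_family_def)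

lemma susp_bd_letterwise: "chain_complex R C \<Longrightarrow> letterwise R (gr C) (gr C) (-1) (susp_bd R C)"
  unfolding susp_bd_def by (rule susp_lin_letterwise[OF cx_graded cx_graded cx_lin_family])

lemma susp_bd_emb: "chain_complex R C \<Longrightarrow> a \<in> carrier (gr C d) \<Longrightarrow>
    susp_bd R C (cls R (gr C) [(d, emb (gr C d) a)]) = cls R (gr C) [(d - 1, emb (gr C (d - 1)) (bd C d a))]"
  unfolding susp_bd_def using susp_lin_emb[OF cx_graded cx_graded cx_lin_family] by force

lemma bd_closed: "chain_complex R C \<Longrightarrow> a \<in> carrier (gr C d) \<Longrightarrow> bd C d a \<in> carrier (gr C (d - 1))"
  using lin_family_closed[OF cx_lin_family, of R C a d] by simp

lemma cls1_0: "graded R A \<Longrightarrow> cls R A [(d, 0)] = 0"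
  by (rule lin_0[OF lhom_lin[OF cls1_lhom]])

lemma cls1_add: "graded R A \<Longrightarrow> a \<in> carrier (A d) \<Longrightarrow> b \<in> carrier (A d) \<Longrightarrow>
    cls R A [(d, emb (A d) a)] + cls R A [(d, emb (A d) b)] = cls R A [(d, emb (A d) (a \<oplus>\<^bsub>A d\<^esub> b))]"
  by (simp add: emb_add graded_ab lin_add[OF lhom_lin[OF cls1_lhom]])

lemma cls1_diff: "graded R A \<Longrightarrow> a \<in> carrier (A d) \<Longrightarrow> b \<in> carrier (A d) \<Longrightarrow>
    cls R A [(d, emb (A d) a)] - cls R A [(d, emb (A d) b)] = cls R A [(d, emb (A d) (a \<ominus>\<^bsub>A d\<^esub> b))]"
  by (simp add: emb_diff graded_ab lin_diff[OF lhom_lin[OF cls1_lhom]])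

lemma susp_bd_susp_bd:
  assumes C: "chain_complex R C" shows "susp_bd R C (susp_bd R C x) = 0"
proof -
  note g = cx_graded[OF C] and l = letterwise_D[OF susp_bd_letterwise[OF C]]
  show ?thesis
  proof (rule letterwise_eqI[OF g lhom_comp[OF l(1) l(1)] _ lhom_zero[OF Tc_module[OF g]] refl])
    fix d a assume a: "a \<in> carrier (gr C d)"
    have "bd C (d - 1) (bd C d a) = \<zero>\<^bsub>gr C (d - 2)\<^esub>" using C a by (simp add: chain_complex_def)
    then show "susp_bd R C (susp_bd R C (cls R (gr C) [(d, emb (gr C d) a)])) = 0"
      by (simp add: susp_bd_emb[OF C] a bd_closed[OF C] emb_zero graded_ab[OF g] cls1_0[OF g])
  qed (simp add: l)
qed

lemma chain_mapsD:
  assumes "f \<in> chain_maps R A B" shows "lin_family R (gr A) (gr B) 0 f"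
    "a \<in> carrier (gr A n) \<Longrightarrow> bd B n (f n a) = f (n - 1) (bd A n a)"
    "a \<in> carrier (gr A n) \<Longrightarrow> f n a \<in> carrier (gr B n)"
  using assms linmapsD(1)[of "f n" R "gr A n" "gr B n" a] by (auto simp: chain_maps_def lin_family_def)

lemma susp_chain_letterwise:
  assumes "chain_complex R A" "chain_complex R B" "lin_family R (gr A) (gr B) 0 f"
  shows "letterwise R (gr A) (gr B) 0 (susp_chain R A B f)"
  unfolding susp_chain_def by (rule susp_lin_letterwise[OF cx_graded cx_graded]) fact+

lemma susp_chain_emb:
  assumes "chain_complex R A" "chain_complex R B" "lin_family R (gr A) (gr B) 0 f" "a \<in> carrier (gr A d)"
  shows "susp_chain R A B f (cls R (gr A) [(d, emb (gr A d) a)]) = cls R (gr B) [(d, emb (gr B d) (f d a))]"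
  unfolding susp_chain_def using susp_lin_emb[OF cx_graded cx_graded, OF assms(1,2,3)] assms(4) by force

lemma chain_maps_iff:
  assumes A: "chain_complex R A" and B: "chain_complex R B"
  shows "f \<in> chain_maps R A B \<longleftrightarrow> lin_family R (gr A) (gr B) 0 f \<and> (\<forall>x. susp_bd R B (susp_chain R A B f x) = susp_chain R A B f (susp_bd R A x))"
proof -
  note gA = cx_graded[OF A] and gB = cx_graded[OF B]
  have "(\<forall>n. \<forall>a\<in>carrier (gr A n). bd B n (f n a) = f (n - 1) (bd A n a)) \<longleftrightarrow>
     (\<forall>x. susp_bd R B (susp_chain R A B f x) = susp_chain R A B f (susp_bd R A x))" if f: "lin_family R (gr A) (gr B) 0 f"
  proof -
    note l = letterwise_D[OF susp_chain_letterwise[OF A B f]] and lA = letterwise_D[OF susp_bd_letterwise[OF A]] and lB = letterwise_D[OF susp_bd_letterwise[OF B]]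
    have fc: "f d a \<in> carrier (gr B d)" if "a \<in> carrier (gr A d)" for d a
      using lin_family_closed[OF f that] by simp
    have "(\<forall>x. susp_bd R B (susp_chain R A B f x) = susp_chain R A B f (susp_bd R A x)) \<longleftrightarrow>
      (\<forall>d. \<forall>a\<in>carrier (gr A d). susp_bd R B (susp_chain R A B f (cls R (gr A) [(d, emb (gr A d) a)])) =
         susp_chain R A B f (susp_bd R A (cls R (gr A) [(d, emb (gr A d) a)])))"
      using letterwise_eqI[OF gA lhom_comp[OF lB(1) l(1)] _ lhom_comp[OF l(1) lA(1)]] by (auto simp: l lA)
    also have "\<dots> \<longleftrightarrow> (\<forall>n. \<forall>a\<in>carrier (gr A n). bd B n (f n a) = f (n - 1) (bd A n a))"
      by (intro all_cong1 ball_cong refl)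
         (simp add: susp_chain_emb[OF A B f] susp_bd_emb[OF A] susp_bd_emb[OF B] fc bd_closed[OF A] bd_closed[OF B] cls1_emb_iff[OF gB])
    finally show ?thesis ..
  qed
  then show ?thesis by (auto simp: chain_maps_def lin_family_def)
qed

text \<open>Both sides of the homotopy equation are letterwise operators, so they agree if they do on
  letters, and there the equation is the one in the complex.\<close>

lemma chain_homotopic_iff:
  assumes A: "chain_complex R A" and B: "chain_complex R B"
    and f: "lin_family R (gr A) (gr B) 0 f" and g: "lin_family R (gr A) (gr B) 0 g"
  shows "chain_homotopic R A B f g \<longleftrightarrow> (\<exists>H. letterwise R (gr A) (gr B) 1 H \<and>
     (\<forall>x. susp_chain R A B g x - susp_chain R A B f x = susp_bd R B (H x) + H (susp_bd R A x)))"
proof -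
  note gA = cx_graded[OF A] and gB = cx_graded[OF B]
  note lf = letterwise_D[OF susp_chain_letterwise[OF A B f]] and lg = letterwise_D[OF susp_chain_letterwise[OF A B g]]
    and lA = letterwise_D[OF susp_bd_letterwise[OF A]] and lB = letterwise_D[OF susp_bd_letterwise[OF B]]
  have fc: "f d a \<in> carrier (gr B d)" "g d a \<in> carrier (gr B d)" if "a \<in> carrier (gr A d)" for d a
    using lin_family_closed[OF f that] lin_family_closed[OF g that] by simp_all
  have *: "(\<forall>n. \<forall>a\<in>carrier (gr A n).
        g n a \<ominus>\<^bsub>gr B n\<^esub> f n a = bd B (n + 1) (h n a) \<oplus>\<^bsub>gr B n\<^esub> h (n - 1) (bd A n a)) \<longleftrightarrow>
     (\<forall>x. susp_chain R A B g x - susp_chain R A B f x = susp_bd R B (susp_lin R (gr A) (gr B) 1 h x) + susp_lin R (gr A) (gr B) 1 h (susp_bd R A x))"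
    if h: "lin_family R (gr A) (gr B) 1 h" for h
  proof -
    let ?H = "susp_lin R (gr A) (gr B) 1 h"
    note l = letterwise_D[OF susp_lin_letterwise[OF gA gB h]]
    have hc: "h d a \<in> carrier (gr B (d + 1))" if "a \<in> carrier (gr A d)" for d a
      using lin_family_closed[OF h that] by simp
    have c1: "bd B (d + 1) (h d a) \<in> carrier (gr B d)" "h (d - 1) (bd A d a) \<in> carrier (gr B d)"
      if "a \<in> carrier (gr A d)" for d a
      using bd_closed[OF B hc[OF that]] hc[OF bd_closed[OF A that]] by simp_all
    note TB = Tc_module[OF gB]
    have "(\<forall>x. susp_chain R A B g x - susp_chain R A B f x = susp_bd R B (?H x) + ?H (susp_bd R A x)) \<longleftrightarrow>
      (\<forall>d. \<forall>a\<in>carrier (gr A d). susp_chain R A B g (cls R (gr A) [(d, emb (gr A d) a)]) - susp_chain R A B f (cls R (gr A) [(d, emb (gr A d) a)]) =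
         susp_bd R B (?H (cls R (gr A) [(d, emb (gr A d) a)])) + ?H (susp_bd R A (cls R (gr A) [(d, emb (gr A d) a)])))"
      using letterwise_eqI[OF gA lhom_minus[OF TB lg(1) lf(1)] _ lhom_plus[OF TB lhom_comp[OF lB(1) l(1)] lhom_comp[OF l(1) lA(1)]]]
      by (auto simp: l lA lf lg)
    also have "\<dots> \<longleftrightarrow> (\<forall>n. \<forall>a\<in>carrier (gr A n).
        g n a \<ominus>\<^bsub>gr B n\<^esub> f n a = bd B (n + 1) (h n a) \<oplus>\<^bsub>gr B n\<^esub> h (n - 1) (bd A n a))"
    proof (intro all_cong1 ball_cong refl)
      fix d a assume a: "a \<in> carrier (gr A d)"
      interpret Bd: module R "gr B d" by (rule graded_D[OF gB])
      have hb: "?H (cls R (gr A) [(d, emb (gr A d) a)]) = cls R (gr B) [(d + 1, emb (gr B (d + 1)) (h d a))]"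
        by (rule susp_lin_emb[OF gA gB h a])
      have hb': "?H (cls R (gr A) [(d - 1, emb (gr A (d - 1)) (bd A d a))]) =
          cls R (gr B) [(d, emb (gr B d) (h (d - 1) (bd A d a)))]"
        using susp_lin_emb[OF gA gB h bd_closed[OF A a]] by simp
      have bh: "susp_bd R B (cls R (gr B) [(d + 1, emb (gr B (d + 1)) (h d a))]) =
          cls R (gr B) [(d, emb (gr B d) (bd B (d + 1) (h d a)))]"
        using susp_bd_emb[OF B hc[OF a]] by simp
      show "(susp_chain R A B g (cls R (gr A) [(d, emb (gr A d) a)]) - susp_chain R A B f (cls R (gr A) [(d, emb (gr A d) a)]) =
         susp_bd R B (?H (cls R (gr A) [(d, emb (gr A d) a)])) + ?H (susp_bd R A (cls R (gr A) [(d, emb (gr A d) a)]))) \<longleftrightarrow>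
        (g d a \<ominus>\<^bsub>gr B d\<^esub> f d a = bd B (d + 1) (h d a) \<oplus>\<^bsub>gr B d\<^esub> h (d - 1) (bd A d a))"
        unfolding susp_chain_emb[OF A B f a] susp_chain_emb[OF A B g a] susp_bd_emb[OF A a] hb hb' bh
          cls1_add[OF gB c1[OF a]] cls1_diff[OF gB fc(2,1)[OF a]]
        by (rule cls1_emb_iff[OF gB]) (use fc[OF a] c1[OF a] in auto)
    qed
    finally show ?thesis ..
  qed
  show ?thesis
  proof
    assume "chain_homotopic R A B f g"
    then obtain h where h: "lin_family R (gr A) (gr B) 1 h" "\<forall>n. \<forall>a\<in>carrier (gr A n).
        g n a \<ominus>\<^bsub>gr B n\<^esub> f n a = bd B (n + 1) (h n a) \<oplus>\<^bsub>gr B n\<^esub> h (n - 1) (bd A n a)"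
      by (auto simp: chain_homotopic_def lin_family_def)
    then show "\<exists>H. letterwise R (gr A) (gr B) 1 H \<and> (\<forall>x. susp_chain R A B g x - susp_chain R A B f x = susp_bd R B (H x) + H (susp_bd R A x))"
      using *[OF h(1)] susp_lin_letterwise[OF gA gB h(1)] by blast
  next
    assume "\<exists>H. letterwise R (gr A) (gr B) 1 H \<and> (\<forall>x. susp_chain R A B g x - susp_chain R A B f x = susp_bd R B (H x) + H (susp_bd R A x))"
    then obtain H where H: "letterwise R (gr A) (gr B) 1 H" "\<And>x. susp_chain R A B g x - susp_chain R A B f x = susp_bd R B (H x) + H (susp_bd R A x)"
      by blast
    from letterwise_susp_lin[OF gA gB H(1)] obtain h where h: "lin_family R (gr A) (gr B) 1 h" "\<And>x. susp_lin R (gr A) (gr B) 1 h x = H x"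
      by blast
    then show "chain_homotopic R A B f g"
      using *[OF h(1)] H(2) unfolding chain_homotopic_def lin_family_def by auto
  qed
qed

lemma chain_comp_susp_chain:
  assumes A: "chain_complex R A" and B: "chain_complex R B" and C: "chain_complex R C"
    and f: "lin_family R (gr A) (gr B) 0 f" and g: "lin_family R (gr B) (gr C) 0 g"
  shows "lin_family R (gr A) (gr C) 0 (chain_comp A g f)" "susp_chain R A C (chain_comp A g f) x = susp_chain R B C g (susp_chain R A B f x)"
proof -
  note gA = cx_graded[OF A] and gB = cx_graded[OF B] and gC = cx_graded[OF C]
  have fc: "f d a \<in> carrier (gr B d)" if "a \<in> carrier (gr A d)" for d a
    using lin_family_closed[OF f that] by simp
  have len_le: "f d \<in> linmaps R (gr A d) (gr B d)" "g d \<in> linmaps R (gr B d) (gr C d)" for d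
    using f g by (auto simp: lin_family_def)
  show GLc: "lin_family R (gr A) (gr C) 0 (chain_comp A g f)"
    unfolding lin_family_def
  proof
    fix n
    interpret An: module R "gr A n" by (rule graded_D[OF gA])
    show "chain_comp A g f n \<in> linmaps R (gr A n) (gr C (n + 0))"
      using linmapsD[OF len_le(1)[of n]] linmapsD[OF len_le(2)[of n]]
      by (auto simp: linmaps_def chain_comp_def compose_def)
  qed
  note lf = letterwise_D[OF susp_chain_letterwise[OF A B f]] and lg = letterwise_D[OF susp_chain_letterwise[OF B C g]] and lc = letterwise_D[OF susp_chain_letterwise[OF A C GLc]]
  show "susp_chain R A C (chain_comp A g f) x = susp_chain R B C g (susp_chain R A B f x)"
    by (rule letterwise_eqI[OF gA lc(1,3) lhom_comp[OF lg(1) lf(1)]])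
       (simp add: lf, simp add: susp_chain_emb[OF A C GLc] susp_chain_emb[OF A B f] susp_chain_emb[OF B C g] fc,
         simp add: chain_comp_def compose_def)
qed

lemma chain_id_susp_chain:
  assumes A: "chain_complex R A"
  shows "lin_family R (gr A) (gr A) 0 (chain_id A)" "susp_chain R A A (chain_id A) x = proj1 R (gr A) x"
proof -
  note gA = cx_graded[OF A]
  show GLc: "lin_family R (gr A) (gr A) 0 (chain_id A)"
    using lin_id_hat(1)[OF graded_D[OF gA]] by (simp add: lin_family_def chain_id_def)
  note lc = letterwise_D[OF susp_chain_letterwise[OF A A GLc]]
  show "susp_chain R A A (chain_id A) x = proj1 R (gr A) x"
    by (rule letterwise_eqI[OF gA lc(1,3) proj1(1)[OF gA] proj1_proj1[OF gA]])
       (simp add: susp_chain_emb[OF A A GLc] proj1(2)[OF gA], simp add: chain_id_def lin_id_def)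
qed

lemma susp_chain_inj:
  assumes A: "chain_complex R A" and B: "chain_complex R B"
    and f: "lin_family R (gr A) (gr B) 0 f" and g: "lin_family R (gr A) (gr B) 0 g" and e: "\<And>x. susp_chain R A B f x = susp_chain R A B g x"
  shows "f = g"
  by (rule susp_lin_inj[OF cx_graded[OF A] cx_graded[OF B] f g]) (use e in \<open>simp add: susp_chain_def\<close>)

lemma chain_homotopic_refl:
  assumes A: "chain_complex R A" and B: "chain_complex R B" and f: "lin_family R (gr A) (gr B) 0 f"
  shows "chain_homotopic R A B f f"
proof -
  have "susp_bd R B 0 = 0" by (rule lin_0[OF lhom_lin[OF letterwise_D(1)[OF susp_bd_letterwise[OF B]]]])
  then show ?thesis
    unfolding chain_homotopic_iff[OF A B f f] using letterwise_zero[OF cx_graded[OF B]]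
    by (intro exI[of _ "\<lambda>x. 0"]) simp
qed

lemma chain_homotopic_sym:
  assumes A: "chain_complex R A" and B: "chain_complex R B" and f: "lin_family R (gr A) (gr B) 0 f" and g: "lin_family R (gr A) (gr B) 0 g"
    and h: "chain_homotopic R A B f g"
  shows "chain_homotopic R A B g f"
proof -
  obtain H where H: "letterwise R (gr A) (gr B) 1 H" "\<And>x. susp_chain R A B g x - susp_chain R A B f x = susp_bd R B (H x) + H (susp_bd R A x)"
    using h unfolding chain_homotopic_iff[OF A B f g] by blast
  note lb = lhom_lin[OF letterwise_D(1)[OF susp_bd_letterwise[OF B]]]
  have "susp_chain R A B f x - susp_chain R A B g x = susp_bd R B (- H x) + (- H (susp_bd R A x))" for x
    using H(2)[of x] by (simp add: lin_uminus[OF lb] algebra_simps)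
  then show ?thesis
    unfolding chain_homotopic_iff[OF A B g f] using letterwise_plus(2)[OF cx_graded[OF B] H(1) H(1)] by blast
qed

lemma chain_homotopic_trans:
  assumes A: "chain_complex R A" and B: "chain_complex R B" and f: "lin_family R (gr A) (gr B) 0 f" and g: "lin_family R (gr A) (gr B) 0 g"
    and k: "lin_family R (gr A) (gr B) 0 k"
    and h: "chain_homotopic R A B f g" "chain_homotopic R A B g k"
  shows "chain_homotopic R A B f k"
proof -
  obtain H where H: "letterwise R (gr A) (gr B) 1 H" "\<And>x. susp_chain R A B g x - susp_chain R A B f x = susp_bd R B (H x) + H (susp_bd R A x)"
    using h(1) unfolding chain_homotopic_iff[OF A B f g] by blast
  obtain K where K: "letterwise R (gr A) (gr B) 1 K" "\<And>x. susp_chain R A B k x - susp_chain R A B g x = susp_bd R B (K x) + K (susp_bd R A x)"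
    using h(2) unfolding chain_homotopic_iff[OF A B g k] by blast
  note lb = lhom_lin[OF letterwise_D(1)[OF susp_bd_letterwise[OF B]]]
  have "susp_chain R A B k x - susp_chain R A B f x = susp_bd R B (H x + K x) + (H (susp_bd R A x) + K (susp_bd R A x))" for x
    using H(2)[of x] K(2)[of x] by (simp add: lin_add[OF lb] algebra_simps)
  then show ?thesis
    unfolding chain_homotopic_iff[OF A B f k] using letterwise_plus(1)[OF cx_graded[OF B] H(1) K(1)] by blast
qed

lemma chain_homotopic_comp:
  assumes A: "chain_complex R A" and B: "chain_complex R B" and C: "chain_complex R C"
    and f: "f \<in> chain_maps R A B" "f' \<in> chain_maps R A B" and g: "g \<in> chain_maps R B C" "g' \<in> chain_maps R B C"
    and h: "chain_homotopic R A B f f'" "chain_homotopic R B C g g'"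
  shows "chain_homotopic R A C (chain_comp A g f) (chain_comp A g' f')"
proof -
  note F = chain_mapsD(1)[OF f(1)] chain_mapsD(1)[OF f(2)] and G = chain_mapsD(1)[OF g(1)] chain_mapsD(1)[OF g(2)]
  obtain H where H: "letterwise R (gr A) (gr B) 1 H" "\<And>x. susp_chain R A B f' x - susp_chain R A B f x = susp_bd R B (H x) + H (susp_bd R A x)"
    using h(1) unfolding chain_homotopic_iff[OF A B F] by blast
  obtain K where K: "letterwise R (gr B) (gr C) 1 K" "\<And>x. susp_chain R B C g' x - susp_chain R B C g x = susp_bd R C (K x) + K (susp_bd R B x)"
    using h(2) unfolding chain_homotopic_iff[OF B C G] by blast
  note gA = cx_graded[OF A] and gB = cx_graded[OF B] and gC = cx_graded[OF C]
  let ?J = "\<lambda>x. susp_chain R B C g (H x) + K (susp_chain R A B f' x)"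
  have J: "letterwise R (gr A) (gr C) 1 ?J"
    using letterwise_comp[OF gA gB gC susp_chain_letterwise[OF B C G(1)] H(1)] letterwise_comp[OF gA gB gC K(1) susp_chain_letterwise[OF A B F(2)]]
    by (intro letterwise_plus(1)[OF gC]) simp_all
  note lC = lhom_lin[OF letterwise_D(1)[OF susp_bd_letterwise[OF C]]] and lg = lhom_lin[OF letterwise_D(1)[OF susp_chain_letterwise[OF B C G(1)]]]
    and lK = lhom_lin[OF letterwise_D(1)[OF K(1)]]
  have cm: "susp_bd R B (susp_chain R A B f' x) = susp_chain R A B f' (susp_bd R A x)" "susp_bd R C (susp_chain R B C g y) = susp_chain R B C g (susp_bd R B y)" for x y
    using f(2) g(1) by (simp_all add: chain_maps_iff[OF A B] chain_maps_iff[OF B C])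
  have "susp_chain R B C g' (susp_chain R A B f' x) - susp_chain R B C g (susp_chain R A B f x) = susp_bd R C (?J x) + ?J (susp_bd R A x)" for x
  proof -
    have "susp_chain R B C g' (susp_chain R A B f' x) - susp_chain R B C g (susp_chain R A B f x) =
      (susp_chain R B C g' (susp_chain R A B f' x) - susp_chain R B C g (susp_chain R A B f' x)) + susp_chain R B C g (susp_chain R A B f' x - susp_chain R A B f x)"
      by (simp add: lin_diff[OF lg])
    also have "\<dots> = susp_bd R C (?J x) + ?J (susp_bd R A x)"
      unfolding K(2) H(2) by (simp add: lin_add[OF lg] lin_add[OF lC] cm)
    finally show ?thesis .
  qed
  then show ?thesis
    unfolding chain_homotopic_iff[OF A C chain_comp_susp_chain(1)[OF A B C F(1) G(1)] chain_comp_susp_chain(1)[OF A B C F(2) G(2)]]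
    using J by (intro exI[of _ ?J]) (simp add: chain_comp_susp_chain(2)[OF A B C F(1) G(1)] chain_comp_susp_chain(2)[OF A B C F(2) G(2)])
qed

lemma chain_comp_maps:
  assumes A: "chain_complex R A" and B: "chain_complex R B" and C: "chain_complex R C"
    and f: "f \<in> chain_maps R A B" and g: "g \<in> chain_maps R B C"
  shows "chain_comp A g f \<in> chain_maps R A C"
proof -
  note F = chain_mapsD(1)[OF f] and G = chain_mapsD(1)[OF g]
  show ?thesis
    using f g chain_comp_susp_chain[OF A B C F G] by (simp add: chain_maps_iff[OF A B] chain_maps_iff[OF B C] chain_maps_iff[OF A C])
qed

lemma chain_id_maps: assumes A: "chain_complex R A" shows "chain_id A \<in> chain_maps R A A"
  using chain_id_susp_chain[OF A] letterwise_D(2,3)[OF susp_bd_letterwise[OF A]] by (simp add: chain_maps_iff[OF A A])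

lemma chain_comp_assoc:
  assumes A: "chain_complex R A" and B: "chain_complex R B" and C: "chain_complex R C" and D: "chain_complex R D"
    and f: "f \<in> chain_maps R A B" and g: "g \<in> chain_maps R B C" and h: "h \<in> chain_maps R C D"
  shows "chain_comp A h (chain_comp A g f) = chain_comp A (chain_comp B h g) f"
proof -
  note F = chain_mapsD(1)[OF f] and G = chain_mapsD(1)[OF g] and H = chain_mapsD(1)[OF h]
  note gf = chain_comp_susp_chain[OF A B C F G] and homog = chain_comp_susp_chain[OF B C D G H]
  show ?thesis
    by (rule susp_chain_inj[OF A D chain_comp_susp_chain(1)[OF A C D gf(1) H] chain_comp_susp_chain(1)[OF A B D F homog(1)]])
       (simp add: chain_comp_susp_chain(2)[OF A C D gf(1) H] chain_comp_susp_chain(2)[OF A B D F homog(1)] gf(2) homog(2))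
qed

lemma chain_comp_id:
  assumes A: "chain_complex R A" and B: "chain_complex R B" and f: "f \<in> chain_maps R A B"
  shows "chain_comp A f (chain_id A) = f" "chain_comp A (chain_id B) f = f"
proof -
  note F = chain_mapsD(1)[OF f] and iA = chain_id_susp_chain[OF A] and iB = chain_id_susp_chain[OF B]
  note l = letterwise_D[OF susp_chain_letterwise[OF A B F]]
  show "chain_comp A f (chain_id A) = f"
    by (rule susp_chain_inj[OF A B chain_comp_susp_chain(1)[OF A A B iA(1) F] F])
       (simp add: chain_comp_susp_chain(2)[OF A A B iA(1) F] iA(2) l)
  show "chain_comp A (chain_id B) f = f"
    by (rule susp_chain_inj[OF A B chain_comp_susp_chain(1)[OF A B B F iB(1)] F])
       (simp add: chain_comp_susp_chain(2)[OF A B B F iB(1)] iB(2) l)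
qed

lemma chain_equivsD: "f \<in> chain_equivs R A B \<Longrightarrow> f \<in> chain_maps R A B"
  by (simp add: chain_equivs_def)

lemma chain_equivs_inverse:
  assumes "f \<in> chain_equivs R A B"
  obtains g where "g \<in> chain_equivs R B A"
    "chain_homotopic R A A (chain_comp A g f) (chain_id A)" "chain_homotopic R B B (chain_comp B f g) (chain_id B)"
  using assms by (auto simp: chain_equivs_def)

lemma chain_id_equiv: assumes A: "chain_complex R A" shows "chain_id A \<in> chain_equivs R A A"
  using chain_id_maps[OF A] chain_comp_id[OF A A chain_id_maps[OF A]] chain_homotopic_refl[OF A A chain_id_susp_chain(1)[OF A]]
  by (auto simp: chain_equivs_def intro!: bexI[of _ "chain_id A"])

lemma chain_equivs_comp:
  assumes A: "chain_complex R A" and B: "chain_complex R B" and C: "chain_complex R C"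
    and f: "f \<in> chain_equivs R A B" and g: "g \<in> chain_equivs R B C"
  shows "chain_comp A g f \<in> chain_equivs R A C"
proof -
  have *: "chain_homotopic R A A (chain_comp A (chain_comp C f' g') (chain_comp A g f)) (chain_id A)"
    if A: "chain_complex R A" and B: "chain_complex R B" and C: "chain_complex R C"
      and m: "f \<in> chain_maps R A B" "g \<in> chain_maps R B C" "f' \<in> chain_maps R B A" "g' \<in> chain_maps R C B"
      and h: "chain_homotopic R A A (chain_comp A f' f) (chain_id A)" "chain_homotopic R B B (chain_comp B g' g) (chain_id B)"
    for A B C f g f' g'
  proof -
    note refl = chain_homotopic_refl[OF _ _ chain_mapsD(1)]
    note cm = chain_comp_maps
    have e: "chain_comp A (chain_comp C f' g') (chain_comp A g f) = chain_comp A f' (chain_comp A (chain_comp B g' g) f)"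
      using chain_comp_assoc[OF A B C B m(1,2,4)] chain_comp_assoc[OF A C B A cm[OF A B C m(1,2)] m(4,3)] by metis
    have "chain_homotopic R A B (chain_comp A (chain_comp B g' g) f) (chain_comp A (chain_id B) f)"
      by (rule chain_homotopic_comp[OF A B B m(1,1) cm[OF B C B m(2,4)] chain_id_maps[OF B] refl[OF A B m(1)] h(2)])
    then have "chain_homotopic R A B (chain_comp A (chain_comp B g' g) f) f"
      by (simp add: chain_comp_id[OF A B m(1)])
    from chain_homotopic_comp[OF A B A cm[OF A B B m(1) cm[OF B C B m(2,4)]] m(1) m(3,3) this refl[OF B A m(3)]]
    have "chain_homotopic R A A (chain_comp A f' (chain_comp A (chain_comp B g' g) f)) (chain_comp A f' f)" .
    from chain_homotopic_trans[OF A A chain_mapsD(1)[OF cm[OF A B A cm[OF A B B m(1) cm[OF B C B m(2,4)]] m(3)]]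
        chain_mapsD(1)[OF cm[OF A B A m(1,3)]] chain_mapsD(1)[OF chain_id_maps[OF A]] this h(1)]
    show ?thesis unfolding e .
  qed
  obtain f' where f': "f' \<in> chain_maps R B A" "chain_homotopic R A A (chain_comp A f' f) (chain_id A)"
    "chain_homotopic R B B (chain_comp B f f') (chain_id B)" using f by (auto simp: chain_equivs_def)
  obtain g' where g': "g' \<in> chain_maps R C B" "chain_homotopic R B B (chain_comp B g' g) (chain_id B)"
    "chain_homotopic R C C (chain_comp C g g') (chain_id C)" using g by (auto simp: chain_equivs_def)
  note fm = chain_equivsD[OF f] and graded = chain_equivsD[OF g]
  have "chain_comp C f' g' \<in> chain_maps R C A" by (rule chain_comp_maps[OF C B A g'(1) f'(1)])
  then show ?thesis
    unfolding chain_equivs_def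
    using *[OF A B C fm graded f'(1) g'(1) f'(2) g'(2)] *[OF C B A g'(1) f'(1) graded fm g'(3) f'(3)]
      chain_comp_maps[OF A B C fm graded] by blast
qed

section \<open>A-infinity algebras and morphisms as operators\<close>

text \<open>The differential fits with the higher operations as the operation of arity one.\<close>

lemma ainf_ops_multi:
  assumes C: "chain_complex R (fst a)" and m: "snd a \<in> multi_ops R (ugr a) (ugr a) {2..} (-1)"
  shows "ainf_ops a \<in> multi_ops R (ugr a) (ugr a) {1..} (-1)" "linear_part (ainf_ops a) = bd (fst a)"
proof -
  let ?A = "ugr a"
  note D = multi_opsD[OF m]
  have bdl: "bd (fst a) d \<in> linmaps R (?A d) (?A (d - 1))" for d using C by (simp add: chain_complex_def)
  note bD = linmapsD[OF bdl]
  have w2: "w \<in> words ?A {2..}" if "w \<in> words ?A {1..}" "length w \<noteq> 1" for w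
    using that by (auto simp: words_def)
  have w1: "\<exists>d x. w = [(d, x)]" if "length w = 1" for w :: "'c word" using that by (cases w) auto
  have w12: "w \<in> words ?A {1..}" if "w \<in> words ?A {2..}" for w using that by (auto simp: words_def)
  show "linear_part (ainf_ops a) = bd (fst a)" by (simp add: linear_part_def ainf_ops_def)
  show "ainf_ops a \<in> multi_ops R ?A ?A {1..} (-1)"
    unfolding multi_ops_def wdeg_alt mem_Collect_eq
  proof (intro conjI allI ballI impI)
    have "ainf_ops a w = undefined" if w: "w \<notin> words ?A {1..}" for w
    proof (cases "length w = 1")
      case True
      then obtain d x where wd: "w = [(d, x)]" using w1 by blast
      then have "x \<notin> carrier (?A d)" using w by (simp add: words_def)
      with extensional_arb[OF bD(4)] wd show ?thesis by (simp add: ainf_ops_def)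
    next
      case False
      then show ?thesis using extensional_arb[OF D(4)] w w12 by (auto simp: ainf_ops_def)
    qed
    then show "ainf_ops a \<in> extensional (words ?A {1..})" by (simp add: extensional_def)
  next
    fix w assume w: "w \<in> words ?A {1..}"
    show "ainf_ops a w \<in> carrier (?A (wdeg w - 1 + - 1))"
    proof (cases "length w = 1")
      case True
      then obtain d x where wd: "w = [(d, x)]" using w1 by blast
      with w bD(1)[of x d] show ?thesis by (simp add: ainf_ops_def words_def)
    next
      case False
      then show ?thesis using D(1)[OF w2[OF w False]] by (simp add: ainf_ops_def)
    qed
  next
    fix u v :: "'c word" and d x y assume w: "u @ (d, x) # v \<in> words ?A {1..}" and y: "y \<in> carrier (?A d)"
    show "ainf_ops a (u @ (d, x \<oplus>\<^bsub>?A d\<^esub> y) # v) = ainf_ops a (u @ (d, x) # v)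
       \<oplus>\<^bsub>?A (wdeg (u @ (d, x) # v) - 1 + - 1)\<^esub> ainf_ops a (u @ (d, y) # v)"
    proof (cases "u = [] \<and> v = []")
      case True
      with w y bD(2)[of x d y] show ?thesis by (simp add: ainf_ops_def words_def)
    next
      case False
      then have "length (u @ (d, x) # v) \<noteq> 1" by (cases u) auto
      from D(2)[OF w2[OF w this] y] False show ?thesis by (auto simp: ainf_ops_def)
    qed
  next
    fix u v :: "'c word" and d r x assume w: "u @ (d, x) # v \<in> words ?A {1..}" and r: "r \<in> carrier R"
    show "ainf_ops a (u @ (d, r \<odot>\<^bsub>?A d\<^esub> x) # v) = r \<odot>\<^bsub>?A (wdeg (u @ (d, x) # v) - 1 + - 1)\<^esub> ainf_ops a (u @ (d, x) # v)"
    proof (cases "u = [] \<and> v = []")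
      case True
      with w r bD(3)[of r x d] show ?thesis by (simp add: ainf_ops_def words_def)
    next
      case False
      then have "length (u @ (d, x) # v) \<noteq> 1" by (cases u) auto
      from D(3)[OF w2[OF w this] r] False show ?thesis by (auto simp: ainf_ops_def)
    qed
  qed
qed

definition codiff_hat where "codiff_hat R a = hatc R (ugr a) (ugr a) (codiff R a)"

lemma codiff_hat:
  assumes C: "chain_complex R (fst a)" and m: "snd a \<in> multi_ops R (ugr a) (ugr a) {2..} (-1)"
  shows "codiff R a \<in> linmaps R (Tc R (ugr a)) (Tc R (ugr a))"
    "coder R (ugr a) (ugr a) (sigma R (ugr a)) (tid R (ugr a)) (codiff_hat R a)" "has_deg R (ugr a) (ugr a) (-1) (codiff_hat R a)"
    "proj1 R (ugr a) (codiff_hat R a x) = susp_ops R (ugr a) (ugr a) (-1) (ainf_ops a) x"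
    "codiff_hat R a (proj1 R (ugr a) x) = susp_bd R (fst a) x"
proof -
  note g = cx_graded[OF C]
  note M = ainf_ops_multi[OF C m]
  note c = coder_of[OF g M(1)]
  show 1: "codiff R a \<in> linmaps R (Tc R (ugr a)) (Tc R (ugr a))"
    "coder R (ugr a) (ugr a) (sigma R (ugr a)) (tid R (ugr a)) (codiff_hat R a)" "has_deg R (ugr a) (ugr a) (-1) (codiff_hat R a)"
    and 4: "proj1 R (ugr a) (codiff_hat R a x) = susp_ops R (ugr a) (ugr a) (-1) (ainf_ops a) x" for x
    using c by (simp_all add: codiff_def codiff_hat_def)
  show "codiff_hat R a (proj1 R (ugr a) x) = susp_bd R (fst a) x"
    by (subst coder_proj1[OF g g sigma(1)[OF g] lhom_id[OF Tc_module[OF g]] 1(2)])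
       (simp add: 4 susp_ops_proj1(2)[OF g g M(1)] M(2) susp_bd_def)
qed

lemma zero_iff_hat:
  assumes M: "module R M" and N: "module R N" and f: "lhom R M N f" and L: "\<And>x. x \<in> carrier M \<Longrightarrow> L x \<in> carrier N"
    and e: "\<And>x. x \<in> carrier M \<Longrightarrow> emb N (L x) = f (emb M x)"
  shows "(\<forall>x\<in>carrier M. L x = \<zero>\<^bsub>N\<^esub>) \<longleftrightarrow> (\<forall>v. f v = 0)"
proof -
  interpret N: module R N by fact
  have "(\<forall>x\<in>carrier M. L x = \<zero>\<^bsub>N\<^esub>) \<longleftrightarrow> (\<forall>x\<in>carrier M. f (emb M x) = 0)"
    by (intro ball_cong refl)
       (simp add: eq_emb_iff[OF N.M.abelian_group_axioms L] e emb_zero N.M.abelian_group_axioms)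
  also have "\<dots> \<longleftrightarrow> (\<forall>v. f v = 0)" by (rule all_emb[OF M f lhom_zero[OF N]])
  finally show ?thesis .
qed

text \<open>A-infinity structures on a complex amount to codifferentials of the tensor coalgebra that
  extend its differential; the converse is \<open>ainf_exists\<close>.\<close>

lemma ainf_algebra_iff:
  "ainf_algebra R a \<longleftrightarrow> chain_complex R (fst a) \<and> snd a \<in> multi_ops R (ugr a) (ugr a) {2..} (-1) \<and>
     codifferential R (ugr a) (codiff_hat R a)"
proof -
  have "(\<forall>x\<in>carrier (Tc R (ugr a)). codiff R a (codiff R a x) = \<zero>\<^bsub>Tc R (ugr a)\<^esub>) \<longleftrightarrow>
     (\<forall>x. codiff_hat R a (codiff_hat R a x) = 0)"
    if C: "chain_complex R (fst a)" and m: "snd a \<in> multi_ops R (ugr a) (ugr a) {2..} (-1)"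
  proof -
    note D = codiff_hat[OF C m] and g = cx_graded[OF C]
    note T = Tc_module[OF g] and h = coder_lhom[OF D(2)] and c = linmapsD(1)[OF D(1)]
    show ?thesis
      by (rule zero_iff_hat[OF T T lhom_comp[OF h h] c[OF c]])
         (simp_all add: codiff_hat_def hat_emb[OF Tc_ab[OF g]] c)
  qed
  with codiff_hat(2)[of R a] codiff_hat(3)[of R a] show ?thesis unfolding ainf_algebra_def codifferential_def by blast
qed

lemma ainf_algebraD:
  assumes "ainf_algebra R a"
  shows "chain_complex R (fst a)" "graded R (ugr a)" "codifferential R (ugr a) (codiff_hat R a)"
    "codiff_hat R a (proj1 R (ugr a) x) = susp_bd R (fst a) x"
    "codiff R a \<in> linmaps R (Tc R (ugr a)) (Tc R (ugr a))" "thom R (ugr a) (ugr a) (codiff_hat R a)"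
  using assms codiff_hat[of R a] cx_graded coder_lhom by (auto simp: ainf_algebra_iff)

lemma ainf_exists:
  assumes C: "chain_complex R C" and D: "codifferential R (gr C) \<delta>" and b: "\<And>x. \<delta> (proj1 R (gr C) x) = susp_bd R C x"
  shows "\<exists>a. ainf_algebra R a \<and> fst a = C \<and> codiff_hat R a = \<delta>"
proof -
  let ?A = "gr C"
  note g = cx_graded[OF C]
  have cD: "coder R ?A ?A (sigma R ?A) (tid R ?A) \<delta>" and dD: "has_deg R ?A ?A (-1) \<delta>" using D by (auto simp: codifferential_def)
  note p = proj1(1)[OF g] and i = lhom_id[OF Tc_module[OF g]]
  have dp: "has_deg R ?A ?A (-1) (\<lambda>x. proj1 R ?A (\<delta> x))" using has_deg_comp[OF g g p has_deg_proj1[OF g] dD] by simp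
  obtain F where F: "F \<in> multi_ops R ?A ?A {1..} (-1)" "\<And>x. susp_ops R ?A ?A (-1) F x = proj1 R ?A (\<delta> x)"
    using susp_ops_surj[OF g g lhom_comp[OF p coder_lhom[OF cD]] proj1_proj1[OF g] dp] by blast
  have lF: "linear_part F = bd C"
  proof (rule susp_lin_inj[OF g g susp_ops_proj1(1)[OF g g F(1)] cx_lin_family[OF C]])
    fix x
    have "susp_lin R ?A ?A (-1) (linear_part F) x = proj1 R ?A (\<delta> (proj1 R ?A x))"
      by (simp add: susp_ops_proj1(2)[OF g g F(1), symmetric] F(2))
    then show "susp_lin R ?A ?A (-1) (linear_part F) x = susp_lin R ?A ?A (-1) (bd C) x"
      using letterwise_D(2)[OF susp_bd_letterwise[OF C]] by (simp add: b susp_bd_def)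
  qed
  \<comment> \<open>The operation of arity one is left out, because \<open>ainf_ops\<close> takes it from the complex.\<close>
  define a where "a = (C, \<lambda>w. if w \<in> words ?A {2..} then F w else undefined)"
  have ext: "F w = undefined" if "w \<notin> words ?A {1..}" for w
    using extensional_arb[OF multi_opsD(4)[OF F(1)]] that by simp
  have ops: "ainf_ops a = F"
  proof
    fix w
    show "ainf_ops a w = F w"
    proof (cases "length w = 1")
      case True
      then obtain d x where "w = [(d, x)]" by (cases w) auto
      then show ?thesis using lF by (simp add: ainf_ops_def a_def linear_part_def fun_eq_iff)
    next
      case False
      have "w \<notin> words ?A {1..}" if "w \<notin> words ?A {2..}" using that False by (auto simp: words_def)
      then show ?thesis using ext False by (auto simp: ainf_ops_def a_def)
    qed
  qed
  have m: "snd a \<in> multi_ops R (ugr a) (ugr a) {2..} (-1)"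
  proof -
    have w12: "w \<in> words ?A {1..}" if "w \<in> words ?A {2..}" for w using that by (auto simp: words_def)
    have e: "u @ (d, x \<oplus>\<^bsub>?A d\<^esub> y) # v \<in> words ?A {2..}" "u @ (d, y) # v \<in> words ?A {2..}"
      if "u @ (d, x) # v \<in> words ?A {2..}" "y \<in> carrier (?A d)" for u d x y v
      using that graded_ab[OF g, of d] by (auto simp: words_append abelian_groupE(1))
    have e': "u @ (d, r \<odot>\<^bsub>?A d\<^esub> x) # v \<in> words ?A {2..}"
      if "u @ (d, x) # v \<in> words ?A {2..}" "r \<in> carrier R" for u d x r v
      using that graded_D[OF g, of d] by (auto simp: words_append module.smult_closed)
    have ga: "ugr a = ?A" and sa: "snd a w = (if w \<in> words ?A {2..} then F w else undefined)" for w
      by (simp_all add: a_def)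
    show ?thesis
      unfolding multi_ops_def wdeg_alt mem_Collect_eq ga
    proof (intro conjI allI ballI impI)
      show "snd a \<in> extensional (words ?A {2..})" by (simp add: sa extensional_def)
      show "snd a w \<in> carrier (?A (wdeg w - 1 + - 1))" if "w \<in> words ?A {2..}" for w
        unfolding sa using multi_opsD(1)[OF F(1) w12[OF that]] that by simp
      show "snd a (u @ (d, x \<oplus>\<^bsub>?A d\<^esub> y) # v) = snd a (u @ (d, x) # v)
         \<oplus>\<^bsub>?A (wdeg (u @ (d, x) # v) - 1 + - 1)\<^esub> snd a (u @ (d, y) # v)"
        if "u @ (d, x) # v \<in> words ?A {2..}" "y \<in> carrier (?A d)" for u v d x y
        unfolding sa using multi_opsD(2)[OF F(1) w12[OF that(1)] that(2)] that e[OF that] by simp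
      show "snd a (u @ (d, r \<odot>\<^bsub>?A d\<^esub> x) # v) =
         r \<odot>\<^bsub>?A (wdeg (u @ (d, x) # v) - 1 + - 1)\<^esub> snd a (u @ (d, x) # v)"
        if "u @ (d, x) # v \<in> words ?A {2..}" "r \<in> carrier R" for u v d r x
        unfolding sa using multi_opsD(3)[OF F(1) w12[OF that(1)] that(2)] that e'[OF that] by simp
    qed
  qed
  have C': "chain_complex R (fst a)" and ga: "ugr a = ?A" using C by (simp_all add: a_def)
  note da = codiff_hat[OF C' m, unfolded ga ops]
  have "codiff_hat R a = \<delta>"
    by (rule coder_unique[OF g g sigma(1)[OF g] i da(2) cD]) (simp add: da(4) F(2))
  then show ?thesis using C' m D by (intro exI[of _ a]) (simp add: ainf_algebra_iff a_def)
qed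

definition coalg_hat where "coalg_hat R a b F = hatc R (ugr a) (ugr b) (coalg_of R (ugr a) (ugr b) F)"

text \<open>A-infinity morphisms as operators; \<open>ainf_morphism_exists\<close> recovers the morphism.\<close>

definition hat_mor where
  "hat_mor R a b \<phi> \<longleftrightarrow> comorph R (ugr a) (ugr b) \<phi> \<and> has_deg R (ugr a) (ugr b) 0 \<phi> \<and> (\<forall>x. codiff_hat R b (\<phi> x) = \<phi> (codiff_hat R a x))"

lemma ainf_morphisms_iff:
  "F \<in> ainf_morphisms R a b \<longleftrightarrow> F \<in> multi_ops R (ugr a) (ugr b) {1..} 0 \<and>
     ainf_algebra R a \<and> ainf_algebra R b \<and> hat_mor R a b (coalg_hat R a b F)"
proof -
  have "(\<forall>x\<in>carrier (Tc R (ugr a)). codiff R b (coalg_of R (ugr a) (ugr b) F x) =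
      coalg_of R (ugr a) (ugr b) F (codiff R a x)) \<longleftrightarrow> hat_mor R a b (coalg_hat R a b F)"
    if F: "F \<in> multi_ops R (ugr a) (ugr b) {1..} 0" and a: "ainf_algebra R a" and b: "ainf_algebra R b"
  proof -
    note da = ainf_algebraD[OF a] and db = ainf_algebraD[OF b]
    note f = coalg_of[OF da(2) db(2) F]
    have hP: "thom R (ugr a) (ugr b) (coalg_hat R a b F)" using comorph_lhom[OF f(2)] by (simp add: coalg_hat_def)
    note cf = linmapsD(1)[OF f(1)] and ca = linmapsD(1)[OF da(5)] and susp_chain = linmapsD(1)[OF db(5)]
    note TA = Tc_module[OF da(2)]
    have "(\<forall>x\<in>carrier (Tc R (ugr a)). codiff R b (coalg_of R (ugr a) (ugr b) F x) =
      coalg_of R (ugr a) (ugr b) F (codiff R a x)) \<longleftrightarrow>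
      (\<forall>x\<in>carrier (Tc R (ugr a)). codiff_hat R b (coalg_hat R a b F (emb (Tc R (ugr a)) x)) = coalg_hat R a b F (codiff_hat R a (emb (Tc R (ugr a)) x)))"
      by (intro ball_cong refl)
         (simp add: eq_emb_iff[OF Tc_ab[OF db(2)]] cf ca susp_chain codiff_hat_def coalg_hat_def hat_emb Tc_ab[OF da(2)] Tc_ab[OF db(2)])
    also have "\<dots> \<longleftrightarrow> (\<forall>v. codiff_hat R b (coalg_hat R a b F v) = coalg_hat R a b F (codiff_hat R a v))"
      by (rule all_emb[OF TA lhom_comp[OF db(6) hP] lhom_comp[OF hP da(6)]])
    finally show ?thesis using f(2,3) by (simp add: hat_mor_def coalg_hat_def)
  qed
  then show ?thesis by (auto simp: ainf_morphisms_def)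
qed

lemma coalg_hat_spec:
  assumes a: "graded R (ugr a)" and b: "graded R (ugr b)" and F: "F \<in> multi_ops R (ugr a) (ugr b) {1..} 0"
  shows "proj1 R (ugr b) (coalg_hat R a b F x) = susp_ops R (ugr a) (ugr b) 0 F x"
    "coalg_hat R a b F (proj1 R (ugr a) x) = susp_chain R (fst a) (fst b) (linear_part F) x"
    "comorph R (ugr a) (ugr b) (coalg_hat R a b F)"
proof -
  note f = coalg_of[OF a b F]
  show 1: "proj1 R (ugr b) (coalg_hat R a b F x) = susp_ops R (ugr a) (ugr b) 0 F x" for x using f(4) by (simp add: coalg_hat_def)
  show c: "comorph R (ugr a) (ugr b) (coalg_hat R a b F)" using f(2) by (simp add: coalg_hat_def)
  show "coalg_hat R a b F (proj1 R (ugr a) x) = susp_chain R (fst a) (fst b) (linear_part F) x"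
    by (subst comorph_proj1[OF a b c]) (simp add: 1 susp_ops_proj1(2)[OF a b F] susp_chain_def)
qed

lemma coalg_hat_inj:
  assumes a: "graded R (ugr a)" and b: "graded R (ugr b)" and F: "F \<in> multi_ops R (ugr a) (ugr b) {1..} 0"
    "F' \<in> multi_ops R (ugr a) (ugr b) {1..} 0" and e: "coalg_hat R a b F = coalg_hat R a b F'"
  shows "F = F'"
  by (rule susp_ops_inj[OF a b F]) (simp add: coalg_hat_spec(1)[OF a b F(1), symmetric] coalg_hat_spec(1)[OF a b F(2), symmetric] e)

lemma coalg_hat_surj_ops:
  assumes a: "graded R (ugr a)" and b: "graded R (ugr b)" and c: "comorph R (ugr a) (ugr b) \<phi>" and d: "has_deg R (ugr a) (ugr b) 0 \<phi>"
  shows "\<exists>F\<in>multi_ops R (ugr a) (ugr b) {1..} 0. coalg_hat R a b F = \<phi>"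
proof -
  note p = proj1(1)[OF b]
  have dp: "has_deg R (ugr a) (ugr b) 0 (\<lambda>x. proj1 R (ugr b) (\<phi> x))" using has_deg_comp[OF b b p has_deg_proj1[OF b] d] by simp
  obtain F where F: "F \<in> multi_ops R (ugr a) (ugr b) {1..} 0" "\<And>x. susp_ops R (ugr a) (ugr b) 0 F x = proj1 R (ugr b) (\<phi> x)"
    using susp_ops_surj[OF a b lhom_comp[OF p comorph_lhom[OF c]] proj1_proj1[OF b] dp] by blast
  have "coalg_hat R a b F = \<phi>"
    by (rule comorph_unique[OF a b coalg_hat_spec(3)[OF a b F(1)] c]) (simp add: coalg_hat_spec(1)[OF a b F(1)] F(2))
  with F(1) show ?thesis by blast
qed

lemma ainf_morphismsD:
  assumes "F \<in> ainf_morphisms R a b"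
  shows "F \<in> multi_ops R (ugr a) (ugr b) {1..} 0" "ainf_algebra R a" "ainf_algebra R b" "hat_mor R a b (coalg_hat R a b F)"
    "coalg_hat R a b F (proj1 R (ugr a) x) = susp_chain R (fst a) (fst b) (linear_part F) x"
    "linear_part F \<in> chain_maps R (fst a) (fst b)" "lin_family R (ugr a) (ugr b) 0 (linear_part F)"
proof -
  show F: "F \<in> multi_ops R (ugr a) (ugr b) {1..} 0" and a: "ainf_algebra R a" and b: "ainf_algebra R b"
    and m: "hat_mor R a b (coalg_hat R a b F)" using assms by (auto simp: ainf_morphisms_iff)
  note da = ainf_algebraD[OF a] and db = ainf_algebraD[OF b]
  show lp: "coalg_hat R a b F (proj1 R (ugr a) x) = susp_chain R (fst a) (fst b) (linear_part F) x" for x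
    by (rule coalg_hat_spec(2)[OF da(2) db(2) F])
  show GLl: "lin_family R (ugr a) (ugr b) 0 (linear_part F)" using susp_ops_proj1(1)[OF da(2) db(2) F] .
  note l = letterwise_D[OF susp_chain_letterwise[OF da(1) db(1) GLl]] and la = letterwise_D[OF susp_bd_letterwise[OF da(1)]]
  have "susp_bd R (fst b) (susp_chain R (fst a) (fst b) (linear_part F) x) = susp_chain R (fst a) (fst b) (linear_part F) (susp_bd R (fst a) x)" for x
  proof -
    have "susp_bd R (fst b) (susp_chain R (fst a) (fst b) (linear_part F) x) = codiff_hat R b (coalg_hat R a b F (proj1 R (ugr a) x))"
      unfolding lp by (simp add: db(4)[symmetric] l(2))
    also have "\<dots> = coalg_hat R a b F (codiff_hat R a (proj1 R (ugr a) x))" using m by (simp add: hat_mor_def)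
    also have "\<dots> = coalg_hat R a b F (proj1 R (ugr a) (susp_bd R (fst a) x))" by (simp add: da(4) la(2))
    finally show ?thesis by (simp add: lp)
  qed
  then show "linear_part F \<in> chain_maps R (fst a) (fst b)"
    using GLl by (simp add: chain_maps_iff[OF da(1) db(1)])
qed

lemma ainf_morphism_exists:
  assumes a: "ainf_algebra R a" and b: "ainf_algebra R b" and m: "hat_mor R a b \<phi>"
    and l: "lin_family R (ugr a) (ugr b) 0 f" "\<And>x. \<phi> (proj1 R (ugr a) x) = susp_chain R (fst a) (fst b) f x"
  shows "\<exists>F\<in>ainf_morphisms R a b. coalg_hat R a b F = \<phi> \<and> linear_part F = f"
proof -
  note da = ainf_algebraD[OF a] and db = ainf_algebraD[OF b]
  obtain F where F: "F \<in> multi_ops R (ugr a) (ugr b) {1..} 0" "coalg_hat R a b F = \<phi>"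
    using coalg_hat_surj_ops[OF da(2) db(2)] m by (auto simp: hat_mor_def)
  then have FM: "F \<in> ainf_morphisms R a b" using a b m by (simp add: ainf_morphisms_iff)
  have "linear_part F = f"
    by (rule susp_chain_inj[OF da(1) db(1) ainf_morphismsD(7)[OF FM] l(1)])
       (simp add: ainf_morphismsD(5)[OF FM, symmetric] F(2) l(2))
  with FM F show ?thesis by blast
qed

lemma hat_mor_lhom: "hat_mor R a b \<phi> \<Longrightarrow> thom R (ugr a) (ugr b) \<phi>"
  by (simp add: hat_mor_def comorph_lhom)

lemma hat_mor_comp:
  assumes a: "ainf_algebra R a" and b: "ainf_algebra R b" and c: "ainf_algebra R c"
    and f: "hat_mor R a b \<phi>" and g: "hat_mor R b c \<psi>"
  shows "hat_mor R a c (\<lambda>x. \<psi> (\<phi> x))"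
proof -
  note A = ainf_algebraD(2)[OF a] and B = ainf_algebraD(2)[OF b] and C = ainf_algebraD(2)[OF c]
  show ?thesis
    using comorph_comp[OF A B C, of \<psi> \<phi>] has_deg_comp[OF B C, of \<psi> 0 "ugr a" 0 \<phi>] f g
    by (auto simp: hat_mor_def comorph_lhom)
qed

lemma hat_mor_id: assumes a: "ainf_algebra R a" shows "hat_mor R a a (tid R (ugr a))"
  using ainf_algebraD(2,6)[OF a] comorph_id has_deg_id by (auto simp: hat_mor_def lhom_retr retr_lhom)

text \<open>The descriptions in \<open>ainf_comp\<close> and \<open>ainf_id\<close> denote, because the family of operations is
  determined by its coalgebra morphism.\<close>

lemma ainf_comp:
  assumes F: "F \<in> ainf_morphisms R a b" and G: "G \<in> ainf_morphisms R b c"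
  shows "ainf_comp R a b c G F \<in> ainf_morphisms R a c"
    "coalg_hat R a c (ainf_comp R a b c G F) = (\<lambda>x. coalg_hat R b c G (coalg_hat R a b F x))"
    "linear_part (ainf_comp R a b c G F) = chain_comp (fst a) (linear_part G) (linear_part F)"
proof -
  note f = ainf_morphismsD[OF F] and g = ainf_morphismsD[OF G]
  note da = ainf_algebraD[OF f(2)] and db = ainf_algebraD[OF f(3)] and dc = ainf_algebraD[OF g(3)]
  note m = hat_mor_comp[OF f(2,3) g(3) f(4) g(4)]
  note cc = chain_comp_susp_chain[OF da(1) db(1) dc(1) f(7) g(7)]
  have "coalg_hat R b c G (coalg_hat R a b F (proj1 R (ugr a) x)) =
      susp_chain R (fst a) (fst c) (chain_comp (fst a) (linear_part G) (linear_part F)) x" for x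
    using letterwise_D(2)[OF susp_chain_letterwise[OF da(1) db(1) f(7)]] by (simp add: f(5) g(5)[symmetric] cc(2))
  from ainf_morphism_exists[OF f(2) g(3) m cc(1) this] obtain H where H: "H \<in> ainf_morphisms R a c"
    "coalg_hat R a c H = (\<lambda>x. coalg_hat R b c G (coalg_hat R a b F x))"
    "linear_part H = chain_comp (fst a) (linear_part G) (linear_part F)" by blast
  note h = ainf_morphismsD[OF H(1)]
  let ?T = "Tc R (ugr a)"
  note cF = coalg_of[OF da(2) db(2) f(1)] and cG = coalg_of[OF db(2) dc(2) g(1)]
  have eq: "coalg_of R (ugr a) (ugr c) H' = compose (carrier ?T) (coalg_of R (ugr b) (ugr c) G) (coalg_of R (ugr a) (ugr b) F) \<longleftrightarrow>
      coalg_hat R a c H' = coalg_hat R a c H" if H': "H' \<in> multi_ops R (ugr a) (ugr c) {1..} 0" for H'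
  proof -
    note cH = coalg_of[OF da(2) dc(2) H']
    have "coalg_of R (ugr a) (ugr c) H' = compose (carrier ?T) (coalg_of R (ugr b) (ugr c) G) (coalg_of R (ugr a) (ugr b) F) \<longleftrightarrow>
      (\<forall>x\<in>carrier ?T. coalg_of R (ugr a) (ugr c) H' x = coalg_of R (ugr b) (ugr c) G (coalg_of R (ugr a) (ugr b) F x))"
    proof
      assume "\<forall>x\<in>carrier ?T. coalg_of R (ugr a) (ugr c) H' x = coalg_of R (ugr b) (ugr c) G (coalg_of R (ugr a) (ugr b) F x)"
      then show "coalg_of R (ugr a) (ugr c) H' = compose (carrier ?T) (coalg_of R (ugr b) (ugr c) G) (coalg_of R (ugr a) (ugr b) F)"
        by (intro extensionalityI[OF linmapsD(4)[OF cH(1)] compose_extensional]) (simp add: compose_def)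
    qed (simp add: compose_def)
    also have "\<dots> \<longleftrightarrow> (\<forall>x\<in>carrier ?T. coalg_hat R a c H' (emb ?T x) = coalg_hat R a c H (emb ?T x))"
      unfolding H(2) by (intro ball_cong refl)
         (simp add: coalg_hat_def hat_emb Tc_ab[OF da(2)] Tc_ab[OF db(2)] eq_emb_iff[OF Tc_ab[OF dc(2)]]
           linmapsD(1)[OF cH(1)] linmapsD(1)[OF cG(1)] linmapsD(1)[OF cF(1)])
    also have "\<dots> \<longleftrightarrow> (\<forall>v. coalg_hat R a c H' v = coalg_hat R a c H v)"
      by (rule all_emb[OF Tc_module[OF da(2)] comorph_lhom[OF coalg_hat_spec(3)[OF da(2) dc(2) H']] hat_mor_lhom[OF h(4)]])
    finally show ?thesis by (simp add: fun_eq_iff)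
  qed
  have "ainf_comp R a b c G F = H"
    unfolding ainf_comp_def
    by (rule the_equality) (use h(1) eq coalg_hat_inj[OF da(2) dc(2)] in auto)
  then show "ainf_comp R a b c G F \<in> ainf_morphisms R a c"
    "coalg_hat R a c (ainf_comp R a b c G F) = (\<lambda>x. coalg_hat R b c G (coalg_hat R a b F x))"
    "linear_part (ainf_comp R a b c G F) = chain_comp (fst a) (linear_part G) (linear_part F)"
    using H by simp_all
qed

lemma ainf_id:
  assumes a: "ainf_algebra R a"
  shows "ainf_id R a \<in> ainf_morphisms R a a" "linear_part (ainf_id R a) = chain_id (fst a)"
proof -
  note da = ainf_algebraD[OF a]
  note ci = chain_id_susp_chain[OF da(1)]
  note T = Tc_module[OF da(2)]
  have "tid R (ugr a) (proj1 R (ugr a) x) = susp_chain R (fst a) (fst a) (chain_id (fst a)) x" for x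
    using retr_lhom[OF proj1(1)[OF da(2)]] by (simp add: ci(2))
  from ainf_morphism_exists[OF a a hat_mor_id[OF a] ci(1) this] obtain H where H: "H \<in> ainf_morphisms R a a"
    "coalg_hat R a a H = tid R (ugr a)" "linear_part H = chain_id (fst a)" by blast
  note h = ainf_morphismsD[OF H(1)]
  have eq: "coalg_of R (ugr a) (ugr a) H' = lin_id (Tc R (ugr a)) \<longleftrightarrow> coalg_hat R a a H' = coalg_hat R a a H"
    if H': "H' \<in> multi_ops R (ugr a) (ugr a) {1..} 0" for H'
    unfolding H(2)
    unfolding lin_id_hat(2)[OF T, symmetric] coalg_hat_def
    using hatc_inj[OF da(2) da(2) coalg_of(1)[OF da(2) da(2) H'] lin_id_hat(1)[OF T]] by metis
  have "ainf_id R a = H"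
    unfolding ainf_id_def
    by (rule the_equality) (use h(1) eq coalg_hat_inj[OF da(2) da(2)] in auto)
  then show "ainf_id R a \<in> ainf_morphisms R a a" "linear_part (ainf_id R a) = chain_id (fst a)" using H by simp_all
qed

section \<open>Isotopies\<close>

lemma isotopiesD:
  assumes "S \<in> isotopies R a a'"
  shows "S \<in> ainf_morphisms R a a'" "fst a = fst a'" "linear_part S = chain_id (fst a)"
  using assms by (auto simp: isotopies_def)

lemma isotopyI: "S \<in> ainf_morphisms R a a' \<Longrightarrow> fst a = fst a' \<Longrightarrow> linear_part S = chain_id (fst a) \<Longrightarrow> isotopic R a a'"
  by (auto simp: isotopies_def isotopic_def)

lemma isotopicD: "isotopic R a a' \<Longrightarrow> ainf_algebra R a \<and> ainf_algebra R a' \<and> fst a = fst a'"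
proof -
  assume "isotopic R a a'"
  then obtain S where S: "S \<in> isotopies R a a'" by (auto simp: isotopic_def)
  show ?thesis using isotopiesD[OF S] ainf_morphismsD(2,3)[OF isotopiesD(1)[OF S]] by simp
qed

lemma isotopic_refl: "ainf_algebra R a \<Longrightarrow> isotopic R a a"
  using ainf_id isotopyI by blast

lemma isotopic_trans:
  assumes "isotopic R a b" "isotopic R b c" shows "isotopic R a c"
proof -
  obtain S T where S: "S \<in> isotopies R a b" and T: "T \<in> isotopies R b c" using assms by (auto simp: isotopic_def)
  note s = isotopiesD[OF S] and t = isotopiesD[OF T]
  note c = ainf_comp[OF s(1) t(1)]
  have A: "chain_complex R (fst a)" using ainf_algebraD(1) ainf_morphismsD(2)[OF s(1)] by blast
  show ?thesis
    by (rule isotopyI[OF c(1)]) (use s t c(3) chain_comp_id(1)[OF A A chain_id_maps[OF A]] in simp_all)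
qed

text \<open>The inverse of a morphism of coalgebras commutes with the codifferentials if the morphism does.\<close>

lemma isotopic_sym:
  assumes "isotopic R a b" shows "isotopic R b a"
proof -
  obtain S where S: "S \<in> isotopies R a b" using assms by (auto simp: isotopic_def)
  note s = isotopiesD[OF S]
  note sm = ainf_morphismsD[OF s(1)]
  note da = ainf_algebraD[OF sm(2)] and db = ainf_algebraD[OF sm(3)]
  let ?A = "ugr a"
  have g: "ugr b = ?A" using s(2) by simp
  let ?f = "coalg_hat R a b S"
  note ci = chain_id_susp_chain[OF da(1)]
  have f: "comorph R ?A ?A ?f" "has_deg R ?A ?A 0 ?f" and fm: "\<And>x. codiff_hat R b (?f x) = ?f (codiff_hat R a x)"
    using sm(4) by (auto simp: hat_mor_def g)
  have fp: "?f (proj1 R ?A x) = proj1 R ?A x" for x using sm(5)[of x] ci(2)[of x] s by simp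
  obtain \<chi> where x: "comorph R ?A ?A \<chi>" "has_deg R ?A ?A 0 \<chi>" "\<And>x. \<chi> (proj1 R ?A x) = proj1 R ?A x"
    "\<And>x. ?f (\<chi> x) = tid R ?A x" "\<And>x. \<chi> (?f x) = tid R ?A x"
    using comorph_inverse[OF da(2) f fp] by blast
  have "codiff_hat R a (\<chi> x) = \<chi> (codiff_hat R b x)" for x
  proof -
    have "codiff_hat R a (\<chi> x) = \<chi> (?f (codiff_hat R a (\<chi> x)))" by (simp add: x(5) retr_lhom[OF da(6)])
    also have "\<dots> = \<chi> (codiff_hat R b (?f (\<chi> x)))" by (simp add: fm)
    also have "\<dots> = \<chi> (codiff_hat R b x)" using db(6) by (simp add: x(4) g lhom_retr)
    finally show ?thesis .
  qed
  then have m: "hat_mor R b a \<chi>" using x by (simp add: hat_mor_def g)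
  have "\<chi> (proj1 R (ugr b) y) = susp_chain R (fst b) (fst a) (chain_id (fst a)) y" for y
    by (simp only: s(2)[symmetric] x(3) ci(2))
  from ainf_morphism_exists[OF sm(3,2) m _ this] obtain T where "T \<in> ainf_morphisms R b a"
    "linear_part T = chain_id (fst a)" using ci(1) by (auto simp: g)
  then show ?thesis using s(2) by (intro isotopyI) simp_all
qed

lemma isotopy_class_eq: "ainf_algebra R a \<Longrightarrow> isotopy_class R a = isotopy_class R a' \<longleftrightarrow> isotopic R a a'"
proof
  assume a: "ainf_algebra R a" and e: "isotopy_class R a = isotopy_class R a'"
  have "a \<in> isotopy_class R a" using isotopic_refl[OF a] by (simp add: isotopy_class_def)
  then have "isotopic R a' a" unfolding e by (simp add: isotopy_class_def)
  then show "isotopic R a a'" by (rule isotopic_sym)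
next
  assume "isotopic R a a'"
  then show "isotopy_class R a = isotopy_class R a'"
    unfolding isotopy_class_def using isotopic_trans isotopic_sym by blast
qed

section \<open>Transfer and homotopy of A-infinity structures\<close>

text \<open>A structure on the target of \<open>f\<close> is transferred to the source as soon as \<open>f\<close> has a right
  inverse up to homotopy.\<close>

lemma pull:
  assumes b: "ainf_algebra R b" and A: "chain_complex R A" and f: "f \<in> chain_maps R A (fst b)" and g: "g \<in> chain_maps R (fst b) A"
    and h: "chain_homotopic R (fst b) (fst b) (chain_comp (fst b) f g) (chain_id (fst b))"
  shows "\<exists>a. \<exists>F\<in>ainf_morphisms R a b. fst a = A \<and> linear_part F = f"
proof -
  note db = ainf_algebraD[OF b]
  let ?B = "fst b"
  note gA = cx_graded[OF A]
  note F = chain_mapsD(1)[OF f] and G = chain_mapsD(1)[OF g]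
  note lf = letterwise_D[OF susp_chain_letterwise[OF A db(1) F]] and lg = letterwise_D[OF susp_chain_letterwise[OF db(1) A G]]
    and lA = letterwise_D[OF susp_bd_letterwise[OF A]] and lB = letterwise_D[OF susp_bd_letterwise[OF db(1)]]
  note cc = chain_comp_susp_chain[OF db(1) A db(1) G F] and ci = chain_id_susp_chain[OF db(1)]
  obtain H where H: "letterwise R (gr ?B) (gr ?B) 1 H"
    "\<And>x. proj1 R (gr ?B) x - susp_chain R A ?B f (susp_chain R ?B A g x) = susp_bd R ?B (H x) + H (susp_bd R ?B x)"
    using h unfolding chain_homotopic_iff[OF db(1,1) cc(1) ci(1)] by (auto simp: cc(2) ci(2))
  note lH = letterwise_D[OF letterwise_plus(2)[OF db(2) H(1) H(1)]]
  have hH: "susp_bd R ?B (- H x) + - H (susp_bd R ?B x) = susp_chain R A ?B f (susp_chain R ?B A g x) - proj1 R (gr ?B) x" for x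
    using H(2)[of x] by (simp add: lin_uminus[OF lhom_lin[OF lB(1)]] algebra_simps)
  have fm: "susp_bd R ?B (susp_chain R A ?B f x) = susp_chain R A ?B f (susp_bd R A x)" for x
    using f by (simp add: chain_maps_iff[OF A db(1)])
  have graded: "susp_bd R A (susp_chain R ?B A g x) = susp_chain R ?B A g (susp_bd R ?B x)" for x
    using g by (simp add: chain_maps_iff[OF db(1) A])
  have dB: "proj1 R (gr ?B) (codiff_hat R b (proj1 R (gr ?B) x)) = susp_bd R ?B x" for x by (simp add: db(4) lB(2))
  obtain \<phi> \<mu> where p: "comorph R (gr A) (gr ?B) \<phi>" "has_deg R (gr A) (gr ?B) 0 \<phi>" and M: "codifferential R (gr A) \<mu>"
    and pp: "\<And>x. \<phi> (proj1 R (gr A) x) = susp_chain R A ?B f x" and mp: "\<And>x. \<mu> (proj1 R (gr A) x) = susp_bd R A x"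
    and ch: "\<And>x. codiff_hat R b (\<phi> x) = \<phi> (\<mu> x)"
    using transfer[OF gA db(2,3) lA susp_bd_susp_bd[OF A] dB lf fm lg(1,2,4) graded lH(1,2,4) hH] by blast
  obtain a where a: "ainf_algebra R a" "fst a = A" "codiff_hat R a = \<mu>" using ainf_exists[OF A M mp] by blast
  have "hat_mor R a b \<phi>" using p ch by (simp add: hat_mor_def a)
  from ainf_morphism_exists[OF a(1) b this, of f] obtain F' where "F' \<in> ainf_morphisms R a b" "linear_part F' = f"
    using F pp a(2) by auto
  then show ?thesis using a(2) by blast
qed

lemma rehomotope:
  assumes F: "F \<in> ainf_morphisms R a b" and f: "f \<in> chain_maps R (fst a) (fst b)"
    and h: "chain_homotopic R (fst a) (fst b) (linear_part F) f"
  shows "\<exists>F'\<in>ainf_morphisms R a b. linear_part F' = f"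
proof -
  note D = ainf_morphismsD[OF F]
  note da = ainf_algebraD[OF D(2)] and db = ainf_algebraD[OF D(3)]
  note G = chain_mapsD(1)[OF f]
  obtain H where H: "letterwise R (ugr a) (ugr b) 1 H"
    "\<And>x. susp_chain R (fst a) (fst b) f x - susp_chain R (fst a) (fst b) (linear_part F) x = susp_bd R (fst b) (H x) + H (susp_bd R (fst a) x)"
    using h unfolding chain_homotopic_iff[OF da(1) db(1) D(7) G] by blast
  note lH = letterwise_D[OF H(1)]
  have m: "comorph R (ugr a) (ugr b) (coalg_hat R a b F)" "has_deg R (ugr a) (ugr b) 0 (coalg_hat R a b F)"
    "codiff_hat R b (coalg_hat R a b F x) = coalg_hat R a b F (codiff_hat R a x)" for x using D(4) by (auto simp: hat_mor_def)
  obtain \<psi> where p: "comorph R (ugr a) (ugr b) \<psi>" "has_deg R (ugr a) (ugr b) 0 \<psi>" "\<And>x. codiff_hat R b (\<psi> x) = \<psi> (codiff_hat R a x)"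
    "\<And>x. \<psi> (proj1 R (ugr a) x) = coalg_hat R a b F (proj1 R (ugr a) x) + codiff_hat R b (H x) + H (codiff_hat R a (proj1 R (ugr a) x))"
    using homotope[OF da(2) db(2) da(3) db(3) m lH] by blast
  have "\<psi> (proj1 R (ugr a) x) = susp_chain R (fst a) (fst b) f x" for x
  proof -
    have "codiff_hat R b (H x) = susp_bd R (fst b) (H x)" using db(4)[of "H x"] by (simp add: lH)
    then show ?thesis using H(2)[of x] by (simp add: p(4) D(5) da(4) algebra_simps)
  qed
  moreover have "hat_mor R a b \<psi>" using p by (simp add: hat_mor_def)
  ultimately show ?thesis using ainf_morphism_exists[OF D(2,3)] G by blast
qed

text \<open>The homotopy of linear parts is the operation of arity one of the A-infinity homotopy.\<close>

lemma ainf_homotopic_linear: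
  assumes F: "F \<in> ainf_morphisms R a b" and G: "G \<in> ainf_morphisms R a b" and h: "ainf_homotopic R a b F G"
  shows "chain_homotopic R (fst a) (fst b) (linear_part F) (linear_part G)"
proof -
  note f = ainf_morphismsD[OF F] and g = ainf_morphismsD[OF G]
  note da = ainf_algebraD[OF f(2)] and db = ainf_algebraD[OF f(3)]
  obtain k where k: "k \<in> multi_ops R (ugr a) (ugr b) {1..} 1"
    and e: "\<And>x. x \<in> carrier (Tc R (ugr a)) \<Longrightarrow>
       coalg_of R (ugr a) (ugr b) G x \<ominus>\<^bsub>Tc R (ugr b)\<^esub> coalg_of R (ugr a) (ugr b) F x =
         codiff R b (homotopy_of R (ugr a) (ugr b) F G k x)
           \<oplus>\<^bsub>Tc R (ugr b)\<^esub> homotopy_of R (ugr a) (ugr b) F G k (codiff R a x)"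
    using h by (auto simp: ainf_homotopic_def)
  note n = homotopy_of[OF da(2) db(2) f(1) g(1) k]
  let ?n = "hatc R (ugr a) (ugr b) (homotopy_of R (ugr a) (ugr b) F G k)"
  note hn = coder_lhom[OF n(2)] and hF = hat_mor_lhom[OF f(4)] and hG = hat_mor_lhom[OF g(4)]
  note TA = Tc_module[OF da(2)] and TB = Tc_module[OF db(2)]
  note aa = Tc_ab[OF da(2)] and ab = Tc_ab[OF db(2)]
  note c = linmapsD(1)[OF coalg_of(1)[OF da(2) db(2) f(1)]] linmapsD(1)[OF coalg_of(1)[OF da(2) db(2) g(1)]]
    linmapsD(1)[OF n(1)] linmapsD(1)[OF da(5)] linmapsD(1)[OF db(5)]
  have "\<forall>v. coalg_hat R a b G v - coalg_hat R a b F v = codiff_hat R b (?n v) + ?n (codiff_hat R a v)"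
  proof (rule all_emb[OF TA lhom_minus[OF TB hG hF] lhom_plus[OF TB lhom_comp[OF db(6) hn] lhom_comp[OF hn da(6)]], THEN iffD1], rule ballI)
    fix x assume x: "x \<in> carrier (Tc R (ugr a))"
    from arg_cong[OF e[OF x], of "emb (Tc R (ugr b))"]
    show "coalg_hat R a b G (emb (Tc R (ugr a)) x) - coalg_hat R a b F (emb (Tc R (ugr a)) x) =
       codiff_hat R b (?n (emb (Tc R (ugr a)) x)) + ?n (codiff_hat R a (emb (Tc R (ugr a)) x))"
      using x by (simp add: emb_diff[OF ab] emb_add[OF ab] c coalg_hat_def codiff_hat_def hat_emb aa ab)
  qed
  note E = this[rule_format]
  define H where "H = susp_lin R (ugr a) (ugr b) 1 (linear_part k)"
  have H: "letterwise R (ugr a) (ugr b) 1 H" unfolding H_def by (rule susp_lin_letterwise[OF da(2) db(2) susp_ops_proj1(1)[OF da(2) db(2) k]])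
  note lH = letterwise_D[OF H] and la = letterwise_D[OF susp_bd_letterwise[OF da(1)]]
  have hp: "?n (proj1 R (ugr a) x) = H x" for x
    by (subst coder_proj1[OF da(2) db(2) lhom_comp[OF _ sigma(1)[OF da(2)]] _ n(2)])
       (use hF hG in \<open>simp_all add: n(3) susp_ops_proj1(2)[OF da(2) db(2) k] H_def coalg_hat_def\<close>)
  have "susp_chain R (fst a) (fst b) (linear_part G) x - susp_chain R (fst a) (fst b) (linear_part F) x =
      susp_bd R (fst b) (H x) + H (susp_bd R (fst a) x)" for x
  proof -
    have "codiff_hat R b (H x) = susp_bd R (fst b) (H x)" using db(4)[of "H x"] by (simp add: lH)
    moreover have "?n (susp_bd R (fst a) x) = H (susp_bd R (fst a) x)" using hp[of "susp_bd R (fst a) x"] by (simp add: la)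
    ultimately show ?thesis using E[of "proj1 R (ugr a) x"] by (simp add: f(5) g(5) hp da(4))
  qed
  then show ?thesis unfolding chain_homotopic_iff[OF da(1) db(1) f(7) g(7)] using H by blast
qed

text \<open>The witness has zero higher operations.\<close>

lemma trivial_structure:
  assumes C: "chain_complex R C" shows "\<exists>a. ainf_algebra R a \<and> fst a = C"
proof -
  note g = cx_graded[OF C] and l = letterwise_D[OF susp_bd_letterwise[OF C]]
  obtain D where D: "coder R (gr C) (gr C) (sigma R (gr C)) (tid R (gr C)) D" "has_deg R (gr C) (gr C) (-1) D"
    "\<And>x. proj1 R (gr C) (D x) = susp_bd R C x"
    using coder_exists[OF g g comorph_sigma[OF g] has_deg_sigma[OF g] comorph_id[OF g] has_deg_id[OF g] l(1,2,4)] by blast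
  have "proj1 R (gr C) (D (D x)) = 0" for x
  proof -
    have "proj1 R (gr C) (D (D x)) = susp_bd R C (proj1 R (gr C) (D x))" by (simp only: D(3) l(3)) (simp add: l(3)[of "D x", symmetric] D(3))
    then show ?thesis by (simp add: D(3) susp_bd_susp_bd[OF C])
  qed
  then have "codifferential R (gr C) D" using D square_zero[OF g D(1,2)] by (simp add: codifferential_def)
  moreover have "D (proj1 R (gr C) x) = susp_bd R C x" for x
    by (subst coder_proj1[OF g g sigma(1)[OF g] lhom_id[OF Tc_module[OF g]] D(1)]) (simp add: D(3) l(3))
  ultimately show ?thesis using ainf_exists[OF C] by blast
qed

section \<open>Existence and uniqueness of transferred structures\<close>

lemma isotopic_if_homotopic_id:
  assumes F: "F \<in> ainf_morphisms R a a'" and e: "fst a = fst a'"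
    and h: "chain_homotopic R (fst a) (fst a) (linear_part F) (chain_id (fst a))"
  shows "isotopic R a a'"
proof -
  have C: "chain_complex R (fst a)" using ainf_algebraD(1)[OF ainf_morphismsD(2)[OF F]] .
  have i: "chain_id (fst a) \<in> chain_maps R (fst a) (fst a')" using chain_id_maps[OF C] e by simp
  have h': "chain_homotopic R (fst a) (fst a') (linear_part F) (chain_id (fst a))" using h e by simp
  obtain S where "S \<in> ainf_morphisms R a a'" "linear_part S = chain_id (fst a)"
    using rehomotope[OF F i h'] by blast
  then show ?thesis using e by (intro isotopyI)
qed

text \<open>Transfer the structure \<open>c\<close> along \<open>r\<close> to a morphism \<open>K\<close> from some \<open>b'\<close>, on the complex of
  \<open>b\<close>, to \<open>c\<close>.  The linear part of \<open>G K\<close> is homotopic to the identity, so \<open>b'\<close> is isotopic to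
  \<open>b\<close>, and composing \<open>K\<close> with an isotopy gives a morphism from \<open>b\<close>.\<close>

lemma quasi_inverse:
  assumes G: "G \<in> ainf_morphisms R c b" and r: "r \<in> chain_maps R (fst b) (fst c)"
    and h1: "chain_homotopic R (fst c) (fst c) (chain_comp (fst c) r (linear_part G)) (chain_id (fst c))"
    and h2: "chain_homotopic R (fst b) (fst b) (chain_comp (fst b) (linear_part G) r) (chain_id (fst b))"
  shows "\<exists>K\<in>ainf_morphisms R b c. linear_part K = r"
proof -
  note g = ainf_morphismsD[OF G]
  note dc = ainf_algebraD[OF g(2)] and db = ainf_algebraD[OF g(3)]
  obtain b' K where K: "K \<in> ainf_morphisms R b' c" "fst b' = fst b" "linear_part K = r"
    using pull[OF g(2) db(1) r g(6) h1] by blast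
  note c = ainf_comp[OF K(1) G]
  have "isotopic R b' b"
    by (rule isotopic_if_homotopic_id[OF c(1) K(2)]) (simp add: c(3) K(2,3) h2)
  then have "isotopic R b b'" by (rule isotopic_sym)
  then obtain T where T: "T \<in> isotopies R b b'" by (auto simp: isotopic_def)
  note t = isotopiesD[OF T]
  note d = ainf_comp[OF t(1) K(1)]
  have "linear_part (ainf_comp R b b' c K T) = r"
    unfolding d(3) t(3) K(3) by (rule chain_comp_id(1)[OF db(1) dc(1) r])
  with d(1) show ?thesis by blast
qed

text \<open>A structure on the source is transferred along a homotopy inverse of \<open>f\<close>; the morphism
  so obtained goes the wrong way, and \<open>f\<close> is the linear part of an inverse of it.\<close>

lemma push:
  assumes a: "ainf_algebra R a" and B: "chain_complex R B" and f: "f \<in> chain_equivs R (fst a) B"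
  shows "\<exists>b. \<exists>F\<in>ainf_morphisms R a b. fst b = B \<and> linear_part F = f"
proof -
  note da = ainf_algebraD[OF a]
  obtain g where g: "g \<in> chain_equivs R B (fst a)"
    "chain_homotopic R (fst a) (fst a) (chain_comp (fst a) g f) (chain_id (fst a))"
    "chain_homotopic R B B (chain_comp B f g) (chain_id B)"
    using chain_equivs_inverse[OF f] by blast
  obtain b G where G: "G \<in> ainf_morphisms R b a" "fst b = B" "linear_part G = g"
    using pull[OF a B chain_equivsD[OF g(1)] chain_equivsD[OF f] g(2)] by blast
  have "\<exists>F\<in>ainf_morphisms R a b. linear_part F = f"
    by (rule quasi_inverse[OF G(1)]) (use G g chain_equivsD[OF f] in simp_all)
  with G(2) show ?thesis by blast
qed

text \<open>Following \<open>F\<close> by an isotopy and by an inverse of \<open>F'\<close> gives a morphism from \<open>a\<close> to \<open>a'\<close>, with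
  linear part homotopic to the identity.\<close>

lemma isotopic_sources:
  assumes F: "F \<in> ainf_morphisms R a b" and F': "F' \<in> ainf_morphisms R a' b'"
    and e: "linear_part F' \<in> chain_equivs R (fst a') (fst b')" and i: "isotopic R b b'" and aa: "fst a = fst a'"
    and h: "chain_homotopic R (fst a) (fst b) (linear_part F) (linear_part F')"
  shows "isotopic R a a'"
proof -
  note f = ainf_morphismsD[OF F] and f' = ainf_morphismsD[OF F']
  obtain T where T: "T \<in> isotopies R b b'" using i by (auto simp: isotopic_def)
  note t = isotopiesD[OF T]
  let ?A = "fst a" and ?B = "fst b"
  have A: "chain_complex R ?A" and B: "chain_complex R ?B" using f ainf_algebraD(1) by blast+
  obtain r where r: "r \<in> chain_equivs R ?B ?A"
    "chain_homotopic R ?A ?A (chain_comp ?A r (linear_part F')) (chain_id ?A)"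
    "chain_homotopic R ?B ?B (chain_comp ?B (linear_part F') r) (chain_id ?B)"
    using chain_equivs_inverse[OF e] unfolding aa t(2) by blast
  note rm = chain_equivsD[OF r(1)]
  obtain K where K: "K \<in> ainf_morphisms R b' a'" "linear_part K = r"
    using quasi_inverse[OF F', of r] r rm unfolding aa t(2) by blast
  note c1 = ainf_comp[OF F t(1)]
  note c2 = ainf_comp[OF c1(1) K(1)]
  have lf: "linear_part F \<in> chain_maps R ?A ?B" "linear_part F' \<in> chain_maps R ?A ?B"
    using f(6) f'(6) aa t(2) by simp_all
  have l: "linear_part (ainf_comp R a b' a' K (ainf_comp R a b b' T F)) = chain_comp ?A r (linear_part F)"
    by (simp add: c2(3) c1(3) K(2) t(3) chain_comp_id(2)[OF A B lf(1)])
  have "chain_homotopic R ?A ?A (chain_comp ?A r (linear_part F)) (chain_comp ?A r (linear_part F'))"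
    by (rule chain_homotopic_comp[OF A B A lf rm rm h chain_homotopic_refl[OF B A chain_mapsD(1)[OF rm]]])
  then have "chain_homotopic R ?A ?A (chain_comp ?A r (linear_part F)) (chain_id ?A)"
    using r(2) by (rule chain_homotopic_trans[OF A A, rotated 3])
      (simp_all add: chain_mapsD(1)[OF chain_comp_maps[OF A B A lf(1) rm]]
        chain_mapsD(1)[OF chain_comp_maps[OF A B A lf(2) rm]] chain_id_susp_chain(1)[OF A])
  then show ?thesis using isotopic_if_homotopic_id[OF c2(1) aa] by (simp add: l)
qed

lemma isotopic_targets:
  assumes F: "F \<in> ainf_morphisms R a b" and F': "F' \<in> ainf_morphisms R a' b'"
    and e: "linear_part F \<in> chain_equivs R (fst a) (fst b)" and i: "isotopic R a a'" and susp_bd: "fst b = fst b'"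
    and h: "chain_homotopic R (fst a) (fst b) (linear_part F) (linear_part F')"
  shows "isotopic R b b'"
proof -
  note f = ainf_morphismsD[OF F] and f' = ainf_morphismsD[OF F']
  obtain S where S: "S \<in> isotopies R a a'" using i by (auto simp: isotopic_def)
  note s = isotopiesD[OF S]
  let ?A = "fst a" and ?B = "fst b"
  have A: "chain_complex R ?A" and B: "chain_complex R ?B" using f ainf_algebraD(1) by blast+
  obtain r where r: "r \<in> chain_equivs R ?B ?A"
    "chain_homotopic R ?A ?A (chain_comp ?A r (linear_part F)) (chain_id ?A)"
    "chain_homotopic R ?B ?B (chain_comp ?B (linear_part F) r) (chain_id ?B)"
    using chain_equivs_inverse[OF e] by blast
  note rm = chain_equivsD[OF r(1)]
  obtain K where K: "K \<in> ainf_morphisms R b a" "linear_part K = r"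
    using quasi_inverse[OF F rm r(2,3)] by blast
  note c1 = ainf_comp[OF K(1) s(1)]
  note c2 = ainf_comp[OF c1(1) F']
  have lf: "linear_part F \<in> chain_maps R ?A ?B" "linear_part F' \<in> chain_maps R ?A ?B"
    using f(6) f'(6) susp_bd s(2) by simp_all
  have l: "linear_part (ainf_comp R b a' b' F' (ainf_comp R b a a' S K)) = chain_comp ?B (linear_part F') r"
    by (simp add: c2(3) c1(3) K(2) s(3) chain_comp_id(2)[OF B A rm])
  have "chain_homotopic R ?B ?B (chain_comp ?B (linear_part F') r) (chain_comp ?B (linear_part F) r)"
    by (rule chain_homotopic_comp[OF B A B rm rm lf(2,1) chain_homotopic_refl[OF B A chain_mapsD(1)[OF rm]]
          chain_homotopic_sym[OF A B chain_mapsD(1)[OF lf(1)] chain_mapsD(1)[OF lf(2)] h]])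
  then have "chain_homotopic R ?B ?B (chain_comp ?B (linear_part F') r) (chain_id ?B)"
    using r(3) by (rule chain_homotopic_trans[OF B B, rotated 3])
      (simp_all add: chain_mapsD(1)[OF chain_comp_maps[OF B A B rm lf(1)]]
        chain_mapsD(1)[OF chain_comp_maps[OF B A B rm lf(2)]] chain_id_susp_chain(1)[OF B])
  then show ?thesis using isotopic_if_homotopic_id[OF c2(1) susp_bd] by (simp add: l)
qed

section \<open>The category of chain complexes and homotopy classes of equivalences\<close>

lemma homotopy_class_eq:
  assumes A: "chain_complex R A" and B: "chain_complex R B" and f: "f \<in> chain_maps R A B" and g: "g \<in> chain_maps R A B"
  shows "homotopy_class R A B f = homotopy_class R A B g \<longleftrightarrow> chain_homotopic R A B f g"
proof
  note G = chain_mapsD(1)[of _ R A B]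
  have "g \<in> homotopy_class R A B g" using g chain_homotopic_refl[OF A B G[OF g]] by (simp add: homotopy_class_def)
  then show "homotopy_class R A B f = homotopy_class R A B g \<Longrightarrow> chain_homotopic R A B f g"
    by (auto simp: homotopy_class_def)
  assume h: "chain_homotopic R A B f g"
  show "homotopy_class R A B f = homotopy_class R A B g"
    unfolding homotopy_class_def
    using chain_homotopic_trans[OF A B G[OF f] G[OF g] G h] chain_homotopic_trans[OF A B G[OF g] G[OF f] G]
      chain_homotopic_sym[OF A B G[OF f] G[OF g] h] by blast
qed

lemma CHE_sel:
  "Obj (CHE R) = {A. chain_complex R A}" "Dom (CHE R) (A, B, P) = A" "Cod (CHE R) (A, B, P) = B"
  "Ident (CHE R) A = (A, A, homotopy_class R A A (chain_id A))"
  by (simp_all add: CHE_def)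

lemma CHE_arr: "\<beta> \<in> Arr (CHE R) \<longleftrightarrow> (\<exists>A B f. \<beta> = (A, B, homotopy_class R A B f) \<and>
    chain_complex R A \<and> chain_complex R B \<and> f \<in> chain_equivs R A B)"
  by (auto simp: CHE_def)

lemma CHE_comp:
  assumes A: "chain_complex R A" and B: "chain_complex R B" and C: "chain_complex R C"
    and f: "f \<in> chain_maps R A B" and g: "g \<in> chain_maps R B C"
  shows "Comp (CHE R) (B, C, homotopy_class R B C g) (A, B, homotopy_class R A B f) =
     (A, C, homotopy_class R A C (chain_comp A g f))"
proof -
  have "homotopy_class R A C (chain_comp A g' f') = homotopy_class R A C (chain_comp A g f)"
    if "f' \<in> homotopy_class R A B f" "g' \<in> homotopy_class R B C g" for f' g'
  proof -
    have m: "f' \<in> chain_maps R A B" "g' \<in> chain_maps R B C" and h: "chain_homotopic R A B f f'" "chain_homotopic R B C g g'"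
      using that by (auto simp: homotopy_class_def)
    from chain_homotopic_comp[OF A B C f m(1) g m(2) h] show ?thesis
      using homotopy_class_eq[OF A C chain_comp_maps[OF A B C f g] chain_comp_maps[OF A B C m]] by simp
  qed
  moreover have "f \<in> homotopy_class R A B f" "g \<in> homotopy_class R B C g"
    using f g chain_homotopic_refl[OF A B chain_mapsD(1)[OF f]] chain_homotopic_refl[OF B C chain_mapsD(1)[OF g]]
    by (auto simp: homotopy_class_def)
  ultimately have "(\<Union>f'\<in>homotopy_class R A B f. \<Union>g'\<in>homotopy_class R B C g. homotopy_class R A C (chain_comp A g' f'))
      = homotopy_class R A C (chain_comp A g f)" by blast
  then show ?thesis by (simp add: CHE_def)
qed

lemma is_category_CHE: "is_category (CHE R)"
  unfolding is_category_def
proof (intro conjI ballI impI)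
  fix \<beta> assume "\<beta> \<in> Arr (CHE R)"
  then obtain A B f where b: "\<beta> = (A, B, homotopy_class R A B f)" and c: "chain_complex R A" "chain_complex R B"
    and f: "f \<in> chain_equivs R A B" by (auto simp: CHE_arr)
  note fm = chain_equivsD[OF f]
  show "Dom (CHE R) \<beta> \<in> Obj (CHE R)" "Cod (CHE R) \<beta> \<in> Obj (CHE R)" using c by (simp_all add: b CHE_sel)
  show "Comp (CHE R) \<beta> (Ident (CHE R) (Dom (CHE R) \<beta>)) = \<beta>"
    by (simp add: b CHE_sel CHE_comp[OF c(1,1,2) chain_id_maps[OF c(1)] fm] chain_comp_id[OF c fm])
  show "Comp (CHE R) (Ident (CHE R) (Cod (CHE R) \<beta>)) \<beta> = \<beta>"
    by (simp add: b CHE_sel CHE_comp[OF c(1,2,2) fm chain_id_maps[OF c(2)]] chain_comp_id[OF c fm])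
  fix \<gamma> assume "\<gamma> \<in> Arr (CHE R)" and "Cod (CHE R) \<beta> = Dom (CHE R) \<gamma>"
  then obtain C g where g: "\<gamma> = (B, C, homotopy_class R B C g)" and C: "chain_complex R C"
    and ge: "g \<in> chain_equivs R B C" by (auto simp: CHE_arr CHE_sel b)
  note graded = chain_equivsD[OF ge]
  note cc = CHE_comp[OF c C fm graded]
  show "Comp (CHE R) \<gamma> \<beta> \<in> Arr (CHE R)"
    unfolding b g cc CHE_arr using c C chain_equivs_comp[OF c C f ge] by blast
  show "Dom (CHE R) (Comp (CHE R) \<gamma> \<beta>) = Dom (CHE R) \<beta>" "Cod (CHE R) (Comp (CHE R) \<gamma> \<beta>) = Cod (CHE R) \<gamma>"
    unfolding b g cc by (simp_all add: CHE_sel)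
  fix \<delta> assume "\<delta> \<in> Arr (CHE R)" and "Cod (CHE R) \<gamma> = Dom (CHE R) \<delta>"
  then obtain D h where h: "\<delta> = (C, D, homotopy_class R C D h)" and D: "chain_complex R D"
    and he: "h \<in> chain_equivs R C D" by (auto simp: CHE_arr CHE_sel g)
  note hmm = chain_equivsD[OF he]
  show "Comp (CHE R) \<delta> (Comp (CHE R) \<gamma> \<beta>) = Comp (CHE R) (Comp (CHE R) \<delta> \<gamma>) \<beta>"
    unfolding b g h cc CHE_comp[OF c(2) C D graded hmm]
      CHE_comp[OF c(1) C D chain_comp_maps[OF c C fm graded] hmm]
      CHE_comp[OF c D fm chain_comp_maps[OF c(2) C D graded hmm]]
    by (simp add: chain_comp_assoc[OF c C D fm graded hmm])
qed (auto simp: CHE_sel CHE_arr intro: chain_id_equiv)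

section \<open>The category of isotopy classes\<close>

lemma ainf_equivsD:
  assumes "(a, b, F) \<in> ainf_equivs R"
  shows "F \<in> ainf_morphisms R a b" "linear_part F \<in> chain_equivs R (fst a) (fst b)"
    "ainf_algebra R a" "ainf_algebra R b" "chain_complex R (fst a)" "chain_complex R (fst b)"
    "linear_part F \<in> chain_maps R (fst a) (fst b)" "lin_family R (ugr a) (ugr b) 0 (linear_part F)"
proof -
  show m: "F \<in> ainf_morphisms R a b" and "linear_part F \<in> chain_equivs R (fst a) (fst b)"
    using assms by (auto simp: ainf_equivs_def)
  note f = ainf_morphismsD[OF m]
  show "ainf_algebra R a" "ainf_algebra R b" "chain_complex R (fst a)" "chain_complex R (fst b)"
    "linear_part F \<in> chain_maps R (fst a) (fst b)" "lin_family R (ugr a) (ugr b) 0 (linear_part F)"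
    using f ainf_algebraD(1)[OF f(2)] ainf_algebraD(1)[OF f(3)] by blast+
qed

text \<open>Each of the four conditions of the definition implies this one, which is the third of them: an
  isotopy on one side provides one on the other by \<open>isotopic_targets\<close> and \<open>isotopic_sources\<close>, and an
  A-infinity homotopy provides a homotopy of linear parts.\<close>

lemma identified_iff:
  "identified R (a, b, F) (a', b', F') \<longleftrightarrow> (a, b, F) \<in> ainf_equivs R \<and> (a', b', F') \<in> ainf_equivs R \<and>
     isotopic R a a' \<and> isotopic R b b' \<and> chain_homotopic R (fst a) (fst b) (linear_part F) (linear_part F')"
proof
  assume id: "identified R (a, b, F) (a', b', F')"
  then have e: "(a, b, F) \<in> ainf_equivs R" "(a', b', F') \<in> ainf_equivs R" and s: "fst a = fst a'" "fst b = fst b'"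
    by (auto simp: identified_def)
  note f = ainf_equivsD[OF e(1)] and f' = ainf_equivsD[OF e(2)]
  let ?h = "chain_homotopic R (fst a) (fst b) (linear_part F) (linear_part F')"
  from id consider "?h" "isotopic R a a'" | "?h" "isotopic R b b'"
    | S T where "S \<in> isotopies R a a'" "T \<in> isotopies R b b'"
      "ainf_homotopic R a b' (ainf_comp R a b b' T F) (ainf_comp R a a' b' F' S)"
    unfolding identified_def Let_def by blast
  then have "?h \<and> isotopic R a a' \<and> isotopic R b b'"
  proof cases
    case 1
    then show ?thesis using isotopic_targets[OF f(1) f'(1) f(2) _ s(2)] by blast
  next
    case 2
    then show ?thesis using isotopic_sources[OF f(1) f'(1) f'(2) _ s(1)] by blast
  next
    case 3
    note S = isotopiesD[OF 3(1)] and T = isotopiesD[OF 3(2)]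
    note c = ainf_comp[OF f(1) T(1)] and c' = ainf_comp[OF S(1) f'(1)]
    have m: "linear_part F' \<in> chain_maps R (fst a) (fst b)" using f'(7) s by simp
    from ainf_homotopic_linear[OF c(1) c'(1) 3(3)]
    have "?h" using s chain_comp_id[OF f(5,6) f(7)] chain_comp_id[OF f(5,6) m]
      by (simp add: c(3) c'(3) S(3) T(3))
    with 3 show ?thesis by (auto simp: isotopic_def)
  qed
  with e show "(a, b, F) \<in> ainf_equivs R \<and> (a', b', F') \<in> ainf_equivs R \<and>
     isotopic R a a' \<and> isotopic R b b' \<and> ?h" by blast
next
  assume "(a, b, F) \<in> ainf_equivs R \<and> (a', b', F') \<in> ainf_equivs R \<and>
     isotopic R a a' \<and> isotopic R b b' \<and> chain_homotopic R (fst a) (fst b) (linear_part F) (linear_part F')"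
  then show "identified R (a, b, F) (a', b', F')" using isotopicD[of R a a'] isotopicD[of R b b'] by (simp add: identified_def)
qed

definition isot_arrow where "isot_arrow R a b F = (isotopy_class R a, isotopy_class R b, mor_class R (a, b, F))"

lemma identified_sym: "identified R t t' \<Longrightarrow> identified R t' t"
proof -
  assume i: "identified R t t'"
  obtain a b F a' b' F' where t: "t = (a, b, F)" "t' = (a', b', F')" by (metis prod_cases3)
  from i have F: "(a, b, F) \<in> ainf_equivs R" and F': "(a', b', F') \<in> ainf_equivs R"
    and ia: "isotopic R a a'" and ib: "isotopic R b b'"
    and h: "chain_homotopic R (fst a) (fst b) (linear_part F) (linear_part F')"
    unfolding t identified_iff by blast+
  have s: "fst a' = fst a" "fst b' = fst b" using isotopicD[OF ia] isotopicD[OF ib] by simp_all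
  note f = ainf_equivsD[OF F]
  have g: "lin_family R (ugr a) (ugr b) 0 (linear_part F')" using ainf_equivsD(8)[OF F'] unfolding s .
  show ?thesis
    unfolding t identified_iff s
    using F F' isotopic_sym[OF ia] isotopic_sym[OF ib] chain_homotopic_sym[OF f(5,6,8) g h] by blast
qed

lemma identified_trans: "identified R t t' \<Longrightarrow> identified R t' t'' \<Longrightarrow> identified R t t''"
proof -
  assume i: "identified R t t'" "identified R t' t''"
  obtain a b F a' b' F' a'' b'' F'' where t: "t = (a, b, F)" "t' = (a', b', F')" "t'' = (a'', b'', F'')" by (metis prod_cases3)
  from i(1) have F: "(a, b, F) \<in> ainf_equivs R" and ia: "isotopic R a a'" and ib: "isotopic R b b'"
    and h: "chain_homotopic R (fst a) (fst b) (linear_part F) (linear_part F')"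
    unfolding t identified_iff by blast+
  from i(2) have F': "(a', b', F') \<in> ainf_equivs R" and F'': "(a'', b'', F'') \<in> ainf_equivs R"
    and ia': "isotopic R a' a''" and ib': "isotopic R b' b''"
    and h': "chain_homotopic R (fst a') (fst b') (linear_part F') (linear_part F'')"
    unfolding t identified_iff by blast+
  have s: "fst a' = fst a" "fst b' = fst b" using isotopicD[OF ia] isotopicD[OF ib] by simp_all
  have s': "fst a'' = fst a" "fst b'' = fst b" using s isotopicD[OF ia'] isotopicD[OF ib'] by simp_all
  note f = ainf_equivsD[OF F]
  have g: "lin_family R (ugr a) (ugr b) 0 (linear_part F')" using ainf_equivsD(8)[OF F'] unfolding s .
  have g': "lin_family R (ugr a) (ugr b) 0 (linear_part F'')" using ainf_equivsD(8)[OF F''] unfolding s' .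
  show ?thesis
    unfolding t identified_iff
    using F F'' isotopic_trans[OF ia ia'] isotopic_trans[OF ib ib']
      chain_homotopic_trans[OF f(5,6,8) g g' h h'[unfolded s]] by blast
qed

lemma identified_refl: assumes "(a, b, F) \<in> ainf_equivs R" shows "identified R (a, b, F) (a, b, F)"
  using ainf_equivsD[OF assms] assms unfolding identified_iff
  by (auto intro: isotopic_refl chain_homotopic_refl)

lemma mor_class_eq:
  assumes "(a, b, F) \<in> ainf_equivs R"
  shows "mor_class R (a, b, F) = mor_class R t' \<longleftrightarrow> identified R (a, b, F) t'"
  using identified_refl[OF assms] identified_sym identified_trans unfolding mor_class_def by blast

lemma isot_arrow_eq:
  assumes "(a, b, F) \<in> ainf_equivs R" "(a', b', F') \<in> ainf_equivs R"
  shows "isot_arrow R a b F = isot_arrow R a' b' F' \<longleftrightarrow> identified R (a, b, F) (a', b', F')"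
  using assms ainf_equivsD(3,4)[OF assms(1)] mor_class_eq[OF assms(1)]
  by (auto simp: isot_arrow_def isotopy_class_eq identified_iff)

lemma Isot_sel:
  "Obj (Isot_inf R) = {isotopy_class R a | a. ainf_algebra R a}"
  "Dom (Isot_inf R) (isot_arrow R a b F) = isotopy_class R a" "Cod (Isot_inf R) (isot_arrow R a b F) = isotopy_class R b"
  by (auto simp: Isot_inf_def isot_arrow_def)

lemma Isot_arr: "\<epsilon> \<in> Arr (Isot_inf R) \<longleftrightarrow> (\<exists>a b F. \<epsilon> = isot_arrow R a b F \<and> (a, b, F) \<in> ainf_equivs R)"
  by (auto simp: Isot_inf_def isot_arrow_def)

lemma ainf_id_equiv: "ainf_algebra R a \<Longrightarrow> (a, a, ainf_id R a) \<in> ainf_equivs R"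
  by (simp add: ainf_equivs_def ainf_id chain_id_equiv ainf_algebraD(1))

lemma Isot_Ident:
  assumes a: "ainf_algebra R a"
  shows "Ident (Isot_inf R) (isotopy_class R a) = isot_arrow R a a (ainf_id R a)"
proof -
  have e: "mor_class R (a', a', ainf_id R a') = mor_class R (a, a, ainf_id R a)" if "isotopic R a a'" for a'
  proof -
    have a': "ainf_algebra R a'" "fst a = fst a'" using isotopicD[OF that] by auto
    have C: "chain_complex R (fst a)" by (rule ainf_algebraD(1)[OF a])
    have "identified R (a, a, ainf_id R a) (a', a', ainf_id R a')"
      unfolding identified_iff ainf_id(2)[OF a] ainf_id(2)[OF a'(1)] a'(2)[symmetric]
      using that ainf_id_equiv[OF a] ainf_id_equiv[OF a'(1)]
        chain_homotopic_refl[OF C C chain_id_susp_chain(1)[OF C]] by blast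
    then show ?thesis by (rule mor_class_eq[OF ainf_id_equiv[OF a], THEN iffD2, symmetric])
  qed
  have "a \<in> isotopy_class R a" using isotopic_refl[OF a] by (simp add: isotopy_class_def)
  moreover have "mor_class R (a', a', ainf_id R a') = mor_class R (a, a, ainf_id R a)"
    if "a' \<in> isotopy_class R a" for a' using that by (intro e) (simp add: isotopy_class_def)
  ultimately have "(\<Union>a'\<in>isotopy_class R a. mor_class R (a', a', ainf_id R a')) = mor_class R (a, a, ainf_id R a)"
    by blast
  then show ?thesis by (simp add: Isot_inf_def isot_arrow_def)
qed

lemma ainf_equivs_comp:
  assumes F: "(a, b, F) \<in> ainf_equivs R" and Y: "(b', c, Y) \<in> ainf_equivs R" and S: "S \<in> isotopies R b b'"
  shows "(a, c, ainf_comp R a b' c Y (ainf_comp R a b b' S F)) \<in> ainf_equivs R"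
    "linear_part (ainf_comp R a b' c Y (ainf_comp R a b b' S F)) = chain_comp (fst a) (linear_part Y) (linear_part F)"
proof -
  note f = ainf_equivsD[OF F] and y = ainf_equivsD[OF Y] and s = isotopiesD[OF S]
  note c1 = ainf_comp[OF f(1) s(1)]
  note c2 = ainf_comp[OF c1(1) y(1)]
  show l: "linear_part (ainf_comp R a b' c Y (ainf_comp R a b b' S F)) = chain_comp (fst a) (linear_part Y) (linear_part F)"
    by (simp add: c2(3) c1(3) s(3) chain_comp_id(2)[OF f(5,6,7)])
  have "linear_part Y \<in> chain_equivs R (fst b) (fst c)" using y(2) s(2) by simp
  from chain_equivs_comp[OF f(5,6) y(6) f(2) this] c2(1) l
  show "(a, c, ainf_comp R a b' c Y (ainf_comp R a b b' S F)) \<in> ainf_equivs R" by (simp add: ainf_equivs_def)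
qed

text \<open>All choices of representatives and of the isotopy give morphisms with homotopic linear parts and
  isotopic ends, so that the union in \<open>Comp\<close> is a single class.\<close>

lemma Isot_comp:
  assumes F: "(a, b, F) \<in> ainf_equivs R" and Y: "(b', c, Y) \<in> ainf_equivs R" and i: "isotopic R b b'"
  shows "\<exists>H. (a, c, H) \<in> ainf_equivs R \<and> linear_part H = chain_comp (fst a) (linear_part Y) (linear_part F) \<and>
    Comp (Isot_inf R) (isot_arrow R b' c Y) (isot_arrow R a b F) = isot_arrow R a c H"
proof -
  obtain S where S: "S \<in> isotopies R b b'" using i by (auto simp: isotopic_def)
  let ?H = "\<lambda>a b b' c Y S F. ainf_comp R a b' c Y (ainf_comp R a b b' S F)"
  note H = ainf_equivs_comp[OF F Y S]
  note f = ainf_equivsD[OF F] and y = ainf_equivsD[OF Y]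
  have susp_bd: "fst b = fst b'" using isotopiesD(2)[OF S] .
  have e: "mor_class R (a1, c1, ?H a1 b1 b2 c1 Y1 S1 F1) = mor_class R (a, c, ?H a b b' c Y S F)"
    if t: "(a1, b1, F1) \<in> mor_class R (a, b, F)" "(b2, c1, Y1) \<in> mor_class R (b', c, Y)" "S1 \<in> isotopies R b1 b2"
    for a1 b1 F1 b2 c1 Y1 S1
  proof -
    have i1: "identified R (a, b, F) (a1, b1, F1)" and i2: "identified R (b', c, Y) (b2, c1, Y1)"
      using t by (auto simp: mor_class_def)
    note e1 = i1[unfolded identified_iff] and e2 = i2[unfolded identified_iff]
    have F1: "(a1, b1, F1) \<in> ainf_equivs R" and Y1: "(b2, c1, Y1) \<in> ainf_equivs R" using e1 e2 by blast+
    note H1 = ainf_equivs_comp[OF F1 Y1 t(3)]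
    note f1 = ainf_equivsD[OF F1] and y1 = ainf_equivsD[OF Y1]
    have s: "fst a1 = fst a" "fst b1 = fst b" "fst b2 = fst b" "fst c1 = fst c"
      using e1 e2 isotopicD susp_bd by metis+
    have B: "chain_complex R (fst b)" using f by simp
    have ym: "linear_part Y \<in> chain_maps R (fst b) (fst c)" "linear_part Y1 \<in> chain_maps R (fst b) (fst c)"
      "linear_part F1 \<in> chain_maps R (fst a) (fst b)"
      using y(7) y1(7) f1(7) susp_bd s by simp_all
    have "chain_homotopic R (fst a) (fst c) (chain_comp (fst a) (linear_part Y) (linear_part F))
       (chain_comp (fst a) (linear_part Y1) (linear_part F1))"
      by (rule chain_homotopic_comp[OF f(5) B y(6) f(7) ym(3) ym(1,2)]) (use e1 e2 susp_bd in simp_all)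
    then have "identified R (a, c, ?H a b b' c Y S F) (a1, c1, ?H a1 b1 b2 c1 Y1 S1 F1)"
      unfolding identified_iff using H H1 e1 e2 s by simp
    then show ?thesis by (rule mor_class_eq[OF H(1), THEN iffD2, symmetric])
  qed
  have m: "(a, b, F) \<in> mor_class R (a, b, F)" "(b', c, Y) \<in> mor_class R (b', c, Y)"
    using identified_refl[OF F] identified_refl[OF Y] by (simp_all add: mor_class_def)
  have "(\<Union>(a1, b1, F1)\<in>mor_class R (a, b, F). \<Union>(b2, c1, Y1)\<in>mor_class R (b', c, Y). \<Union>S1\<in>isotopies R b1 b2.
      mor_class R (a1, c1, ?H a1 b1 b2 c1 Y1 S1 F1)) = mor_class R (a, c, ?H a b b' c Y S F)"
  proof (intro equalityI subsetI)
    fix t assume "t \<in> mor_class R (a, c, ?H a b b' c Y S F)"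
    then show "t \<in> (\<Union>(a1, b1, F1)\<in>mor_class R (a, b, F). \<Union>(b2, c1, Y1)\<in>mor_class R (b', c, Y). \<Union>S1\<in>isotopies R b1 b2.
      mor_class R (a1, c1, ?H a1 b1 b2 c1 Y1 S1 F1))" using m S by blast
  next
    fix t assume "t \<in> (\<Union>(a1, b1, F1)\<in>mor_class R (a, b, F). \<Union>(b2, c1, Y1)\<in>mor_class R (b', c, Y). \<Union>S1\<in>isotopies R b1 b2.
      mor_class R (a1, c1, ?H a1 b1 b2 c1 Y1 S1 F1))"
    then show "t \<in> mor_class R (a, c, ?H a b b' c Y S F)" using e by auto
  qed
  then have "Comp (Isot_inf R) (isot_arrow R b' c Y) (isot_arrow R a b F) = isot_arrow R a c (?H a b b' c Y S F)"
    by (simp add: Isot_inf_def isot_arrow_def)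
  with H show ?thesis by blast
qed

text \<open>Arrows with equal ends are compared by their linear parts, so that the category axioms reduce to
  those for chain maps.\<close>

lemma isot_arrow_eqI:
  assumes "(a, b, F) \<in> ainf_equivs R" "(a', b', F') \<in> ainf_equivs R" "isotopic R a a'" "isotopic R b b'"
    "linear_part F = linear_part F'"
  shows "isot_arrow R a b F = isot_arrow R a' b' F'"
  unfolding isot_arrow_eq[OF assms(1,2)] identified_iff
  using assms ainf_equivsD[OF assms(1)] chain_homotopic_refl by metis

lemma is_category_Isot: "is_category (Isot_inf R)"
  unfolding is_category_def
proof (intro conjI ballI impI)
  let ?E = "Isot_inf R"
  fix \<beta> assume "\<beta> \<in> Arr ?E"
  then obtain a b F where b: "\<beta> = isot_arrow R a b F" and F: "(a, b, F) \<in> ainf_equivs R" by (auto simp: Isot_arr)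
  note f = ainf_equivsD[OF F]
  note ir = isotopic_refl[OF f(3)] isotopic_refl[OF f(4)]
  show "Dom ?E \<beta> \<in> Obj ?E" "Cod ?E \<beta> \<in> Obj ?E" unfolding b Isot_sel using f(3,4) by blast+
  obtain H where H: "(a, b, H) \<in> ainf_equivs R" "linear_part H = chain_comp (fst a) (linear_part F) (linear_part (ainf_id R a))"
    "Comp ?E (isot_arrow R a b F) (isot_arrow R a a (ainf_id R a)) = isot_arrow R a b H"
    using Isot_comp[OF ainf_id_equiv[OF f(3)] F ir(1)] by blast
  have "isot_arrow R a b H = isot_arrow R a b F"
    by (rule isot_arrow_eqI[OF H(1) F ir]) (simp add: H(2) ainf_id(2)[OF f(3)] chain_comp_id[OF f(5,6,7)])
  then show "Comp ?E \<beta> (Ident ?E (Dom ?E \<beta>)) = \<beta>" using H(3) by (simp add: b Isot_sel Isot_Ident[OF f(3)])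
  obtain H where H: "(a, b, H) \<in> ainf_equivs R" "linear_part H = chain_comp (fst a) (linear_part (ainf_id R b)) (linear_part F)"
    "Comp ?E (isot_arrow R b b (ainf_id R b)) (isot_arrow R a b F) = isot_arrow R a b H"
    using Isot_comp[OF F ainf_id_equiv[OF f(4)] ir(2)] by blast
  have "isot_arrow R a b H = isot_arrow R a b F"
    by (rule isot_arrow_eqI[OF H(1) F ir]) (simp add: H(2) ainf_id(2)[OF f(4)] chain_comp_id[OF f(5,6,7)])
  then show "Comp ?E (Ident ?E (Cod ?E \<beta>)) \<beta> = \<beta>" using H(3) by (simp add: b Isot_sel Isot_Ident[OF f(4)])
  fix \<gamma> assume "\<gamma> \<in> Arr ?E" and cd: "Cod ?E \<beta> = Dom ?E \<gamma>"
  then obtain b' c Y where g: "\<gamma> = isot_arrow R b' c Y" and Y: "(b', c, Y) \<in> ainf_equivs R" by (auto simp: Isot_arr)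
  note y = ainf_equivsD[OF Y]
  have i: "isotopic R b b'" using cd by (simp add: b g Isot_sel isotopy_class_eq[OF f(4)])
  have susp_bd: "fst b' = fst b" using isotopicD[OF i] by simp
  obtain H where H: "(a, c, H) \<in> ainf_equivs R" "linear_part H = chain_comp (fst a) (linear_part Y) (linear_part F)"
    "Comp ?E \<gamma> \<beta> = isot_arrow R a c H" using Isot_comp[OF F Y i] unfolding b g by blast
  show "Comp ?E \<gamma> \<beta> \<in> Arr ?E" unfolding H(3) Isot_arr using H(1) by blast
  show "Dom ?E (Comp ?E \<gamma> \<beta>) = Dom ?E \<beta>" "Cod ?E (Comp ?E \<gamma> \<beta>) = Cod ?E \<gamma>"
    unfolding H(3) by (simp_all add: b g Isot_sel)
  fix \<delta> assume "\<delta> \<in> Arr ?E" and cd': "Cod ?E \<gamma> = Dom ?E \<delta>"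
  then obtain c' d Z where h: "\<delta> = isot_arrow R c' d Z" and Z: "(c', d, Z) \<in> ainf_equivs R" by (auto simp: Isot_arr)
  note z = ainf_equivsD[OF Z]
  have i': "isotopic R c c'" using cd' by (simp add: g h Isot_sel isotopy_class_eq[OF y(4)])
  have cc: "fst c' = fst c" using isotopicD[OF i'] by simp
  obtain K where K: "(b', d, K) \<in> ainf_equivs R" "linear_part K = chain_comp (fst b') (linear_part Z) (linear_part Y)"
    "Comp ?E \<delta> \<gamma> = isot_arrow R b' d K" using Isot_comp[OF Y Z i'] unfolding g h by blast
  obtain L where L: "(a, d, L) \<in> ainf_equivs R" "linear_part L = chain_comp (fst a) (linear_part Z) (linear_part H)"
    "Comp ?E \<delta> (isot_arrow R a c H) = isot_arrow R a d L" using Isot_comp[OF H(1) Z i'] unfolding h by blast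
  obtain M where M: "(a, d, M) \<in> ainf_equivs R" "linear_part M = chain_comp (fst a) (linear_part K) (linear_part F)"
    "Comp ?E (isot_arrow R b' d K) \<beta> = isot_arrow R a d M" using Isot_comp[OF F K(1) i] unfolding b by blast
  have ym: "linear_part Y \<in> chain_maps R (fst b) (fst c)" and zm: "linear_part Z \<in> chain_maps R (fst c) (fst d)"
    using y(7) z(7) susp_bd cc by simp_all
  have "isot_arrow R a d L = isot_arrow R a d M"
    by (rule isot_arrow_eqI[OF L(1) M(1) ir(1) isotopic_refl[OF z(4)]])
       (simp add: L(2) M(2) H(2) K(2) susp_bd chain_comp_assoc[OF f(5,6) y(6) z(6) f(7) ym zm])
  then show "Comp ?E \<delta> (Comp ?E \<gamma> \<beta>) = Comp ?E (Comp ?E \<delta> \<gamma>) \<beta>" by (simp add: H(3) K(3) L(3) M(3))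
next
  let ?E = "Isot_inf R"
  fix x assume "x \<in> Obj ?E"
  then obtain a where a: "x = isotopy_class R a" "ainf_algebra R a" by (auto simp: Isot_sel)
  show "Ident ?E x \<in> Arr ?E" unfolding a(1) Isot_Ident[OF a(2)] Isot_arr using ainf_id_equiv[OF a(2)] by blast
  show "Dom ?E (Ident ?E x) = x" "Cod ?E (Ident ?E x) = x"
    unfolding a(1) Isot_Ident[OF a(2)] Isot_sel by simp_all
qed

section \<open>The forgetful functor\<close>

lemma underlying: assumes a: "ainf_algebra R a" shows "underlying (isotopy_class R a) = fst a"
  unfolding underlying_def
proof (rule the_equality)
  have "a \<in> isotopy_class R a" using isotopic_refl[OF a] by (simp add: isotopy_class_def)
  then show "\<exists>\<mu>. (fst a, \<mu>) \<in> isotopy_class R a" by (metis prod.collapse)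
  show "A = fst a" if ex: "\<exists>\<mu>. (A, \<mu>) \<in> isotopy_class R a" for A
  proof -
    obtain \<mu> where "isotopic R a (A, \<mu>)" using ex by (auto simp: isotopy_class_def)
    from isotopicD[OF this] show ?thesis by simp
  qed
qed

lemma Forget_arr:
  assumes F: "(a, b, F) \<in> ainf_equivs R"
  shows "snd (Forget R) (isot_arrow R a b F) = (fst a, fst b, homotopy_class R (fst a) (fst b) (linear_part F))"
proof -
  note f = ainf_equivsD[OF F]
  have e: "homotopy_class R (fst a') (fst b') (linear_part F') = homotopy_class R (fst a) (fst b) (linear_part F)"
    if "(a', b', F') \<in> mor_class R (a, b, F)" for a' b' F'
  proof -
    have i: "(a', b', F') \<in> ainf_equivs R" "isotopic R a a'" "isotopic R b b'"
      "chain_homotopic R (fst a) (fst b) (linear_part F) (linear_part F')"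
      using that by (auto simp: mor_class_def identified_iff)
    have s: "fst a' = fst a" "fst b' = fst b" using isotopicD[OF i(2)] isotopicD[OF i(3)] by simp_all
    have m: "linear_part F' \<in> chain_maps R (fst a) (fst b)" using ainf_equivsD(7)[OF i(1)] unfolding s .
    show ?thesis unfolding s using homotopy_class_eq[OF f(5,6,7) m] i(4) by simp
  qed
  have "(a, b, F) \<in> mor_class R (a, b, F)" using identified_refl[OF F] by (simp add: mor_class_def)
  then have "(\<Union>(a', b', F')\<in>mor_class R (a, b, F). homotopy_class R (fst a') (fst b') (linear_part F')) =
      homotopy_class R (fst a) (fst b) (linear_part F)" using e by (fastforce split: prod.splits)
  then show ?thesis by (simp add: Forget_def isot_arrow_def underlying f)
qed

lemma is_functor_Forget: "is_functor (Isot_inf R) (CHE R) (Forget R)"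
  unfolding is_functor_def
proof (intro conjI ballI impI is_category_CHE is_category_Isot)
  let ?E = "Isot_inf R"
  fix x assume "x \<in> Obj ?E"
  then obtain a where a: "x = isotopy_class R a" "ainf_algebra R a" by (auto simp: Isot_sel)
  have u: "fst (Forget R) x = fst a" by (simp add: Forget_def a underlying)
  then show "fst (Forget R) x \<in> Obj (CHE R)" using ainf_algebraD(1)[OF a(2)] by (simp add: CHE_sel)
  show "snd (Forget R) (Ident ?E x) = Ident (CHE R) (fst (Forget R) x)"
    unfolding u unfolding a(1) Isot_Ident[OF a(2)] Forget_arr[OF ainf_id_equiv[OF a(2)]]
    by (simp add: CHE_sel ainf_id(2)[OF a(2)])
next
  let ?E = "Isot_inf R"
  fix \<beta> assume "\<beta> \<in> Arr ?E"
  then obtain a b F where b: "\<beta> = isot_arrow R a b F" and F: "(a, b, F) \<in> ainf_equivs R" by (auto simp: Isot_arr)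
  note f = ainf_equivsD[OF F]
  show "snd (Forget R) \<beta> \<in> Arr (CHE R)" unfolding b Forget_arr[OF F] CHE_arr using f by blast
  show "Dom (CHE R) (snd (Forget R) \<beta>) = fst (Forget R) (Dom ?E \<beta>)"
    "Cod (CHE R) (snd (Forget R) \<beta>) = fst (Forget R) (Cod ?E \<beta>)"
    unfolding b Forget_arr[OF F] by (simp_all add: CHE_sel Isot_sel Forget_def underlying f)
  fix \<gamma> assume "\<gamma> \<in> Arr ?E" and cd: "Cod ?E \<beta> = Dom ?E \<gamma>"
  then obtain b' c Y where g: "\<gamma> = isot_arrow R b' c Y" and Y: "(b', c, Y) \<in> ainf_equivs R" by (auto simp: Isot_arr)
  note y = ainf_equivsD[OF Y]
  have i: "isotopic R b b'" using cd by (simp add: b g Isot_sel isotopy_class_eq[OF f(4)])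
  have susp_bd: "fst b' = fst b" using isotopicD[OF i] by simp
  obtain H where H: "(a, c, H) \<in> ainf_equivs R" "linear_part H = chain_comp (fst a) (linear_part Y) (linear_part F)"
    "Comp ?E \<gamma> \<beta> = isot_arrow R a c H" using Isot_comp[OF F Y i] unfolding b g by blast
  have ym: "linear_part Y \<in> chain_maps R (fst b) (fst c)" using y(7) susp_bd by simp
  show "snd (Forget R) (Comp ?E \<gamma> \<beta>) = Comp (CHE R) (snd (Forget R) \<gamma>) (snd (Forget R) \<beta>)"
    unfolding H(3) Forget_arr[OF H(1)] unfolding b g Forget_arr[OF F] Forget_arr[OF Y] susp_bd
      CHE_comp[OF f(5,6) y(6) f(7) ym] by (simp add: H(2))
qed

lemma is_category_op: "is_category C \<Longrightarrow> is_category (op_category C)"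
  unfolding is_category_def op_category_def by auto

lemma is_functor_op: "is_functor E B p \<Longrightarrow> is_functor (op_category E) (op_category B) p"
  using is_category_op[of E] is_category_op[of B] unfolding is_functor_def by (auto simp: op_category_def)

text \<open>The uniqueness in both lifting properties: the isotopy class of the remaining end is forced.\<close>

lemma isot_arrow_determined:
  assumes F: "(a, b, F) \<in> ainf_equivs R" and F': "(a', b', F') \<in> ainf_equivs R"
    and e: "snd (Forget R) (isot_arrow R a b F) = snd (Forget R) (isot_arrow R a' b' F')" and i: "isotopic R a a' \<or> isotopic R b b'"
  shows "isot_arrow R a b F = isot_arrow R a' b' F'"
proof -
  note f = ainf_equivsD[OF F] and f' = ainf_equivsD[OF F']
  have s: "fst a = fst a'" "fst b = fst b'"
    and hc: "homotopy_class R (fst a) (fst b) (linear_part F) = homotopy_class R (fst a') (fst b') (linear_part F')"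
    using e unfolding Forget_arr[OF F] Forget_arr[OF F'] prod.inject by blast+
  have m: "linear_part F' \<in> chain_maps R (fst a) (fst b)" using f'(7) s by simp
  have "chain_homotopic R (fst a) (fst b) (linear_part F) (linear_part F')"
    using hc homotopy_class_eq[OF f(5,6,7) m] s by simp
  then have "identified R (a, b, F) (a', b', F')" using F F' s i by (auto simp: identified_def)
  then show ?thesis by (simp add: isot_arrow_eq[OF F F'])
qed

text \<open>The lift exists by \<open>pull\<close>.\<close>

lemma discrete_fibration_Forget: "discrete_fibration (Isot_inf R) (CHE R) (Forget R)"
  unfolding discrete_fibration_def
proof (intro conjI ballI impI is_functor_Forget)
  let ?E = "Isot_inf R"
  fix e \<beta> assume "e \<in> Obj ?E" "\<beta> \<in> Arr (CHE R)" and cod: "Cod (CHE R) \<beta> = fst (Forget R) e"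
  then obtain b A B f where b: "e = isotopy_class R b" "ainf_algebra R b"
    and be: "\<beta> = (A, B, homotopy_class R A B f)" "chain_complex R A" "f \<in> chain_equivs R A B"
    by (auto simp: Isot_sel CHE_arr)
  have B: "B = fst b" using cod by (simp add: be b CHE_sel Forget_def underlying)
  note fb = be(3)[unfolded B]
  obtain g where g: "g \<in> chain_equivs R (fst b) A"
    "chain_homotopic R (fst b) (fst b) (chain_comp (fst b) f g) (chain_id (fst b))"
    using chain_equivs_inverse[OF fb] by blast
  obtain a F where F: "F \<in> ainf_morphisms R a b" "fst a = A" "linear_part F = f"
    using pull[OF b(2) be(2) chain_equivsD[OF fb] chain_equivsD[OF g(1)] g(2)] by blast
  then have Fe: "(a, b, F) \<in> ainf_equivs R" using fb by (simp add: ainf_equivs_def)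
  then have arr: "isot_arrow R a b F \<in> Arr ?E" unfolding Isot_arr by blast
  show "\<exists>!\<epsilon>. \<epsilon> \<in> Arr ?E \<and> Cod ?E \<epsilon> = e \<and> snd (Forget R) \<epsilon> = \<beta>"
  proof (rule ex1I[of _ "isot_arrow R a b F"])
    show 1: "isot_arrow R a b F \<in> Arr ?E \<and> Cod ?E (isot_arrow R a b F) = e \<and> snd (Forget R) (isot_arrow R a b F) = \<beta>"
      using arr by (simp add: Isot_sel b Forget_arr[OF Fe] be B F)
    fix \<epsilon> assume 2: "\<epsilon> \<in> Arr ?E \<and> Cod ?E \<epsilon> = e \<and> snd (Forget R) \<epsilon> = \<beta>"
    then obtain a' b' F' where e: "\<epsilon> = isot_arrow R a' b' F'" and F': "(a', b', F') \<in> ainf_equivs R" by (auto simp: Isot_arr)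
    have "isotopic R b' b" using 2 isotopy_class_eq[OF ainf_equivsD(4)[OF F']] by (simp add: e Isot_sel b)
    then show "\<epsilon> = isot_arrow R a b F"
      unfolding e using 1 2 e by (intro isot_arrow_determined[OF F' Fe]) auto
  qed
qed

text \<open>The lift exists by \<open>push\<close>.\<close>

lemma discrete_opfibration_Forget: "discrete_opfibration (Isot_inf R) (CHE R) (Forget R)"
  unfolding discrete_opfibration_def discrete_fibration_def
proof (intro conjI ballI impI is_functor_op is_functor_Forget)
  let ?E = "Isot_inf R"
  fix e \<beta> assume "e \<in> Obj (op_category ?E)" "\<beta> \<in> Arr (op_category (CHE R))"
    "Cod (op_category (CHE R)) \<beta> = fst (Forget R) e"
  then have "e \<in> Obj ?E" "\<beta> \<in> Arr (CHE R)" and dom: "Dom (CHE R) \<beta> = fst (Forget R) e"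
    by (simp_all add: op_category_def)
  then obtain a A B f where a: "e = isotopy_class R a" "ainf_algebra R a"
    and be: "\<beta> = (A, B, homotopy_class R A B f)" "chain_complex R B" "f \<in> chain_equivs R A B"
    by (auto simp: Isot_sel CHE_arr)
  have A: "A = fst a" using dom by (simp add: be a CHE_sel Forget_def underlying)
  obtain b F where F: "F \<in> ainf_morphisms R a b" "fst b = B" "linear_part F = f"
    using push[OF a(2) be(2) be(3)[unfolded A]] by blast
  then have Fe: "(a, b, F) \<in> ainf_equivs R" using be(3) A by (simp add: ainf_equivs_def)
  then have arr: "isot_arrow R a b F \<in> Arr ?E" unfolding Isot_arr by blast
  have "\<exists>!\<epsilon>. \<epsilon> \<in> Arr ?E \<and> Dom ?E \<epsilon> = e \<and> snd (Forget R) \<epsilon> = \<beta>"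
  proof (rule ex1I[of _ "isot_arrow R a b F"])
    show 1: "isot_arrow R a b F \<in> Arr ?E \<and> Dom ?E (isot_arrow R a b F) = e \<and> snd (Forget R) (isot_arrow R a b F) = \<beta>"
      using arr by (simp add: Isot_sel a Forget_arr[OF Fe] be A F)
    fix \<epsilon> assume 2: "\<epsilon> \<in> Arr ?E \<and> Dom ?E \<epsilon> = e \<and> snd (Forget R) \<epsilon> = \<beta>"
    then obtain a' b' F' where e: "\<epsilon> = isot_arrow R a' b' F'" and F': "(a', b', F') \<in> ainf_equivs R" by (auto simp: Isot_arr)
    have "isotopic R a' a" using 2 isotopy_class_eq[OF ainf_equivsD(3)[OF F']] by (simp add: e Isot_sel a)
    then show "\<epsilon> = isot_arrow R a b F"
      unfolding e using 1 2 e by (intro isot_arrow_determined[OF F' Fe]) auto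
  qed
  then show "\<exists>!\<epsilon>. \<epsilon> \<in> Arr (op_category ?E) \<and> Cod (op_category ?E) \<epsilon> = e \<and> snd (Forget R) \<epsilon> = \<beta>"
    by (simp add: op_category_def)
qed

lemma surjective_on_objects_Forget: "surjective_on_objects (Isot_inf R) (CHE R) (Forget R)"
  unfolding surjective_on_objects_def
proof (intro equalityI subsetI)
  fix A assume "A \<in> Obj (CHE R)"
  then obtain a where a: "ainf_algebra R a" "fst a = A" using trivial_structure[of R A] unfolding CHE_sel by blast
  then have "fst (Forget R) (isotopy_class R a) = A" by (simp add: Forget_def underlying)
  moreover have "isotopy_class R a \<in> Obj (Isot_inf R)" unfolding Isot_sel using a(1) by blast
  ultimately show "A \<in> fst (Forget R) ` Obj (Isot_inf R)" by (metis imageI)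
qed (use is_functor_Forget[of R] in \<open>auto simp: is_functor_def\<close>)

theorem theorem8:
  fixes R :: "('r, 'x) ring_scheme"
    and E :: "(('r, 'm) ainf set, ('r, 'm) isot_arr) category"
    and B :: "(('r, 'm) chain_cx, ('r, 'm) che_arr) category"
  defines "E \<equiv> Isot_inf R" and "B \<equiv> CHE R"
  assumes "cring R"
  shows "surjective_on_objects E B (Forget R) \<and> discrete_bifibration E B (Forget R)"
  unfolding E_def B_def discrete_bifibration_def
  by (intro conjI surjective_on_objects_Forget discrete_fibration_Forget discrete_opfibration_Forget)

end
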